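(* Let $G$ be a connected quantum graph with vertex set $V$, edge set $E$ and edge lengths $(L_e)_{e\in E}$, let $V_{\mathrm i}$ and $V_{\mathrm o}\neq\emptyset$ be the sets of inner and outer vertices, respectively, and let $G_{\mathrm o}$ be the reduced graph associated with $V_{\mathrm o}$. Then the following assertions hold. (i) If $\lambda<\lambda_1(-\Delta_{V_{\mathrm o}})$, then the semigroup $(e^{-tD_{\lambda,V_{\mathrm o}}})_{t\ge0}$ is strongly positive. (ii) If the reduced graph $G_{\mathrm o}$ is a tree, then for every $\lambda\in\mathbb R\setminus\sigma(-\Delta_{V_{\mathrm o}})$ the semigroup $(e^{-tD_{\lambda,V_{\mathrm o}}})_{t\ge0}$ is either positive or not eventually strongly positive. Suppose in addition that the family $(L_e)_{e\in E}$ of edge lengths is linearly independent over $\mathbb Q$. Then the following assertions hold. (iii) For each $\hat\lambda\in\mathbb R$ there exists $\lambda>\hat\lambda$ with $\lambda\notin\sigma(-\Delta_{V_{\mathrm o}})$ such that the semigroup $(e^{-tD_{\lambda,V_{\mathrm o}}})_{t\ge0}$ is strongly positive. (iv) If $|V_{\mathrm o}|\ge2$, then for each $\hat\lambda\in\mathbb R$ there exists $\lambda>\hat\lambda$ with $\lambda\notin\sigma(-\Delta_{V_{\mathrm o}})$ such that the semigroup $(e^{-tD_{\lambda,V_{\mathrm o}}})_{t\ge0}$ is not eventually positive. (v) If the reduced graph $G_{\mathrm o}$ has a cycle, then for each $\hat\lambda\in\mathbb R$ there exists $\lambda>\hat\lambda$ with $\lambda\notin\sigma(-\Delta_{V_{\mathrm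 o}})$ such that the semigroup $(e^{-tD_{\lambda,V_{\mathrm o}}})_{t\ge0}$ is eventually strongly positive, but not positive.
   Context: Quantum graph. $G=(V,E)$ is a finite connected simple undirected graph (no loops, no parallel edges) with $E\neq\emptyset$, together with a length $L_e\in(0,\infty)$ for each $e\in E$. Each edge $e$ is identified with the interval $[0,L_e]$, one endpoint $e_{\mathrm l}$ of $e$ being identified with $0$ and the other endpoint $e_{\mathrm r}$ with $L_e$ (the choice of orientation is irrelevant). Functions are complex valued. $L^2(G)=\bigoplus_{e\in E}L^2([0,L_e])$. Maximal Laplacian. $D(\Delta_{\max})$ is the set of all $f=(f_e)_{e\in E}$ with $f_e\in H^2([0,L_e])$ for all $e$ that are continuous across vertices, i.e. $f_e(v)=f_{\tilde e}(v)$ whenever $e,\tilde e\in E$ both meet $v\in V$; $\Delta_{\max}f:=(f_e'')_{e\in E}$. The trace $\gamma f\in\mathbb C^V$ is $(\gamma f)(v):=$ the common value of $f$ at $v$. The outer normal derivative $\nu f\in\mathbb C^V$ is $(\nu f)(v):=-\sum_{e:\,e_{\mathrm l}=v}f_e'(0)+\sum_{e:\,e_{\mathrm r}=v}f_e'(L_e)$. Laplacian $\Delta_{V_{\mathrm o}}$. For the non-empty set $V_{\mathrm o}\subseteq V$ of outer vertices and the set $V_{\mathrm i}=V\setminus V_{\mathrm o}$ of inner vertices (possibly empty), $\Delta_{V_{\mathrm o}}$ is the restriction of $\Delta_{\max}$ to $\{f\in D(\Delta_{\max})\colon(\gamma f)|_{V_{\mathrm o}}=0,\ (\nu f)|_{V_{\mathrm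 i}}=0\}$, an operator on $L^2(G)$; $-\Delta_{V_{\mathrm o}}$ is self-adjoint with compact resolvent and spectrum $\sigma(-\Delta_{V_{\mathrm o}})\subseteq(0,\infty)$, and $\lambda_1(-\Delta_{V_{\mathrm o}}):=\min\sigma(-\Delta_{V_{\mathrm o}})>0$. Dirichlet-to-Neumann operator. For $\lambda\in\mathbb R\setminus\sigma(-\Delta_{V_{\mathrm o}})$ and $x\in\mathbb C^{V_{\mathrm o}}$ there is a unique $f\in D(\Delta_{\max})$ with $\Delta_{\max}f+\lambda f=0$, $(\gamma f)|_{V_{\mathrm o}}=x$, $(\nu f)|_{V_{\mathrm i}}=0$; one sets $D_{\lambda,V_{\mathrm o}}x:=(\nu f)|_{V_{\mathrm o}}$. $D_{\lambda,V_{\mathrm o}}\colon\mathbb C^{V_{\mathrm o}}\to\mathbb C^{V_{\mathrm o}}$ is identified with its matrix in the standard basis. Reduced graph. $G_{\mathrm o}=(V_{\mathrm o},E_{\mathrm o})$ is the simple graph with vertex set $V_{\mathrm o}$ in which distinct $v,w\in V_{\mathrm o}$ are joined by a single edge if and only if there is an edge of $G$ between them or there is a path in $G$ from $v$ to $w$ all of whose intermediate vertices (at least one) lie in $V_{\mathrm i}$. A cycle is a closed path traversing each of its vertices and edges exactly once (so it has at least three vertices); a tree is a connected graph without cycles. Positivity. The semigroup $(e^{-tD_{\lambda,V_{\mathrm o}}})_{t\ge0}$ is positive if all entries of $e^{-tD_{\lambda,V_{\mathrm o}}}$ are $\ge0$ for all $t\ge0$; strongly positive if all entries are $>0$ for all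 $t>0$; eventually positive if there is $t_0>0$ such that all entries are $\ge0$ for all $t\ge t_0$; eventually strongly positive if there is $t_0>0$ such that all entries are $>0$ for all $t\ge t_0$. *)

theory Defs
  imports "HOL-Analysis.Analysis"
begin

section \<open>Quantum graphs\<close>

text \<open>
  Every edge carries an (arbitrary, fixed) orientation: the edge with left endpoint \<open>u\<close> and right
  endpoint \<open>w\<close> is the pair \<open>(u, w)\<close>.  Asymmetry of the set of pairs rules out loops and parallel edges.
\<close>

record 'v qgraph =
  verts :: "'v set"
  edges :: "('v \<times> 'v) set"
  len :: "'v \<times> 'v \<Rightarrow> real"

definition adj :: "'v qgraph \<Rightarrow> 'v \<Rightarrow> 'v \<Rightarrow> bool" where
  "adj G v w \<longleftrightarrow> (v, w) \<in> edges G \<or> (w, v) \<in> edges G"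

definition is_path :: "('v \<Rightarrow> 'v \<Rightarrow> bool) \<Rightarrow> 'v list \<Rightarrow> bool" where
  "is_path R p \<longleftrightarrow> p \<noteq> [] \<and> distinct p \<and> successively R p"

definition graph_connected :: "'v set \<Rightarrow> ('v \<Rightarrow> 'v \<Rightarrow> bool) \<Rightarrow> bool" where
  "graph_connected V R \<longleftrightarrow>
     (\<forall>v\<in>V. \<forall>w\<in>V. \<exists>p. is_path R p \<and> set p \<subseteq> V \<and> hd p = v \<and> last p = w)"

definition quantum_graph :: "'v qgraph \<Rightarrow> bool" where
  "quantum_graph G \<longleftrightarrow>
     finite (verts G) \<and> edges G \<noteq> {} \<and> edges G \<subseteq> verts G \<times> verts G \<and>
     (\<forall>v w. (v, w) \<in> edges G \<longrightarrow> (w, v) \<notin> edges G) \<and>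
     graph_connected (verts G) (adj G) \<and>
     (\<forall>e\<in>edges G. 0 < len G e)"

definition lengths_independent :: "'v qgraph \<Rightarrow> bool" where
  "lengths_independent G \<longleftrightarrow>
     (\<forall>c :: 'v \<times> 'v \<Rightarrow> rat. (\<Sum>e\<in>edges G. of_rat (c e) * len G e) = 0 \<longrightarrow> (\<forall>e\<in>edges G. c e = 0))"


section \<open>The reduced graph\<close>

text \<open>The vertex set of the reduced graph is \<open>Vo\<close>; its edges are given by the following relation.\<close>

definition reduced_adj :: "'v qgraph \<Rightarrow> 'v set \<Rightarrow> 'v \<Rightarrow> 'v \<Rightarrow> bool" where
  "reduced_adj G Vo v w \<longleftrightarrow> v \<in> Vo \<and> w \<in> Vo \<and> v \<noteq> w \<and>
     (adj G v w \<or>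
      (\<exists>p. p \<noteq> [] \<and> set p \<subseteq> verts G - Vo \<and> is_path (adj G) (v # p @ [w])))"

text \<open>In a simple graph, a closed path through at least three distinct vertices does not repeat an edge.\<close>

definition has_cycle :: "'v set \<Rightarrow> ('v \<Rightarrow> 'v \<Rightarrow> bool) \<Rightarrow> bool" where
  "has_cycle V R \<longleftrightarrow>
     (\<exists>p. 3 \<le> length p \<and> set p \<subseteq> V \<and> is_path R p \<and> R (last p) (hd p))"

definition is_tree :: "'v set \<Rightarrow> ('v \<Rightarrow> 'v \<Rightarrow> bool) \<Rightarrow> bool" where
  "is_tree V R \<longleftrightarrow> graph_connected V R \<and> \<not> has_cycle V R"


section \<open>Sobolev functions on an interval\<close>

definition L2_on :: "real \<Rightarrow> (real \<Rightarrow> complex) \<Rightarrow> bool" where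
  "L2_on L f \<longleftrightarrow> f \<in> borel_measurable (lebesgue_on {0..L}) \<and>
     integrable (lebesgue_on {0..L}) (\<lambda>t. (cmod (f t))\<^sup>2)"

text \<open>\<open>\<phi>\<close> is a continuously differentiable test function with compact support in \<open>(0, L)\<close>.\<close>

definition test_function :: "real \<Rightarrow> (real \<Rightarrow> complex) \<Rightarrow> (real \<Rightarrow> complex) \<Rightarrow> bool" where
  "test_function L \<phi> \<phi>' \<longleftrightarrow>
     (\<forall>t. (\<phi> has_vector_derivative \<phi>' t) (at t)) \<and> continuous_on UNIV \<phi>' \<and>
     (\<exists>a b. 0 < a \<and> b < L \<and> (\<forall>t. t \<notin> {a..b} \<longrightarrow> \<phi> t = 0))"

definition weak_derivative :: "real \<Rightarrow> (real \<Rightarrow> complex) \<Rightarrow> (real \<Rightarrow> complex) \<Rightarrow> bool" where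
  "weak_derivative L f g \<longleftrightarrow>
     (\<forall>\<phi> \<phi>'. test_function L \<phi> \<phi>' \<longrightarrow>
        (LINT t|lebesgue_on {0..L}. f t * \<phi>' t) = - (LINT t|lebesgue_on {0..L}. g t * \<phi> t))"

definition second_weak_derivative :: "real \<Rightarrow> (real \<Rightarrow> complex) \<Rightarrow> (real \<Rightarrow> complex) \<Rightarrow> bool" where
  "second_weak_derivative L f h \<longleftrightarrow>
     (\<exists>g. L2_on L g \<and> L2_on L h \<and> weak_derivative L f g \<and> weak_derivative L g h)"

definition H2 :: "real \<Rightarrow> (real \<Rightarrow> complex) \<Rightarrow> bool" where
  "H2 L f \<longleftrightarrow> L2_on L f \<and> (\<exists>h. second_weak_derivative L f h)"


section \<open>The space of square integrable functions on a quantum graph\<close>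

text \<open>
  Elements are families of functions on the edges, equal when they agree almost everywhere on every edge.
\<close>

type_synonym 'v gfun = "'v \<times> 'v \<Rightarrow> real \<Rightarrow> complex"

definition L2 :: "'v qgraph \<Rightarrow> 'v gfun set" where
  "L2 G = {f. \<forall>e\<in>edges G. L2_on (len G e) (f e)}"

definition L2_eq :: "'v qgraph \<Rightarrow> 'v gfun \<Rightarrow> 'v gfun \<Rightarrow> bool" where
  "L2_eq G f g \<longleftrightarrow> (\<forall>e\<in>edges G. AE t in lebesgue_on {0..len G e}. f e t = g e t)"

definition L2_norm :: "'v qgraph \<Rightarrow> 'v gfun \<Rightarrow> real" where
  "L2_norm G f = sqrt (\<Sum>e\<in>edges G. LINT t|lebesgue_on {0..len G e}. (cmod (f e t))\<^sup>2)"


section \<open>Laplacians\<close>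

text \<open>
  A function in the domain of the maximal Laplacian is represented on each edge by its continuous
  representative, extended by zero outside the edge, so that each element of the domain (a class
  modulo null sets) corresponds to exactly one HOL function.
\<close>

definition edge_value :: "'v qgraph \<Rightarrow> 'v gfun \<Rightarrow> 'v \<times> 'v \<Rightarrow> 'v \<Rightarrow> complex" where
  "edge_value G f e v = (if v = fst e then f e 0 else f e (len G e))"

definition dom_max :: "'v qgraph \<Rightarrow> 'v gfun set" where
  "dom_max G = {f.
     (\<forall>e\<in>edges G. H2 (len G e) (f e) \<and> continuous_on {0..len G e} (f e)) \<and>
     (\<forall>e t. e \<notin> edges G \<or> t \<notin> {0..len G e} \<longrightarrow> f e t = 0) \<and>
     (\<forall>v\<in>verts G. \<forall>e\<in>edges G. \<forall>e'\<in>edges G.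
        v \<in> {fst e, snd e} \<and> v \<in> {fst e', snd e'} \<longrightarrow> edge_value G f e v = edge_value G f e' v)}"

definition laplacian :: "'v qgraph \<Rightarrow> 'v gfun \<Rightarrow> 'v gfun" where
  "laplacian G f = (\<lambda>e. SOME h. second_weak_derivative (len G e) (f e) h)"

definition vertex_trace :: "'v qgraph \<Rightarrow> 'v gfun \<Rightarrow> 'v \<Rightarrow> complex" where
  "vertex_trace G f v = (THE c. \<forall>e\<in>edges G. v \<in> {fst e, snd e} \<longrightarrow> edge_value G f e v = c)"

text \<open>
  The continuous representative of an \<open>H2\<close> function is continuously differentiable on the closed
  interval, so boundary values of the derivative are classical one-sided derivatives.
\<close>

definition normal_derivative :: "'v qgraph \<Rightarrow> 'v gfun \<Rightarrow> 'v \<Rightarrow> complex" where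
  "normal_derivative G f v =
     - (\<Sum>e\<in>{e\<in>edges G. fst e = v}. vector_derivative (f e) (at 0 within {0..len G e}))
     + (\<Sum>e\<in>{e\<in>edges G. snd e = v}. vector_derivative (f e) (at (len G e) within {0..len G e}))"

definition dom_outer :: "'v qgraph \<Rightarrow> 'v set \<Rightarrow> 'v gfun set" where
  "dom_outer G Vo = {f \<in> dom_max G.
     (\<forall>v\<in>Vo. vertex_trace G f v = 0) \<and> (\<forall>v\<in>verts G - Vo. normal_derivative G f v = 0)}"

text \<open>
  Resolvent set and spectrum of an operator \<open>A\<close> with domain \<open>D\<close> on \<open>L2 G\<close>: the operator
  \<open>\<mu> - A\<close> is a bijection from \<open>D\<close> onto \<open>L2 G\<close> with bounded inverse.
\<close>

definition resolvent_set :: "'v qgraph \<Rightarrow> 'v gfun set \<Rightarrow> ('v gfun \<Rightarrow> 'v gfun) \<Rightarrow> complex set" where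
  "resolvent_set G D A = {\<mu>.
     (\<forall>g\<in>L2 G. \<exists>!f. f \<in> D \<and> L2_eq G (\<lambda>e t. \<mu> * f e t - A f e t) g) \<and>
     (\<exists>C. \<forall>f\<in>D. L2_norm G f \<le> C * L2_norm G (\<lambda>e t. \<mu> * f e t - A f e t))}"

definition spectrum :: "'v qgraph \<Rightarrow> 'v set \<Rightarrow> complex set" where
  "spectrum G Vo = - resolvent_set G (dom_outer G Vo) (\<lambda>f e t. - laplacian G f e t)"

text \<open>The spectrum is a closed non-empty set of positive reals, so the infimum is a minimum.\<close>

definition lambda1 :: "'v qgraph \<Rightarrow> 'v set \<Rightarrow> real" where
  "lambda1 G Vo = Inf {\<mu>. complex_of_real \<mu> \<in> spectrum G Vo}"


section \<open>The Dirichlet-to-Neumann operator\<close>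

definition dtn_solution :: "'v qgraph \<Rightarrow> 'v set \<Rightarrow> real \<Rightarrow> ('v \<Rightarrow> complex) \<Rightarrow> 'v gfun" where
  "dtn_solution G Vo \<mu> x = (THE f. f \<in> dom_max G \<and>
     L2_eq G (\<lambda>e t. laplacian G f e t + complex_of_real \<mu> * f e t) (\<lambda>e t. 0) \<and>
     (\<forall>v\<in>Vo. vertex_trace G f v = x v) \<and> (\<forall>v\<in>verts G - Vo. normal_derivative G f v = 0))"

definition dtn :: "'v qgraph \<Rightarrow> 'v set \<Rightarrow> real \<Rightarrow> ('v \<Rightarrow> complex) \<Rightarrow> 'v \<Rightarrow> complex" where
  "dtn G Vo \<mu> x = normal_derivative G (dtn_solution G Vo \<mu> x)"

definition dtn_matrix :: "'v qgraph \<Rightarrow> 'v set \<Rightarrow> real \<Rightarrow> 'v \<Rightarrow> 'v \<Rightarrow> complex" where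
  "dtn_matrix G Vo \<mu> v w = dtn G Vo \<mu> (\<lambda>u. if u = w then 1 else 0) v"


section \<open>Matrix semigroups and positivity\<close>

text \<open>Matrices with rows and columns indexed by the finite set \<open>S\<close>; entries outside \<open>S\<close> are irrelevant.\<close>

primrec mat_power :: "'v set \<Rightarrow> ('v \<Rightarrow> 'v \<Rightarrow> complex) \<Rightarrow> nat \<Rightarrow> 'v \<Rightarrow> 'v \<Rightarrow> complex" where
  "mat_power S A 0 = (\<lambda>v w. if v = w then 1 else 0)"
| "mat_power S A (Suc k) = (\<lambda>v w. \<Sum>u\<in>S. A v u * mat_power S A k u w)"

definition mat_exp :: "'v set \<Rightarrow> ('v \<Rightarrow> 'v \<Rightarrow> complex) \<Rightarrow> 'v \<Rightarrow> 'v \<Rightarrow> complex" where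
  "mat_exp S A v w = (\<Sum>k. mat_power S A k v w / fact k)"

definition mat_semigroup :: "'v set \<Rightarrow> ('v \<Rightarrow> 'v \<Rightarrow> complex) \<Rightarrow> real \<Rightarrow> 'v \<Rightarrow> 'v \<Rightarrow> complex" where
  "mat_semigroup S A t = mat_exp S (\<lambda>v w. - complex_of_real t * A v w)"

definition entries_nonneg :: "'v set \<Rightarrow> ('v \<Rightarrow> 'v \<Rightarrow> complex) \<Rightarrow> bool" where
  "entries_nonneg S A \<longleftrightarrow> (\<forall>v\<in>S. \<forall>w\<in>S. A v w \<in> \<real> \<and> 0 \<le> Re (A v w))"

definition entries_pos :: "'v set \<Rightarrow> ('v \<Rightarrow> 'v \<Rightarrow> complex) \<Rightarrow> bool" where
  "entries_pos S A \<longleftrightarrow> (\<forall>v\<in>S. \<forall>w\<in>S. A v w \<in> \<real> \<and> 0 < Re (A v w))"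

text \<open>The following properties refer to the semigroup generated by \<open>-A\<close>.\<close>

definition sg_positive :: "'v set \<Rightarrow> ('v \<Rightarrow> 'v \<Rightarrow> complex) \<Rightarrow> bool" where
  "sg_positive S A \<longleftrightarrow> (\<forall>t\<ge>0. entries_nonneg S (mat_semigroup S A t))"

definition sg_strongly_positive :: "'v set \<Rightarrow> ('v \<Rightarrow> 'v \<Rightarrow> complex) \<Rightarrow> bool" where
  "sg_strongly_positive S A \<longleftrightarrow> (\<forall>t>0. entries_pos S (mat_semigroup S A t))"

definition sg_eventually_positive :: "'v set \<Rightarrow> ('v \<Rightarrow> 'v \<Rightarrow> complex) \<Rightarrow> bool" where
  "sg_eventually_positive S A \<longleftrightarrow> (\<exists>t0>0. \<forall>t\<ge>t0. entries_nonneg S (mat_semigroup S A t))"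

definition sg_eventually_strongly_positive :: "'v set \<Rightarrow> ('v \<Rightarrow> 'v \<Rightarrow> complex) \<Rightarrow> bool" where
  "sg_eventually_strongly_positive S A \<longleftrightarrow> (\<exists>t0>0. \<forall>t\<ge>t0. entries_pos S (mat_semigroup S A t))"

end

theory Submission
  imports Defs
begin

text \<open>
  If \<open>\<mu> = \<omega>\<^sup>2\<close> and no \<open>sin (\<omega> L\<^sub>e)\<close> vanishes, the Dirichlet-to-Neumann matrix is the Schur complement, with respect to the
  inner vertices, of the weighted graph matrix with diagonal weights \<open>\<omega> cot (\<omega> L\<^sub>e)\<close> and off-diagonal weights
  \<open>- \<omega> / sin (\<omega> L\<^sub>e)\<close>.  When the off-diagonal weights are negative and the inner block is positive definite, it is an
  irreducible Z-matrix by the minimum principle, so its semigroup is strongly positive; positive definiteness persists up to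
  the first eigenvalue.  On a tree the matrix is, up to conjugation by a diagonal matrix of signs, a Z-matrix, and an
  eventually strongly positive semigroup forces these signs to agree.

  If the lengths are rationally independent, Kronecker's theorem brings all angles \<open>\<omega> L\<^sub>e\<close> modulo \<open>2 \<pi>\<close> close to
  prescribed targets, with \<open>\<omega>\<close> arbitrarily large.  Small positive targets give strong positivity; small negative targets
  reverse the sign of the matrix and destroy eventual positivity.  For the last assertion the vertices are partitioned into
  connected classes, one for each outer vertex; the target is \<open>- p ^ 3\<close> inside the classes and \<open>p\<close> between them,
  so that for \<open>p \<rightarrow> 0\<close> the rescaled matrix tends to an irreducible Z-matrix on the quotient graph and the semigroup is
  eventually strongly positive.  If the quotient has a cycle, the target \<open>- \<pi> / 2\<close> on the edges between two classes
  adjacent on the cycle makes the corresponding entry positive of first order in \<open>p\<close>.  Otherwise the cycle of the reduced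
  graph shows that some class is adjacent, through a chain of its inner vertices, to two classes which are not adjacent to
  each other, and the entry for these two classes is positive of second order.
\<close>

section \<open>Weak second derivatives on an interval\<close>

text \<open>Neither self-adjointness nor compactness of the resolvent is derived. The spectrum,
  defined by bijectivity and a bounded inverse, is approached from two sides only: a non-trivial
  solution with homogeneous boundary data puts \<open>\<mu>\<close> into it, and non-vanishing sines
  together with an injective inner block keep \<open>\<mu>\<close> out of it. Since
  \<open>lambda1\<close> is an infimum and the argument below it needs all angles in
  \<open>(0, pi)\<close>, a spectral point whose angles are at most \<open>pi\<close> has to be
  exhibited. The assertion on trees also concerns parameters at which some sine vanishes. Hence
  reality, symmetry and locality of the Dirichlet-to-Neumann matrix are read off from solutions of
  the differential equation, not from the Schur complement. In the last assertion the sign of the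
  angle inside the classes matters: small positive angles on all edges would give a Z-matrix. With
  the angle \<open>- p ^ 3\<close> the inner block is negative definite for small \<open>p\<close>,
  and the second order correction produced by eliminating the inner vertices can become
  positive.\<close>

lemma L2_on_integrable:
  assumes "L2_on L f"
  shows "integrable (lebesgue_on {0..L}) f"
proof (rule Bochner_Integration.integrable_bound)
  interpret finite_measure "lebesgue_on {0..L}"
    by (rule finite_measure_lebesgue_on) auto
  show "integrable (lebesgue_on {0..L}) (\<lambda>t. 1 + (cmod (f t))\<^sup>2)"
    using assms by (intro Bochner_Integration.integrable_add) (auto simp: L2_on_def)
  show "f \<in> borel_measurable (lebesgue_on {0..L})"
    using assms by (simp add: L2_on_def)
  have "x \<le> 1 + x\<^sup>2" for x :: real
    using sum_power2_ge_zero[of "x - 1/2" 0] by (simp add: power2_eq_square algebra_simps)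
  then show "AE t in lebesgue_on {0..L}. norm (f t) \<le> norm (1 + (cmod (f t))\<^sup>2)"
    by (intro AE_I2) (simp add: add_nonneg_nonneg)
qed

lemma continuous_on_measurable_lebesgue_on:
  fixes f :: "real \<Rightarrow> 'a::euclidean_space"
  shows "continuous_on {0..L} f \<Longrightarrow> f \<in> borel_measurable (lebesgue_on {0..L})"
  by (rule continuous_imp_measurable_on_sets_lebesgue) auto

lemma integrable_mult_continuous:
  fixes f \<phi> :: "real \<Rightarrow> complex"
  assumes "integrable (lebesgue_on {0..L}) f" and "continuous_on {0..L} \<phi>"
  shows "integrable (lebesgue_on {0..L}) (\<lambda>t. f t * \<phi> t)"
proof -
  have "bounded (\<phi> ` {0..L})"
    using assms(2) compact_continuous_image compact_imp_bounded by blast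
  then obtain K where K: "\<And>t. t \<in> {0..L} \<Longrightarrow> norm (\<phi> t) \<le> K"
    unfolding bounded_iff by (metis imageI)
  show ?thesis
  proof (rule Bochner_Integration.integrable_bound)
    show "integrable (lebesgue_on {0..L}) (\<lambda>t. norm (f t) * K)"
      using assms(1) by auto
    show "(\<lambda>t. f t * \<phi> t) \<in> borel_measurable (lebesgue_on {0..L})"
      using assms continuous_on_measurable_lebesgue_on by (intro borel_measurable_times) auto
    show "AE t in lebesgue_on {0..L}. norm (f t * \<phi> t) \<le> norm (norm (f t) * K)"
    proof (rule AE_I2)
      fix t assume "t \<in> space (lebesgue_on {0..L})"
      then have "norm (\<phi> t) \<le> K" using K by simp
      then show "norm (f t * \<phi> t) \<le> norm (norm (f t) * K)"
        by (simp add: norm_mult abs_mult mult_left_mono order.trans[OF _ abs_ge_self])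
    qed
  qed
qed

lemma continuous_on_integrable_lebesgue_on:
  fixes f :: "real \<Rightarrow> 'a::euclidean_space"
  assumes "continuous_on {0..L} f"
  shows "integrable (lebesgue_on {0..L}) f"
  using absolutely_integrable_continuous_real[OF assms]
  by (simp add: set_integrable_def integrable_restrict_space)

lemma L2_on_continuous: "continuous_on {0..L} f \<Longrightarrow> L2_on L f"
  unfolding L2_on_def
  by (intro conjI continuous_on_measurable_lebesgue_on continuous_on_integrable_lebesgue_on
        continuous_intros) auto

lemma L2_on_cmult: "L2_on L f \<Longrightarrow> L2_on L (\<lambda>t. c * f t)"
  by (auto simp: L2_on_def norm_mult power_mult_distrib)

lemma L2_on_add:
  assumes "L2_on L f" "L2_on L g"
  shows "L2_on L (\<lambda>t. f t + g t)"
  unfolding L2_on_def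
proof
  show m: "(\<lambda>t. f t + g t) \<in> borel_measurable (lebesgue_on {0..L})"
    using assms by (auto simp: L2_on_def)
  have *: "(cmod (a + b))\<^sup>2 \<le> 2 * (cmod a)\<^sup>2 + 2 * (cmod b)\<^sup>2" for a b
  proof -
    have "(cmod (a + b))\<^sup>2 \<le> (cmod a + cmod b)\<^sup>2"
      by (intro power_mono norm_triangle_ineq) auto
    also have "\<dots> \<le> 2 * (cmod a)\<^sup>2 + 2 * (cmod b)\<^sup>2"
      using sum_power2_ge_zero[of "cmod a - cmod b" 0] by (simp add: power2_eq_square algebra_simps)
    finally show ?thesis .
  qed
  show "integrable (lebesgue_on {0..L}) (\<lambda>t. (cmod (f t + g t))\<^sup>2)"
  proof (rule Bochner_Integration.integrable_bound)
    show "integrable (lebesgue_on {0..L}) (\<lambda>t. 2 * (cmod (f t))\<^sup>2 + 2 * (cmod (g t))\<^sup>2)"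
      using assms by (auto simp: L2_on_def)
    show "AE t in lebesgue_on {0..L}. norm ((cmod (f t + g t))\<^sup>2) \<le> norm (2 * (cmod (f t))\<^sup>2 + 2 * (cmod (g t))\<^sup>2)"
      using * by (intro AE_I2) (auto simp: abs_of_nonneg)
    show "(\<lambda>t. (cmod (f t + g t))\<^sup>2) \<in> borel_measurable (lebesgue_on {0..L})"
      using m by measurable
  qed
qed

lemma L2_on_cnj:
  assumes "L2_on L f"
  shows "L2_on L (\<lambda>t. cnj (f t))"
proof -
  have "(\<lambda>t. cnj (f t)) \<in> borel_measurable (lebesgue_on {0..L})"
    by (rule borel_measurable_continuous_on[OF continuous_on_cnj[OF continuous_on_id]])
      (use assms in \<open>simp add: L2_on_def\<close>)
  with assms show ?thesis
    by (simp add: L2_on_def)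
qed

lemma L2_on_integrable_on: "L2_on L f \<Longrightarrow> f integrable_on {0..L}"
  by (rule integrable_on_lebesgue_on[OF L2_on_integrable]) auto

lemma lebesgue_on_integral:
  fixes f :: "real \<Rightarrow> 'a::euclidean_space"
  assumes "integrable (lebesgue_on {0..L}) f"
  shows "(LINT t|lebesgue_on {0..L}. f t) = integral {0..L} f"
  using has_integral_integral_lebesgue_on[OF assms] by (simp add: integral_unique)

text \<open>Cauchy-Schwarz against a constant, in the form that a variance is non-negative: expand
  the integral of the squared distance of \<open>cmod (f t)\<close> from its mean
  \<open>m\<close>.\<close>

lemma L1_le_L2:
  assumes "L2_on L f" "0 < L"
  shows "(LINT t|lebesgue_on {0..L}. cmod (f t)) \<le> sqrt L * sqrt (LINT t|lebesgue_on {0..L}. (cmod (f t))\<^sup>2)"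
proof -
  interpret finite_measure "lebesgue_on {0..L}"
    by (rule finite_measure_lebesgue_on) auto
  let ?I = "LINT t|lebesgue_on {0..L}. cmod (f t)" and ?J = "LINT t|lebesgue_on {0..L}. (cmod (f t))\<^sup>2"
  define m where "m = ?I / L"
  have i: "integrable (lebesgue_on {0..L}) (\<lambda>t. cmod (f t))"
    using L2_on_integrable[OF assms(1)] by auto
  have j: "integrable (lebesgue_on {0..L}) (\<lambda>t. (cmod (f t))\<^sup>2)"
    using assms(1) by (simp add: L2_on_def)
  have "0 \<le> (LINT t|lebesgue_on {0..L}. (cmod (f t) - m)\<^sup>2)"
    by simp
  also have "\<dots> = (LINT t|lebesgue_on {0..L}. (cmod (f t))\<^sup>2 - 2 * m * cmod (f t) + m\<^sup>2)"
    by (simp add: power2_diff algebra_simps)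
  also have "\<dots> = ?J - 2 * m * ?I + m\<^sup>2 * L"
    using i j assms(2) by (simp add: measure_restrict_space)
  finally have "?I\<^sup>2 \<le> L * ?J"
    using assms(2) by (simp add: m_def field_simps power2_eq_square)
  then have "sqrt (?I\<^sup>2) \<le> sqrt (L * ?J)"
    using real_sqrt_le_mono by blast
  then show ?thesis
    by (simp add: real_sqrt_mult)
qed

text \<open>Lebesgue differentiation applied to the extension by zero. The clause
  \<open>x + h < L\<close> keeps the averages inside the interval, where the extension
  \<open>w\<close> and \<open>u\<close> agree.\<close>

lemma lebesgue_point:
  fixes u :: "real \<Rightarrow> complex"
  assumes "u integrable_on {0..L}"
  obtains N where "negligible N"
    and "\<And>x e. x \<notin> N \<Longrightarrow> 0 \<le> x \<Longrightarrow> x < L \<Longrightarrow> 0 < e \<Longrightarrow>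
           \<exists>d>0. \<forall>h. 0 < h \<and> h < d \<longrightarrow> x + h < L \<and> norm (integral {x..x+h} u /\<^sub>R h - u x) < e"
proof -
  define w where "w = (\<lambda>t. if t \<in> {0..L} then u t else 0)"
  have "w integrable_on UNIV"
    unfolding w_def integrable_restrict_UNIV by (rule assms)
  then have "w integrable_on cbox a b" for a b
    using integrable_on_subcbox by blast
  then obtain N where N: "negligible N" and *: "\<And>x e. \<lbrakk>x \<notin> N; 0 < e\<rbrakk> \<Longrightarrow>
      \<exists>d>0. \<forall>h. 0 < h \<and> h < d \<longrightarrow> norm (integral (cbox x (x + h *\<^sub>R One)) w /\<^sub>R h ^ DIM(real) - w x) < e"
    using integrable_ccontinuous_explicit by blast
  show ?thesis
  proof (rule that[OF N])
    fix x e :: real assume x: "x \<notin> N" "0 \<le> x" "x < L" and e: "0 < e"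
    from *[OF x(1) e] obtain d where d: "d > 0"
      and b: "\<And>h. 0 < h \<Longrightarrow> h < d \<Longrightarrow> norm (integral {x..x + h} w /\<^sub>R h - w x) < e"
      by auto
    show "\<exists>d>0. \<forall>h. 0 < h \<and> h < d \<longrightarrow> x + h < L \<and> norm (integral {x..x+h} u /\<^sub>R h - u x) < e"
    proof (intro exI[of _ "min d (L - x)"] conjI allI impI)
      show "0 < min d (L - x)" using d x by auto
      fix h assume h: "0 < h \<and> h < min d (L - x)"
      then show "x + h < L" by auto
      have "integral {x..x+h} w = integral {x..x+h} u"
        by (rule integral_cong) (use x h in \<open>auto simp: w_def\<close>)
      then show "norm (integral {x..x+h} u /\<^sub>R h - u x) < e"
        using b[of h] h x by (auto simp: w_def)
    qed
  qed
qed

lemma AE_lebesgue_on_negligible: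
  fixes N :: "real set"
  assumes "negligible N" and "\<And>x. x \<notin> N \<Longrightarrow> 0 < x \<Longrightarrow> x < L \<Longrightarrow> P x"
  shows "AE x in lebesgue_on {0..L}. P x"
proof -
  have "negligible (N \<union> {0, L})"
    using assms(1) by (simp add: negligible_Un_eq)
  then have "N \<union> {0, L} \<in> null_sets lebesgue"
    by (simp add: negligible_iff_null_sets)
  moreover have "x \<in> N \<union> {0, L}" if "\<not> (x \<in> {0..L} \<longrightarrow> P x)" for x
    using assms(2)[of x] that by force
  ultimately have "AE x in lebesgue. x \<in> {0..L} \<longrightarrow> P x"
    by (intro AE_I'[where N = "N \<union> {0, L}"]) blast+
  then show ?thesis
    by (subst AE_restrict_space_iff) auto
qed

text \<open>At a Lebesgue point the averages over short intervals to the right approximate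
  \<open>u x\<close>, yet each of them is a difference of two vanishing primitives.\<close>

lemma indefinite_integral_zero_AE:
  fixes u :: "real \<Rightarrow> complex"
  assumes "u integrable_on {0..L}" and "\<And>t. t \<in> {0..L} \<Longrightarrow> integral {0..t} u = 0"
  shows "AE t in lebesgue_on {0..L}. u t = 0"
proof -
  obtain N where N: "negligible N" and
    *: "\<And>x e. x \<notin> N \<Longrightarrow> 0 \<le> x \<Longrightarrow> x < L \<Longrightarrow> 0 < e \<Longrightarrow>
           \<exists>d>0. \<forall>h. 0 < h \<and> h < d \<longrightarrow> x + h < L \<and> norm (integral {x..x+h} u /\<^sub>R h - u x) < e"
    using lebesgue_point[OF assms(1)] by metis
  show ?thesis
  proof (rule AE_lebesgue_on_negligible[OF N])
    fix x assume x: "x \<notin> N" "0 < x" "x < L"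
    show "u x = 0"
    proof (rule ccontr)
      assume "u x \<noteq> 0"
      then obtain d where d: "d > 0" and
        b: "\<And>h. 0 < h \<Longrightarrow> h < d \<Longrightarrow> x + h < L \<and> norm (integral {x..x+h} u /\<^sub>R h - u x) < norm (u x)"
        using *[of x "norm (u x)"] x by auto
      have h: "x + d/2 < L" using b[of "d/2"] d by auto
      have "integral {0..x} u + integral {x..x+d/2} u = integral {0..x+d/2} u"
        by (rule Henstock_Kurzweil_Integration.integral_combine)
          (use x d h in \<open>auto intro: integrable_on_subinterval[OF assms(1)]\<close>)
      then have "integral {x..x+d/2} u = 0"
        using assms(2)[of x] assms(2)[of "x+d/2"] x d h by auto
      then show False using b[of "d/2"] d by auto
    qed
  qed
qed

text \<open>The classical description of H2: \<open>f\<close> is continuously differentiable with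
  derivative \<open>g\<close>, and \<open>g\<close> is absolutely continuous with derivative
  \<open>h\<close>. Absolute continuity is expressed by an indefinite integral, so \<open>h\<close>
  matters only up to null sets. Everything about operator domains passes through this
  predicate.\<close>

definition C1AC :: "real \<Rightarrow> (real \<Rightarrow> complex) \<Rightarrow> (real \<Rightarrow> complex) \<Rightarrow> (real \<Rightarrow> complex) \<Rightarrow> bool" where
  "C1AC L f g h \<longleftrightarrow> L2_on L h \<and>
     (\<forall>t\<in>{0..L}. (f has_vector_derivative g t) (at t within {0..L}) \<and> g t = g 0 + integral {0..t} h)"

lemma test_function_zero:
  assumes "test_function L \<phi> \<phi>'"
  shows "\<phi> 0 = 0" "\<phi> L = 0"
proof -
  obtain a b where "0 < a" "b < L" "\<And>t. t \<notin> {a..b} \<Longrightarrow> \<phi> t = 0"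
    using assms by (auto simp: test_function_def)
  then show "\<phi> 0 = 0" "\<phi> L = 0" by auto
qed

lemma integral_test_derivative:
  assumes "test_function L \<phi> \<phi>'" "s \<in> {0..L}"
  shows "integral {s..L} \<phi>' = - \<phi> s"
proof -
  have d: "\<And>t. (\<phi> has_vector_derivative \<phi>' t) (at t)"
    using assms(1) by (simp add: test_function_def)
  note z = test_function_zero(2)[OF assms(1)]
  have "(\<phi>' has_integral (\<phi> L - \<phi> s)) {s..L}"
    by (rule fundamental_theorem_of_calculus) (use assms(2) d in \<open>auto intro: has_vector_derivative_at_within\<close>)
  then show ?thesis using z by (simp add: integral_unique)
qed

lemma integrable_lebesgue_on_restrict:
  fixes h :: "real \<Rightarrow> complex"
  assumes "integrable (lebesgue_on {0..L}) h" "{a..b} \<subseteq> {0..L}"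
  shows "(LINT s|lebesgue_on {0..L}. (if s \<in> {a..b} then h s else 0)) = integral {a..b} h"
proof -
  have "integrable (lebesgue_on {0..L}) (\<lambda>s. indicat_real {a..b} s *\<^sub>R h s)"
    by (rule integrable_mult_indicator) (use assms in \<open>auto simp: sets_restrict_space_iff\<close>)
  moreover have e: "(\<lambda>s. indicat_real {a..b} s *\<^sub>R h s) = (\<lambda>s. if s \<in> {a..b} then h s else 0)"
    by (auto simp: indicator_def)
  ultimately have "(LINT s|lebesgue_on {0..L}. (if s \<in> {a..b} then h s else 0))
      = integral {0..L} (\<lambda>s. if s \<in> {a..b} then h s else 0)"
    by (intro lebesgue_on_integral) simp
  also have "\<dots> = integral {a..b} h"
    unfolding integral_restrict_Int Int_absorb2[OF assms(2)] ..
  finally show ?thesis .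
qed

text \<open>Integration by parts for a merely integrable \<open>h\<close>, by Fubini on the triangle
  \<open>s \<le> t\<close>: \<open>F\<close> is \<open>h s * \<phi>' t\<close> cut off to it, and
  integrating over \<open>t\<close> first leaves \<open>- h s * \<phi> s\<close> because
  \<open>\<phi> L = 0\<close>. The constant \<open>c\<close> drops out since \<open>\<phi>\<close>
  vanishes at both ends.\<close>

lemma weak_derivative_indefinite_integral:
  assumes h: "integrable (lebesgue_on {0..L}) h"
    and g: "\<And>t. t \<in> {0..L} \<Longrightarrow> g t = c + integral {0..t} h"
  shows "weak_derivative L g h"
  unfolding weak_derivative_def
proof (intro allI impI)
  fix \<phi> \<phi>' assume T: "test_function L \<phi> \<phi>'"
  let ?M = "lebesgue_on {0..L}"
  interpret M: finite_measure ?M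
    by (rule finite_measure_lebesgue_on) auto
  interpret P: pair_sigma_finite ?M ?M ..
  have cont: "continuous_on {0..L} \<phi>'"
    using T by (auto simp: test_function_def intro: continuous_on_subset)
  then have mp: "\<phi>' \<in> borel_measurable ?M"
    by (rule continuous_on_measurable_lebesgue_on)
  have ip: "integrable ?M \<phi>'"
    by (rule continuous_on_integrable_lebesgue_on[OF cont])
  have mh: "h \<in> borel_measurable ?M"
    using h by auto
  have mi: "(\<lambda>x::real. x) \<in> borel_measurable ?M"
    using id_borel_measurable_lebesgue_on[of "{0..L}"] by (simp add: id_def)
  define F where "F = (\<lambda>(s, t). if s \<le> t then h s * \<phi>' t else 0)"
  have mF: "F \<in> borel_measurable (?M \<Otimes>\<^sub>M ?M)"
  proof -
    have [measurable]: "(\<lambda>p. h (fst p)) \<in> borel_measurable (?M \<Otimes>\<^sub>M ?M)"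
         "(\<lambda>p. \<phi>' (snd p)) \<in> borel_measurable (?M \<Otimes>\<^sub>M ?M)"
         "(\<lambda>p. fst p) \<in> borel_measurable (?M \<Otimes>\<^sub>M ?M)"
         "(\<lambda>p. snd p) \<in> borel_measurable (?M \<Otimes>\<^sub>M ?M)"
      using measurable_compose[OF measurable_fst mh] measurable_compose[OF measurable_snd mp]
        measurable_compose[OF measurable_fst mi] measurable_compose[OF measurable_snd mi] by auto
    have "F = (\<lambda>p. if fst p \<le> snd p then h (fst p) * \<phi>' (snd p) else 0)"
      by (auto simp: F_def)
    then show ?thesis by simp
  qed
  have bnd: "integrable ?M (\<lambda>t. norm (F (s, t)))" "(LINT t|?M. norm (F (s, t))) \<le> norm (h s) * (LINT t|?M. norm (\<phi>' t))"
    if "s \<in> {0..L}" for s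
  proof -
    have 1: "integrable ?M (\<lambda>t. norm (h s) * norm (\<phi>' t))"
      using ip by auto
    show 2: "integrable ?M (\<lambda>t. norm (F (s, t)))"
    proof (rule Bochner_Integration.integrable_bound[OF 1])
      have "(\<lambda>t. F (s, t)) \<in> borel_measurable ?M"
        by (rule measurable_compose[OF _ mF]) (use that in auto)
      then show "(\<lambda>t. norm (F (s, t))) \<in> borel_measurable ?M" by auto
    qed (auto simp: F_def norm_mult)
    have "(LINT t|?M. norm (F (s, t))) \<le> (LINT t|?M. norm (h s) * norm (\<phi>' t))"
      by (rule integral_mono[OF 2 1]) (auto simp: F_def norm_mult)
    then show "(LINT t|?M. norm (F (s, t))) \<le> norm (h s) * (LINT t|?M. norm (\<phi>' t))" by simp
  qed
  have iF: "integrable (?M \<Otimes>\<^sub>M ?M) F"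
  proof (rule P.Fubini_integrable[OF mF])
    show "integrable ?M (\<lambda>s. LINT t|?M. norm (F (s, t)))"
    proof (rule Bochner_Integration.integrable_bound)
      show "integrable ?M (\<lambda>s. norm (h s) * (LINT t|?M. norm (\<phi>' t)))"
        using h by auto
      show "(\<lambda>s. LINT t|?M. norm (F (s, t))) \<in> borel_measurable ?M"
        by (rule M.borel_measurable_lebesgue_integral) (use mF in auto)
      show "AE s in ?M. norm (LINT t|?M. norm (F (s, t))) \<le> norm (norm (h s) * (LINT t|?M. norm (\<phi>' t)))"
        using bnd(2) by (intro AE_I2) (simp add: abs_mult)
    qed
    show "AE s in ?M. integrable ?M (\<lambda>t. F (s, t))"
    proof (rule AE_I2)
      fix s assume s: "s \<in> space ?M"
      have "(\<lambda>t. F (s, t)) \<in> borel_measurable ?M"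
        by (rule measurable_compose[OF _ mF]) (use s in auto)
      then show "integrable ?M (\<lambda>t. F (s, t))"
        using bnd(1) s by (subst integrable_norm_iff[symmetric]) auto
    qed
  qed
  have "(LINT t|?M. g t * \<phi>' t) = (LINT t|?M. c * \<phi>' t + (LINT s|?M. F (s, t)))"
  proof (rule Bochner_Integration.integral_cong[OF refl])
    fix t assume "t \<in> space ?M"
    then have t: "t \<in> {0..L}" by simp
    have "(LINT s|?M. F (s, t)) = (LINT s|?M. (if s \<in> {0..t} then h s else 0) * \<phi>' t)"
      by (rule Bochner_Integration.integral_cong[OF refl]) (use t in \<open>auto simp: F_def\<close>)
    also have "\<dots> = (LINT s|?M. (if s \<in> {0..t} then h s else 0)) * \<phi>' t"
      by simp
    also have "\<dots> = integral {0..t} h * \<phi>' t"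
      using integrable_lebesgue_on_restrict[OF h, of 0 t] t by simp
    finally show "g t * \<phi>' t = c * \<phi>' t + (LINT s|?M. F (s, t))"
      using g[OF t] by (simp add: algebra_simps)
  qed
  also have "\<dots> = c * (LINT t|?M. \<phi>' t) + (LINT t|?M. (LINT s|?M. F (s, t)))"
    using ip P.integrable_snd[of "\<lambda>s t. F (s, t)"] iF by (subst Bochner_Integration.integral_add) (auto simp: case_prod_unfold)
  also have "(LINT t|?M. \<phi>' t) = 0"
  proof (cases "0 \<le> L")
    case True
    show ?thesis
      using test_function_zero[OF T] integral_test_derivative[OF T, of 0] True lebesgue_on_integral[OF ip] by simp
  qed simp
  also have "(LINT t|?M. (LINT s|?M. F (s, t))) = (LINT s|?M. (LINT t|?M. F (s, t)))"
    using P.Fubini_integral[of "\<lambda>s t. F (s, t)"] iF by (simp add: case_prod_unfold)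
  also have "\<dots> = (LINT s|?M. - (h s * \<phi> s))"
  proof (rule Bochner_Integration.integral_cong[OF refl])
    fix s assume "s \<in> space ?M"
    then have s: "s \<in> {0..L}" by simp
    have "(LINT t|?M. F (s, t)) = (LINT t|?M. h s * (if t \<in> {s..L} then \<phi>' t else 0))"
      by (rule Bochner_Integration.integral_cong[OF refl]) (use s in \<open>auto simp: F_def\<close>)
    also have "\<dots> = h s * (LINT t|?M. (if t \<in> {s..L} then \<phi>' t else 0))"
      by simp
    also have "\<dots> = h s * integral {s..L} \<phi>'"
      using integrable_lebesgue_on_restrict[OF ip, of s L] s by simp
    finally show "(LINT t|?M. F (s, t)) = - (h s * \<phi> s)"
      using integral_test_derivative[OF T s] by simp
  qed
  finally show "(LINT t|?M. g t * \<phi>' t) = - (LINT t|?M. h t * \<phi> t)"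
    by simp
qed

section \<open>Ramp functions and the lemma of du Bois-Reymond\<close>

lemma has_real_derivative_ramp_square:
  "((\<lambda>t::real. (max 0 t)\<^sup>2 / 2) has_real_derivative max 0 t) (at t)"
proof -
  consider "t > 0" | "t < 0" | "t = 0" by linarith
  then show ?thesis
  proof cases
    case 1
    have "((\<lambda>t::real. t\<^sup>2 / 2) has_real_derivative t) (at t)"
      by (auto intro!: derivative_eq_intros)
    then have "((\<lambda>t::real. (max 0 t)\<^sup>2 / 2) has_real_derivative t) (at t)"
      by (rule has_field_derivative_transform_within_open[of _ _ _ "{0<..}"]) (use 1 in auto)
    then show ?thesis using 1 by simp
  next
    case 2
    have "((\<lambda>t::real. 0) has_real_derivative 0) (at t)"
      by (auto intro!: derivative_eq_intros)
    then have "((\<lambda>t::real. (max 0 t)\<^sup>2 / 2) has_real_derivative 0) (at t)"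
      by (rule has_field_derivative_transform_within_open[of _ _ _ "{..<0}"]) (use 2 in auto)
    then show ?thesis using 2 by simp
  next
    case 3
    have "((\<lambda>h. (max 0 h)\<^sup>2 / 2 / h) \<longlongrightarrow> 0) (at (0::real))"
    proof (rule Lim_null_comparison)
      show "\<forall>\<^sub>F h in at 0. norm ((max 0 h)\<^sup>2 / 2 / h) \<le> \<bar>h\<bar>"
        by (intro always_eventually) (auto simp: max_def power2_eq_square)
      show "((\<lambda>h::real. \<bar>h\<bar>) \<longlongrightarrow> 0) (at 0)"
        using tendsto_rabs[OF tendsto_ident_at, of "0::real" UNIV] by simp
    qed
    then show ?thesis using 3 by (simp add: has_field_derivative_iff)
  qed
qed

text \<open>A continuous approximation of the jump at \<open>a\<close>, rising from 0 to 1 over the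
  length \<open>1 / m\<close>. Test functions need continuous derivatives, so indicator functions
  are reached only as limits of ramps; \<open>ramp_int\<close> is the explicit primitive.\<close>

definition ramp :: "real \<Rightarrow> real \<Rightarrow> real \<Rightarrow> real" where
  "ramp m a t = max 0 (m * (t - a)) - max 0 (m * (t - a) - 1)"

definition ramp_int :: "real \<Rightarrow> real \<Rightarrow> real \<Rightarrow> real" where
  "ramp_int m a t = ((max 0 (m * (t - a)))\<^sup>2 / 2 - (max 0 (m * (t - a) - 1))\<^sup>2 / 2) / m"

lemma has_derivative_ramp_int:
  assumes "m > 0"
  shows "(ramp_int m a has_real_derivative ramp m a t) (at t)"
proof -
  have 1: "((\<lambda>t. (max 0 (m * (t - a)))\<^sup>2 / 2) has_real_derivative max 0 (m * (t - a)) * m) (at t)"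
    by (rule DERIV_chain2[OF has_real_derivative_ramp_square]) (auto intro!: derivative_eq_intros)
  have 2: "((\<lambda>t. (max 0 (m * (t - a) - 1))\<^sup>2 / 2) has_real_derivative max 0 (m * (t - a) - 1) * m) (at t)"
    by (rule DERIV_chain2[OF has_real_derivative_ramp_square]) (auto intro!: derivative_eq_intros)
  show ?thesis
    unfolding ramp_int_def[abs_def]
    by (rule DERIV_cong[OF DERIV_cdivide[OF DERIV_diff[OF 1 2]]])
      (use assms in \<open>auto simp: ramp_def field_simps\<close>)
qed

lemma ramp_int_left:
  assumes "m > 0" "t \<le> a"
  shows "ramp_int m a t = 0"
proof -
  have "m * (t - a) \<le> 0" using assms by (intro mult_nonneg_nonpos) auto
  then have "max 0 (m * (t - a)) = 0" "max 0 (m * (t - a) - 1) = 0" by auto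
  then show ?thesis by (simp add: ramp_int_def)
qed

lemma ramp_int_right:
  assumes "m > 0" "a + 1 / m \<le> t"
  shows "ramp_int m a t = t - a - 1 / (2 * m)"
proof -
  define x where "x = t - a"
  have "1 \<le> m * x" using assms by (simp add: x_def field_simps)
  then have "max 0 (m * x) = m * x" "max 0 (m * x - 1) = m * x - 1" by auto
  then show ?thesis
    using assms(1) by (simp add: ramp_int_def flip: x_def) (simp add: power2_eq_square field_simps)
qed

lemma ramp_bounds: "0 \<le> ramp m a t" "ramp m a t \<le> 1"
  by (auto simp: ramp_def max_def)

lemma continuous_on_ramp: "continuous_on S (ramp m a)"
  unfolding ramp_def[abs_def] by (intro continuous_intros)

lemma ramp_tendsto: "(\<lambda>n. ramp (real (n + N)) a t) \<longlonglongrightarrow> (if a < t then 1 else 0)"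
proof (cases "a < t")
  case True
  obtain K where K: "1 / (t - a) < real K"
    using reals_Archimedean2 by blast
  have "\<forall>\<^sub>F n in sequentially. ramp (real (n + N)) a t = 1"
  proof (rule eventually_sequentiallyI[of K])
    fix n assume "n \<ge> K"
    then have "1 / (t - a) \<le> real (n + N)" using K by simp
    then have "1 \<le> real (n + N) * (t - a)" using True by (simp add: field_simps)
    then show "ramp (real (n + N)) a t = 1" by (simp add: ramp_def)
  qed
  then show ?thesis using True by (simp add: tendsto_eventually)
next
  case False
  have "ramp (real (n + N)) a t = 0" for n
  proof -
    have "real (n + N) * (t - a) \<le> 0" using False by (intro mult_nonneg_nonpos) auto
    then show ?thesis unfolding ramp_def by simp
  qed
  then show ?thesis using False by simp
qed

lemma integrable_indicator_interval:
  fixes u :: "real \<Rightarrow> complex"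
  assumes "integrable (lebesgue_on {0..L}) u" "0 \<le> a" "a \<le> L"
  shows "integrable (lebesgue_on {0..L}) (\<lambda>t. u t * (if a < t then 1 else 0))"
    and "(LINT t|lebesgue_on {0..L}. u t * (if a < t then 1 else 0)) = integral {a..L} u"
proof -
  have i: "integrable (lebesgue_on {0..L}) (\<lambda>s. indicat_real {a<..L} s *\<^sub>R u s)"
    by (rule integrable_mult_indicator) (use assms in \<open>auto simp: sets_restrict_space_iff\<close>)
  have e: "indicat_real {a<..L} s *\<^sub>R u s = u s * (if a < s then 1 else 0)"
    if "s \<in> space (lebesgue_on {0..L})" for s
    using that by (auto simp: indicator_def)
  have "integrable (lebesgue_on {0..L}) (\<lambda>s. indicat_real {a<..L} s *\<^sub>R u s) \<longleftrightarrow>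
        integrable (lebesgue_on {0..L}) (\<lambda>t. u t * (if a < t then 1 else 0))"
    by (rule Bochner_Integration.integrable_cong[OF refl e])
  with i show *: "integrable (lebesgue_on {0..L}) (\<lambda>t. u t * (if a < t then 1 else 0))"
    by blast
  have i2: "integrable (lebesgue_on {0..L}) (\<lambda>s. indicat_real {a..L} s *\<^sub>R u s)"
    by (rule integrable_mult_indicator) (use assms in \<open>auto simp: sets_restrict_space_iff\<close>)
  have e2: "(\<lambda>s. indicat_real {a..L} s *\<^sub>R u s) = (\<lambda>s. if s \<in> {a..L} then u s else 0)"
    by (auto simp: indicator_def)
  have "(LINT t|lebesgue_on {0..L}. u t * (if a < t then 1 else 0)) =
        (LINT t|lebesgue_on {0..L}. (if t \<in> {a..L} then u t else 0))"
  proof (rule integral_cong_AE)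
    show "AE t in lebesgue_on {0..L}. u t * (if a < t then 1 else 0) = (if t \<in> {a..L} then u t else 0)"
      by (rule AE_lebesgue_on_negligible[of "{a}"]) auto
  qed (use * i2 e2 in auto)
  also have "\<dots> = integral {a..L} u"
    by (rule integrable_lebesgue_on_restrict) (use assms in auto)
  finally show "(LINT t|lebesgue_on {0..L}. u t * (if a < t then 1 else 0)) = integral {a..L} u" .
qed

text \<open>Testing with functions whose derivatives approximate the indicator of one interval minus
  that of a translate shows that \<open>u\<close> has equal integrals over intervals of equal
  length. At Lebesgue points the values of \<open>u\<close> then coincide.\<close>

lemma du_bois_reymond:
  fixes u :: "real \<Rightarrow> complex"
  assumes u: "integrable (lebesgue_on {0..L}) u"
    and zero: "\<And>\<phi> \<phi>'. test_function L \<phi> \<phi>' \<Longrightarrow> (LINT t|lebesgue_on {0..L}. u t * \<phi>' t) = 0"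
  shows "\<exists>c. AE t in lebesgue_on {0..L}. u t = c"
proof -
  have iu: "u integrable_on {0..L}"
    by (rule integrable_on_lebesgue_on[OF u]) auto
  have eq: "integral {a..a+h} u = integral {b..b+h} u"
    if ab: "0 < a" "a < b" and h: "0 < h" "b + h < L" for a b h
  proof -
    \<comment> \<open>\<open>N\<close> makes all ramps so short that the last one is complete before
      \<open>L\<close>; the support condition of a test function then holds for every
      \<open>n\<close>.\<close>
    obtain N where N: "1 / (L - (b + h)) < real N"
      using reals_Archimedean2 by blast
    have "0 < 1 / (L - (b + h))" using h by simp
    then have N0: "0 < real N" using N by linarith
    define m where "m n = real (n + N)" for n
    have m: "m n > 0" "b + h + 1 / m n < L" for n
    proof -
      show "m n > 0" using N0 by (simp add: m_def)
      have "1 / (L - (b + h)) < m n" using N by (simp add: m_def)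
      then show "b + h + 1 / m n < L" using \<open>m n > 0\<close> h by (simp add: field_simps)
    qed
    \<comment> \<open>Pointwise limit: the indicator of \<open>{a<..a+h}\<close> minus that of
      \<open>{b<..b+h}\<close>. Right of the last ramp the four primitives are affine with slope 1
      and cancel, so \<open>K n\<close> has compact support.\<close>
    define k where "k n t = ramp (m n) a t - ramp (m n) (a + h) t - ramp (m n) b t + ramp (m n) (b + h) t" for n t
    define K where "K n t = ramp_int (m n) a t - ramp_int (m n) (a + h) t - ramp_int (m n) b t + ramp_int (m n) (b + h) t" for n t
    have tf: "test_function L (\<lambda>t. complex_of_real (K n t)) (\<lambda>t. complex_of_real (k n t))" for n
      unfolding test_function_def
    proof (intro conjI allI)
      fix t
      have "(K n has_real_derivative k n t) (at t)"
        unfolding K_def k_def by (intro DERIV_add DERIV_diff has_derivative_ramp_int m)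
      then show "((\<lambda>t. complex_of_real (K n t)) has_vector_derivative complex_of_real (k n t)) (at t)"
        by (simp add: has_real_derivative_iff_has_vector_derivative has_vector_derivative_of_real)
    next
      show "continuous_on UNIV (\<lambda>t. complex_of_real (k n t))"
        unfolding k_def by (intro continuous_intros continuous_on_ramp)
    next
      show "\<exists>a b. 0 < a \<and> b < L \<and> (\<forall>t. t \<notin> {a..b} \<longrightarrow> complex_of_real (K n t) = 0)"
      proof (intro exI conjI allI impI)
        show "0 < a" "b + h + 1 / m n < L" using ab m by auto
        fix t assume "t \<notin> {a..b + h + 1 / m n}"
        then consider "t < a" | "t > b + h + 1 / m n" by fastforce
        then show "complex_of_real (K n t) = 0"
        proof cases
          case 1
          then show ?thesis using ab h m(1)[of n] by (simp add: K_def ramp_int_left)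
        next
          case 2
          then have "ramp_int (m n) x t = t - x - 1 / (2 * m n)" if "x \<in> {a, a + h, b, b + h}" for x
            using that ab h by (intro ramp_int_right[OF m(1)]) auto
          then show ?thesis by (simp add: K_def)
        qed
      qed
    qed
    define i where "i a t = (if a < t then 1 else 0 :: complex)" for a t :: real
    define w where "w t = u t * i a t - u t * i (a + h) t - u t * i b t + u t * i (b + h) t" for t
    have int: "integrable (lebesgue_on {0..L}) (\<lambda>t. u t * i x t)"
        "(LINT t|lebesgue_on {0..L}. u t * i x t) = integral {x..L} u" if "x \<in> {a, a + h, b, b + h}" for x
      using that ab h integrable_indicator_interval[OF u, of x] by (auto simp: i_def)
    have w: "(LINT t|lebesgue_on {0..L}. w t) =
       integral {a..L} u - integral {a+h..L} u - integral {b..L} u + integral {b+h..L} u"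
      unfolding w_def using int by simp
    have "(\<lambda>n. LINT t|lebesgue_on {0..L}. u t * complex_of_real (k n t)) \<longlonglongrightarrow> (LINT t|lebesgue_on {0..L}. w t)"
    proof (rule integral_dominated_convergence)
      show "w \<in> borel_measurable (lebesgue_on {0..L})"
        unfolding w_def using int by (intro borel_measurable_add borel_measurable_diff) auto
      show "(\<lambda>t. u t * complex_of_real (k n t)) \<in> borel_measurable (lebesgue_on {0..L})" for n
      proof -
        have "continuous_on {0..L} (\<lambda>t. complex_of_real (k n t))"
          unfolding k_def by (intro continuous_intros continuous_on_ramp)
        then show ?thesis
          by (intro borel_measurable_integrable integrable_mult_continuous[OF u])
      qed
      show "integrable (lebesgue_on {0..L}) (\<lambda>t. 4 * norm (u t))"
        using u by auto
      show "AE t in lebesgue_on {0..L}. (\<lambda>n. u t * complex_of_real (k n t)) \<longlonglongrightarrow> w t"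
      proof (rule AE_I2)
        fix t
        have r: "(\<lambda>n. complex_of_real (ramp (m n) x t)) \<longlonglongrightarrow> i x t" for x
          using tendsto_of_real[OF ramp_tendsto[of N x t], where ?'a = complex]
          unfolding m_def i_def by (simp split: if_splits)
        have "(\<lambda>n. u t * complex_of_real (k n t)) \<longlonglongrightarrow> u t * (i a t - i (a + h) t - i b t + i (b + h) t)"
          unfolding k_def of_real_add of_real_diff by (intro tendsto_intros r)
        then show "(\<lambda>n. u t * complex_of_real (k n t)) \<longlonglongrightarrow> w t"
          by (simp add: w_def algebra_simps)
      qed
      show "AE t in lebesgue_on {0..L}. norm (u t * complex_of_real (k n t)) \<le> 4 * norm (u t)" for n
      proof (rule AE_I2)
        fix t
        have "\<bar>k n t\<bar> \<le> 4"
          using ramp_bounds[of "m n" _ t] unfolding k_def by (smt (verit))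
        then show "norm (u t * complex_of_real (k n t)) \<le> 4 * norm (u t)"
          by (simp add: norm_mult mult.commute mult_left_mono)
      qed
    qed
    moreover have "(LINT t|lebesgue_on {0..L}. u t * complex_of_real (k n t)) = 0" for n
      by (rule zero[OF tf])
    ultimately have "(LINT t|lebesgue_on {0..L}. w t) = 0"
      by (simp add: LIMSEQ_const_iff)
    then have z: "integral {a..L} u - integral {a+h..L} u - integral {b..L} u + integral {b+h..L} u = 0"
      using w by simp
    have comb: "integral {x..x+h} u = integral {x..L} u - integral {x+h..L} u" if "x = a \<or> x = b" for x
    proof -
      have "integral {x..x+h} u + integral {x+h..L} u = integral {x..L} u"
        by (rule Henstock_Kurzweil_Integration.integral_combine)
          (use that ab h in \<open>auto intro: integrable_on_subinterval[OF iu]\<close>)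
      then show ?thesis by (simp add: eq_diff_eq)
    qed
    have "integral {a..a+h} u - integral {b..b+h} u
        = integral {a..L} u - integral {a+h..L} u - integral {b..L} u + integral {b+h..L} u"
      using comb[of a] comb[of b] by simp
    then show ?thesis using z by simp
  qed
  obtain N where N: "negligible N" and
    *: "\<And>x e. x \<notin> N \<Longrightarrow> 0 \<le> x \<Longrightarrow> x < L \<Longrightarrow> 0 < e \<Longrightarrow>
           \<exists>d>0. \<forall>h. 0 < h \<and> h < d \<longrightarrow> x + h < L \<and> norm (integral {x..x+h} u /\<^sub>R h - u x) < e"
    using lebesgue_point[OF iu] by metis
  have less: "u x = u y" if x: "x \<notin> N" "0 < x" and y: "y \<notin> N" "x < y" "y < L" for x y
  proof (rule ccontr)
    assume "u x \<noteq> u y"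
    define e where "e = norm (u x - u y) / 2"
    have "e > 0" using \<open>u x \<noteq> u y\<close> by (simp add: e_def)
    obtain d1 where d1: "d1 > 0" "\<And>h. 0 < h \<and> h < d1 \<Longrightarrow> x + h < L \<and> norm (integral {x..x+h} u /\<^sub>R h - u x) < e"
      using *[of x e] x y \<open>e > 0\<close> by auto
    obtain d2 where d2: "d2 > 0" "\<And>h. 0 < h \<and> h < d2 \<Longrightarrow> y + h < L \<and> norm (integral {y..y+h} u /\<^sub>R h - u y) < e"
      using *[of y e] x y \<open>e > 0\<close> by auto
    define h where "h = min d1 d2 / 2"
    have h: "0 < h" "h < d1" "h < d2" using d1 d2 by (auto simp: h_def)
    have "integral {x..x+h} u = integral {y..y+h} u"
      using eq[of x y h] x y d2(2)[of h] h by auto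
    moreover have "norm (integral {x..x+h} u /\<^sub>R h - u x) < e" "norm (integral {y..y+h} u /\<^sub>R h - u y) < e"
      using d1(2)[of h] d2(2)[of h] h by auto
    ultimately have "norm (u x - u y) < e + e"
      by (metis norm_diff_triangle_less norm_minus_commute)
    then show False by (simp add: e_def)
  qed
  show ?thesis
  proof (cases "\<exists>x. x \<notin> N \<and> 0 < x \<and> x < L")
    case True
    then obtain x where x: "x \<notin> N" "0 < x" "x < L" by blast
    have "AE t in lebesgue_on {0..L}. u t = u x"
    proof (rule AE_lebesgue_on_negligible[OF N])
      fix t assume "t \<notin> N" "0 < t" "t < L"
      then consider "t < x" "u t = u x" | "x < t" "u x = u t" | "t = x"
        using less[of t x] less[of x t] x by linarith
      then show "u t = u x" by cases (simp_all only:)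
    qed
    then show ?thesis by blast
  next
    case False
    then have "AE t in lebesgue_on {0..L}. u t = 0"
      by (intro AE_lebesgue_on_negligible[OF N]) auto
    then show ?thesis by blast
  qed
qed

section \<open>From weak to classical derivatives\<close>

lemma C1AC_L2: "C1AC L f g h \<Longrightarrow> L2_on L h"
  unfolding C1AC_def by blast

lemma C1AC_deriv: "C1AC L f g h \<Longrightarrow> t \<in> {0..L} \<Longrightarrow> (f has_vector_derivative g t) (at t within {0..L})"
  unfolding C1AC_def by blast

lemma C1AC_int: "C1AC L f g h \<Longrightarrow> t \<in> {0..L} \<Longrightarrow> g t = g 0 + integral {0..t} h"
  unfolding C1AC_def by blast

lemma integral_AE_eq:
  fixes f g :: "real \<Rightarrow> complex"
  assumes f: "integrable (lebesgue_on {0..L}) f" and g: "integrable (lebesgue_on {0..L}) g"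
    and ae: "AE t in lebesgue_on {0..L}. f t = g t" and t: "t \<in> {0..L}"
  shows "integral {0..t} f = integral {0..t} g"
proof -
  have m: "(\<lambda>s. if s \<in> {0..t} then w s else 0) \<in> borel_measurable (lebesgue_on {0..L})"
    if "integrable (lebesgue_on {0..L}) w" for w :: "real \<Rightarrow> complex"
  proof -
    have "integrable (lebesgue_on {0..L}) (\<lambda>s. indicat_real {0..t} s *\<^sub>R w s)"
      by (rule integrable_mult_indicator) (use that t in \<open>auto simp: sets_restrict_space_iff\<close>)
    moreover have "(\<lambda>s. indicat_real {0..t} s *\<^sub>R w s) = (\<lambda>s. if s \<in> {0..t} then w s else 0)"
      by (auto simp: indicator_def)
    ultimately show ?thesis by (simp only: borel_measurable_integrable)
  qed
  have sub: "{0..t} \<subseteq> {0..L}" using t by auto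
  have "(LINT s|lebesgue_on {0..L}. (if s \<in> {0..t} then f s else 0)) =
        (LINT s|lebesgue_on {0..L}. (if s \<in> {0..t} then g s else 0))"
  proof (rule integral_cong_AE[OF m[OF f] m[OF g]])
    show "AE s in lebesgue_on {0..L}. (if s \<in> {0..t} then f s else 0) = (if s \<in> {0..t} then g s else 0)"
      using ae by eventually_elim simp
  qed
  then show ?thesis
    by (simp only: integrable_lebesgue_on_restrict[OF f sub] integrable_lebesgue_on_restrict[OF g sub])
qed

lemma AE_eq_continuous:
  fixes f g :: "real \<Rightarrow> complex"
  assumes f: "continuous_on {0..L} f" and g: "continuous_on {0..L} g"
    and ae: "AE t in lebesgue_on {0..L}. f t = g t" and t: "t \<in> {0..L}" and L: "0 < L"
  shows "f t = g t"
proof -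
  have eq: "integral {0..s} f = integral {0..s} g" if "s \<in> {0..L}" for s
    by (rule integral_AE_eq[OF _ _ ae that])
      (intro continuous_on_integrable_lebesgue_on f g)+
  have "((\<lambda>s. integral {0..s} f) has_vector_derivative f t) (at t within {0..L})"
    by (rule integral_has_vector_derivative[OF f t])
  then have "((\<lambda>s. integral {0..s} g) has_vector_derivative f t) (at t within {0..L})"
    by (rule has_vector_derivative_transform[OF t, rotated]) (use eq in auto)
  moreover have "((\<lambda>s. integral {0..s} g) has_vector_derivative g t) (at t within {0..L})"
    by (rule integral_has_vector_derivative[OF g t])
  ultimately show ?thesis
    using vector_derivative_unique_within_closed_interval[of 0 L t] L t by auto
qed

context
  fixes L :: real
  assumes L: "0 < L"
begin

lemma C1AC_continuous:
  assumes "C1AC L f g h"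
  shows "continuous_on {0..L} f" "continuous_on {0..L} g"
proof -
  show "continuous_on {0..L} f"
    by (rule continuous_on_vector_derivative) (rule C1AC_deriv[OF assms])
  have "continuous_on {0..L} (\<lambda>t. g 0 + integral {0..t} h)"
    by (intro continuous_intros indefinite_integral_continuous_1 L2_on_integrable_on C1AC_L2[OF assms])
  then show "continuous_on {0..L} g"
    by (rule continuous_on_eq) (rule C1AC_int[OF assms, symmetric])
qed

lemma C1AC_FTC:
  assumes "C1AC L f g h" "t \<in> {0..L}"
  shows "f t = f 0 + integral {0..t} g"
proof -
  have "(g has_integral (f t - f 0)) {0..t}"
  proof (rule fundamental_theorem_of_calculus)
    show "0 \<le> t" using assms(2) by auto
    fix x assume "x \<in> {0..t}"
    then show "(f has_vector_derivative g x) (at x within {0..t})"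
      using assms(2) by (intro has_vector_derivative_within_subset[OF C1AC_deriv[OF assms(1)]]) auto
  qed
  then show ?thesis by (simp add: integral_unique)
qed

lemma C1AC_imp_second_weak:
  assumes "C1AC L f g h"
  shows "second_weak_derivative L f h"
  unfolding second_weak_derivative_def
proof (intro exI[of _ g] conjI)
  show g: "L2_on L g"
    by (rule L2_on_continuous[OF C1AC_continuous(2)[OF assms]])
  show h: "L2_on L h" by (rule C1AC_L2[OF assms])
  show "weak_derivative L f g"
    by (rule weak_derivative_indefinite_integral[OF L2_on_integrable[OF g]])
      (rule C1AC_FTC[OF assms])
  show "weak_derivative L g h"
    by (rule weak_derivative_indefinite_integral[OF L2_on_integrable[OF h]])
      (rule C1AC_int[OF assms])
qed

lemma C1AC_imp_H2: "C1AC L f g h \<Longrightarrow> H2 L f"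
  unfolding H2_def using C1AC_imp_second_weak L2_on_continuous[OF C1AC_continuous(1)] by blast

text \<open>The difference of \<open>f\<close> and the indefinite integral of \<open>g\<close> has
  weak derivative zero, which is the situation of \<open>du_bois_reymond\<close>.\<close>

lemma weak_derivative_unique_primitive:
  assumes f: "integrable (lebesgue_on {0..L}) f" and g: "integrable (lebesgue_on {0..L}) g"
    and w: "weak_derivative L f g"
  shows "\<exists>c. AE t in lebesgue_on {0..L}. f t = c + integral {0..t} g"
proof -
  have c: "continuous_on {0..L} (\<lambda>t. integral {0..t} g)"
    by (intro indefinite_integral_continuous_1 integrable_on_lebesgue_on[OF g]) auto
  have i: "integrable (lebesgue_on {0..L}) (\<lambda>t. integral {0..t} g)"
    by (rule continuous_on_integrable_lebesgue_on[OF c])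
  have w2: "weak_derivative L (\<lambda>t. integral {0..t} g) g"
    by (rule weak_derivative_indefinite_integral[OF g, of _ 0]) simp
  have "\<exists>c. AE t in lebesgue_on {0..L}. f t - integral {0..t} g = c"
  proof (rule du_bois_reymond)
    show "integrable (lebesgue_on {0..L}) (\<lambda>t. f t - integral {0..t} g)"
      using f i by auto
    fix \<phi> \<phi>' assume T: "test_function L \<phi> \<phi>'"
    then have cont: "continuous_on {0..L} \<phi>'"
      by (auto simp: test_function_def intro: continuous_on_subset)
    have "(LINT t|lebesgue_on {0..L}. (f t - integral {0..t} g) * \<phi>' t) =
      (LINT t|lebesgue_on {0..L}. f t * \<phi>' t) - (LINT t|lebesgue_on {0..L}. integral {0..t} g * \<phi>' t)"
      unfolding left_diff_distrib
      by (intro Bochner_Integration.integral_diff integrable_mult_continuous f i cont)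
    also have "\<dots> = 0"
      using w w2 T by (simp add: weak_derivative_def)
    finally show "(LINT t|lebesgue_on {0..L}. (f t - integral {0..t} g) * \<phi>' t) = 0" .
  qed
  then obtain c where "AE t in lebesgue_on {0..L}. f t - integral {0..t} g = c" ..
  then have "AE t in lebesgue_on {0..L}. f t = c + integral {0..t} g"
    by eventually_elim (simp add: algebra_simps)
  then show ?thesis ..
qed

text \<open>Taking primitives twice recovers \<open>f\<close> almost everywhere; its continuity
  upgrades this to every point, endpoints included, so that boundary values of \<open>f\<close> and
  of its derivative make sense.\<close>

lemma second_weak_imp_C1AC:
  assumes f: "continuous_on {0..L} f" and sw: "second_weak_derivative L f h"
  shows "\<exists>g. C1AC L f g h"
proof -
  from sw obtain g0 where g0: "L2_on L g0" and h: "L2_on L h"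
    and w1: "weak_derivative L f g0" and w2: "weak_derivative L g0 h"
    by (auto simp: second_weak_derivative_def)
  obtain c where c: "AE t in lebesgue_on {0..L}. g0 t = c + integral {0..t} h"
    using weak_derivative_unique_primitive[OF L2_on_integrable[OF g0] L2_on_integrable[OF h] w2] ..
  define g where "g t = c + integral {0..t} h" for t
  have cg: "continuous_on {0..L} g"
    unfolding g_def
    by (intro continuous_intros indefinite_integral_continuous_1 L2_on_integrable_on h)
  obtain d where d: "AE t in lebesgue_on {0..L}. f t = d + integral {0..t} g0"
    using weak_derivative_unique_primitive[OF continuous_on_integrable_lebesgue_on[OF f] L2_on_integrable[OF g0] w1] ..
  have eq: "integral {0..t} g0 = integral {0..t} g" if "t \<in> {0..L}" for t
    by (rule integral_AE_eq[OF L2_on_integrable[OF g0] continuous_on_integrable_lebesgue_on[OF cg] _ that])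
      (use c in \<open>simp add: g_def\<close>)
  have "AE t in lebesgue_on {0..L}. f t = d + integral {0..t} g"
    using d AE_space by eventually_elim (simp add: eq)
  moreover have cF: "continuous_on {0..L} (\<lambda>t. d + integral {0..t} g)"
    by (intro continuous_intros indefinite_integral_continuous_1 integrable_continuous_real cg)
  ultimately have fF: "f t = d + integral {0..t} g" if "t \<in> {0..L}" for t
    using AE_eq_continuous[OF f cF _ that L] by blast
  have "C1AC L f g h"
    unfolding C1AC_def
  proof (intro conjI h ballI)
    fix t assume t: "t \<in> {0..L}"
    have "((\<lambda>t. d + integral {0..t} g) has_vector_derivative g t) (at t within {0..L})"
      using has_vector_derivative_add[OF has_vector_derivative_const integral_has_vector_derivative[OF cg t], of d] by simp
    then show "(f has_vector_derivative g t) (at t within {0..L})"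
      by (rule has_vector_derivative_transform[OF t, rotated]) (use fF in auto)
    show "g t = g 0 + integral {0..t} h"
      by (simp add: g_def)
  qed
  then show ?thesis by blast
qed

text \<open>This makes the arbitrary choice in \<open>laplacian\<close> harmless: two second
  derivatives differ on a null set at most.\<close>

lemma C1AC_unique:
  assumes "C1AC L f g h" "C1AC L f g' h'"
  shows "\<And>t. t \<in> {0..L} \<Longrightarrow> g t = g' t" and "AE t in lebesgue_on {0..L}. h t = h' t"
proof -
  show *: "g t = g' t" if "t \<in> {0..L}" for t
    by (rule vector_derivative_unique_within_closed_interval[of 0 L t f])
      (use L that C1AC_deriv[OF assms(1) that] C1AC_deriv[OF assms(2) that] in auto)
  note h = C1AC_L2[OF assms(1)] C1AC_L2[OF assms(2)]
  have "integral {0..t} (\<lambda>s. h s - h' s) = 0" if "t \<in> {0..L}" for t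
  proof -
    have "h integrable_on {0..t}" "h' integrable_on {0..t}"
      using L2_on_integrable_on[OF h(1)] L2_on_integrable_on[OF h(2)] that
      by (auto intro: integrable_on_subinterval)
    then have "integral {0..t} (\<lambda>s. h s - h' s) = integral {0..t} h - integral {0..t} h'"
      by (rule Henstock_Kurzweil_Integration.integral_diff)
    moreover have "integral {0..t} h = g t - g 0" "integral {0..t} h' = g' t - g' 0"
      using C1AC_int[OF assms(1) that] C1AC_int[OF assms(2) that] by simp_all
    moreover have "g 0 = g' 0" using *[of 0] L by simp
    ultimately show ?thesis using *[OF that] by simp
  qed
  then have "AE t in lebesgue_on {0..L}. h t - h' t = 0"
    by (intro indefinite_integral_zero_AE integrable_diff L2_on_integrable_on h)
  then show "AE t in lebesgue_on {0..L}. h t = h' t"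
    by eventually_elim simp
qed

lemma C1AC_AE_cong:
  assumes "C1AC L f g h" "AE t in lebesgue_on {0..L}. h t = h' t" "L2_on L h'"
  shows "C1AC L f g h'"
proof -
  have "integral {0..t} h = integral {0..t} h'" if "t \<in> {0..L}" for t
    by (rule integral_AE_eq[OF _ _ assms(2) that]; rule L2_on_integrable)
      (rule C1AC_L2[OF assms(1)] assms(3))+
  then show ?thesis
    using assms(1,3) unfolding C1AC_def by metis
qed

lemma C1AC_cong:
  assumes "C1AC L f g h" "\<And>t. t \<in> {0..L} \<Longrightarrow> f' t = f t" "\<And>t. t \<in> {0..L} \<Longrightarrow> g' t = g t"
  shows "C1AC L f' g' h"
  unfolding C1AC_def
proof (intro conjI ballI)
  show "L2_on L h" by (rule C1AC_L2[OF assms(1)])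
  fix t assume t: "t \<in> {0..L}"
  have "(f has_vector_derivative g t) (at t within {0..L})"
    by (rule C1AC_deriv[OF assms(1) t])
  then show "(f' has_vector_derivative g' t) (at t within {0..L})"
    by (subst assms(3)[OF t], rule has_vector_derivative_transform[OF t, rotated]) (use assms(2) in auto)
  show "g' t = g' 0 + integral {0..t} h"
    using C1AC_int[OF assms(1) t] assms(3)[of 0] assms(3)[OF t] L by simp
qed

lemma C1AC_add:
  assumes "C1AC L f g h" "C1AC L f' g' h'"
  shows "C1AC L (\<lambda>t. f t + f' t) (\<lambda>t. g t + g' t) (\<lambda>t. h t + h' t)"
  unfolding C1AC_def
proof (intro conjI ballI)
  note h = C1AC_L2[OF assms(1)] C1AC_L2[OF assms(2)]
  show "L2_on L (\<lambda>t. h t + h' t)" by (rule L2_on_add[OF h])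
  fix t assume t: "t \<in> {0..L}"
  show "((\<lambda>t. f t + f' t) has_vector_derivative g t + g' t) (at t within {0..L})"
    by (intro has_vector_derivative_add C1AC_deriv[OF _ t]) (rule assms)+
  have "h integrable_on {0..t}" "h' integrable_on {0..t}"
    using L2_on_integrable_on[OF h(1)] L2_on_integrable_on[OF h(2)] t
    by (auto intro: integrable_on_subinterval)
  then have "integral {0..t} (\<lambda>s. h s + h' s) = integral {0..t} h + integral {0..t} h'"
    by (rule Henstock_Kurzweil_Integration.integral_add)
  moreover have "integral {0..t} h = g t - g 0" "integral {0..t} h' = g' t - g' 0"
    using C1AC_int[OF assms(1) t] C1AC_int[OF assms(2) t] by simp_all
  ultimately show "g t + g' t = g 0 + g' 0 + integral {0..t} (\<lambda>s. h s + h' s)"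
    by simp
qed

lemma C1AC_cmult:
  assumes "C1AC L f g h"
  shows "C1AC L (\<lambda>t. c * f t) (\<lambda>t. c * g t) (\<lambda>t. c * h t)"
  unfolding C1AC_def
proof (intro conjI ballI)
  show "L2_on L (\<lambda>t. c * h t)" by (rule L2_on_cmult[OF C1AC_L2[OF assms]])
  fix t assume t: "t \<in> {0..L}"
  show "((\<lambda>t. c * f t) has_vector_derivative c * g t) (at t within {0..L})"
    by (rule has_vector_derivative_mult_right[OF C1AC_deriv[OF assms t]])
  show "c * g t = c * g 0 + integral {0..t} (\<lambda>s. c * h s)"
    by (subst C1AC_int[OF assms t]) (simp add: distrib_left)
qed

lemma C1AC_cnj:
  assumes "C1AC L f g h"
  shows "C1AC L (\<lambda>t. cnj (f t)) (\<lambda>t. cnj (g t)) (\<lambda>t. cnj (h t))"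
  unfolding C1AC_def
proof (intro conjI ballI)
  have h: "L2_on L h" by (rule C1AC_L2[OF assms])
  show "L2_on L (\<lambda>t. cnj (h t))" by (rule L2_on_cnj[OF h])
  fix t assume t: "t \<in> {0..L}"
  show "((\<lambda>t. cnj (f t)) has_vector_derivative cnj (g t)) (at t within {0..L})"
    by (rule has_vector_derivative_cnj[OF C1AC_deriv[OF assms t]])
  have "h integrable_on {0..t}"
    using L2_on_integrable_on[OF h] t by (auto intro: integrable_on_subinterval)
  then have "((\<lambda>s. cnj (h s)) has_integral cnj (integral {0..t} h)) {0..t}"
    using has_integral_cnj[of h "integral {0..t} h"] integrable_integral by (simp add: o_def)
  then have "integral {0..t} (\<lambda>s. cnj (h s)) = cnj (integral {0..t} h)"
    by (rule integral_unique)
  moreover have "g t = g 0 + integral {0..t} h"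
    by (rule C1AC_int[OF assms t])
  ultimately show "cnj (g t) = cnj (g 0) + integral {0..t} (\<lambda>s. cnj (h s))"
    by (metis complex_cnj_add)
qed

lemma C1AC_C2I:
  assumes "\<And>t. t \<in> {0..L} \<Longrightarrow> (f has_vector_derivative g t) (at t within {0..L})"
    and "\<And>t. t \<in> {0..L} \<Longrightarrow> (g has_vector_derivative h t) (at t within {0..L})"
    and "continuous_on {0..L} h"
  shows "C1AC L f g h"
  unfolding C1AC_def
proof (intro conjI ballI)
  show "L2_on L h" by (rule L2_on_continuous[OF assms(3)])
  fix t assume t: "t \<in> {0..L}"
  show "(f has_vector_derivative g t) (at t within {0..L})" by (rule assms(1)[OF t])
  have "(h has_integral (g t - g 0)) {0..t}"
    by (rule fundamental_theorem_of_calculus)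
      (use t in \<open>auto intro!: has_vector_derivative_within_subset[OF assms(2)]\<close>)
  then show "g t = g 0 + integral {0..t} h"
    by (simp add: integral_unique)
qed

lemma C1AC_continuous_derivative:
  assumes "C1AC L f g h" "continuous_on {0..L} h" "t \<in> {0..L}"
  shows "(g has_vector_derivative h t) (at t within {0..L})"
proof -
  have "((\<lambda>t. g 0 + integral {0..t} h) has_vector_derivative h t) (at t within {0..L})"
    using has_vector_derivative_add[OF has_vector_derivative_const integral_has_vector_derivative[OF assms(2,3)], of "g 0"] by simp
  then show ?thesis
    by (rule has_vector_derivative_transform[OF assms(3), rotated]) (rule C1AC_int[OF assms(1)])
qed

end

section \<open>The equation \<open>f'' + \<mu> f = \<psi>\<close>\<close>

text \<open>Together with \<open>sinm\<close>: the fundamental system of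
  \<open>f'' + \<mu> f = 0\<close> with initial data (1, 0) and (0, 1), real for every sign of
  \<open>\<mu>\<close>.\<close>

definition cosm :: "real \<Rightarrow> real \<Rightarrow> real" where
  "cosm \<mu> t = (if \<mu> > 0 then cos (sqrt \<mu> * t) else if \<mu> = 0 then 1 else cosh (sqrt (- \<mu>) * t))"

definition sinm :: "real \<Rightarrow> real \<Rightarrow> real" where
  "sinm \<mu> t = (if \<mu> > 0 then sin (sqrt \<mu> * t) / sqrt \<mu> else if \<mu> = 0 then t
     else sinh (sqrt (- \<mu>) * t) / sqrt (- \<mu>))"

lemma cosm_0 [simp]: "cosm \<mu> 0 = 1" and sinm_0 [simp]: "sinm \<mu> 0 = 0"
  by (simp_all add: cosm_def sinm_def)

lemma has_derivative_cosm: "(cosm \<mu> has_real_derivative - \<mu> * sinm \<mu> t) (at t within S)"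
proof -
  consider "\<mu> > 0" | "\<mu> = 0" | "\<mu> < 0" by linarith
  then show ?thesis
  proof cases
    case 1
    have "((\<lambda>t. cos (sqrt \<mu> * t)) has_real_derivative - \<mu> * (sin (sqrt \<mu> * t) / sqrt \<mu>)) (at t within S)"
      using 1 by (auto intro!: derivative_eq_intros simp: field_simps)
    then show ?thesis using 1 by (simp add: cosm_def[abs_def] sinm_def)
  next
    case 2
    then show ?thesis by (simp add: cosm_def[abs_def])
  next
    case 3
    have "((\<lambda>t. cosh (sqrt (- \<mu>) * t)) has_real_derivative - \<mu> * (sinh (sqrt (- \<mu>) * t) / sqrt (- \<mu>))) (at t within S)"
    proof -
      define \<kappa> where "\<kappa> = sqrt (- \<mu>)"
      have "\<kappa> > 0" "\<mu> = - (\<kappa> * \<kappa>)" using 3 by (simp_all add: \<kappa>_def)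
      then show ?thesis unfolding \<kappa>_def[symmetric]
        by (auto intro!: derivative_eq_intros)
    qed
    then show ?thesis using 3 by (simp add: cosm_def[abs_def] sinm_def)
  qed
qed

lemma has_derivative_sinm: "(sinm \<mu> has_real_derivative cosm \<mu> t) (at t within S)"
proof -
  consider "\<mu> > 0" | "\<mu> = 0" | "\<mu> < 0" by linarith
  then show ?thesis
  proof cases
    case 1
    have "((\<lambda>t. sin (sqrt \<mu> * t) / sqrt \<mu>) has_real_derivative cos (sqrt \<mu> * t)) (at t within S)"
      using 1 by (auto intro!: derivative_eq_intros simp: field_simps)
    then show ?thesis using 1 by (simp add: cosm_def sinm_def[abs_def])
  next
    case 2
    then show ?thesis by (simp add: cosm_def sinm_def[abs_def])
  next
    case 3
    have "((\<lambda>t. sinh (sqrt (- \<mu>) * t) / sqrt (- \<mu>)) has_real_derivative cosh (sqrt (- \<mu>) * t)) (at t within S)"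
    proof -
      define \<kappa> where "\<kappa> = sqrt (- \<mu>)"
      have "\<kappa> > 0" using 3 by (simp add: \<kappa>_def)
      then show ?thesis unfolding \<kappa>_def[symmetric]
        by (auto intro!: derivative_eq_intros)
    qed
    then show ?thesis using 3 by (simp add: cosm_def sinm_def[abs_def])
  qed
qed

lemma cosm_sinm: "(cosm \<mu> t)\<^sup>2 + \<mu> * (sinm \<mu> t)\<^sup>2 = 1"
proof -
  consider "\<mu> > 0" | "\<mu> = 0" | "\<mu> < 0" by linarith
  then show ?thesis
  proof cases
    case 3
    have "(cosh (sqrt (- \<mu>) * t))\<^sup>2 - (sinh (sqrt (- \<mu>) * t))\<^sup>2 = 1"
      by (rule hyperbolic_pythagoras)
    then show ?thesis using 3 by (simp add: cosm_def sinm_def power_divide)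
  qed (simp_all add: cosm_def sinm_def power_divide)
qed

lemma continuous_on_cosm: "continuous_on S (cosm \<mu>)" and continuous_on_sinm: "continuous_on S (sinm \<mu>)"
  by (meson DERIV_continuous_on has_derivative_cosm has_derivative_sinm)+

lemma sinm_pos: "\<mu> \<le> 0 \<Longrightarrow> 0 < t \<Longrightarrow> 0 < sinm \<mu> t"
  by (auto simp: sinm_def)

lemma cosm_ge_1: "\<mu> \<le> 0 \<Longrightarrow> 1 \<le> cosm \<mu> t"
  by (auto simp: cosm_def cosh_real_ge_1)

abbreviation ccosm :: "real \<Rightarrow> real \<Rightarrow> complex" where "ccosm \<mu> t \<equiv> complex_of_real (cosm \<mu> t)"
abbreviation csinm :: "real \<Rightarrow> real \<Rightarrow> complex" where "csinm \<mu> t \<equiv> complex_of_real (sinm \<mu> t)"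

lemma has_vector_derivative_ccosm: "(ccosm \<mu> has_vector_derivative - (of_real \<mu> * csinm \<mu> t)) (at t within S)"
  using has_vector_derivative_of_real[OF has_derivative_cosm[of \<mu> t S]]
  by simp

lemma has_vector_derivative_csinm: "(csinm \<mu> has_vector_derivative ccosm \<mu> t) (at t within S)"
  using has_vector_derivative_of_real[OF has_derivative_sinm[of \<mu> t S]]
  by simp

lemma ccosm_csinm: "(ccosm \<mu> t)\<^sup>2 + of_real \<mu> * (csinm \<mu> t)\<^sup>2 = 1"
proof -
  have "complex_of_real ((cosm \<mu> t)\<^sup>2 + \<mu> * (sinm \<mu> t)\<^sup>2) = 1" by (simp only: cosm_sinm of_real_1)
  then show ?thesis by simp
qed

lemma continuous_on_ccosm: "continuous_on S (ccosm \<mu>)" and continuous_on_csinm: "continuous_on S (csinm \<mu>)"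
  by (intro continuous_on_of_real continuous_on_cosm continuous_on_sinm)+

lemma C1AC_fundamental:
  assumes "0 < L"
  shows "C1AC L (\<lambda>t. a * ccosm \<mu> t + b * csinm \<mu> t) (\<lambda>t. - (of_real \<mu> * a * csinm \<mu> t) + b * ccosm \<mu> t)
    (\<lambda>t. - (of_real \<mu> * (a * ccosm \<mu> t + b * csinm \<mu> t)))"
proof (rule C1AC_C2I[OF assms])
  fix t
  show "((\<lambda>t. a * ccosm \<mu> t + b * csinm \<mu> t) has_vector_derivative - (of_real \<mu> * a * csinm \<mu> t) + b * ccosm \<mu> t) (at t within {0..L})"
    by (rule derivative_eq_intros has_vector_derivative_ccosm has_vector_derivative_csinm refl)+ (simp add: algebra_simps)
  show "((\<lambda>t. - (of_real \<mu> * a * csinm \<mu> t) + b * ccosm \<mu> t) has_vector_derivative - (of_real \<mu> * (a * ccosm \<mu> t + b * csinm \<mu> t))) (at t within {0..L})"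
    by (rule derivative_eq_intros has_vector_derivative_ccosm has_vector_derivative_csinm refl)+ (simp add: algebra_simps)
next
  show "continuous_on {0..L} (\<lambda>t. - (of_real \<mu> * (a * ccosm \<mu> t + b * csinm \<mu> t)))"
    by (intro continuous_intros continuous_on_ccosm continuous_on_csinm)
qed

lemma has_vector_derivative_zero_eq:
  fixes F :: "real \<Rightarrow> complex"
  assumes "\<And>t. t \<in> {0..L} \<Longrightarrow> (F has_vector_derivative 0) (at t within {0..L})" "t \<in> {0..L}"
  shows "F t = F 0"
proof -
  have "0 \<in> {0..L}" using assms(2) by auto
  obtain c where "\<And>x. x \<in> {0..L} \<Longrightarrow> F x = c"
    using has_vector_derivative_zero_constant[of "{0..L}" F] assms(1) by auto
  then show ?thesis using \<open>0 \<in> {0..L}\<close> assms(2) by metis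
qed

text \<open>\<open>A\<close> and \<open>B\<close> are the coefficients of variation of constants.
  Their derivatives vanish, so they keep their initial values, and \<open>ccosm_csinm\<close>
  recovers \<open>f\<close> and \<open>g\<close> from them.\<close>

lemma homogeneous_solution:
  assumes L: "0 < L" and f: "C1AC L f g h" and h: "AE t in lebesgue_on {0..L}. h t = - (of_real \<mu> * f t)"
    and t: "t \<in> {0..L}"
  shows "f t = f 0 * ccosm \<mu> t + g 0 * csinm \<mu> t"
    and "g t = - (of_real \<mu> * f 0 * csinm \<mu> t) + g 0 * ccosm \<mu> t"
proof -
  have cont: "continuous_on {0..L} (\<lambda>t. - (of_real \<mu> * f t))"
    by (intro continuous_intros C1AC_continuous(1)[OF L f])
  have f': "C1AC L f g (\<lambda>t. - (of_real \<mu> * f t))"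
    by (rule C1AC_AE_cong[OF L f h L2_on_continuous[OF cont]])
  have dg: "(g has_vector_derivative - (of_real \<mu> * f t)) (at t within {0..L})" if "t \<in> {0..L}" for t
    by (rule C1AC_continuous_derivative[OF L f' cont that])
  note df = C1AC_deriv[OF f]
  define A where "A t = f t * ccosm \<mu> t - g t * csinm \<mu> t" for t
  define B where "B t = of_real \<mu> * (f t * csinm \<mu> t) + g t * ccosm \<mu> t" for t
  have A: "A t = f 0" if "t \<in> {0..L}" for t
  proof -
    have "A t = A 0"
      unfolding A_def
    proof (rule has_vector_derivative_zero_eq[OF _ that])
      fix t assume "t \<in> {0..L}"
      then show "((\<lambda>t. f t * ccosm \<mu> t - g t * csinm \<mu> t) has_vector_derivative 0) (at t within {0..L})"
        by - (rule derivative_eq_intros df dg has_vector_derivative_ccosm has_vector_derivative_csinm refl | assumption | simp add: algebra_simps)+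
    qed
    then show ?thesis by (simp add: A_def)
  qed
  have B: "B t = g 0" if "t \<in> {0..L}" for t
  proof -
    have "B t = B 0"
      unfolding B_def
    proof (rule has_vector_derivative_zero_eq[OF _ that])
      fix t assume "t \<in> {0..L}"
      then show "((\<lambda>t. of_real \<mu> * (f t * csinm \<mu> t) + g t * ccosm \<mu> t) has_vector_derivative 0) (at t within {0..L})"
        by - (rule derivative_eq_intros df dg has_vector_derivative_ccosm has_vector_derivative_csinm refl | assumption | simp add: algebra_simps)+
    qed
    then show ?thesis by (simp add: B_def)
  qed
  let ?c = "ccosm \<mu> t" and ?s = "csinm \<mu> t"
  have "f t = f t * (?c\<^sup>2 + of_real \<mu> * ?s\<^sup>2)" by (simp only: ccosm_csinm mult_1_right)
  also have "\<dots> = A t * ?c + B t * ?s" by (simp add: A_def B_def power2_eq_square algebra_simps)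
  finally show "f t = f 0 * ?c + g 0 * ?s" by (simp only: A[OF t] B[OF t])
  have "g t = g t * (?c\<^sup>2 + of_real \<mu> * ?s\<^sup>2)" by (simp only: ccosm_csinm mult_1_right)
  also have "\<dots> = - (of_real \<mu> * A t * ?s) + B t * ?c" by (simp add: A_def B_def power2_eq_square algebra_simps)
  finally show "g t = - (of_real \<mu> * f 0 * ?s) + g 0 * ?c" by (simp only: A[OF t] B[OF t])
qed

lemma fundamental_bounded:
  "\<exists>B\<ge>0. \<forall>t\<in>{0..L}. norm (ccosm \<mu> t) \<le> B \<and> norm (csinm \<mu> t) \<le> B"
proof -
  have "bounded (ccosm \<mu> ` {0..L})" "bounded (csinm \<mu> ` {0..L})"
    by (intro compact_imp_bounded compact_continuous_image continuous_on_ccosm continuous_on_csinm; simp)+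
  then obtain B1 B2 where B: "\<forall>t\<in>{0..L}. norm (ccosm \<mu> t) \<le> B1" "\<forall>t\<in>{0..L}. norm (csinm \<mu> t) \<le> B2"
    unfolding bounded_iff by (metis imageI)
  show ?thesis
    by (rule exI[of _ "max 0 (max B1 B2)"]) (use B in fastforce)
qed

text \<open>Since \<open>\<psi>\<close> is only square integrable, it is first removed by its double
  integral \<open>G2\<close>. What remains is an equation for \<open>k\<close> with the continuous
  right-hand side \<open>- \<mu> G2\<close>, to which variation of constants applies in the
  classical sense. That \<open>C\<close> does not depend on \<open>\<psi>\<close> later yields the
  bounded inverse.\<close>

lemma particular_solution:
  assumes L: "0 < L"
  shows "\<exists>C\<ge>0. \<forall>\<psi>. L2_on L \<psi> \<longrightarrow> (\<exists>f g. C1AC L f g (\<lambda>t. \<psi> t - of_real \<mu> * f t) \<and> f 0 = 0 \<and> g 0 = 0 \<and>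
    (\<forall>t\<in>{0..L}. norm (f t) \<le> C * sqrt (LINT t|lebesgue_on {0..L}. (cmod (\<psi> t))\<^sup>2) \<and>
                norm (g t) \<le> C * sqrt (LINT t|lebesgue_on {0..L}. (cmod (\<psi> t))\<^sup>2)))"
proof -
  obtain B where B0: "0 \<le> B" and B: "\<And>t. t \<in> {0..L} \<Longrightarrow> norm (ccosm \<mu> t) \<le> B" "\<And>t. t \<in> {0..L} \<Longrightarrow> norm (csinm \<mu> t) \<le> B"
    using fundamental_bounded[of L \<mu>] by blast
  \<comment> \<open>With \<open>M\<close> a bound for the L1 norm of \<open>\<psi>\<close>, the
    product \<open>R * M\<close> bounds the coefficients \<open>P\<close> and \<open>Q\<close>
    below; \<open>C\<close> collects the bounds for \<open>G1\<close>, \<open>G2\<close>,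
    \<open>k\<close> and \<open>k'\<close>.\<close>
  define R where "R = B * (\<bar>\<mu>\<bar> * L) * L"
  have R0: "0 \<le> R" using B0 L by (simp add: R_def)
  define C where "C = (1 + L + 2 * B * R + (1 + \<bar>\<mu>\<bar>) * B * R) * sqrt L"
  have C0: "C \<ge> 0" using B0 R0 L by (simp add: C_def)
  show ?thesis
  proof (intro exI[of _ C] conjI allI impI C0)
    fix \<psi> assume \<psi>: "L2_on L \<psi>"
    define N where "N = sqrt (LINT t|lebesgue_on {0..L}. (cmod (\<psi> t))\<^sup>2)"
    define M where "M = sqrt L * N"
    have N0: "0 \<le> N" by (simp add: N_def)
    have M0: "0 \<le> M" using L N0 by (simp add: M_def)
    define G1 where "G1 t = integral {0..t} \<psi>" for t
    define G2 where "G2 t = integral {0..t} G1" for t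
    note i\<psi> = L2_on_integrable[OF \<psi>]
    have G1b: "norm (G1 t) \<le> M" if "t \<in> {0..L}" for t
    proof -
      have ii: "(\<lambda>s. cmod (\<psi> s)) integrable_on {0..L}"
        by (rule integrable_on_lebesgue_on) (use i\<psi> in auto)
      have it: "(\<lambda>s. cmod (\<psi> s)) integrable_on {0..t}" "\<psi> integrable_on {0..t}"
        using ii L2_on_integrable_on[OF \<psi>] that by (auto intro: integrable_on_subinterval)
      have "norm (G1 t) \<le> integral {0..t} (\<lambda>s. cmod (\<psi> s))"
        unfolding G1_def by (rule integral_norm_bound_integral[OF it(2,1)]) simp
      also have "\<dots> \<le> integral {0..L} (\<lambda>s. cmod (\<psi> s))"
        by (rule integral_subset_le) (use that ii it in auto)
      also have "\<dots> = (LINT t|lebesgue_on {0..L}. cmod (\<psi> t))"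
        by (rule lebesgue_on_integral[symmetric]) (use i\<psi> in auto)
      also have "\<dots> \<le> M"
        unfolding M_def N_def by (rule L1_le_L2[OF \<psi> L])
      finally show ?thesis .
    qed
    have cG1: "continuous_on {0..L} G1"
      unfolding G1_def by (intro indefinite_integral_continuous_1 L2_on_integrable_on \<psi>)
    have dG2: "(G2 has_vector_derivative G1 t) (at t within {0..L})" if "t \<in> {0..L}" for t
      unfolding G2_def by (rule integral_has_vector_derivative[OF cG1 that])
    have cG2: "continuous_on {0..L} G2"
      unfolding G2_def by (intro indefinite_integral_continuous_1 integrable_continuous_real cG1)
    have G: "C1AC L G2 G1 \<psi>"
      unfolding C1AC_def using \<psi> dG2 by (simp add: G1_def)
    have G2b: "norm (G2 t) \<le> L * M" if "t \<in> {0..L}" for t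
    proof -
      have "norm (G2 t) \<le> M * (t - 0)"
        unfolding G2_def
        by (rule integral_bound) (use that in \<open>auto intro: continuous_on_subset[OF cG1] G1b\<close>)
      also have "\<dots> \<le> L * M" using that M0 by (simp add: mult.commute[of L] mult_left_mono)
      finally show ?thesis .
    qed
    define \<phi> where "\<phi> t = - (of_real \<mu> * G2 t)" for t
    have c\<phi>: "continuous_on {0..L} \<phi>" unfolding \<phi>_def by (intro continuous_intros cG2)
    have \<phi>b: "norm (\<phi> t) \<le> \<bar>\<mu>\<bar> * L * M" if "t \<in> {0..L}" for t
      using G2b[OF that] by (simp add: \<phi>_def norm_mult mult_left_mono mult.assoc)
    define P where "P t = integral {0..t} (\<lambda>s. ccosm \<mu> s * \<phi> s)" for t
    define Q where "Q t = integral {0..t} (\<lambda>s. csinm \<mu> s * \<phi> s)" for t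
    have cc: "continuous_on {0..L} (\<lambda>s. ccosm \<mu> s * \<phi> s)" "continuous_on {0..L} (\<lambda>s. csinm \<mu> s * \<phi> s)"
      by (intro continuous_intros c\<phi> continuous_on_ccosm continuous_on_csinm)+
    have dP: "(P has_vector_derivative ccosm \<mu> t * \<phi> t) (at t within {0..L})" if "t \<in> {0..L}" for t
      unfolding P_def by (rule integral_has_vector_derivative[OF cc(1) that])
    have dQ: "(Q has_vector_derivative csinm \<mu> t * \<phi> t) (at t within {0..L})" if "t \<in> {0..L}" for t
      unfolding Q_def by (rule integral_has_vector_derivative[OF cc(2) that])
    have bnd: "norm (integral {0..t} (\<lambda>s. w s * \<phi> s)) \<le> R * M"
      if "t \<in> {0..L}" and w: "continuous_on {0..L} (\<lambda>s. w s * \<phi> s)" "\<And>s. s \<in> {0..L} \<Longrightarrow> norm (w s) \<le> B"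
      for t and w :: "real \<Rightarrow> complex"
    proof -
      have "norm (integral {0..t} (\<lambda>s. w s * \<phi> s)) \<le> (B * (\<bar>\<mu>\<bar> * L * M)) * (t - 0)"
      proof (rule integral_bound)
        fix s assume "s \<in> {0..t}"
        then have "s \<in> {0..L}" using that(1) by auto
        then show "norm (w s * \<phi> s) \<le> B * (\<bar>\<mu>\<bar> * L * M)"
          unfolding norm_mult by (intro mult_mono w \<phi>b B0) auto
      qed (use that in \<open>auto intro: continuous_on_subset[OF w(1)]\<close>)
      also have "\<dots> \<le> (B * (\<bar>\<mu>\<bar> * L * M)) * L"
        using that(1) B0 M0 L by (intro mult_left_mono) auto
      finally show ?thesis by (simp add: R_def mult_ac)
    qed
    have Pb: "norm (P t) \<le> R * M" and Qb: "norm (Q t) \<le> R * M" if "t \<in> {0..L}" for t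
      unfolding P_def Q_def using bnd[OF that] cc B by auto
    define k where "k t = csinm \<mu> t * P t - ccosm \<mu> t * Q t" for t
    define k' where "k' t = ccosm \<mu> t * P t + of_real \<mu> * (csinm \<mu> t * Q t)" for t
    have K: "C1AC L k k' (\<lambda>t. \<phi> t - of_real \<mu> * k t)"
    proof (rule C1AC_C2I[OF L])
      fix t assume t: "t \<in> {0..L}"
      show "(k has_vector_derivative k' t) (at t within {0..L})"
        unfolding k_def k'_def using t
        by - (rule derivative_eq_intros dP dQ has_vector_derivative_ccosm has_vector_derivative_csinm refl | assumption | simp add: algebra_simps)+
      have e: "\<phi> t - of_real \<mu> * k t = \<phi> t * ((ccosm \<mu> t)\<^sup>2 + of_real \<mu> * (csinm \<mu> t)\<^sup>2) - of_real \<mu> * k t"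
        by (simp only: ccosm_csinm mult_1_right)
      show "(k' has_vector_derivative \<phi> t - of_real \<mu> * k t) (at t within {0..L})"
        unfolding e unfolding k_def k'_def using t
        by - (rule derivative_eq_intros dP dQ has_vector_derivative_ccosm has_vector_derivative_csinm refl | assumption | simp add: algebra_simps power2_eq_square)+
    next
      show "continuous_on {0..L} (\<lambda>t. \<phi> t - of_real \<mu> * k t)"
        unfolding k_def P_def Q_def
        by (intro continuous_intros c\<phi> continuous_on_ccosm continuous_on_csinm indefinite_integral_continuous_1 integrable_continuous_real cc)
    qed
    have kb: "norm (k t) \<le> 2 * B * R * M" "norm (k' t) \<le> (1 + \<bar>\<mu>\<bar>) * B * R * M" if t: "t \<in> {0..L}" for t
    proof -
      have s: "norm (csinm \<mu> t * X) \<le> B * (R * M)" "norm (ccosm \<mu> t * X) \<le> B * (R * M)" if "norm X \<le> R * M" for X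
        unfolding norm_mult using B[OF t] B0 that by (intro mult_mono; simp)+
      have "norm (k t) \<le> norm (csinm \<mu> t * P t) + norm (ccosm \<mu> t * Q t)"
        unfolding k_def by (rule norm_triangle_ineq4)
      also have "\<dots> \<le> B * (R * M) + B * (R * M)"
        by (intro add_mono s Pb Qb t)
      finally show "norm (k t) \<le> 2 * B * R * M" by (simp add: algebra_simps)
      have "norm (k' t) \<le> norm (ccosm \<mu> t * P t) + norm (of_real \<mu> * (csinm \<mu> t * Q t))"
        unfolding k'_def by (rule norm_triangle_ineq)
      also have "\<dots> = norm (ccosm \<mu> t * P t) + \<bar>\<mu>\<bar> * norm (csinm \<mu> t * Q t)"
        by (simp add: norm_mult)
      also have "\<dots> \<le> B * (R * M) + \<bar>\<mu>\<bar> * (B * (R * M))"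
        by (intro add_mono mult_left_mono s Pb Qb t) auto
      finally show "norm (k' t) \<le> (1 + \<bar>\<mu>\<bar>) * B * R * M" by (simp add: algebra_simps)
    qed
    have CM: "C * N = M + L * M + 2 * B * R * M + (1 + \<bar>\<mu>\<bar>) * B * R * M"
      by (simp add: C_def M_def algebra_simps)
    have nn: "0 \<le> 2 * B * R * M" "0 \<le> (1 + \<bar>\<mu>\<bar>) * B * R * M" "0 \<le> L * M"
      using B0 R0 M0 L by auto
    show "\<exists>f g. C1AC L f g (\<lambda>t. \<psi> t - of_real \<mu> * f t) \<and> f 0 = 0 \<and> g 0 = 0 \<and>
      (\<forall>t\<in>{0..L}. norm (f t) \<le> C * sqrt (LINT t|lebesgue_on {0..L}. (cmod (\<psi> t))\<^sup>2) \<and>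
                  norm (g t) \<le> C * sqrt (LINT t|lebesgue_on {0..L}. (cmod (\<psi> t))\<^sup>2))"
    proof (intro exI conjI ballI)
      have "(\<lambda>t. \<psi> t + (\<phi> t - of_real \<mu> * k t)) = (\<lambda>t. \<psi> t - of_real \<mu> * (G2 t + k t))"
        by (simp add: \<phi>_def algebra_simps)
      then show "C1AC L (\<lambda>t. G2 t + k t) (\<lambda>t. G1 t + k' t) (\<lambda>t. \<psi> t - of_real \<mu> * (G2 t + k t))"
        using C1AC_add[OF L G K] by simp
      show "G2 0 + k 0 = 0" "G1 0 + k' 0 = 0"
        by (simp_all add: G1_def G2_def k_def k'_def P_def Q_def)
      fix t assume t: "t \<in> {0..L}"
      have "norm (G2 t + k t) \<le> L * M + 2 * B * R * M"
        using norm_triangle_ineq[of "G2 t" "k t"] G2b[OF t] kb(1)[OF t] by linarith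
      then show "norm (G2 t + k t) \<le> C * sqrt (LINT t|lebesgue_on {0..L}. (cmod (\<psi> t))\<^sup>2)"
        using CM nn M0 unfolding N_def[symmetric] by linarith
      have "norm (G1 t + k' t) \<le> M + (1 + \<bar>\<mu>\<bar>) * B * R * M"
        using norm_triangle_ineq[of "G1 t" "k' t"] G1b[OF t] kb(2)[OF t] by linarith
      then show "norm (G1 t + k' t) \<le> C * sqrt (LINT t|lebesgue_on {0..L}. (cmod (\<psi> t))\<^sup>2)"
        using CM nn M0 unfolding N_def[symmetric] by linarith
    qed
  qed
qed

section \<open>Linear systems on graphs\<close>

definition lin_op :: "(('v \<Rightarrow> 'a) \<Rightarrow> 'r \<Rightarrow> 'a::field) \<Rightarrow> bool" where
  "lin_op T \<longleftrightarrow> (\<forall>x y c v. T (\<lambda>u. x u + c * y u) v = T x v + c * T y v)"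

lemma lin_opD: "lin_op T \<Longrightarrow> T (\<lambda>u. x u + c * y u) v = T x v + c * T y v"
  unfolding lin_op_def by blast

lemma lin_op_zero:
  assumes "lin_op T"
  shows "T (\<lambda>u. 0) v = 0"
  using lin_opD[OF assms, of "\<lambda>u. 0" "-1" "\<lambda>u. 0" v] by simp

lemma lin_op_sum:
  assumes "lin_op T" "finite S"
  shows "T (\<lambda>u. \<Sum>i\<in>S. c i * x i u) v = (\<Sum>i\<in>S. c i * T (x i) v)"
  using assms(2)
proof induction
  case empty
  then show ?case using lin_op_zero[OF assms(1)] by simp
next
  case (insert i S)
  then show ?case
    using lin_opD[OF assms(1), of "\<lambda>u. \<Sum>i\<in>S. c i * x i u" "c i" "x i" v]
    by (simp add: add.commute)
qed

text \<open>Gaussian elimination, one column \<open>s\<close> and one row \<open>r\<close> at a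
  time: injectivity supplies a non-zero pivot, and \<open>T'\<close> is the system with
  \<open>s\<close> eliminated. Functions vanishing off \<open>S\<close> play the role of vectors
  indexed by \<open>S\<close>.\<close>

lemma lin_op_surj:
  fixes T :: "('v \<Rightarrow> 'a::field) \<Rightarrow> 'r \<Rightarrow> 'a"
  assumes "finite S" "finite R" "card R = card S" "lin_op T"
    and "\<And>x. \<forall>u. u \<notin> S \<longrightarrow> x u = 0 \<Longrightarrow> \<forall>r\<in>R. T x r = 0 \<Longrightarrow> \<forall>u\<in>S. x u = 0"
  shows "\<exists>x. (\<forall>u. u \<notin> S \<longrightarrow> x u = 0) \<and> (\<forall>r\<in>R. T x r = b r)"
  using assms
proof (induction S arbitrary: R T b rule: finite_induct)
  case empty
  then show ?case by auto
next
  case (insert s S)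
  note T = \<open>lin_op T\<close> and inj = insert.prems(4)
  define e where "e u = (if u = s then 1 else 0 :: 'a)" for u
  have "\<exists>r\<in>R. T e r \<noteq> 0"
  proof (rule ccontr)
    assume "\<not> (\<exists>r\<in>R. T e r \<noteq> 0)"
    then have z: "\<forall>r\<in>R. T e r = 0" by blast
    have "\<forall>u. u \<notin> insert s S \<longrightarrow> e u = 0" by (simp add: e_def)
    from inj[OF this z] show False by (simp add: e_def)
  qed
  then obtain r where r: "r \<in> R" "T e r \<noteq> 0" by blast
  define q where "q = T e r"
  have q: "q \<noteq> 0" using r by (simp add: q_def)
  define T' where "T' x v = T x v - T e v / q * T x r" for x v
  have lin': "lin_op T'"
    unfolding lin_op_def T'_def by (simp add: lin_opD[OF T] algebra_simps add_divide_distrib)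
  have card: "card (R - {r}) = card S"
    using r insert.prems(1,2) insert.hyps by simp
  have inj': "\<forall>u\<in>S. x u = 0" if x: "\<forall>u. u \<notin> S \<longrightarrow> x u = 0" and z: "\<forall>v\<in>R - {r}. T' x v = 0" for x
  proof -
    define y where "y u = x u + (- (T x r / q)) * e u" for u
    have y: "T y v = T x v + (- (T x r / q)) * T e v" for v
      unfolding y_def[abs_def] by (rule lin_opD[OF T])
    have Ty: "\<forall>v\<in>R. T y v = 0"
    proof
      fix v assume v: "v \<in> R"
      show "T y v = 0"
      proof (cases "v = r")
        case True
        then show ?thesis using q unfolding y by (simp add: q_def)
      next
        case False
        then have "T' x v = 0" using z v by simp
        then show ?thesis unfolding y T'_def by (simp add: algebra_simps)
      qed
    qed
    have "\<forall>u. u \<notin> insert s S \<longrightarrow> y u = 0"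
      using x by (simp add: y_def e_def)
    from inj[OF this Ty] show ?thesis using insert.hyps(2) unfolding y_def e_def by auto
  qed
  obtain x where x: "\<forall>u. u \<notin> S \<longrightarrow> x u = 0" "\<And>v. v \<in> R - {r} \<Longrightarrow> T' x v = b v - T e v / q * b r"
    using insert.IH[OF _ card lin' inj', of "\<lambda>v. b v - T e v / q * b r"] insert.prems(1) by auto
  define y where "y u = x u + ((b r - T x r) / q) * e u" for u
  have y: "T y v = T x v + ((b r - T x r) / q) * T e v" for v
    unfolding y_def[abs_def] by (rule lin_opD[OF T])
  show ?case
  proof (intro exI[of _ y] conjI allI impI ballI)
    fix u assume "u \<notin> insert s S"
    then show "y u = 0" using x(1) by (simp add: y_def e_def)
  next
    fix v assume v: "v \<in> R"
    show "T y v = b v"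
    proof (cases "v = r")
      case True
      then show ?thesis using q unfolding y by (simp add: q_def)
    next
      case False
      then have b: "b v = T' x v + T e v / q * b r" using x(2)[of v] v by simp
      show ?thesis unfolding y b T'_def by (simp add: diff_divide_distrib algebra_simps)
    qed
  qed
qed

text \<open>The functions \<open>X w\<close> are the columns of the inverse matrix, and
  \<open>K\<close> is the sum of the norms of its entries.\<close>

lemma lin_op_bounded_inverse:
  fixes T :: "('v \<Rightarrow> 'a::{field, real_normed_field}) \<Rightarrow> 'v \<Rightarrow> 'a"
  assumes S: "finite S" and T: "lin_op T"
    and inj: "\<And>x. \<forall>u. u \<notin> S \<longrightarrow> x u = 0 \<Longrightarrow> \<forall>r\<in>S. T x r = 0 \<Longrightarrow> \<forall>u\<in>S. x u = 0"
  shows "\<exists>K\<ge>0. \<forall>b. \<exists>x. (\<forall>u. u \<notin> S \<longrightarrow> x u = 0) \<and> (\<forall>v\<in>S. T x v = b v) \<and>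
    (\<forall>u. norm (x u) \<le> K * (\<Sum>v\<in>S. norm (b v)))"
proof -
  have "\<forall>w. \<exists>x. (\<forall>u. u \<notin> S \<longrightarrow> x u = 0) \<and> (\<forall>v\<in>S. T x v = (if v = w then 1 else 0))"
    by (intro allI lin_op_surj[OF S S refl T]) (use inj in blast)
  then obtain X where X: "\<And>w u. u \<notin> S \<Longrightarrow> X w u = 0" "\<And>w v. v \<in> S \<Longrightarrow> T (X w) v = (if v = w then 1 else 0)"
    by metis
  define K where "K = (\<Sum>w\<in>S. \<Sum>u\<in>S. norm (X w u))"
  have XK: "norm (X w u) \<le> K" if "w \<in> S" for w u
  proof (cases "u \<in> S")
    case True
    have "norm (X w u) \<le> (\<Sum>u\<in>S. norm (X w u))"
      by (rule member_le_sum[OF True _ S]) auto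
    also have "\<dots> \<le> K"
      unfolding K_def by (rule member_le_sum[OF that _ S, of "\<lambda>w. \<Sum>u\<in>S. norm (X w u)"]) (auto intro: sum_nonneg)
    finally show ?thesis .
  next
    case False
    then show ?thesis using X by (auto simp: K_def intro!: sum_nonneg)
  qed
  show ?thesis
  proof (intro exI[of _ K] conjI allI)
    show "0 \<le> K" by (auto simp: K_def intro!: sum_nonneg)
    fix b :: "'v \<Rightarrow> 'a"
    define x where "x u = (\<Sum>w\<in>S. b w * X w u)" for u
    have "T x v = b v" if "v \<in> S" for v
      unfolding x_def[abs_def] lin_op_sum[OF T S] using that S by (simp add: X if_distrib sum.delta' cong: if_cong)
    moreover have "norm (x u) \<le> K * (\<Sum>v\<in>S. norm (b v))" for u
    proof -
      have "norm (x u) \<le> (\<Sum>w\<in>S. norm (b w) * K)"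
        unfolding x_def by (rule sum_norm_le) (auto simp: norm_mult intro!: mult_left_mono XK)
      then show ?thesis by (simp add: sum_distrib_left mult.commute)
    qed
    moreover have "x u = 0" if "u \<notin> S" for u
      using that by (simp add: x_def X)
    ultimately show "\<exists>x. (\<forall>u. u \<notin> S \<longrightarrow> x u = 0) \<and> (\<forall>v\<in>S. T x v = b v) \<and>
       (\<forall>u. norm (x u) \<le> K * (\<Sum>v\<in>S. norm (b v)))" by blast
  qed
qed

text \<open>A weighted graph matrix applied to \<open>x\<close>: each edge adds \<open>a\<close> to
  the diagonal entries of its two endpoints and \<open>- b\<close> to the two off-diagonal ones. For
  \<open>a = b\<close> it is the weighted graph Laplacian. The two sums only reflect the orientation
  of the edges.\<close>

definition net :: "('v \<times> 'v) set \<Rightarrow> ('v \<times> 'v \<Rightarrow> 'a) \<Rightarrow> ('v \<times> 'v \<Rightarrow> 'a) \<Rightarrow> ('v \<Rightarrow> 'a) \<Rightarrow> 'v \<Rightarrow> 'a::comm_ring_1" where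
  "net E a b x v = (\<Sum>e\<in>{e\<in>E. fst e = v}. a e * x v - b e * x (snd e)) +
                   (\<Sum>e\<in>{e\<in>E. snd e = v}. a e * x v - b e * x (fst e))"

lemma lin_op_net: "lin_op (net E a b)"
  unfolding lin_op_def net_def
  by (simp add: algebra_simps sum.distrib sum_subtractf sum_distrib_left)

lemma sum_vertices_edges:
  fixes p q :: "'v \<times> 'v \<Rightarrow> 'a::comm_ring_1"
  assumes "finite V" "E \<subseteq> V \<times> V"
  shows "(\<Sum>v\<in>V. y v * ((\<Sum>e\<in>{e\<in>E. fst e = v}. p e) + (\<Sum>e\<in>{e\<in>E. snd e = v}. q e))) =
    (\<Sum>e\<in>E. y (fst e) * p e + y (snd e) * q e)"
proof -
  have fE: "finite E" using assms finite_subset by blast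
  have "(\<Sum>v\<in>V. \<Sum>e\<in>{e\<in>E. fst e = v}. y (fst e) * p e) = (\<Sum>e\<in>E. y (fst e) * p e)"
    by (rule sum.group[OF fE assms(1)]) (use assms(2) in auto)
  moreover have "(\<Sum>v\<in>V. \<Sum>e\<in>{e\<in>E. fst e = v}. y (fst e) * p e) = (\<Sum>v\<in>V. \<Sum>e\<in>{e\<in>E. fst e = v}. y v * p e)"
    by (intro sum.cong refl) auto
  ultimately have 1: "(\<Sum>v\<in>V. \<Sum>e\<in>{e\<in>E. fst e = v}. y v * p e) = (\<Sum>e\<in>E. y (fst e) * p e)" by simp
  have "(\<Sum>v\<in>V. \<Sum>e\<in>{e\<in>E. snd e = v}. y (snd e) * q e) = (\<Sum>e\<in>E. y (snd e) * q e)"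
    by (rule sum.group[OF fE assms(1)]) (use assms(2) in auto)
  moreover have "(\<Sum>v\<in>V. \<Sum>e\<in>{e\<in>E. snd e = v}. y (snd e) * q e) = (\<Sum>v\<in>V. \<Sum>e\<in>{e\<in>E. snd e = v}. y v * q e)"
    by (intro sum.cong refl) auto
  ultimately have 2: "(\<Sum>v\<in>V. \<Sum>e\<in>{e\<in>E. snd e = v}. y v * q e) = (\<Sum>e\<in>E. y (snd e) * q e)" by simp
  have "(\<Sum>v\<in>V. y v * ((\<Sum>e\<in>{e\<in>E. fst e = v}. p e) + (\<Sum>e\<in>{e\<in>E. snd e = v}. q e))) =
     (\<Sum>v\<in>V. \<Sum>e\<in>{e\<in>E. fst e = v}. y v * p e) + (\<Sum>v\<in>V. \<Sum>e\<in>{e\<in>E. snd e = v}. y v * q e)"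
    by (simp add: distrib_left sum_distrib_left sum.distrib)
  then show ?thesis by (simp add: 1 2 sum.distrib)
qed

lemma net_form:
  assumes "finite V" "E \<subseteq> V \<times> V"
  shows "(\<Sum>v\<in>V. y v * net E a b x v) =
    (\<Sum>e\<in>E. a e * (y (fst e) * x (fst e) + y (snd e) * x (snd e)) - b e * (y (fst e) * x (snd e) + y (snd e) * x (fst e)))"
proof -
  have "net E a b x v = (\<Sum>e\<in>{e\<in>E. fst e = v}. a e * x (fst e) - b e * x (snd e)) +
                   (\<Sum>e\<in>{e\<in>E. snd e = v}. a e * x (snd e) - b e * x (fst e))" for v
    unfolding net_def by (intro arg_cong2[of _ _ _ _ "(+)"] sum.cong) auto
  then show ?thesis
    by (simp only: sum_vertices_edges[OF assms]) (simp add: algebra_simps)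
qed

lemma net_of_real:
  "net E (\<lambda>e. of_real (a e)) (\<lambda>e. of_real (b e)) (\<lambda>v. of_real (x v)) v = of_real (net E a b x v)"
  by (simp add: net_def)

section \<open>Domain elements with explicit derivatives and vertex values\<close>

locale qgraph_locale =
  fixes G :: "'v qgraph" and Vo :: "'v set"
  assumes qg: "quantum_graph G" and Vo: "Vo \<subseteq> verts G" "Vo \<noteq> {}"
begin

abbreviation "V \<equiv> verts G"
abbreviation "E \<equiv> edges G"
abbreviation "Vi \<equiv> verts G - Vo"

lemma finite_V: "finite V" and E_sub: "E \<subseteq> V \<times> V" and E_ne: "E \<noteq> {}"
  and connected_G: "graph_connected V (adj G)"
  using qg by (auto simp: quantum_graph_def)

lemma finite_E: "finite E"
  using finite_V E_sub finite_subset by blast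

lemma finite_Vo: "finite Vo" and finite_Vi: "finite Vi"
  using finite_V Vo finite_subset by blast+

lemma len_pos: "e \<in> E \<Longrightarrow> 0 < len G e"
  using qg by (simp add: quantum_graph_def)

lemma edge_V: "e \<in> E \<Longrightarrow> fst e \<in> V" "e \<in> E \<Longrightarrow> snd e \<in> V"
  using E_sub by auto

lemma edge_ne: "e \<in> E \<Longrightarrow> fst e \<noteq> snd e" "e \<in> E \<Longrightarrow> snd e \<noteq> fst e"
  using qg unfolding quantum_graph_def by (metis prod.collapse)+

lemma adj_sym: "adj G v w \<Longrightarrow> adj G w v"
  by (auto simp: adj_def)

lemma adj_V: "adj G v w \<Longrightarrow> v \<in> V" "adj G v w \<Longrightarrow> w \<in> V"
  using E_sub by (auto simp: adj_def)

lemma edge_adj: "e \<in> E \<Longrightarrow> adj G (fst e) (snd e)"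
  by (simp add: adj_def)

text \<open>The form in which connectedness is used: instead of following paths, a property is shown
  to spread from a vertex to its neighbours.\<close>

lemma connected_closed_set:
  assumes "U \<subseteq> V" "U \<noteq> {}" and closed: "\<And>v w. v \<in> U \<Longrightarrow> adj G v w \<Longrightarrow> w \<in> U"
  shows "U = V"
proof
  show "V \<subseteq> U"
  proof
    fix w assume w: "w \<in> V"
    obtain v where v: "v \<in> U" using assms(2) by blast
    obtain p where p: "is_path (adj G) p" "hd p = v" "last p = w"
      using connected_G v w assms(1) unfolding graph_connected_def by blast
    have "p \<noteq> [] \<Longrightarrow> successively (adj G) p \<Longrightarrow> hd p \<in> U \<Longrightarrow> last p \<in> U"
    proof (induction p)
      case (Cons x p)
      then show ?case
        using closed by (cases p) auto
    qed simp
    then show "w \<in> U" using p v by (auto simp: is_path_def)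
  qed
qed (rule assms(1))

text \<open>Needed for the definite description in \<open>vertex_trace\<close>, which at an isolated
  vertex would be satisfied by every number. An isolated vertex would be the whole graph, but there
  is an edge and it is not a loop.\<close>

lemma vertex_edge:
  assumes "v \<in> V"
  shows "\<exists>e\<in>E. v \<in> {fst e, snd e}"
proof (rule ccontr)
  assume *: "\<not> ?thesis"
  have "{v} = V"
  proof (rule connected_closed_set)
    fix a w assume "a \<in> {v}" "adj G a w"
    then show "w \<in> {v}" using * by (force simp: adj_def)
  qed (use assms in auto)
  moreover obtain e where "e \<in> E" using E_ne by blast
  ultimately have "fst e = v" "snd e = v" using edge_V by blast+
  then show False using edge_ne(1)[OF \<open>e \<in> E\<close>] by simp
qed

definition nd :: "('v \<times> 'v \<Rightarrow> real \<Rightarrow> complex) \<Rightarrow> 'v \<Rightarrow> complex" where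
  "nd g v = - (\<Sum>e\<in>{e\<in>E. fst e = v}. g e 0) + (\<Sum>e\<in>{e\<in>E. snd e = v}. g e (len G e))"

text \<open>A domain element together with its witnesses. Carrying \<open>g\<close>,
  \<open>h\<close> and \<open>x\<close> along replaces \<open>normal_derivative\<close>,
  \<open>laplacian\<close> and \<open>vertex_trace\<close> by plain functions. Vanishing outside the
  edges is not demanded here, so that explicit formulas qualify; \<open>cutoff\<close> restores
  it.\<close>

definition dom_data :: "'v gfun \<Rightarrow> 'v gfun \<Rightarrow> 'v gfun \<Rightarrow> ('v \<Rightarrow> complex) \<Rightarrow> bool" where
  "dom_data f g h x \<longleftrightarrow> (\<forall>e\<in>E. C1AC (len G e) (f e) (g e) (h e) \<and> f e 0 = x (fst e) \<and> f e (len G e) = x (snd e))"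

definition cutoff :: "'v gfun \<Rightarrow> 'v gfun" where
  "cutoff f = (\<lambda>e t. if e \<in> E \<and> t \<in> {0..len G e} then f e t else 0)"

lemma C1AC_normal:
  assumes "e \<in> E" "C1AC (len G e) f g h" "t \<in> {0..len G e}"
  shows "vector_derivative f (at t within {0..len G e}) = g t"
  using vector_derivative_within_cbox[of 0 "len G e" t f "g t"] C1AC_deriv[OF assms(2,3)] len_pos[OF assms(1)] assms(3)
  by simp

lemma dom_data_nd:
  assumes "dom_data f g h x"
  shows "normal_derivative G f v = nd g v"
proof -
  have *: "vector_derivative (f e) (at t within {0..len G e}) = g e t" if "e \<in> E" "t \<in> {0..len G e}" for e t
    using C1AC_normal[OF that(1) _ that(2)] assms that(1) unfolding dom_data_def by blast
  show ?thesis
    unfolding normal_derivative_def nd_def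
    by (intro arg_cong2[of _ _ _ _ "(+)"] arg_cong[of _ _ uminus] sum.cong refl *)
      (auto intro: less_imp_le[OF len_pos])
qed

lemma dom_data_edge_value:
  assumes "dom_data f g h x" "e \<in> E" "v \<in> {fst e, snd e}"
  shows "edge_value G f e v = x v"
  using assms edge_ne(1)[OF assms(2)] by (auto simp: edge_value_def dom_data_def)

lemma dom_data_trace:
  assumes "dom_data f g h x" "v \<in> V"
  shows "vertex_trace G f v = x v"
proof -
  obtain e where e: "e \<in> E" "v \<in> {fst e, snd e}" using vertex_edge[OF assms(2)] by blast
  show ?thesis
    unfolding vertex_trace_def
    by (rule the_equality) (use dom_data_edge_value[OF assms(1)] e in metis)+
qed

lemma dom_data_laplacian:
  assumes "dom_data f g h x" "e \<in> E"
  shows "AE t in lebesgue_on {0..len G e}. laplacian G f e t = h e t"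
    and "\<exists>g'. C1AC (len G e) (f e) g' (laplacian G f e)"
proof -
  have L: "0 < len G e" by (rule len_pos[OF assms(2)])
  have c: "C1AC (len G e) (f e) (g e) (h e)" using assms unfolding dom_data_def by blast
  have "second_weak_derivative (len G e) (f e) (laplacian G f e)"
    unfolding laplacian_def
    using someI[of "second_weak_derivative (len G e) (f e)", OF C1AC_imp_second_weak[OF L c]] .
  from second_weak_imp_C1AC[OF L C1AC_continuous(1)[OF L c] this]
  obtain g' where g': "C1AC (len G e) (f e) g' (laplacian G f e)" by blast
  from C1AC_unique(2)[OF L g' c] show "AE t in lebesgue_on {0..len G e}. laplacian G f e t = h e t" .
  from g' show "\<exists>g'. C1AC (len G e) (f e) g' (laplacian G f e)" by blast
qed

lemma dom_data_cutoff:
  assumes "dom_data f g h x"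
  shows "dom_data (cutoff f) g h x"
  unfolding dom_data_def
proof (intro ballI conjI)
  fix e assume e: "e \<in> E"
  have L: "0 < len G e" by (rule len_pos[OF e])
  have d: "C1AC (len G e) (f e) (g e) (h e)" "f e 0 = x (fst e)" "f e (len G e) = x (snd e)"
    using assms e unfolding dom_data_def by blast+
  show "C1AC (len G e) (cutoff f e) (g e) (h e)"
    by (rule C1AC_cong[OF L d(1)]) (use e in \<open>auto simp: cutoff_def\<close>)
  show "cutoff f e 0 = x (fst e)" "cutoff f e (len G e) = x (snd e)"
    using d e L by (auto simp: cutoff_def)
qed

lemma dom_data_dom_max:
  assumes d: "dom_data f g h x" and z: "\<And>e t. e \<notin> E \<or> t \<notin> {0..len G e} \<Longrightarrow> f e t = 0"
  shows "f \<in> dom_max G"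
  unfolding dom_max_def
proof (intro CollectI conjI ballI allI impI)
  fix e assume e: "e \<in> E"
  have L: "0 < len G e" by (rule len_pos[OF e])
  have c: "C1AC (len G e) (f e) (g e) (h e)" using d e unfolding dom_data_def by blast
  show "H2 (len G e) (f e)" by (rule C1AC_imp_H2[OF L c])
  show "continuous_on {0..len G e} (f e)" by (rule C1AC_continuous(1)[OF L c])
next
  fix e t assume "e \<notin> E \<or> t \<notin> {0..len G e}"
  then show "f e t = 0" by (rule z)
next
  fix v e e' assume "v \<in> V" "e \<in> E" "e' \<in> E" "v \<in> {fst e, snd e} \<and> v \<in> {fst e', snd e'}"
  then show "edge_value G f e v = edge_value G f e' v"
    using dom_data_edge_value[OF d] by metis
qed

lemma cutoff_dom_max:
  assumes "dom_data f g h x"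
  shows "cutoff f \<in> dom_max G"
  by (rule dom_data_dom_max[OF dom_data_cutoff[OF assms]]) (auto simp: cutoff_def)

lemma dom_maxE:
  assumes "f \<in> dom_max G"
  obtains g where "dom_data f g (laplacian G f) (vertex_trace G f)"
proof -
  have "\<exists>g. C1AC (len G e) (f e) g (laplacian G f e)" if e: "e \<in> E" for e
  proof -
    have L: "0 < len G e" by (rule len_pos[OF e])
    have H: "H2 (len G e) (f e)" "continuous_on {0..len G e} (f e)"
      using assms e by (auto simp: dom_max_def)
    then obtain h where "second_weak_derivative (len G e) (f e) h"
      by (auto simp: H2_def)
    then have "second_weak_derivative (len G e) (f e) (laplacian G f e)"
      unfolding laplacian_def using someI[of "second_weak_derivative (len G e) (f e)"] by blast
    then show ?thesis by (rule second_weak_imp_C1AC[OF L H(2)])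
  qed
  then obtain g where g: "\<And>e. e \<in> E \<Longrightarrow> C1AC (len G e) (f e) (g e) (laplacian G f e)" by metis
  have tr: "edge_value G f e v = vertex_trace G f v" if "e \<in> E" "v \<in> {fst e, snd e}" for e v
  proof -
    have "v \<in> V" using that(2) edge_V[OF that(1)] by blast
    then have "\<forall>e'\<in>E. v \<in> {fst e', snd e'} \<longrightarrow> edge_value G f e' v = edge_value G f e v"
      using assms that unfolding dom_max_def by blast
    then show ?thesis
      unfolding vertex_trace_def by (intro the_equality[symmetric]) (use that in auto)
  qed
  show ?thesis
  proof (rule that[of g], unfold dom_data_def, intro ballI conjI)
    fix e assume e: "e \<in> E"
    show "C1AC (len G e) (f e) (g e) (laplacian G f e)" by (rule g[OF e])
    show "f e 0 = vertex_trace G f (fst e)" "f e (len G e) = vertex_trace G f (snd e)"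
      using tr[OF e, of "fst e"] tr[OF e, of "snd e"] edge_ne[OF e] by (auto simp: edge_value_def)
  qed
qed

lemma dom_max_zero: "f \<in> dom_max G \<Longrightarrow> e \<notin> E \<or> t \<notin> {0..len G e} \<Longrightarrow> f e t = 0"
  unfolding dom_max_def by blast

lemma dom_max_eqI:
  assumes "f \<in> dom_max G" "f' \<in> dom_max G" "\<And>e t. e \<in> E \<Longrightarrow> t \<in> {0..len G e} \<Longrightarrow> f e t = f' e t"
  shows "f = f'"
proof (intro ext)
  fix e t
  show "f e t = f' e t"
    using assms(3)[of e t] dom_max_zero[OF assms(1), of e t] dom_max_zero[OF assms(2), of e t] by metis
qed

lemma dom_data_lin:
  assumes "dom_data f g h x" "dom_data f' g' h' x'"
  shows "dom_data (\<lambda>e t. f e t + c * f' e t) (\<lambda>e t. g e t + c * g' e t) (\<lambda>e t. h e t + c * h' e t) (\<lambda>v. x v + c * x' v)"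
  unfolding dom_data_def
proof (intro ballI conjI)
  fix e assume e: "e \<in> E"
  have d: "C1AC (len G e) (f e) (g e) (h e)" "f e 0 = x (fst e)" "f e (len G e) = x (snd e)"
    and d': "C1AC (len G e) (f' e) (g' e) (h' e)" "f' e 0 = x' (fst e)" "f' e (len G e) = x' (snd e)"
    using assms e unfolding dom_data_def by blast+
  note L = len_pos[OF e]
  show "C1AC (len G e) (\<lambda>t. f e t + c * f' e t) (\<lambda>t. g e t + c * g' e t) (\<lambda>t. h e t + c * h' e t)"
    by (rule C1AC_add[OF L d(1) C1AC_cmult[OF L d'(1)]])
  show "f e 0 + c * f' e 0 = x (fst e) + c * x' (fst e)" "f e (len G e) + c * f' e (len G e) = x (snd e) + c * x' (snd e)"
    using d d' by auto
qed

lemma nd_lin: "nd (\<lambda>e t. g e t + c * g' e t) v = nd g v + c * nd g' v"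
  by (simp add: nd_def sum.distrib sum_distrib_left algebra_simps)

lemma dom_data_zero: "dom_data (\<lambda>e t. 0) (\<lambda>e t. 0) (\<lambda>e t. 0) (\<lambda>v. 0)"
  unfolding dom_data_def
proof (intro ballI conjI)
  fix e assume e: "e \<in> E"
  show "C1AC (len G e) (\<lambda>t. 0) (\<lambda>t. 0) (\<lambda>t. 0)"
    by (rule C1AC_C2I[OF len_pos[OF e]]) auto
qed auto

lemma nd_zero: "nd (\<lambda>e t. 0) v = 0"
  by (simp add: nd_def)

definition solution :: "real \<Rightarrow> 'v gfun \<Rightarrow> 'v gfun \<Rightarrow> ('v \<Rightarrow> complex) \<Rightarrow> bool" where
  "solution \<mu> f g x \<longleftrightarrow> dom_data f g (\<lambda>e t. - (of_real \<mu> * f e t)) x"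

lemma L2_eq_sym_iff: "L2_eq G (\<lambda>e t. A e t + complex_of_real \<mu> * f e t) (\<lambda>e t. 0) \<longleftrightarrow>
   (\<forall>e\<in>E. AE t in lebesgue_on {0..len G e}. A e t = - (of_real \<mu> * f e t))"
  unfolding L2_eq_def by (simp add: eq_neg_iff_add_eq_0)

lemma solution_L2_eq:
  assumes "solution \<mu> f g x"
  shows "L2_eq G (\<lambda>e t. laplacian G f e t + complex_of_real \<mu> * f e t) (\<lambda>e t. 0)"
  unfolding L2_eq_sym_iff using dom_data_laplacian(1)[OF assms[unfolded solution_def]] by blast

lemma solutionI:
  assumes "f \<in> dom_max G" "L2_eq G (\<lambda>e t. laplacian G f e t + complex_of_real \<mu> * f e t) (\<lambda>e t. 0)"
  obtains g where "solution \<mu> f g (vertex_trace G f)" "\<And>v. normal_derivative G f v = nd g v"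
proof -
  from dom_maxE[OF assms(1)] obtain g where g: "dom_data f g (laplacian G f) (vertex_trace G f)" .
  have "solution \<mu> f g (vertex_trace G f)"
    unfolding solution_def dom_data_def
  proof (intro ballI conjI)
    fix e assume e: "e \<in> E"
    have d: "C1AC (len G e) (f e) (g e) (laplacian G f e)"
      using g e unfolding dom_data_def by blast
    note L = len_pos[OF e]
    show "C1AC (len G e) (f e) (g e) (\<lambda>t. - (of_real \<mu> * f e t))"
    proof (rule C1AC_AE_cong[OF L d])
      show "AE t in lebesgue_on {0..len G e}. laplacian G f e t = - (of_real \<mu> * f e t)"
        using assms(2) e unfolding L2_eq_sym_iff by blast
      show "L2_on (len G e) (\<lambda>t. - (of_real \<mu> * f e t))"
        by (intro L2_on_continuous continuous_intros C1AC_continuous(1)[OF L d])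
    qed
    show "f e 0 = vertex_trace G f (fst e)" "f e (len G e) = vertex_trace G f (snd e)"
      using g e unfolding dom_data_def by blast+
  qed
  then show ?thesis using that dom_data_nd[OF g] by blast
qed

lemma solution_formula:
  assumes "solution \<mu> f g x" "e \<in> E" "t \<in> {0..len G e}"
  shows "f e t = x (fst e) * ccosm \<mu> t + g e 0 * csinm \<mu> t"
    and "g e t = - (of_real \<mu> * x (fst e) * csinm \<mu> t) + g e 0 * ccosm \<mu> t"
proof -
  have d: "C1AC (len G e) (f e) (g e) (\<lambda>t. - (of_real \<mu> * f e t))" "f e 0 = x (fst e)"
    using assms unfolding solution_def dom_data_def by blast+
  show "f e t = x (fst e) * ccosm \<mu> t + g e 0 * csinm \<mu> t"
    "g e t = - (of_real \<mu> * x (fst e) * csinm \<mu> t) + g e 0 * ccosm \<mu> t"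
    using homogeneous_solution[OF len_pos[OF assms(2)] d(1) _ assms(3)] d(2) by simp_all
qed

text \<open>Green's formula, from the constancy of the Wronskian on every edge.\<close>

lemma solution_symmetric:
  assumes 1: "solution \<mu> f1 g1 x1" and 2: "solution \<mu> f2 g2 x2"
  shows "(\<Sum>v\<in>V. x1 v * nd g2 v) = (\<Sum>v\<in>V. x2 v * nd g1 v)"
proof -
  have *: "(\<Sum>v\<in>V. x v * nd g v) = (\<Sum>e\<in>E. x (fst e) * (- g e 0) + x (snd e) * g e (len G e))" for x g
    using sum_vertices_edges[OF finite_V E_sub, of x "\<lambda>e. - g e 0" "\<lambda>e. g e (len G e)"]
    by (simp add: nd_def sum_negf)
  show ?thesis
    unfolding *
  proof (rule sum.cong[OF refl])
    fix e assume e: "e \<in> E"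
    let ?L = "len G e"
    let ?c = "ccosm \<mu> ?L" and ?s = "csinm \<mu> ?L"
    have L: "?L \<in> {0..?L}" using len_pos[OF e] by auto
    have x: "x1 (snd e) = f1 e ?L" "x2 (snd e) = f2 e ?L"
      using 1 2 e unfolding solution_def dom_data_def by auto
    note F1 = solution_formula[OF 1 e L] and F2 = solution_formula[OF 2 e L]
    have "f1 e ?L * g2 e ?L - f2 e ?L * g1 e ?L =
        (x1 (fst e) * g2 e 0 - x2 (fst e) * g1 e 0) * (?c\<^sup>2 + of_real \<mu> * ?s\<^sup>2)"
      unfolding F1 F2 by (simp add: algebra_simps power2_eq_square)
    then have "f1 e ?L * g2 e ?L - f2 e ?L * g1 e ?L = x1 (fst e) * g2 e 0 - x2 (fst e) * g1 e 0"
      by (simp only: ccosm_csinm mult_1_right)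
    then show "x1 (fst e) * - g2 e 0 + x1 (snd e) * g2 e ?L = x2 (fst e) * - g1 e 0 + x2 (snd e) * g1 e ?L"
      unfolding x by (simp add: algebra_simps)
  qed
qed

end

text \<open>The path stays free of repetitions while it grows: if the new vertex already occurs, the
  path is cut back to that occurrence.\<close>

lemma rtranclp_path:
  assumes "R\<^sup>*\<^sup>* a b"
  shows "\<exists>p. is_path R p \<and> hd p = a \<and> last p = b"
  using assms
proof induction
  case base
  show ?case by (rule exI[of _ "[a]"]) (simp add: is_path_def)
next
  case (step b c)
  then obtain p where p: "is_path R p" "hd p = a" "last p = b" by blast
  show ?case
  proof (cases "c \<in> set p")
    case True
    then obtain p1 p2 where "p = p1 @ c # p2" by (meson split_list)
    then show ?thesis
      using p by (intro exI[of _ "p1 @ [c]"]) (auto simp: is_path_def successively_append_iff hd_append)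
  next
    case False
    then show ?thesis
      using p step.hyps by (intro exI[of _ "p @ [c]"]) (auto simp: is_path_def successively_append_iff)
  qed
qed

section \<open>Spectrum and Dirichlet-to-Neumann matrix in terms of solutions\<close>

context qgraph_locale
begin

lemma dom_data_AE:
  assumes "dom_data f g h x" "\<And>e. e \<in> E \<Longrightarrow> AE t in lebesgue_on {0..len G e}. h e t = h' e t"
    "\<And>e. e \<in> E \<Longrightarrow> L2_on (len G e) (h' e)"
  shows "dom_data f g h' x"
  unfolding dom_data_def
proof (intro ballI conjI)
  fix e assume e: "e \<in> E"
  have d: "C1AC (len G e) (f e) (g e) (h e)" "f e 0 = x (fst e)" "f e (len G e) = x (snd e)"
    using assms(1) e unfolding dom_data_def by blast+
  show "C1AC (len G e) (f e) (g e) (h' e)"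
    by (rule C1AC_AE_cong[OF len_pos[OF e] d(1) assms(2)[OF e] assms(3)[OF e]])
  show "f e 0 = x (fst e)" "f e (len G e) = x (snd e)" by fact+
qed

lemma solution_cutoff:
  assumes "solution \<mu> f g x"
  shows "solution \<mu> (cutoff f) g x"
  unfolding solution_def
proof (rule dom_data_AE[OF dom_data_cutoff[OF assms[unfolded solution_def]]])
  fix e assume e: "e \<in> E"
  have d: "C1AC (len G e) (cutoff f e) (g e) (\<lambda>t. - (of_real \<mu> * f e t))"
    using dom_data_cutoff[OF assms[unfolded solution_def]] e unfolding dom_data_def by blast
  show "AE t in lebesgue_on {0..len G e}. - (of_real \<mu> * f e t) = - (of_real \<mu> * cutoff f e t)"
    by (rule AE_I2) (use e in \<open>simp add: cutoff_def\<close>)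
  show "L2_on (len G e) (\<lambda>t. - (of_real \<mu> * cutoff f e t))"
    by (intro L2_on_continuous continuous_intros C1AC_continuous(1)[OF len_pos[OF e] d])
qed

lemma cutoff_zero: "e \<notin> E \<or> t \<notin> {0..len G e} \<Longrightarrow> cutoff f e t = 0"
  by (auto simp: cutoff_def)

lemma solution_dom_outer:
  assumes "solution \<mu> f g x" "\<And>e t. e \<notin> E \<or> t \<notin> {0..len G e} \<Longrightarrow> f e t = 0"
    "\<forall>v\<in>Vo. x v = 0" "\<forall>v\<in>Vi. nd g v = 0"
  shows "f \<in> dom_outer G Vo"
proof -
  note d = assms(1)[unfolded solution_def]
  show ?thesis
    unfolding dom_outer_def
    using dom_data_dom_max[OF d assms(2)] dom_data_trace[OF d] dom_data_nd[OF d] assms(3,4) Vo(1) by auto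
qed

text \<open>Otherwise the resolvent equation with right-hand side zero would have two solutions, the
  zero function and the cut-off of \<open>f\<close>.\<close>

lemma eigenvalue_in_spectrum:
  assumes s: "solution \<mu> f g x" and x: "\<forall>v\<in>Vo. x v = 0" and n: "\<forall>v\<in>Vi. nd g v = 0"
    and ne: "e \<in> E" "t \<in> {0..len G e}" "f e t \<noteq> 0"
  shows "complex_of_real \<mu> \<in> spectrum G Vo"
proof (rule ccontr)
  assume "complex_of_real \<mu> \<notin> spectrum G Vo"
  then have "\<forall>\<psi>\<in>L2 G. \<exists>!f. f \<in> dom_outer G Vo \<and>
     L2_eq G (\<lambda>e t. complex_of_real \<mu> * f e t - - laplacian G f e t) \<psi>"
    unfolding spectrum_def resolvent_set_def by simp
  moreover have "(\<lambda>e t. 0) \<in> L2 G"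
    unfolding L2_def by (auto intro: L2_on_continuous)
  ultimately have ex1: "\<exists>!f. f \<in> dom_outer G Vo \<and>
     L2_eq G (\<lambda>e t. complex_of_real \<mu> * f e t - - laplacian G f e t) (\<lambda>e t. 0)" by blast
  have *: "f \<in> dom_outer G Vo \<and> L2_eq G (\<lambda>e t. complex_of_real \<mu> * f e t - - laplacian G f e t) (\<lambda>e t. 0)"
    if s: "solution \<mu> f g x" and "\<And>e t. e \<notin> E \<or> t \<notin> {0..len G e} \<Longrightarrow> f e t = 0"
      "\<forall>v\<in>Vo. x v = 0" "\<forall>v\<in>Vi. nd g v = 0" for f g x
    using solution_dom_outer[OF that] solution_L2_eq[OF s] by (simp add: add.commute)
  have "cutoff f = (\<lambda>e t. 0)"
  proof -
    note * [OF solution_cutoff[OF s] cutoff_zero x n]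
    moreover have "solution \<mu> (\<lambda>e t. 0) (\<lambda>e t. 0) (\<lambda>v. 0)"
      using dom_data_zero by (simp add: solution_def)
    from * [OF this]
    have "(\<lambda>e t. 0) \<in> dom_outer G Vo \<and>
       L2_eq G (\<lambda>e t. complex_of_real \<mu> * 0 - - laplacian G (\<lambda>e t. 0) e t) (\<lambda>e t. 0)"
      by (simp add: nd_zero)
    ultimately show ?thesis using ex1 by blast
  qed
  then have "cutoff f e t = 0" by simp
  then show False using ne by (simp add: cutoff_def)
qed

lemma solution_zero:
  assumes \<mu>: "complex_of_real \<mu> \<notin> spectrum G Vo" and s: "solution \<mu> f g x" and x: "\<forall>v\<in>Vo. x v = 0"
    and n: "\<forall>v\<in>Vi. nd g v = 0" and e: "e \<in> E" "t \<in> {0..len G e}"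
  shows "f e t = 0" "g e t = 0"
proof -
  have f: "f e t = 0" if "t \<in> {0..len G e}" for t
    using eigenvalue_in_spectrum[OF s x n e(1) that] \<mu> by blast
  then show "f e t = 0" using e by blast
  have L: "0 < len G e" by (rule len_pos[OF e(1)])
  have "C1AC (len G e) (f e) (g e) (\<lambda>t. - (of_real \<mu> * f e t))"
    using s e(1) unfolding solution_def dom_data_def by blast
  then have 1: "C1AC (len G e) (\<lambda>t. 0) (g e) (\<lambda>t. - (of_real \<mu> * f e t))"
    by (rule C1AC_cong[OF L]) (use f in auto)
  have 2: "C1AC (len G e) (\<lambda>t. 0) (\<lambda>t. 0) (\<lambda>t. 0)"
    by (rule C1AC_C2I[OF L]) auto
  show "g e t = 0"
    by (rule C1AC_unique(1)[OF L 1 2 e(2)])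
qed

lemma solution_lin:
  assumes "solution \<mu> f g x" "solution \<mu> f' g' x'"
  shows "solution \<mu> (\<lambda>e t. f e t + c * f' e t) (\<lambda>e t. g e t + c * g' e t) (\<lambda>v. x v + c * x' v)"
  using dom_data_lin[OF assms[unfolded solution_def], of c] unfolding solution_def
  by (simp add: algebra_simps)

lemma nd_diff: "nd (\<lambda>e t. g e t - g' e t) v = nd g v - nd g' v"
  using nd_lin[of g "-1" g' v] by simp

text \<open>Resolves the definite description in \<open>dtn_solution\<close>: two candidates differ
  by a solution with homogeneous data, which vanishes off the spectrum. From here on the operator
  can be computed from any explicit solution.\<close>

lemma dtn_eq:
  assumes \<mu>: "complex_of_real \<mu> \<notin> spectrum G Vo" and s: "solution \<mu> f g y" and y: "\<forall>v\<in>Vo. y v = x v"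
    and n: "\<forall>v\<in>Vi. nd g v = 0"
  shows "dtn G Vo \<mu> x v = nd g v"
proof -
  note s' = solution_cutoff[OF s]
  note d' = s'[unfolded solution_def]
  have "dtn_solution G Vo \<mu> x = cutoff f"
    unfolding dtn_solution_def
  proof (rule the_equality)
    show "cutoff f \<in> dom_max G \<and>
      L2_eq G (\<lambda>e t. laplacian G (cutoff f) e t + complex_of_real \<mu> * cutoff f e t) (\<lambda>e t. 0) \<and>
      (\<forall>v\<in>Vo. vertex_trace G (cutoff f) v = x v) \<and> (\<forall>v\<in>Vi. normal_derivative G (cutoff f) v = 0)"
      using dom_data_dom_max[OF d' cutoff_zero] solution_L2_eq[OF s'] dom_data_trace[OF d'] dom_data_nd[OF d'] y n Vo(1)
      by auto
  next
    fix f2 assume f2: "f2 \<in> dom_max G \<and>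
      L2_eq G (\<lambda>e t. laplacian G f2 e t + complex_of_real \<mu> * f2 e t) (\<lambda>e t. 0) \<and>
      (\<forall>v\<in>Vo. vertex_trace G f2 v = x v) \<and> (\<forall>v\<in>Vi. normal_derivative G f2 v = 0)"
    then have a: "f2 \<in> dom_max G" "L2_eq G (\<lambda>e t. laplacian G f2 e t + complex_of_real \<mu> * f2 e t) (\<lambda>e t. 0)"
      by blast+
    obtain g2 where g2: "solution \<mu> f2 g2 (vertex_trace G f2)" "\<And>v. normal_derivative G f2 v = nd g2 v"
      using solutionI[OF a] by blast
    show "f2 = cutoff f"
    proof (rule dom_max_eqI)
      show "f2 \<in> dom_max G" using f2 by blast
      show "cutoff f \<in> dom_max G" by (rule dom_data_dom_max[OF d' cutoff_zero])
      fix e t assume e: "e \<in> E" "t \<in> {0..len G e}"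
      have "f2 e t + (-1) * cutoff f e t = 0"
        by (rule solution_zero(1)[OF \<mu> solution_lin[OF g2(1) s', of "-1"] _ _ e])
          (use f2 g2 y n in \<open>auto simp: nd_diff\<close>)
      then show "f2 e t = cutoff f e t" by simp
    qed
  qed
  then show ?thesis
    unfolding dtn_def using dom_data_nd[OF d'] by simp
qed

text \<open>Cubic Hermite interpolation: \<open>3 * s^2 - 2 * s^3\<close> runs from 0 to 1 with zero
  slope at both ends, so vertex values are lifted without creating normal derivatives.\<close>

lemma hermite_dom_data:
  "\<exists>f g h. dom_data f g h x \<and> (\<forall>e\<in>E. continuous_on {0..len G e} (h e)) \<and> (\<forall>v. nd g v = 0)"
proof -
  define k where "k e = 1 / len G e" for e
  have k: "k e * len G e = 1" if "e \<in> E" for e using len_pos[OF that] by (simp add: k_def)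
  define f where "f e t = x (fst e) + (x (snd e) - x (fst e)) * complex_of_real (3 * (k e * t)\<^sup>2 - 2 * (k e * t) ^ 3)" for e t
  define g where "g e t = (x (snd e) - x (fst e)) * complex_of_real (6 * k e * (k e * t) - 6 * k e * (k e * t)\<^sup>2)" for e t
  define h where "h e t = (x (snd e) - x (fst e)) * complex_of_real (6 * (k e)\<^sup>2 - 12 * (k e)\<^sup>2 * (k e * t))" for e t
  have ch: "continuous_on {0..len G e} (h e)" for e
    unfolding h_def by (intro continuous_intros)
  have "dom_data f g h x"
    unfolding dom_data_def
  proof (intro ballI conjI)
    fix e assume e: "e \<in> E"
    show "f e 0 = x (fst e)" "f e (len G e) = x (snd e)"
      by (simp_all add: f_def k[OF e])
    show "C1AC (len G e) (f e) (g e) (h e)"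
    proof (rule C1AC_C2I[OF len_pos[OF e]])
      fix t
      have "((\<lambda>t. 3 * (k e * t)\<^sup>2 - 2 * (k e * t) ^ 3) has_real_derivative
            6 * k e * (k e * t) - 6 * k e * (k e * t)\<^sup>2) (at t within {0..len G e})"
        by (auto intro!: derivative_eq_intros)
      then have "(f e has_vector_derivative 0 + g e t) (at t within {0..len G e})"
        unfolding f_def g_def
        by (intro has_vector_derivative_add has_vector_derivative_const
            has_vector_derivative_mult_right has_vector_derivative_of_real)
      then show "(f e has_vector_derivative g e t) (at t within {0..len G e})"
        by simp
      have "((\<lambda>t. 6 * k e * (k e * t) - 6 * k e * (k e * t)\<^sup>2) has_real_derivative
            6 * (k e)\<^sup>2 - 12 * (k e)\<^sup>2 * (k e * t)) (at t within {0..len G e})"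
        by (auto intro!: derivative_eq_intros simp: power2_eq_square)
      then show "(g e has_vector_derivative h e t) (at t within {0..len G e})"
        unfolding g_def h_def
        by (intro has_vector_derivative_mult_right has_vector_derivative_of_real)
    qed (rule ch)
  qed
  moreover have "g e 0 = 0" "e \<in> E \<Longrightarrow> g e (len G e) = 0" for e
    by (simp_all add: g_def k)
  then have "nd g v = 0" for v
    by (simp add: nd_def)
  ultimately show ?thesis using ch by blast
qed

text \<open>Lift the boundary values by the cubic \<open>p\<close> and subtract the solution of the
  resolvent equation with right-hand side \<open>p'' + \<mu> p\<close>. This rests on invertibility
  alone and so covers values of \<open>\<mu>\<close> at which some
  \<open>sinm \<mu> (len G e)\<close> is zero.\<close>

lemma dtn_ex:
  assumes \<mu>: "complex_of_real \<mu> \<notin> spectrum G Vo"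
  shows "\<exists>f g y. solution \<mu> f g y \<and> (\<forall>v\<in>Vo. y v = x v) \<and> (\<forall>v\<in>Vi. nd g v = 0) \<and> (\<forall>v. dtn G Vo \<mu> x v = nd g v)"
proof -
  obtain p p' p'' where p: "dom_data p p' p'' x" "\<And>e. e \<in> E \<Longrightarrow> continuous_on {0..len G e} (p'' e)" "\<And>v. nd p' v = 0"
    using hermite_dom_data by metis
  define \<psi> where "\<psi> e t = p'' e t + of_real \<mu> * p e t" for e t
  have cp: "continuous_on {0..len G e} (p e)" if "e \<in> E" for e
    using C1AC_continuous(1)[OF len_pos[OF that]] p(1) that unfolding dom_data_def by blast
  have "\<psi> \<in> L2 G"
    unfolding L2_def \<psi>_def by (intro CollectI ballI L2_on_continuous continuous_intros p cp)
  moreover have "\<forall>\<psi>\<in>L2 G. \<exists>!f. f \<in> dom_outer G Vo \<and>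
     L2_eq G (\<lambda>e t. complex_of_real \<mu> * f e t - - laplacian G f e t) \<psi>"
    using \<mu> unfolding spectrum_def resolvent_set_def by simp
  ultimately obtain f where f: "f \<in> dom_outer G Vo"
    "L2_eq G (\<lambda>e t. complex_of_real \<mu> * f e t - - laplacian G f e t) \<psi>" by blast
  then have fm: "f \<in> dom_max G" by (simp add: dom_outer_def)
  from dom_maxE[OF fm] obtain g where g: "dom_data f g (laplacian G f) (vertex_trace G f)" .
  let ?f = "\<lambda>e t. p e t + (-1) * f e t" and ?g = "\<lambda>e t. p' e t + (-1) * g e t" and ?y = "\<lambda>v. x v + (-1) * vertex_trace G f v"
  have s: "solution \<mu> ?f ?g ?y"
    unfolding solution_def
  proof (rule dom_data_AE[OF dom_data_lin[OF p(1) g]])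
    fix e assume e: "e \<in> E"
    have "AE t in lebesgue_on {0..len G e}. complex_of_real \<mu> * f e t - - laplacian G f e t = \<psi> e t"
      using f(2) e unfolding L2_eq_def by blast
    then show "AE t in lebesgue_on {0..len G e}. p'' e t + (-1) * laplacian G f e t = - (of_real \<mu> * (p e t + (-1) * f e t))"
    proof eventually_elim
      case (elim t)
      then have "laplacian G f e t = p'' e t + of_real \<mu> * p e t - of_real \<mu> * f e t"
        unfolding \<psi>_def by (simp add: algebra_simps)
      then show ?case by (simp add: algebra_simps)
    qed
    have "continuous_on {0..len G e} (f e)"
      using fm e by (simp add: dom_max_def)
    then show "L2_on (len G e) (\<lambda>t. - (of_real \<mu> * (p e t + (-1) * f e t)))"
      by (intro L2_on_continuous continuous_intros cp e)
  qed
  have y: "\<forall>v\<in>Vo. ?y v = x v" using f(1) by (simp add: dom_outer_def)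
  have n: "\<forall>v\<in>Vi. nd ?g v = 0"
    unfolding nd_lin using f(1) p(3) dom_data_nd[OF g] by (simp add: dom_outer_def)
  show ?thesis
    using s y n dtn_eq[OF \<mu> s y n] by blast
qed

lemma solution_cnj:
  assumes "solution \<mu> f g x"
  shows "solution \<mu> (\<lambda>e t. cnj (f e t)) (\<lambda>e t. cnj (g e t)) (\<lambda>v. cnj (x v))"
  unfolding solution_def dom_data_def
proof (intro ballI conjI)
  fix e assume e: "e \<in> E"
  have d: "C1AC (len G e) (f e) (g e) (\<lambda>t. - (of_real \<mu> * f e t))" "f e 0 = x (fst e)" "f e (len G e) = x (snd e)"
    using assms e unfolding solution_def dom_data_def by blast+
  show "C1AC (len G e) (\<lambda>t. cnj (f e t)) (\<lambda>t. cnj (g e t)) (\<lambda>t. - (of_real \<mu> * cnj (f e t)))"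
    using C1AC_cnj[OF len_pos[OF e] d(1)] by simp
  show "cnj (f e 0) = cnj (x (fst e))" "cnj (f e (len G e)) = cnj (x (snd e))" using d by auto
qed

lemma nd_cnj: "nd (\<lambda>e t. cnj (g e t)) v = cnj (nd g v)"
  by (simp add: nd_def)

text \<open>The boundary data are real, so the conjugate of the solution solves the same problem,
  and uniqueness applies.\<close>

lemma dtn_matrix_real:
  assumes \<mu>: "complex_of_real \<mu> \<notin> spectrum G Vo"
  shows "dtn_matrix G Vo \<mu> v w \<in> \<real>"
proof -
  let ?x = "\<lambda>u. if u = w then 1 else 0 :: complex"
  obtain f g y where s: "solution \<mu> f g y" and y: "\<forall>v\<in>Vo. y v = ?x v" and n: "\<forall>v\<in>Vi. nd g v = 0"
    and d: "\<And>v. dtn G Vo \<mu> ?x v = nd g v"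
    using dtn_ex[OF \<mu>, of ?x] by metis
  have "dtn G Vo \<mu> ?x v = nd (\<lambda>e t. cnj (g e t)) v"
    by (rule dtn_eq[OF \<mu> solution_cnj[OF s]]) (use y n in \<open>auto simp: nd_cnj\<close>)
  then have "cnj (nd g v) = nd g v"
    unfolding nd_cnj d by (rule sym)
  then show ?thesis
    unfolding dtn_matrix_def d by (simp add: Reals_cnj_iff)
qed

text \<open>In \<open>solution_symmetric\<close>, applied to the solutions for two unit vectors,
  each side collapses to one entry: inner normal derivatives vanish, and outer values are those of a
  unit vector.\<close>

lemma dtn_matrix_sym:
  assumes \<mu>: "complex_of_real \<mu> \<notin> spectrum G Vo" and vw: "v \<in> Vo" "w \<in> Vo"
  shows "dtn_matrix G Vo \<mu> v w = dtn_matrix G Vo \<mu> w v"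
proof -
  let ?x = "\<lambda>w u. if u = w then 1 else 0 :: complex"
  obtain f1 g1 y1 where s1: "solution \<mu> f1 g1 y1" and y1: "\<forall>u\<in>Vo. y1 u = ?x v u" and n1: "\<forall>u\<in>Vi. nd g1 u = 0"
    and d1: "\<And>u. dtn G Vo \<mu> (?x v) u = nd g1 u"
    using dtn_ex[OF \<mu>, of "?x v"] by metis
  obtain f2 g2 y2 where s2: "solution \<mu> f2 g2 y2" and y2: "\<forall>u\<in>Vo. y2 u = ?x w u" and n2: "\<forall>u\<in>Vi. nd g2 u = 0"
    and d2: "\<And>u. dtn G Vo \<mu> (?x w) u = nd g2 u"
    using dtn_ex[OF \<mu>, of "?x w"] by metis
  have *: "(\<Sum>u\<in>V. y u * nd g u) = nd g v" if "v \<in> Vo" "\<forall>u\<in>Vo. y u = ?x v u" "\<forall>u\<in>Vi. nd g u = 0" for y g v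
  proof -
    have "(\<Sum>u\<in>V. y u * nd g u) = (\<Sum>u\<in>Vo. y u * nd g u)"
      by (rule sum.mono_neutral_right) (use finite_V Vo that in auto)
    also have "\<dots> = (\<Sum>u\<in>Vo. (if u = v then nd g u else 0))"
      by (rule sum.cong) (use that in auto)
    also have "\<dots> = nd g v" using that(1) finite_Vo by simp
    finally show ?thesis .
  qed
  show ?thesis
    unfolding dtn_matrix_def d1 d2
    using solution_symmetric[OF s1 s2] *[OF vw(1) y1 n2] *[OF vw(2) y2 n1] by simp
qed

text \<open>Let \<open>U\<close> consist of the vertices reached from \<open>v\<close> through inner
  vertices. The neighbours of \<open>U\<close> outside \<open>U\<close> are outer vertices different
  from \<open>w\<close>, so the solution vanishes there and can be cut off to the edges touching
  \<open>U\<close>. The result has homogeneous data, hence is zero, and so is the normal derivative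
  at \<open>v\<close>.\<close>

lemma dtn_matrix_local:
  assumes \<mu>: "complex_of_real \<mu> \<notin> spectrum G Vo" and vw: "v \<in> Vo" "w \<in> Vo" "v \<noteq> w"
    and na: "\<not> reduced_adj G Vo v w"
  shows "dtn_matrix G Vo \<mu> v w = 0"
proof -
  let ?x = "\<lambda>u. if u = w then 1 else 0 :: complex"
  obtain f g y where s: "solution \<mu> f g y" and y: "\<forall>v\<in>Vo. y v = ?x v" and n: "\<forall>v\<in>Vi. nd g v = 0"
    and d: "\<And>v. dtn G Vo \<mu> ?x v = nd g v"
    using dtn_ex[OF \<mu>, of ?x] by metis
  define R where "R a b \<longleftrightarrow> adj G a b \<and> b \<in> Vi" for a b
  define U where "U = {u. R\<^sup>*\<^sup>* v u}"
  have vU: "v \<in> U" by (simp add: U_def)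
  have Usub: "u = v \<or> u \<in> Vi" if "u \<in> U" for u
    using that unfolding U_def by (auto elim: rtranclp.cases simp: R_def)
  have Ucl: "z \<in> U" if "u \<in> U" "adj G u z" "z \<in> Vi" for u z
    using that unfolding U_def R_def[abs_def] by (auto intro: rtranclp.rtrancl_into_rtrancl)
  have nw: "\<not> adj G u w" if u: "u \<in> U" for u
  proof
    assume a: "adj G u w"
    obtain p where p: "is_path R p" "hd p = v" "last p = u"
      using rtranclp_path[of R v u] u by (auto simp: U_def)
    then obtain q where q: "p = v # q" by (cases p) (auto simp: is_path_def)
    have sub: "set q \<subseteq> Vi"
    proof -
      have "successively R (a # q) \<Longrightarrow> set q \<subseteq> Vi" for a
        by (induction q arbitrary: a) (auto simp: R_def)
      then show ?thesis using p(1) q by (auto simp: is_path_def)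
    qed
    have succ: "successively (adj G) (v # q)"
      using p(1) q by (auto simp: is_path_def R_def elim: successively_mono)
    have "reduced_adj G Vo v w"
    proof (cases "q = []")
      case True
      then show ?thesis using p q a vw by (simp add: reduced_adj_def)
    next
      case False
      have "is_path (adj G) ((v # q) @ [w])"
        unfolding is_path_def successively_append_iff
        using succ p q a sub vw False by (auto simp: is_path_def)
      then show ?thesis using False sub vw by (auto simp: reduced_adj_def)
    qed
    then show False using na by blast
  qed
  define F where "F = {e\<in>E. fst e \<in> U \<or> snd e \<in> U}"
  have boundary: "y z = 0" if "u \<in> U" "adj G u z" "z \<notin> U" for u z
  proof -
    have "z \<in> Vo" using Ucl[OF that(1,2)] that(3) adj_V[OF that(2)] by blast
    moreover have "z \<noteq> w" using nw[OF that(1)] that(2) by blast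
    ultimately show ?thesis using y by simp
  qed
  \<comment> \<open>At \<open>v\<close> and at inner vertices either all incident edges belong to
    \<open>F\<close> or none does; cutting off therefore keeps the whole normal derivative or
    removes it.\<close>
  have inF: "e \<in> F \<longleftrightarrow> u \<in> U" if "u \<in> Vi \<union> {v}" "e \<in> E" "u = fst e \<or> u = snd e" for u e
    using that Ucl edge_adj[OF that(2)] adj_sym[OF edge_adj[OF that(2)]] vU unfolding F_def by blast
  define f2 where "f2 e = (if e \<in> F then f e else (\<lambda>t. 0))" for e
  define g2 where "g2 e = (if e \<in> F then g e else (\<lambda>t. 0))" for e
  define y2 where "y2 u = (if u \<in> U then y u else 0)" for u
  have s2: "solution \<mu> f2 g2 y2"
    unfolding solution_def dom_data_def
  proof (intro ballI)
    fix e assume e: "e \<in> E"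
    have d: "C1AC (len G e) (f e) (g e) (\<lambda>t. - (of_real \<mu> * f e t))" "f e 0 = y (fst e)" "f e (len G e) = y (snd e)"
      using s e unfolding solution_def dom_data_def by blast+
    have d0: "C1AC (len G e) (\<lambda>t. 0) (\<lambda>t. 0) (\<lambda>t. 0)"
      using dom_data_zero e unfolding dom_data_def by blast
    show "C1AC (len G e) (f2 e) (g2 e) (\<lambda>t. - (of_real \<mu> * f2 e t)) \<and> f2 e 0 = y2 (fst e) \<and> f2 e (len G e) = y2 (snd e)"
    proof (cases "e \<in> F")
      case True
      then have "y2 (fst e) = y (fst e)" "y2 (snd e) = y (snd e)"
        using boundary edge_adj[OF e] adj_sym[OF edge_adj[OF e]] unfolding F_def y2_def by auto
      then show ?thesis using True d by (simp add: f2_def g2_def)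
    next
      case False
      then have "y2 (fst e) = 0" "y2 (snd e) = 0" using e by (auto simp: F_def y2_def)
      then show ?thesis using False d0 by (simp add: f2_def g2_def)
    qed
  qed
  have nd2: "nd g2 u = (if u \<in> U then nd g u else 0)" if "u \<in> Vi \<union> {v}" for u
  proof -
    have "g2 e = (if u \<in> U then g e else (\<lambda>t. 0))" if "e \<in> E" "u = fst e \<or> u = snd e" for e
      using inF[OF \<open>u \<in> Vi \<union> {v}\<close> that] by (simp add: g2_def)
    then show ?thesis by (auto simp: nd_def)
  qed
  have "g2 e t = 0" if "e \<in> E" "t \<in> {0..len G e}" for e t
  proof (rule solution_zero(2)[OF \<mu> s2 _ _ that])
    show "\<forall>v\<in>Vo. y2 v = 0"
      using Usub y vw by (auto simp: y2_def)
    show "\<forall>v\<in>Vi. nd g2 v = 0" using nd2 n by auto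
  qed
  then have "nd g2 v = 0"
    using len_pos by (simp add: nd_def less_imp_le)
  then show ?thesis
    unfolding dtn_matrix_def d using nd2[of v] vU by simp
qed

end

text \<open>The particular solution with zero initial data is corrected by a multiple of
  \<open>csinm \<mu>\<close> to vanish at \<open>L\<close>; this is where
  \<open>sinm \<mu> L\<close> has to be non-zero.\<close>

lemma dirichlet_solution:
  assumes L: "0 < L" and s: "sinm \<mu> L \<noteq> 0"
  shows "\<exists>C\<ge>0. \<forall>\<psi>. L2_on L \<psi> \<longrightarrow> (\<exists>f g. C1AC L f g (\<lambda>t. \<psi> t - of_real \<mu> * f t) \<and> f 0 = 0 \<and> f L = 0 \<and>
    (\<forall>t\<in>{0..L}. norm (f t) \<le> C * sqrt (LINT t|lebesgue_on {0..L}. (cmod (\<psi> t))\<^sup>2) \<and>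
                norm (g t) \<le> C * sqrt (LINT t|lebesgue_on {0..L}. (cmod (\<psi> t))\<^sup>2)))"
proof -
  obtain C where C: "C \<ge> 0" and P: "\<And>\<psi>. L2_on L \<psi> \<Longrightarrow> \<exists>f g. C1AC L f g (\<lambda>t. \<psi> t - of_real \<mu> * f t) \<and> f 0 = 0 \<and> g 0 = 0 \<and>
    (\<forall>t\<in>{0..L}. norm (f t) \<le> C * sqrt (LINT t|lebesgue_on {0..L}. (cmod (\<psi> t))\<^sup>2) \<and>
                norm (g t) \<le> C * sqrt (LINT t|lebesgue_on {0..L}. (cmod (\<psi> t))\<^sup>2))"
    using particular_solution[OF L, of \<mu>] by blast
  obtain B where B: "B \<ge> 0" "\<And>t. t \<in> {0..L} \<Longrightarrow> norm (ccosm \<mu> t) \<le> B" "\<And>t. t \<in> {0..L} \<Longrightarrow> norm (csinm \<mu> t) \<le> B"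
    using fundamental_bounded[of L \<mu>] by blast
  let ?s = "csinm \<mu> L"
  have s0: "?s \<noteq> 0" using s by simp
  define C' where "C' = C + C / norm ?s * B"
  have "C' \<ge> 0" using C B by (simp add: C'_def)
  show ?thesis
  proof (intro exI[of _ C'] conjI allI impI \<open>C' \<ge> 0\<close>)
    fix \<psi> assume "L2_on L \<psi>"
    define N where "N = sqrt (LINT t|lebesgue_on {0..L}. (cmod (\<psi> t))\<^sup>2)"
    obtain f g where fg: "C1AC L f g (\<lambda>t. \<psi> t - of_real \<mu> * f t)" "f 0 = 0"
      and b: "\<And>t. t \<in> {0..L} \<Longrightarrow> norm (f t) \<le> C * N" "\<And>t. t \<in> {0..L} \<Longrightarrow> norm (g t) \<le> C * N"
      using P[OF \<open>L2_on L \<psi>\<close>] unfolding N_def by blast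
    define \<beta> where "\<beta> = - f L / ?s"
    have nb: "norm \<beta> \<le> C / norm ?s * N"
      using b(1)[of L] L by (simp add: \<beta>_def norm_divide divide_right_mono)
    have bb: "norm (\<beta> * X) \<le> C / norm ?s * B * N" if "norm X \<le> B" for X
    proof -
      have "norm (\<beta> * X) \<le> (C / norm ?s * N) * B"
        unfolding norm_mult by (rule mult_mono[OF nb that]) (use order_trans[OF norm_ge_zero nb] in auto)
      then show ?thesis by (simp add: mult_ac)
    qed
    have K: "C1AC L (\<lambda>t. f t + \<beta> * csinm \<mu> t) (\<lambda>t. g t + \<beta> * ccosm \<mu> t) (\<lambda>t. \<psi> t - of_real \<mu> * (f t + \<beta> * csinm \<mu> t))"
      using C1AC_add[OF L fg(1) C1AC_fundamental[OF L, of 0 \<mu> \<beta>]] by (simp add: algebra_simps)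
    show "\<exists>f g. C1AC L f g (\<lambda>t. \<psi> t - of_real \<mu> * f t) \<and> f 0 = 0 \<and> f L = 0 \<and>
      (\<forall>t\<in>{0..L}. norm (f t) \<le> C' * sqrt (LINT t|lebesgue_on {0..L}. (cmod (\<psi> t))\<^sup>2) \<and>
                  norm (g t) \<le> C' * sqrt (LINT t|lebesgue_on {0..L}. (cmod (\<psi> t))\<^sup>2))"
      unfolding N_def[symmetric]
    proof (intro exI conjI ballI, rule K)
      show "f 0 + \<beta> * csinm \<mu> 0 = 0" using fg by simp
      show "f L + \<beta> * ?s = 0" using s0 by (simp add: \<beta>_def)
      fix t assume t: "t \<in> {0..L}"
      show "norm (f t + \<beta> * csinm \<mu> t) \<le> C' * N"
        using norm_triangle_ineq[of "f t" "\<beta> * csinm \<mu> t"] b(1)[OF t] bb[OF B(3)[OF t]]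
        by (simp add: C'_def distrib_right)
      show "norm (g t + \<beta> * ccosm \<mu> t) \<le> C' * N"
        using norm_triangle_ineq[of "g t" "\<beta> * ccosm \<mu> t"] b(2)[OF t] bb[OF B(2)[OF t]]
        by (simp add: C'_def distrib_right)
    qed
  qed
qed

section \<open>Regular spectral parameters\<close>

context qgraph_locale
begin

text \<open>With \<open>wb\<close>: the Dirichlet-to-Neumann weights of a single edge. For
  \<open>\<mu> = \<omega>^2\<close> with \<open>\<omega> > 0\<close> they are
  \<open>\<omega> cot (\<omega> L)\<close> and \<open>\<omega> / sin (\<omega> L)\<close>; the form
  chosen here also covers \<open>\<mu> \<le> 0\<close>.\<close>

definition wa :: "real \<Rightarrow> 'v \<times> 'v \<Rightarrow> real" where "wa \<mu> e = cosm \<mu> (len G e) / sinm \<mu> (len G e)"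
definition wb :: "real \<Rightarrow> 'v \<times> 'v \<Rightarrow> real" where "wb \<mu> e = 1 / sinm \<mu> (len G e)"

definition regular :: "real \<Rightarrow> bool" where "regular \<mu> \<longleftrightarrow> (\<forall>e\<in>E. sinm \<mu> (len G e) \<noteq> 0)"

abbreviation cnet :: "real \<Rightarrow> ('v \<Rightarrow> complex) \<Rightarrow> 'v \<Rightarrow> complex" where
  "cnet \<mu> \<equiv> net E (\<lambda>e. of_real (wa \<mu> e)) (\<lambda>e. of_real (wb \<mu> e))"

abbreviation rnet :: "real \<Rightarrow> ('v \<Rightarrow> real) \<Rightarrow> 'v \<Rightarrow> real" where
  "rnet \<mu> \<equiv> net E (wa \<mu>) (wb \<mu>)"

definition nonsingular :: "real \<Rightarrow> bool" where
  "nonsingular \<mu> \<longleftrightarrow> (\<forall>x. (\<forall>u. u \<notin> Vi \<longrightarrow> x u = 0) \<longrightarrow> (\<forall>v\<in>Vi. rnet \<mu> x v = 0) \<longrightarrow> (\<forall>u\<in>Vi. x u = 0))"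

text \<open>On a regular edge the two-point boundary value problem is solvable for all endpoint
  values. This is the passage from the differential operator to the finite matrix
  \<open>cnet\<close>.\<close>

lemma harmonic_extension:
  assumes "regular \<mu>"
  shows "\<exists>f g. solution \<mu> f g x \<and> (\<forall>v. nd g v = cnet \<mu> x v)"
proof -
  define \<beta> where "\<beta> e = (x (snd e) - x (fst e) * ccosm \<mu> (len G e)) / csinm \<mu> (len G e)" for e
  define f where "f e t = x (fst e) * ccosm \<mu> t + \<beta> e * csinm \<mu> t" for e t
  define g where "g e t = - (of_real \<mu> * x (fst e) * csinm \<mu> t) + \<beta> e * ccosm \<mu> t" for e t
  have s: "csinm \<mu> (len G e) \<noteq> 0" if "e \<in> E" for e using assms that by (auto simp: regular_def)
  have "solution \<mu> f g x"
    unfolding solution_def dom_data_def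
  proof (intro ballI conjI)
    fix e assume e: "e \<in> E"
    show "C1AC (len G e) (f e) (g e) (\<lambda>t. - (of_real \<mu> * f e t))"
      unfolding f_def g_def by (rule C1AC_fundamental[OF len_pos[OF e]])
    show "f e 0 = x (fst e)" by (simp add: f_def)
    show "f e (len G e) = x (snd e)" using s[OF e] by (simp add: f_def \<beta>_def)
  qed
  moreover have "nd g v = cnet \<mu> x v" for v
  proof -
    have 1: "- g e 0 = of_real (wa \<mu> e) * x v - of_real (wb \<mu> e) * x (snd e)" if "e \<in> E" "fst e = v" for e
      using s[OF that(1)] that(2) by (simp add: g_def \<beta>_def wa_def wb_def field_simps)
    have 2: "g e (len G e) = of_real (wa \<mu> e) * x v - of_real (wb \<mu> e) * x (fst e)" if "e \<in> E" "snd e = v" for e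
    proof -
      let ?c = "ccosm \<mu> (len G e)" and ?s = "csinm \<mu> (len G e)"
      have "g e (len G e) * ?s = x (snd e) * ?c - x (fst e) * (?c\<^sup>2 + of_real \<mu> * ?s\<^sup>2)"
        using s[OF that(1)] by (simp add: g_def \<beta>_def field_simps power2_eq_square)
      then have "g e (len G e) * ?s = x (snd e) * ?c - x (fst e)"
        by (simp only: ccosm_csinm mult_1_right)
      then have "g e (len G e) = (x (snd e) * ?c - x (fst e)) / ?s"
        using s[OF that(1)] by (simp add: eq_divide_eq)
      then show ?thesis using that(2) by (simp add: wa_def wb_def diff_divide_distrib mult.commute)
    qed
    show ?thesis
      unfolding nd_def net_def sum_negf[symmetric] using 1 2 by (intro arg_cong2[of _ _ _ _ "(+)"] sum.cong) auto
  qed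
  ultimately show ?thesis by blast
qed

lemma dtn_regular:
  assumes \<mu>: "complex_of_real \<mu> \<notin> spectrum G Vo" and r: "regular \<mu>"
    and y: "\<And>v. v \<in> Vo \<Longrightarrow> y v = (if v = w then 1 else 0)" and n: "\<And>v. v \<in> Vi \<Longrightarrow> rnet \<mu> y v = 0"
  shows "dtn_matrix G Vo \<mu> v w = of_real (rnet \<mu> y v)"
proof -
  obtain f g where s: "solution \<mu> f g (\<lambda>v. of_real (y v))" and nd: "\<And>v. nd g v = cnet \<mu> (\<lambda>v. of_real (y v)) v"
    using harmonic_extension[OF r, of "\<lambda>v. of_real (y v)"] by blast
  have "dtn G Vo \<mu> (\<lambda>u. if u = w then 1 else 0) v = nd g v"
    by (rule dtn_eq[OF \<mu> s]) (use y n nd in \<open>auto simp: net_of_real\<close>)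
  then show ?thesis
    by (simp add: dtn_matrix_def nd net_of_real)
qed

lemma singular_in_spectrum:
  assumes r: "regular \<mu>" and x: "\<And>u. u \<in> Vo \<Longrightarrow> x u = 0" and n: "\<And>v. v \<in> Vi \<Longrightarrow> rnet \<mu> x v = 0"
    and u: "u \<in> Vi" "x u \<noteq> 0"
  shows "complex_of_real \<mu> \<in> spectrum G Vo"
proof -
  obtain f g where s: "solution \<mu> f g (\<lambda>v. of_real (x v))" and nd: "\<And>v. nd g v = cnet \<mu> (\<lambda>v. of_real (x v)) v"
    using harmonic_extension[OF r, of "\<lambda>v. of_real (x v)"] by blast
  obtain e where e: "e \<in> E" "u \<in> {fst e, snd e}" using vertex_edge u by blast
  have "f e 0 = of_real (x (fst e))" "f e (len G e) = of_real (x (snd e))"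
    using s e unfolding solution_def dom_data_def by auto
  then obtain t where t: "t \<in> {0..len G e}" "f e t \<noteq> 0"
    using e u len_pos[OF e(1)] by (metis atLeastAtMost_iff empty_iff insert_iff less_imp_le of_real_eq_0_iff order_refl)
  show ?thesis
    by (rule eigenvalue_in_spectrum[OF s _ _ e(1) t]) (use x n nd in \<open>auto simp: net_of_real\<close>)
qed

text \<open>The sine half wave on \<open>e0\<close>, extended by zero, is an eigenfunction: its
  normal derivative is non-zero at most at the endpoints of \<open>e0\<close>, and outer vertices
  carry no condition on it.\<close>

lemma dirichlet_eigenvalue_in_spectrum:
  assumes e0: "e0 \<in> E" "fst e0 \<in> Vo" "snd e0 \<in> Vo"
  shows "complex_of_real ((pi / len G e0)\<^sup>2) \<in> spectrum G Vo"
proof -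
  define \<mu> where "\<mu> = (pi / len G e0)\<^sup>2"
  note L0 = len_pos[OF e0(1)]
  have sq: "sqrt \<mu> = pi / len G e0" "\<mu> > 0" using L0 by (auto simp: \<mu>_def)
  define f where "f e = (if e = e0 then csinm \<mu> else (\<lambda>t. 0))" for e
  define g where "g e = (if e = e0 then ccosm \<mu> else (\<lambda>t. 0))" for e
  have s: "solution \<mu> f g (\<lambda>v. 0)"
    unfolding solution_def dom_data_def
  proof (intro ballI)
    fix e assume e: "e \<in> E"
    show "C1AC (len G e) (f e) (g e) (\<lambda>t. - (of_real \<mu> * f e t)) \<and> f e 0 = 0 \<and> f e (len G e) = 0"
    proof (cases "e = e0")
      case True
      have "csinm \<mu> (len G e0) = 0" using sq L0 by (simp add: sinm_def)
      moreover have "C1AC (len G e0) (csinm \<mu>) (ccosm \<mu>) (\<lambda>t. - (of_real \<mu> * csinm \<mu> t))"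
        using C1AC_fundamental[OF L0, of 0 \<mu> 1] by simp
      ultimately show ?thesis using True by (simp add: f_def g_def)
    next
      case False
      then show ?thesis using dom_data_zero e by (auto simp: f_def g_def dom_data_def)
    qed
  qed
  have "complex_of_real \<mu> \<in> spectrum G Vo"
  proof (rule eigenvalue_in_spectrum[OF s _ _ e0(1)])
    show "len G e0 / 2 \<in> {0..len G e0}" using L0 by auto
    show "f e0 (len G e0 / 2) \<noteq> 0" using sq L0 by (simp add: f_def sinm_def)
    show "\<forall>v\<in>Vi. nd g v = 0"
    proof
      fix v assume "v \<in> Vi"
      then have "fst e = v \<Longrightarrow> g e = (\<lambda>t. 0)" "snd e = v \<Longrightarrow> g e = (\<lambda>t. 0)" for e
        using e0 by (auto simp: g_def)
      then show "nd g v = 0" by (simp add: nd_def)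
    qed
  qed simp
  then show ?thesis by (simp add: \<mu>_def)
qed

lemma complex_injective:
  assumes inj: "nonsingular \<mu>"
    and x: "\<forall>u. u \<notin> Vi \<longrightarrow> x u = 0" "\<forall>v\<in>Vi. cnet \<mu> x v = 0"
  shows "\<forall>u\<in>Vi. x u = 0"
proof -
  have re: "Re (cnet \<mu> x v) = rnet \<mu> (\<lambda>u. Re (x u)) v" "Im (cnet \<mu> x v) = rnet \<mu> (\<lambda>u. Im (x u)) v" for v
    by (simp_all add: net_def)
  have "\<forall>v\<in>Vi. rnet \<mu> (\<lambda>u. Re (x u)) v = 0" "\<forall>v\<in>Vi. rnet \<mu> (\<lambda>u. Im (x u)) v = 0"
    using x(2) by (simp_all flip: re)
  then have "\<forall>u\<in>Vi. Re (x u) = 0" "\<forall>u\<in>Vi. Im (x u) = 0"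
    using inj[unfolded nonsingular_def, rule_format, of "\<lambda>u. Re (x u)"]
      inj[unfolded nonsingular_def, rule_format, of "\<lambda>u. Im (x u)"] x(1) by simp_all
  then show ?thesis by (simp add: complex_eq_iff)
qed

lemma nd_norm_le:
  assumes "\<And>e. e \<in> E \<Longrightarrow> norm (g e 0) \<le> K e" "\<And>e. e \<in> E \<Longrightarrow> norm (g e (len G e)) \<le> K e"
  shows "norm (nd g v) \<le> 2 * (\<Sum>e\<in>E. K e)"
proof -
  have K: "0 \<le> K e" if "e \<in> E" for e using assms(1)[OF that] norm_ge_zero order_trans by blast
  have "norm (\<Sum>e\<in>{e\<in>E. fst e = v}. g e 0) \<le> (\<Sum>e\<in>{e\<in>E. fst e = v}. K e)"
    by (rule sum_norm_le) (use assms in auto)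
  moreover have "(\<Sum>e\<in>{e\<in>E. fst e = v}. K e) \<le> (\<Sum>e\<in>E. K e)"
    by (rule sum_mono2[OF finite_E]) (use K in auto)
  moreover have "norm (\<Sum>e\<in>{e\<in>E. snd e = v}. g e (len G e)) \<le> (\<Sum>e\<in>{e\<in>E. snd e = v}. K e)"
    by (rule sum_norm_le) (use assms in auto)
  moreover have "(\<Sum>e\<in>{e\<in>E. snd e = v}. K e) \<le> (\<Sum>e\<in>E. K e)"
    by (rule sum_mono2[OF finite_E]) (use K in auto)
  moreover have "norm (nd g v) \<le> norm (\<Sum>e\<in>{e\<in>E. fst e = v}. g e 0) + norm (\<Sum>e\<in>{e\<in>E. snd e = v}. g e (len G e))"
    unfolding nd_def using norm_triangle_ineq[of "- (\<Sum>e\<in>{e\<in>E. fst e = v}. g e 0)"] by simp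
  ultimately show ?thesis by linarith
qed

lemma edge_norm_le:
  assumes "\<psi> \<in> L2 G" "e \<in> E"
  shows "sqrt (LINT t|lebesgue_on {0..len G e}. (cmod (\<psi> e t))\<^sup>2) \<le> L2_norm G \<psi>"
  unfolding L2_norm_def
  by (intro real_sqrt_le_mono member_le_sum[OF assms(2) _ finite_E]) simp

lemma L2_norm_bound:
  assumes c: "\<And>e. e \<in> E \<Longrightarrow> continuous_on {0..len G e} (f e)"
    and b: "\<And>e t. e \<in> E \<Longrightarrow> t \<in> {0..len G e} \<Longrightarrow> norm (f e t) \<le> M" and M: "0 \<le> M"
  shows "L2_norm G f \<le> sqrt (\<Sum>e\<in>E. len G e) * M"
proof -
  have "(LINT t|lebesgue_on {0..len G e}. (cmod (f e t))\<^sup>2) \<le> len G e * M\<^sup>2" if e: "e \<in> E" for e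
  proof -
    interpret finite_measure "lebesgue_on {0..len G e}"
      by (rule finite_measure_lebesgue_on) auto
    have "(LINT t|lebesgue_on {0..len G e}. (cmod (f e t))\<^sup>2) \<le> (LINT t|lebesgue_on {0..len G e}. M\<^sup>2)"
    proof (rule integral_mono)
      show "integrable (lebesgue_on {0..len G e}) (\<lambda>t. (cmod (f e t))\<^sup>2)"
        by (intro continuous_on_integrable_lebesgue_on continuous_intros c e)
      fix t assume "t \<in> space (lebesgue_on {0..len G e})"
      then show "(cmod (f e t))\<^sup>2 \<le> M\<^sup>2" using b[OF e] by (intro power_mono) auto
    qed simp
    also have "\<dots> = len G e * M\<^sup>2" using len_pos[OF e] by (simp add: measure_restrict_space)
    finally show ?thesis .
  qed
  then have "(\<Sum>e\<in>E. LINT t|lebesgue_on {0..len G e}. (cmod (f e t))\<^sup>2) \<le> (\<Sum>e\<in>E. len G e) * M\<^sup>2"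
    by (simp add: sum_distrib_right sum_mono)
  then have "L2_norm G f \<le> sqrt ((\<Sum>e\<in>E. len G e) * M\<^sup>2)"
    unfolding L2_norm_def by (rule real_sqrt_le_mono)
  then show ?thesis using M by (simp add: real_sqrt_mult)
qed

text \<open>First solve with zero values at all vertices, edge by edge. Then add the extension of
  vertex values \<open>x\<close> on \<open>Vi\<close> chosen to cancel the normal derivatives
  created at the inner vertices. The constants \<open>C\<close>, \<open>K1\<close> and
  \<open>H\<close> belong to the edge problems, the vertex system and the extension.\<close>

lemma resolvent_equation:
  assumes r: "regular \<mu>"
    and inj: "nonsingular \<mu>"
  shows "\<exists>K\<ge>0. \<forall>\<psi>\<in>L2 G. \<exists>f g x. dom_data f g (\<lambda>e t. \<psi> e t - of_real \<mu> * f e t) x \<and>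
    (\<forall>v\<in>Vo. x v = 0) \<and> (\<forall>v\<in>Vi. nd g v = 0) \<and> (\<forall>e\<in>E. \<forall>t\<in>{0..len G e}. norm (f e t) \<le> K * L2_norm G \<psi>)"
proof -
  have "\<forall>e. \<exists>C\<ge>0. e \<in> E \<longrightarrow> (\<forall>\<psi>. L2_on (len G e) \<psi> \<longrightarrow> (\<exists>f g. C1AC (len G e) f g (\<lambda>t. \<psi> t - of_real \<mu> * f t) \<and> f 0 = 0 \<and> f (len G e) = 0 \<and>
    (\<forall>t\<in>{0..len G e}. norm (f t) \<le> C * sqrt (LINT t|lebesgue_on {0..len G e}. (cmod (\<psi> t))\<^sup>2) \<and>
                norm (g t) \<le> C * sqrt (LINT t|lebesgue_on {0..len G e}. (cmod (\<psi> t))\<^sup>2))))"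
  proof
    fix e
    show "\<exists>C\<ge>0. e \<in> E \<longrightarrow> (\<forall>\<psi>. L2_on (len G e) \<psi> \<longrightarrow> (\<exists>f g. C1AC (len G e) f g (\<lambda>t. \<psi> t - of_real \<mu> * f t) \<and> f 0 = 0 \<and> f (len G e) = 0 \<and>
      (\<forall>t\<in>{0..len G e}. norm (f t) \<le> C * sqrt (LINT t|lebesgue_on {0..len G e}. (cmod (\<psi> t))\<^sup>2) \<and>
                norm (g t) \<le> C * sqrt (LINT t|lebesgue_on {0..len G e}. (cmod (\<psi> t))\<^sup>2))))"
    proof (cases "e \<in> E")
      case True
      then show ?thesis using dirichlet_solution[OF len_pos[OF True], of \<mu>] r unfolding regular_def by blast
    next
      case False
      then show ?thesis by (intro exI[of _ 0]) simp
    qed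
  qed
  from choice[OF this] obtain C where C0: "\<And>e. C e \<ge> 0"
    and C: "\<And>e \<psi>. e \<in> E \<Longrightarrow> L2_on (len G e) \<psi> \<Longrightarrow> \<exists>f g. C1AC (len G e) f g (\<lambda>t. \<psi> t - of_real \<mu> * f t) \<and> f 0 = 0 \<and> f (len G e) = 0 \<and>
    (\<forall>t\<in>{0..len G e}. norm (f t) \<le> C e * sqrt (LINT t|lebesgue_on {0..len G e}. (cmod (\<psi> t))\<^sup>2) \<and>
                norm (g t) \<le> C e * sqrt (LINT t|lebesgue_on {0..len G e}. (cmod (\<psi> t))\<^sup>2))"
    by blast
  have "\<forall>e. \<exists>B\<ge>0. \<forall>t\<in>{0..len G e}. norm (ccosm \<mu> t) \<le> B \<and> norm (csinm \<mu> t) \<le> B"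
    using fundamental_bounded by blast
  from choice[OF this] obtain B where B: "\<And>e. B e \<ge> 0" "\<And>e t. t \<in> {0..len G e} \<Longrightarrow> norm (ccosm \<mu> t) \<le> B e"
     "\<And>e t. t \<in> {0..len G e} \<Longrightarrow> norm (csinm \<mu> t) \<le> B e" by blast
  have "\<exists>K\<ge>0. \<forall>b. \<exists>x. (\<forall>u. u \<notin> Vi \<longrightarrow> x u = 0) \<and> (\<forall>v\<in>Vi. cnet \<mu> x v = b v) \<and>
      (\<forall>u. norm (x u) \<le> K * (\<Sum>v\<in>Vi. norm (b v)))"
  proof (rule lin_op_bounded_inverse[OF finite_Vi lin_op_net])
    fix x :: "'v \<Rightarrow> complex"
    assume "\<forall>u. u \<notin> Vi \<longrightarrow> x u = 0" "\<forall>v\<in>Vi. cnet \<mu> x v = 0"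
    then show "\<forall>u\<in>Vi. x u = 0" by (rule complex_injective[OF inj])
  qed
  then obtain K1 where K1: "K1 \<ge> 0" "\<And>b. \<exists>x. (\<forall>u. u \<notin> Vi \<longrightarrow> x u = 0) \<and> (\<forall>v\<in>Vi. cnet \<mu> x v = b v) \<and>
      (\<forall>u. norm (x u) \<le> K1 * (\<Sum>v\<in>Vi. norm (b v)))"
    by (elim exE conjE) blast
  \<comment> \<open>The edge solutions have normal derivatives of norm at most
    \<open>2 * (\<Sum>e\<in>E. C e) * N\<close>; solving the vertex system costs the factor
    \<open>K1\<close>, so \<open>M * N\<close> bounds \<open>x\<close>.\<close>
  define M where "M = K1 * (\<Sum>v\<in>Vi. 2 * (\<Sum>e\<in>E. C e))"
  have M0: "M \<ge> 0" using K1(1) C0 by (simp add: M_def sum_nonneg)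
  \<comment> \<open>The factor from vertex values to the extension: its initial slope is bounded by
    \<open>(1 + B e) / norm (csinm \<mu> (len G e))\<close> times the bound for
    \<open>x\<close>.\<close>
  define H where "H e = (1 + (1 + B e) / norm (csinm \<mu> (len G e))) * B e" for e
  have H0: "H e \<ge> 0" for e using B(1) by (simp add: H_def)
  define K where "K = (\<Sum>e\<in>E. C e + M * H e)"
  have K0: "K \<ge> 0" unfolding K_def using C0 M0 H0 by (intro sum_nonneg) simp
  show ?thesis
  proof (intro exI[of _ K] conjI ballI K0)
    fix \<psi> assume \<psi>: "\<psi> \<in> L2 G"
    define N where "N = L2_norm G \<psi>"
    have N0: "N \<ge> 0" by (simp add: N_def L2_norm_def sum_nonneg)
    have "\<forall>e. \<exists>f g. e \<in> E \<longrightarrow> C1AC (len G e) f g (\<lambda>t. \<psi> e t - of_real \<mu> * f t) \<and> f 0 = 0 \<and> f (len G e) = 0 \<and>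
      (\<forall>t\<in>{0..len G e}. norm (f t) \<le> C e * N \<and> norm (g t) \<le> C e * N)"
    proof
      fix e
      show "\<exists>f g. e \<in> E \<longrightarrow> C1AC (len G e) f g (\<lambda>t. \<psi> e t - of_real \<mu> * f t) \<and> f 0 = 0 \<and> f (len G e) = 0 \<and>
        (\<forall>t\<in>{0..len G e}. norm (f t) \<le> C e * N \<and> norm (g t) \<le> C e * N)"
      proof (cases "e \<in> E")
        case True
        then have "L2_on (len G e) (\<psi> e)" using \<psi> by (simp add: L2_def)
        from C[OF True this] obtain f g where fg: "C1AC (len G e) f g (\<lambda>t. \<psi> e t - of_real \<mu> * f t)" "f 0 = 0" "f (len G e) = 0"
          and b: "\<And>t. t \<in> {0..len G e} \<Longrightarrow> norm (f t) \<le> C e * sqrt (LINT t|lebesgue_on {0..len G e}. (cmod (\<psi> e t))\<^sup>2)"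
          "\<And>t. t \<in> {0..len G e} \<Longrightarrow> norm (g t) \<le> C e * sqrt (LINT t|lebesgue_on {0..len G e}. (cmod (\<psi> e t))\<^sup>2)"
          by blast
        have "C e * sqrt (LINT t|lebesgue_on {0..len G e}. (cmod (\<psi> e t))\<^sup>2) \<le> C e * N"
          unfolding N_def by (intro mult_left_mono edge_norm_le \<psi> True C0)
        then show ?thesis using fg b order_trans by blast
      qed simp
    qed
    from choice[OF this] obtain f0 where "\<forall>e. \<exists>g. e \<in> E \<longrightarrow> C1AC (len G e) (f0 e) g (\<lambda>t. \<psi> e t - of_real \<mu> * f0 e t) \<and> f0 e 0 = 0 \<and> f0 e (len G e) = 0 \<and>
      (\<forall>t\<in>{0..len G e}. norm (f0 e t) \<le> C e * N \<and> norm (g t) \<le> C e * N)" ..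
    from choice[OF this] obtain g0 where fg0: "\<forall>e. e \<in> E \<longrightarrow> C1AC (len G e) (f0 e) (g0 e) (\<lambda>t. \<psi> e t - of_real \<mu> * f0 e t) \<and> f0 e 0 = 0 \<and> f0 e (len G e) = 0 \<and>
      (\<forall>t\<in>{0..len G e}. norm (f0 e t) \<le> C e * N \<and> norm (g0 e t) \<le> C e * N)" ..
    have b0: "norm (f0 e t) \<le> C e * N" "norm (g0 e t) \<le> C e * N" if "e \<in> E" "t \<in> {0..len G e}" for e t
      using fg0 that by blast+
    have D0: "dom_data f0 g0 (\<lambda>e t. \<psi> e t - of_real \<mu> * f0 e t) (\<lambda>v. 0)"
      unfolding dom_data_def using fg0 by blast
    obtain x where x: "\<And>u. u \<notin> Vi \<Longrightarrow> x u = 0" "\<And>v. v \<in> Vi \<Longrightarrow> cnet \<mu> x v = - nd g0 v"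
      "\<And>u. norm (x u) \<le> K1 * (\<Sum>v\<in>Vi. norm (- nd g0 v))"
      using K1(2)[of "\<lambda>v. - nd g0 v"] by blast
    have xM: "norm (x u) \<le> M * N" for u
    proof -
      have "norm (- nd g0 v) \<le> 2 * ((\<Sum>e\<in>E. C e) * N)" for v
        using nd_norm_le[of g0 "\<lambda>e. C e * N" v] b0(2) len_pos by (simp add: less_imp_le sum_distrib_right)
      then have "(\<Sum>v\<in>Vi. norm (- nd g0 v)) \<le> (\<Sum>v\<in>Vi. 2 * ((\<Sum>e\<in>E. C e) * N))"
        by (rule sum_mono)
      then have "K1 * (\<Sum>v\<in>Vi. norm (- nd g0 v)) \<le> K1 * (\<Sum>v\<in>Vi. 2 * ((\<Sum>e\<in>E. C e) * N))"
        using K1(1) by (rule mult_left_mono)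
      also have "\<dots> = M * N" by (simp add: M_def)
      finally show ?thesis using x(3)[of u] by linarith
    qed
    obtain f1 g1 where s1: "solution \<mu> f1 g1 x" and n1: "\<And>v. nd g1 v = cnet \<mu> x v"
      using harmonic_extension[OF r, of x] by blast
    have b1: "norm (f1 e t) \<le> H e * (M * N)" if e: "e \<in> E" "t \<in> {0..len G e}" for e t
    proof -
      let ?s = "csinm \<mu> (len G e)" and ?c = "ccosm \<mu> (len G e)"
      have s0: "?s \<noteq> 0" using r e by (auto simp: regular_def)
      have Le: "len G e \<in> {0..len G e}" using len_pos[OF e(1)] by auto
      have "x (snd e) = x (fst e) * ?c + g1 e 0 * ?s"
        using solution_formula(1)[OF s1 e(1) Le] s1 e(1) unfolding solution_def dom_data_def by metis
      then have g1: "g1 e 0 = (x (snd e) - x (fst e) * ?c) / ?s" using s0 by (simp add: eq_divide_eq)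
      have "norm (x (snd e) - x (fst e) * ?c) \<le> M * N + M * N * B e"
        using norm_triangle_ineq4[of "x (snd e)" "x (fst e) * ?c"] xM[of "snd e"]
          mult_mono[OF xM[of "fst e"] B(2)[OF Le]] M0 N0 by (simp add: norm_mult)
      then have "norm (g1 e 0) \<le> (M * N + M * N * B e) / norm ?s"
        unfolding g1 norm_divide by (rule divide_right_mono) simp
      then have "norm (g1 e 0 * csinm \<mu> t) \<le> (M * N + M * N * B e) / norm ?s * B e"
        unfolding norm_mult using B(3)[OF e(2)] M0 N0 B(1) by (intro mult_mono) auto
      moreover have "norm (x (fst e) * ccosm \<mu> t) \<le> M * N * B e"
        unfolding norm_mult using xM B(2)[OF e(2)] M0 N0 by (intro mult_mono) auto
      ultimately have "norm (f1 e t) \<le> M * N * B e + (M * N + M * N * B e) / norm ?s * B e"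
        unfolding solution_formula(1)[OF s1 e] using norm_triangle_ineq[of "x (fst e) * ccosm \<mu> t" "g1 e 0 * csinm \<mu> t"]
        by linarith
      also have "\<dots> = H e * (M * N)"
        using s0 by (simp add: H_def field_simps)
      finally show ?thesis .
    qed
    show "\<exists>f g x. dom_data f g (\<lambda>e t. \<psi> e t - of_real \<mu> * f e t) x \<and> (\<forall>v\<in>Vo. x v = 0) \<and> (\<forall>v\<in>Vi. nd g v = 0) \<and>
       (\<forall>e\<in>E. \<forall>t\<in>{0..len G e}. norm (f e t) \<le> K * L2_norm G \<psi>)"
    proof (intro exI conjI ballI)
      show "dom_data (\<lambda>e t. f0 e t + 1 * f1 e t) (\<lambda>e t. g0 e t + 1 * g1 e t) (\<lambda>e t. \<psi> e t - of_real \<mu> * (f0 e t + 1 * f1 e t)) (\<lambda>v. 0 + 1 * x v)"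
        using dom_data_lin[OF D0 s1[unfolded solution_def], of 1] by (simp add: algebra_simps)
      fix v
      show "0 + 1 * x v = 0" if "v \<in> Vo" using x(1) that by simp
      show "nd (\<lambda>e t. g0 e t + 1 * g1 e t) v = 0" if "v \<in> Vi"
        unfolding nd_lin n1 using x(2) that by simp
    next
      fix e t assume e: "e \<in> E" and t: "t \<in> {0..len G e}"
      have "norm (f0 e t + 1 * f1 e t) \<le> (C e + M * H e) * N"
        using norm_triangle_ineq[of "f0 e t" "f1 e t"] b0(1)[OF e t] b1[OF e t] by (simp add: algebra_simps)
      also have "\<dots> \<le> K * N"
      proof (rule mult_right_mono[OF _ N0])
        show "C e + M * H e \<le> K"
          unfolding K_def by (rule member_le_sum[OF e _ finite_E]) (use C0 M0 H0 in auto)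
      qed
      finally show "norm (f0 e t + 1 * f1 e t) \<le> K * L2_norm G \<psi>" unfolding N_def .
    qed
  qed
qed

text \<open>Existence and the estimate come from \<open>resolvent_equation\<close>. The estimate
  transfers to every \<open>f\<close> of the domain because, by uniqueness, \<open>f\<close> is the
  solution constructed for its own image.\<close>

lemma regular_not_in_spectrum:
  assumes r: "regular \<mu>"
    and inj: "nonsingular \<mu>"
  shows "complex_of_real \<mu> \<notin> spectrum G Vo"
proof -
  obtain K where K0: "K \<ge> 0" and K: "\<And>\<psi>. \<psi> \<in> L2 G \<Longrightarrow> \<exists>f g x. dom_data f g (\<lambda>e t. \<psi> e t - of_real \<mu> * f e t) x \<and>
    (\<forall>v\<in>Vo. x v = 0) \<and> (\<forall>v\<in>Vi. nd g v = 0) \<and> (\<forall>e\<in>E. \<forall>t\<in>{0..len G e}. norm (f e t) \<le> K * L2_norm G \<psi>)"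
    using resolvent_equation[OF r inj] by blast
  have uniq0: "f e t = 0" if s: "solution \<mu> f g x" and x: "\<forall>v\<in>Vo. x v = 0" and n: "\<forall>v\<in>Vi. nd g v = 0"
    and e: "e \<in> E" "t \<in> {0..len G e}" for f g x e t
  proof -
    \<comment> \<open>\<open>complex_injective\<close> speaks about functions vanishing everywhere
      outside \<open>Vi\<close>, hence the values off the graph are reset to zero.\<close>
    define x' where "x' u = (if u \<in> V then x u else 0)" for u
    have s': "solution \<mu> f g x'"
      using s edge_V unfolding solution_def dom_data_def x'_def by auto
    have nd: "nd g v = cnet \<mu> x' v" for v
    proof -
      obtain f1 g1 where s1: "solution \<mu> f1 g1 x'" and n1: "\<And>v. nd g1 v = cnet \<mu> x' v"
        using harmonic_extension[OF r, of x'] by blast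
      have g0: "g e 0 = g1 e 0" if e: "e \<in> E" for e
      proof -
        have Le: "len G e \<in> {0..len G e}" using len_pos[OF e] by auto
        have "f e (len G e) = x' (snd e)" "f1 e (len G e) = x' (snd e)"
          using s' s1 e unfolding solution_def dom_data_def by blast+
        then have "x' (fst e) * ccosm \<mu> (len G e) + g e 0 * csinm \<mu> (len G e) =
            x' (fst e) * ccosm \<mu> (len G e) + g1 e 0 * csinm \<mu> (len G e)"
          using solution_formula(1)[OF s' e Le] solution_formula(1)[OF s1 e Le] by (simp only:)
        then show ?thesis using r e by (auto simp: regular_def)
      qed
      have "g e (len G e) = g1 e (len G e)" if e: "e \<in> E" for e
      proof -
        have Le: "len G e \<in> {0..len G e}" using len_pos[OF e] by auto
        show ?thesis
          unfolding solution_formula(2)[OF s' e Le] solution_formula(2)[OF s1 e Le] g0[OF e] ..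
      qed
      then have "nd g v = nd g1 v" using g0 by (simp add: nd_def)
      then show ?thesis using n1 by simp
    qed
    have "\<forall>u\<in>Vi. x' u = 0"
    proof (rule complex_injective[OF inj])
      show "\<forall>u. u \<notin> Vi \<longrightarrow> x' u = 0" using x by (auto simp: x'_def)
      show "\<forall>v\<in>Vi. cnet \<mu> x' v = 0" using n by (simp only: nd)
    qed
    then have x'0: "x' u = 0" for u using x by (auto simp: x'_def)
    have Le: "len G e \<in> {0..len G e}" using len_pos[OF e(1)] by auto
    have "f e (len G e) = x' (snd e)"
      using s' e(1) unfolding solution_def dom_data_def by blast
    then have "g e 0 * csinm \<mu> (len G e) = 0"
      using solution_formula(1)[OF s' e(1) Le] by (simp add: x'0)
    then have "g e 0 = 0" using r e by (auto simp: regular_def)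
    then show ?thesis using solution_formula(1)[OF s' e] by (simp add: x'0)
  qed
  have outer: "\<exists>g x. dom_data f g (laplacian G f) x \<and> (\<forall>v\<in>Vo. x v = 0) \<and> (\<forall>v\<in>Vi. nd g v = 0)" if "f \<in> dom_outer G Vo" for f
  proof -
    have fm: "f \<in> dom_max G" using that by (simp add: dom_outer_def)
    from dom_maxE[OF fm] obtain g where g: "dom_data f g (laplacian G f) (vertex_trace G f)" .
    show ?thesis
      using g that dom_data_nd[OF g] by (intro exI[of _ g] exI[of _ "vertex_trace G f"]) (simp add: dom_outer_def)
  qed
  have uniq: "f = f'" if f: "f \<in> dom_outer G Vo" and f': "f' \<in> dom_outer G Vo"
    and eq: "\<And>e. e \<in> E \<Longrightarrow> AE t in lebesgue_on {0..len G e}. of_real \<mu> * f e t - - laplacian G f e t = of_real \<mu> * f' e t - - laplacian G f' e t" for f f'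
  proof -
    obtain g x where d: "dom_data f g (laplacian G f) x" "\<forall>v\<in>Vo. x v = 0" "\<forall>v\<in>Vi. nd g v = 0" using outer[OF f] by blast
    obtain g' x' where d': "dom_data f' g' (laplacian G f') x'" "\<forall>v\<in>Vo. x' v = 0" "\<forall>v\<in>Vi. nd g' v = 0" using outer[OF f'] by blast
    have fm: "f \<in> dom_max G" "f' \<in> dom_max G" using f f' by (simp_all add: dom_outer_def)
    have cf: "continuous_on {0..len G e} (f e)" "continuous_on {0..len G e} (f' e)" if "e \<in> E" for e
      using fm that by (simp_all add: dom_max_def)
    have s: "solution \<mu> (\<lambda>e t. f e t + (-1) * f' e t) (\<lambda>e t. g e t + (-1) * g' e t) (\<lambda>v. x v + (-1) * x' v)"
      unfolding solution_def
    proof (rule dom_data_AE[OF dom_data_lin[OF d(1) d'(1)]])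
      fix e assume e: "e \<in> E"
      show "AE t in lebesgue_on {0..len G e}. laplacian G f e t + (-1) * laplacian G f' e t = - (of_real \<mu> * (f e t + (-1) * f' e t))"
        using eq[OF e] by eventually_elim (simp add: algebra_simps)
      show "L2_on (len G e) (\<lambda>t. - (of_real \<mu> * (f e t + (-1) * f' e t)))"
        by (intro L2_on_continuous continuous_intros cf e)
    qed
    show "f = f'"
    proof (rule dom_max_eqI[OF fm])
      fix e t assume e: "e \<in> E" "t \<in> {0..len G e}"
      have "f e t + (-1) * f' e t = 0"
        by (rule uniq0[OF s _ _ e]) (use d d' in \<open>auto simp: nd_diff\<close>)
      then show "f e t = f' e t" by simp
    qed
  qed
  have ex: "\<exists>f. f \<in> dom_outer G Vo \<and> L2_eq G (\<lambda>e t. of_real \<mu> * f e t - - laplacian G f e t) \<psi> \<and>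
      L2_norm G f \<le> sqrt (\<Sum>e\<in>E. len G e) * (K * L2_norm G \<psi>)" if \<psi>: "\<psi> \<in> L2 G" for \<psi>
  proof -
    obtain f g x where d: "dom_data f g (\<lambda>e t. \<psi> e t - of_real \<mu> * f e t) x"
      and x: "\<forall>v\<in>Vo. x v = 0" and n: "\<forall>v\<in>Vi. nd g v = 0"
      and b: "\<And>e t. e \<in> E \<Longrightarrow> t \<in> {0..len G e} \<Longrightarrow> norm (f e t) \<le> K * L2_norm G \<psi>"
      using K[OF \<psi>] by blast
    note d' = dom_data_cutoff[OF d]
    show ?thesis
    proof (intro exI[of _ "cutoff f"] conjI)
      show "cutoff f \<in> dom_outer G Vo"
        unfolding dom_outer_def
        using cutoff_dom_max[OF d] dom_data_trace[OF d'] dom_data_nd[OF d'] x n Vo(1) by auto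
      show "L2_eq G (\<lambda>e t. of_real \<mu> * cutoff f e t - - laplacian G (cutoff f) e t) \<psi>"
        unfolding L2_eq_def
      proof
        fix e assume e: "e \<in> E"
        show "AE t in lebesgue_on {0..len G e}. of_real \<mu> * cutoff f e t - - laplacian G (cutoff f) e t = \<psi> e t"
          using dom_data_laplacian(1)[OF d' e] AE_space
        proof eventually_elim
          case (elim t)
          then show ?case using e by (simp add: cutoff_def)
        qed
      qed
      show "L2_norm G (cutoff f) \<le> sqrt (\<Sum>e\<in>E. len G e) * (K * L2_norm G \<psi>)"
      proof (rule L2_norm_bound)
        show "continuous_on {0..len G e} (cutoff f e)" if "e \<in> E" for e
          using cutoff_dom_max[OF d] that by (simp add: dom_max_def)
        show "norm (cutoff f e t) \<le> K * L2_norm G \<psi>" if "e \<in> E" "t \<in> {0..len G e}" for e t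
          using b[OF that] that by (simp add: cutoff_def)
        show "0 \<le> K * L2_norm G \<psi>" using K0 by (simp add: L2_norm_def sum_nonneg)
      qed
    qed
  qed
  have "complex_of_real \<mu> \<in> resolvent_set G (dom_outer G Vo) (\<lambda>f e t. - laplacian G f e t)"
    unfolding resolvent_set_def
  proof (intro CollectI conjI ballI)
    fix \<psi> assume \<psi>: "\<psi> \<in> L2 G"
    obtain f where f: "f \<in> dom_outer G Vo" "L2_eq G (\<lambda>e t. of_real \<mu> * f e t - - laplacian G f e t) \<psi>"
      using ex[OF \<psi>] by blast
    show "\<exists>!f. f \<in> dom_outer G Vo \<and> L2_eq G (\<lambda>e t. of_real \<mu> * f e t - - laplacian G f e t) \<psi>"
    proof (rule ex1I[of _ f])
      fix f' assume f': "f' \<in> dom_outer G Vo \<and> L2_eq G (\<lambda>e t. of_real \<mu> * f' e t - - laplacian G f' e t) \<psi>"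
      show "f' = f"
      proof (rule uniq)
        fix e assume e: "e \<in> E"
        have "AE t in lebesgue_on {0..len G e}. of_real \<mu> * f e t - - laplacian G f e t = \<psi> e t"
          "AE t in lebesgue_on {0..len G e}. of_real \<mu> * f' e t - - laplacian G f' e t = \<psi> e t"
          using f(2) f' e unfolding L2_eq_def by blast+
        then show "AE t in lebesgue_on {0..len G e}. of_real \<mu> * f' e t - - laplacian G f' e t = of_real \<mu> * f e t - - laplacian G f e t"
          by eventually_elim simp
      qed (use f f' in auto)
    qed (use f in auto)
  next
    show "\<exists>C. \<forall>f\<in>dom_outer G Vo. L2_norm G f \<le> C * L2_norm G (\<lambda>e t. of_real \<mu> * f e t - - laplacian G f e t)"
    proof (intro exI[of _ "sqrt (\<Sum>e\<in>E. len G e) * K"] ballI)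
      fix f assume f: "f \<in> dom_outer G Vo"
      let ?\<psi> = "\<lambda>e t. of_real \<mu> * f e t - - laplacian G f e t"
      obtain g x where d: "dom_data f g (laplacian G f) x" using outer[OF f] by blast
      have "?\<psi> \<in> L2 G"
        unfolding L2_def
      proof (intro CollectI ballI)
        fix e assume e: "e \<in> E"
        have c: "C1AC (len G e) (f e) (g e) (laplacian G f e)" using d e unfolding dom_data_def by blast
        have "L2_on (len G e) (\<lambda>t. of_real \<mu> * f e t + laplacian G f e t)"
          by (intro L2_on_add L2_on_cmult L2_on_continuous C1AC_continuous(1)[OF len_pos[OF e] c] C1AC_L2[OF c])
        then show "L2_on (len G e) (?\<psi> e)" by simp
      qed
      from ex[OF this] obtain f' where f': "f' \<in> dom_outer G Vo" "L2_eq G (\<lambda>e t. of_real \<mu> * f' e t - - laplacian G f' e t) ?\<psi>"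
        "L2_norm G f' \<le> sqrt (\<Sum>e\<in>E. len G e) * (K * L2_norm G ?\<psi>)" by blast
      have "f' = f"
        by (rule uniq[OF f'(1) f]) (use f'(2) in \<open>simp add: L2_eq_def\<close>)
      then show "L2_norm G f \<le> sqrt (\<Sum>e\<in>E. len G e) * K * L2_norm G ?\<psi>"
        using f'(3) by (simp add: mult.assoc)
    qed
  qed
  then show ?thesis by (simp add: spectrum_def)
qed

end

section \<open>Exponentials of real matrices\<close>

text \<open>The real counterparts of \<open>mat_power\<close> and its successors;
  \<open>rsg S D t\<close> is the exponential of \<open>- t D\<close>. As the Dirichlet-to-Neumann
  matrix is real, signs are discussed here.\<close>

primrec rpow :: "'v set \<Rightarrow> ('v \<Rightarrow> 'v \<Rightarrow> real) \<Rightarrow> nat \<Rightarrow> 'v \<Rightarrow> 'v \<Rightarrow> real" where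
  "rpow S B 0 = (\<lambda>v w. if v = w then 1 else 0)"
| "rpow S B (Suc k) = (\<lambda>v w. \<Sum>u\<in>S. B v u * rpow S B k u w)"

definition rexp :: "'v set \<Rightarrow> ('v \<Rightarrow> 'v \<Rightarrow> real) \<Rightarrow> 'v \<Rightarrow> 'v \<Rightarrow> real" where
  "rexp S B v w = (\<Sum>k. rpow S B k v w / fact k)"

definition rsg :: "'v set \<Rightarrow> ('v \<Rightarrow> 'v \<Rightarrow> real) \<Rightarrow> real \<Rightarrow> 'v \<Rightarrow> 'v \<Rightarrow> real" where
  "rsg S D t = rexp S (\<lambda>v w. - t * D v w)"

lemma rpow_bound:
  assumes "\<And>v w. v \<in> S \<Longrightarrow> w \<in> S \<Longrightarrow> \<bar>B v w\<bar> \<le> \<beta>" "v \<in> S"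
  shows "\<bar>rpow S B k v w\<bar> \<le> (real (card S) * \<beta>) ^ k"
  using assms(2)
proof (induction k arbitrary: v)
  case (Suc k)
  have \<beta>: "0 \<le> \<beta>" using assms(1)[OF Suc.prems Suc.prems] by linarith
  have "\<bar>rpow S B (Suc k) v w\<bar> \<le> (\<Sum>u\<in>S. \<bar>B v u * rpow S B k u w\<bar>)"
    by (simp add: sum_abs)
  also have "\<dots> \<le> (\<Sum>u\<in>S. \<beta> * (real (card S) * \<beta>) ^ k)"
    unfolding abs_mult by (intro sum_mono mult_mono assms(1) Suc.IH Suc.prems \<beta>) auto
  also have "\<dots> = (real (card S) * \<beta>) ^ Suc k" by simp
  finally show ?case .
qed simp

lemma entry_bound:
  assumes "finite S"
  shows "\<exists>\<beta>\<ge>0. \<forall>v\<in>S. \<forall>w\<in>S. \<bar>B v w :: real\<bar> \<le> \<beta>"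
proof (intro exI[of _ "\<Sum>v\<in>S. \<Sum>w\<in>S. \<bar>B v w\<bar>"] conjI ballI)
  show "0 \<le> (\<Sum>v\<in>S. \<Sum>w\<in>S. \<bar>B v w\<bar>)" by (intro sum_nonneg) auto
  fix v w assume vw: "v \<in> S" "w \<in> S"
  have "\<bar>B v w\<bar> \<le> (\<Sum>w\<in>S. \<bar>B v w\<bar>)" by (rule member_le_sum[OF vw(2) _ assms]) auto
  also have "\<dots> \<le> (\<Sum>v\<in>S. \<Sum>w\<in>S. \<bar>B v w\<bar>)"
    by (rule member_le_sum[OF vw(1) _ assms, of "\<lambda>v. \<Sum>w\<in>S. \<bar>B v w\<bar>"]) (auto intro: sum_nonneg)
  finally show "\<bar>B v w\<bar> \<le> (\<Sum>v\<in>S. \<Sum>w\<in>S. \<bar>B v w\<bar>)" .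
qed

lemma summable_exp_div: "summable (\<lambda>k. (r::real) ^ k / fact k)"
  using summable_exp[of r] by (simp add: field_simps)

lemma suminf_exp_div: "(\<Sum>k. (r::real) ^ k / fact k) = exp r"
  by (simp add: exp_def field_simps scaleR_conv_of_real)

lemma rexp_summable:
  assumes "finite S" "v \<in> S"
  shows "summable (\<lambda>k. \<bar>rpow S B k v w / fact k\<bar>)"
proof -
  obtain \<beta> where \<beta>: "\<forall>v\<in>S. \<forall>w\<in>S. \<bar>B v w\<bar> \<le> \<beta>" using entry_bound[OF assms(1), of B] by blast
  show ?thesis
  proof (rule summable_comparison_test'[OF summable_exp_div[of "real (card S) * \<beta>"]])
    fix k
    have "\<bar>rpow S B k v w\<bar> \<le> (real (card S) * \<beta>) ^ k"
      by (rule rpow_bound) (use \<beta> assms in auto)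
    then show "norm \<bar>rpow S B k v w / fact k\<bar> \<le> (real (card S) * \<beta>) ^ k / fact k"
      by (simp add: divide_right_mono)
  qed
qed

lemma rexp_summable': "finite S \<Longrightarrow> v \<in> S \<Longrightarrow> summable (\<lambda>k. rpow S B k v w / fact k)"
  by (rule summable_rabs_cancel[OF rexp_summable])

lemma mat_power_of_real:
  assumes "\<And>v w. v \<in> S \<Longrightarrow> w \<in> S \<Longrightarrow> A v w = complex_of_real (B v w)" "v \<in> S"
  shows "mat_power S A k v w = complex_of_real (rpow S B k v w)"
  using assms(2) by (induction k arbitrary: v) (auto simp: assms(1) intro!: sum.cong)

lemma mat_semigroup_of_real:
  assumes "finite S" "\<And>v w. v \<in> S \<Longrightarrow> w \<in> S \<Longrightarrow> A v w = complex_of_real (D v w)" "v \<in> S"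
  shows "mat_semigroup S A t v w = complex_of_real (rsg S D t v w)"
proof -
  have "mat_power S (\<lambda>v w. - complex_of_real t * A v w) k v w / fact k
      = complex_of_real (rpow S (\<lambda>v w. - t * D v w) k v w / fact k)" for k
    by (subst mat_power_of_real[where B = "\<lambda>v w. - t * D v w"]) (use assms in auto)
  then show ?thesis
    unfolding mat_semigroup_def mat_exp_def rsg_def rexp_def
    by (simp add: suminf_of_real[OF rexp_summable'[OF assms(1,3)]] del: of_real_divide)
qed

lemma rpow_scale: "rpow S (\<lambda>v w. c * B v w) k v w = c ^ k * rpow S B k v w"
  by (induction k arbitrary: v) (simp_all add: sum_distrib_left mult_ac)

lemma rpow_add:
  assumes "finite S" "v \<in> S"
  shows "(\<Sum>u\<in>S. rpow S B j v u * rpow S B k u w) = rpow S B (j + k) v w"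
  using assms(2)
proof (induction j arbitrary: v)
  case 0
  then show ?case using assms(1) by (simp add: mult_if_delta)
next
  case (Suc j)
  have "(\<Sum>u\<in>S. rpow S B (Suc j) v u * rpow S B k u w) = (\<Sum>u\<in>S. \<Sum>z\<in>S. B v z * (rpow S B j z u * rpow S B k u w))"
    by (simp add: sum_distrib_right mult.assoc)
  also have "\<dots> = (\<Sum>z\<in>S. \<Sum>u\<in>S. B v z * (rpow S B j z u * rpow S B k u w))"
    by (rule sum.swap)
  also have "\<dots> = (\<Sum>z\<in>S. B v z * rpow S B (j + k) z w)"
    by (rule sum.cong[OF refl]) (subst sum_distrib_left[symmetric], simp add: Suc.IH)
  finally show ?case by simp
qed

text \<open>Cauchy product and binomial theorem. Restricting to multiples of one matrix ensures that
  the factors commute.\<close>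

lemma rexp_scale_add:
  assumes "finite S" "v \<in> S"
  shows "(\<Sum>u\<in>S. rexp S (\<lambda>v w. s * B v w) v u * rexp S (\<lambda>v w. t * B v w) u w) = rexp S (\<lambda>v w. (s + t) * B v w) v w"
proof -
  let ?a = "\<lambda>u k. rpow S (\<lambda>v w. s * B v w) k v u / fact k" and ?b = "\<lambda>u k. rpow S (\<lambda>v w. t * B v w) k u w / fact k"
  have "(\<lambda>k. \<Sum>i\<le>k. ?a u i * ?b u (k - i)) sums (rexp S (\<lambda>v w. s * B v w) v u * rexp S (\<lambda>v w. t * B v w) u w)"
    if "u \<in> S" for u
    unfolding rexp_def using rexp_summable[OF assms(1)] assms(2) that
    by (intro Cauchy_product_sums) simp_all
  then have "(\<lambda>k. \<Sum>u\<in>S. \<Sum>i\<le>k. ?a u i * ?b u (k - i)) sums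
     (\<Sum>u\<in>S. rexp S (\<lambda>v w. s * B v w) v u * rexp S (\<lambda>v w. t * B v w) u w)"
    by (rule sums_sum)
  moreover have "(\<Sum>u\<in>S. \<Sum>i\<le>k. ?a u i * ?b u (k - i)) = rpow S (\<lambda>v w. (s + t) * B v w) k v w / fact k" for k
  proof -
    have "(\<Sum>u\<in>S. \<Sum>i\<le>k. ?a u i * ?b u (k - i)) =
        (\<Sum>i\<le>k. \<Sum>u\<in>S. (s ^ i * t ^ (k - i) / (fact i * fact (k - i))) * (rpow S B i v u * rpow S B (k - i) u w))"
      unfolding rpow_scale by (subst sum.swap) (simp add: mult_ac)
    also have "\<dots> = (\<Sum>i\<le>k. (s ^ i * t ^ (k - i) / (fact i * fact (k - i))) * rpow S B k v w)"
      by (rule sum.cong[OF refl]) (subst sum_distrib_left[symmetric], simp add: rpow_add[OF assms])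
    also have "\<dots> = (\<Sum>i\<le>k. (real (k choose i) * s ^ i * t ^ (k - i))) / fact k * rpow S B k v w"
      unfolding sum_distrib_right sum_divide_distrib
      by (rule sum.cong[OF refl]) (simp add: binomial_fact)
    also have "\<dots> = (s + t) ^ k / fact k * rpow S B k v w"
      by (simp add: binomial_ring)
    finally show ?thesis by (simp add: rpow_scale)
  qed
  ultimately show ?thesis
    unfolding rexp_def[of S "\<lambda>v w. (s + t) * B v w"] by (simp add: sums_iff)
qed

lemma rsg_add:
  assumes "finite S" "v \<in> S"
  shows "(\<Sum>u\<in>S. rsg S D s v u * rsg S D t u w) = rsg S D (s + t) v w"
  using rexp_scale_add[OF assms, of "-s" D "-t" w] by (simp add: rsg_def)

lemma rsg_zero: "rsg S D 0 v w = (if v = w then 1 else 0)"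
proof -
  have "rpow S (\<lambda>v w. - 0 * D v w) k v w / fact k = (if k = 0 then if v = w then 1 else 0 else 0)" for k
    by (cases k) auto
  then have "rsg S D 0 v w = (\<Sum>k. if k = 0 then if v = w then 1 else 0 else 0)"
    unfolding rsg_def rexp_def by simp
  also have "\<dots> = (if v = w then 1 else 0)"
    using suminf_finite[of "{0::nat}" "\<lambda>k. if k = 0 then if v = w then 1 else 0 else (0::real)"] by simp
  finally show ?thesis .
qed

lemma rpow_shift:
  assumes "finite S" "v \<in> S"
  shows "rpow S (\<lambda>v w. Q v w + (if v = w then c else 0)) k v w = (\<Sum>i\<le>k. real (k choose i) * c ^ (k - i) * rpow S Q i v w)"
  using assms(2)
proof (induction k arbitrary: v)
  case 0
  then show ?case by simp
next
  case (Suc k)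
  let ?R = "rpow S (\<lambda>v w. Q v w + (if v = w then c else 0))"
  have "?R (Suc k) v w = (\<Sum>u\<in>S. Q v u * ?R k u w) + (\<Sum>u\<in>S. (if v = u then c * ?R k u w else 0))"
    unfolding rpow.simps sum.distrib[symmetric]
    by (rule sum.cong[OF refl]) (simp add: distrib_right)
  also have "(\<Sum>u\<in>S. (if v = u then c * ?R k u w else 0)) = c * ?R k v w"
    using assms(1) Suc.prems by simp
  also have "(\<Sum>u\<in>S. Q v u * ?R k u w) = (\<Sum>u\<in>S. \<Sum>i\<le>k. real (k choose i) * c ^ (k - i) * (Q v u * rpow S Q i u w))"
    by (rule sum.cong[OF refl]) (simp add: Suc.IH sum_distrib_left mult_ac)
  also have "\<dots> = (\<Sum>i\<le>k. real (k choose i) * c ^ (k - i) * rpow S Q (Suc i) v w)"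
    by (subst sum.swap) (simp add: sum_distrib_left)
  also have "c * ?R k v w = (\<Sum>i\<le>k. real (k choose i) * c ^ (Suc k - i) * rpow S Q i v w)"
    unfolding Suc.IH[OF Suc.prems] sum_distrib_left
    by (rule sum.cong[OF refl]) (simp add: Suc_diff_le mult_ac)
  also have "\<dots> = (\<Sum>i\<le>Suc k. real (k choose i) * c ^ (Suc k - i) * rpow S Q i v w)"
    by simp
  also have "\<dots> = c ^ Suc k * rpow S Q 0 v w + (\<Sum>i\<le>k. real (k choose Suc i) * c ^ (k - i) * rpow S Q (Suc i) v w)"
    by (subst sum.atMost_Suc_shift) simp
  also have "(\<Sum>i\<le>k. real (k choose i) * c ^ (k - i) * rpow S Q (Suc i) v w) +
      (c ^ Suc k * rpow S Q 0 v w + (\<Sum>i\<le>k. real (k choose Suc i) * c ^ (k - i) * rpow S Q (Suc i) v w)) =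
      c ^ Suc k * rpow S Q 0 v w + (\<Sum>i\<le>k. real (Suc k choose Suc i) * c ^ (k - i) * rpow S Q (Suc i) v w)"
    by (simp add: sum.distrib distrib_right del: rpow.simps)
  also have "\<dots> = (\<Sum>i\<le>Suc k. real (Suc k choose i) * c ^ (Suc k - i) * rpow S Q i v w)"
    by (subst sum.atMost_Suc_shift) (simp del: rpow.simps)
  finally show ?case .
qed

lemma rexp_shift:
  assumes "finite S" "v \<in> S"
  shows "rexp S (\<lambda>v w. Q v w + (if v = w then c else 0)) v w = rexp S Q v w * exp c"
proof -
  have "(\<lambda>k. \<Sum>i\<le>k. (rpow S Q i v w / fact i) * (c ^ (k - i) / fact (k - i))) sums (rexp S Q v w * (\<Sum>k. c ^ k / fact k))"
    unfolding rexp_def using rexp_summable[OF assms] summable_exp_div[of "\<bar>c\<bar>"]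
    by (intro Cauchy_product_sums) (simp_all add: power_abs)
  moreover have "(\<Sum>i\<le>k. (rpow S Q i v w / fact i) * (c ^ (k - i) / fact (k - i))) =
      rpow S (\<lambda>v w. Q v w + (if v = w then c else 0)) k v w / fact k" for k
    unfolding rpow_shift[OF assms] sum_divide_distrib
    by (rule sum.cong[OF refl]) (simp add: binomial_fact)
  ultimately show ?thesis
    unfolding rexp_def[of S "\<lambda>v w. Q v w + (if v = w then c else 0)"] by (simp add: sums_iff suminf_exp_div)
qed

section \<open>Z-matrices and the signs of their semigroups\<close>

definition Zmatrix :: "'v set \<Rightarrow> ('v \<Rightarrow> 'v \<Rightarrow> real) \<Rightarrow> bool" where
  "Zmatrix S D \<longleftrightarrow> (\<forall>v\<in>S. \<forall>w\<in>S. v \<noteq> w \<longrightarrow> D v w \<le> 0)"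

text \<open>For a Z-matrix this is irreducibility in the usual sense, where a non-zero off-diagonal
  entry is a negative one.\<close>

definition irreducible_matrix :: "'v set \<Rightarrow> ('v \<Rightarrow> 'v \<Rightarrow> real) \<Rightarrow> bool" where
  "irreducible_matrix S D \<longleftrightarrow> (\<forall>T. T \<subseteq> S \<longrightarrow> T \<noteq> {} \<longrightarrow> T \<noteq> S \<longrightarrow> (\<exists>v\<in>S - T. \<exists>w\<in>T. D v w < 0))"

text \<open>Write \<open>D\<close> as \<open>c\<close> times the identity minus a non-negative
  \<open>Q\<close>; the sum \<open>c\<close> of the absolute diagonal entries dominates every one of
  them. The scalar factor \<open>exp (- t * c)\<close> does not affect signs.\<close>

lemma Zmatrix_shift:
  assumes "finite S" "Zmatrix S D"
  obtains c Q where "\<And>v w. v \<in> S \<Longrightarrow> w \<in> S \<Longrightarrow> 0 \<le> Q v w" "\<And>v w. v \<noteq> w \<Longrightarrow> Q v w = - D v w"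
    "\<And>t v w. v \<in> S \<Longrightarrow> rsg S D t v w = rexp S (\<lambda>v w. t * Q v w) v w * exp (- t * c)"
proof -
  define c where "c = (\<Sum>v\<in>S. \<bar>D v v\<bar>)"
  define Q where "Q v w = (if v = w then c - D v v else - D v w)" for v w
  have dc: "D v v \<le> c" if "v \<in> S" for v
    using member_le_sum[OF that, of "\<lambda>v. \<bar>D v v\<bar>"] assms(1) unfolding c_def by fastforce
  show ?thesis
  proof (rule that[of Q c])
    show "0 \<le> Q v w" if "v \<in> S" "w \<in> S" for v w
      using assms(2) that dc by (auto simp: Q_def Zmatrix_def)
    show "Q v w = - D v w" if "v \<noteq> w" for v w using that by (simp add: Q_def)
    show "rsg S D t v w = rexp S (\<lambda>v w. t * Q v w) v w * exp (- t * c)" if "v \<in> S" for t v w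
    proof -
      have "(\<lambda>v w. - t * D v w) = (\<lambda>v w. t * Q v w + (if v = w then - t * c else 0))"
        by (auto simp: Q_def fun_eq_iff algebra_simps)
      then show ?thesis unfolding rsg_def by (simp only: rexp_shift[OF assms(1) that])
    qed
  qed
qed

lemma rpow_nonneg:
  assumes "\<And>v w. v \<in> S \<Longrightarrow> w \<in> S \<Longrightarrow> 0 \<le> Q v w" "v \<in> S" "w \<in> S"
  shows "0 \<le> rpow S Q k v w"
  using assms(2) by (induction k arbitrary: v) (auto intro!: sum_nonneg mult_nonneg_nonneg assms(1))

lemma Zmatrix_nonneg:
  assumes S: "finite S" and Z: "Zmatrix S D" and t: "0 \<le> t" and vw: "v \<in> S" "w \<in> S"
  shows "0 \<le> rsg S D t v w"
proof -
  obtain c Q where Q: "\<And>v w. v \<in> S \<Longrightarrow> w \<in> S \<Longrightarrow> 0 \<le> Q v w"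
    and E: "\<And>t v w. v \<in> S \<Longrightarrow> rsg S D t v w = rexp S (\<lambda>v w. t * Q v w) v w * exp (- t * c)"
    using Zmatrix_shift[OF S Z] by metis
  have "0 \<le> rexp S (\<lambda>v w. t * Q v w) v w"
    unfolding rexp_def
    by (intro suminf_nonneg rexp_summable' S vw divide_nonneg_nonneg rpow_nonneg mult_nonneg_nonneg t Q) auto
  then show ?thesis by (simp add: E[OF vw(1)])
qed

text \<open>\<open>T\<close> contains the rows having a positive entry in column \<open>w\<close> of
  some power of \<open>Q\<close>. A row outside \<open>T\<close> with a negative entry of
  \<open>D\<close> towards \<open>T\<close> would have such an entry in the next power, so
  irreducibility forces \<open>T = S\<close>.\<close>

lemma Zmatrix_pos:
  assumes S: "finite S" and Z: "Zmatrix S D" and irr: "irreducible_matrix S D" and t: "0 < t" and vw: "v \<in> S" "w \<in> S"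
  shows "0 < rsg S D t v w"
proof -
  obtain c Q where Q: "\<And>v w. v \<in> S \<Longrightarrow> w \<in> S \<Longrightarrow> 0 \<le> Q v w" "\<And>v w. v \<noteq> w \<Longrightarrow> Q v w = - D v w"
    and E: "\<And>t v w. v \<in> S \<Longrightarrow> rsg S D t v w = rexp S (\<lambda>v w. t * Q v w) v w * exp (- t * c)"
    using Zmatrix_shift[OF S Z] by metis
  define T where "T = {v\<in>S. \<exists>k. 0 < rpow S Q k v w}"
  have "rpow S Q 0 w w > 0" by simp
  then have wT: "w \<in> T" unfolding T_def using vw(2) by blast
  have "T = S"
  proof (rule ccontr)
    assume "T \<noteq> S"
    then obtain x u where x: "x \<in> S - T" and u: "u \<in> T" and D: "D x u < 0"
      using irr wT unfolding irreducible_matrix_def T_def by (metis (no_types, lifting) empty_iff mem_Collect_eq subsetI)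
    obtain k where k: "0 < rpow S Q k u w" using u by (auto simp: T_def)
    have "x \<noteq> u" using x u by auto
    then have "0 < Q x u * rpow S Q k u w" using D k by (simp add: Q(2) mult_neg_pos)
    also have "\<dots> \<le> (\<Sum>u\<in>S. Q x u * rpow S Q k u w)"
    proof (rule member_le_sum[OF _ _ S])
      show "u \<in> S" using u by (simp add: T_def)
      fix z assume "z \<in> S - {u}"
      then show "0 \<le> Q x z * rpow S Q k z w" using Q(1) x vw(2) by (intro mult_nonneg_nonneg rpow_nonneg) auto
    qed
    finally have "0 < rpow S Q (Suc k) x w" by simp
    then show False using x unfolding T_def by blast
  qed
  then obtain k where k: "0 < rpow S Q k v w" using vw(1) unfolding T_def by blast
  have "0 < rexp S (\<lambda>v w. t * Q v w) v w"
    unfolding rexp_def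
  proof (rule suminf_pos2[where i = k])
    show "summable (\<lambda>k. rpow S (\<lambda>v w. t * Q v w) k v w / fact k)" by (rule rexp_summable'[OF S vw(1)])
    show "0 \<le> rpow S (\<lambda>v w. t * Q v w) n v w / fact n" for n
      using t by (intro divide_nonneg_nonneg rpow_nonneg vw mult_nonneg_nonneg Q) auto
    show "0 < rpow S (\<lambda>v w. t * Q v w) k v w / fact k"
      using k t by (simp add: rpow_scale)
  qed
  then show ?thesis by (simp add: E[OF vw(1)])
qed

lemma rsg_scale: "rsg S (\<lambda>v w. c * D v w) t = rsg S D (c * t)"
  by (simp add: rsg_def mult_ac)

text \<open>Reversing the sign of \<open>D\<close> gives the inverse of an entrywise positive
  matrix. If this inverse were non-negative, an off-diagonal zero of the product would force a whole
  row of it to vanish, contradicting the diagonal entry 1.\<close>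

lemma rsg_uminus_not_eventually_nonneg:
  assumes S: "finite S" and Z: "Zmatrix S D" and irr: "irreducible_matrix S D" and card: "2 \<le> card S" and t: "0 < t"
  shows "\<exists>v\<in>S. \<exists>w\<in>S. rsg S (\<lambda>v w. - D v w) t v w < 0"
proof (rule ccontr)
  assume "\<not> ?thesis"
  then have T: "0 \<le> rsg S D (- t) v w" if "v \<in> S" "w \<in> S" for v w
    using rsg_scale[of S "-1" D t] that by (auto simp: not_less)
  note A = Zmatrix_pos[OF S Z irr t]
  obtain v w where vw: "v \<in> S" "w \<in> S" "v \<noteq> w"
    using card by (metis card_le_Suc0_iff_eq S not_less_eq_eq numeral_2_eq_2)
  have z: "(\<Sum>u\<in>S. rsg S D (- t) v u * rsg S D t u w) = 0"
    using rsg_add[OF S vw(1), of D "- t" t w] vw by (simp add: rsg_zero)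
  have "rsg S D (- t) v u = 0" if u: "u \<in> S" for u
  proof -
    have "rsg S D (- t) v u * rsg S D t u w = 0"
    proof (rule sum_nonneg_0[OF S _ z u])
      fix u assume "u \<in> S"
      then show "0 \<le> rsg S D (- t) v u * rsg S D t u w"
        by (intro mult_nonneg_nonneg T[OF vw(1)] less_imp_le[OF A[OF _ vw(2)]])
    qed
    then show ?thesis using A[OF u vw(2)] by simp
  qed
  then have "(\<Sum>u\<in>S. rsg S D (- t) v u * rsg S D t u v) = 0" by simp
  then show False
    using rsg_add[OF S vw(1), of D "- t" t v] by (simp add: rsg_zero)
qed

text \<open>Conjugation by the diagonal matrix of the signs \<open>\<sigma>\<close>: the signs of
  intermediate indices occur in pairs and cancel.\<close>

lemma rpow_signature:
  assumes "\<And>v. v \<in> S \<Longrightarrow> \<sigma> v * \<sigma> v = (1::real)" "v \<in> S" "w \<in> S"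
  shows "rpow S (\<lambda>v w. \<sigma> v * \<sigma> w * D v w) k v w = \<sigma> v * \<sigma> w * rpow S D k v w"
  using assms(2)
proof (induction k arbitrary: v)
  case 0
  then show ?case using assms(1)[OF 0] by auto
next
  case (Suc k)
  have "rpow S (\<lambda>v w. \<sigma> v * \<sigma> w * D v w) (Suc k) v w = (\<Sum>u\<in>S. (\<sigma> u * \<sigma> u) * (\<sigma> v * \<sigma> w * (D v u * rpow S D k u w)))"
    using Suc.IH by (auto intro!: sum.cong simp: mult_ac)
  also have "\<dots> = (\<Sum>u\<in>S. \<sigma> v * \<sigma> w * (D v u * rpow S D k u w))"
    by (rule sum.cong[OF refl]) (simp only: assms(1) mult_1_left)
  finally show ?case by (simp add: sum_distrib_left)
qed

lemma rsg_signature: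
  assumes "finite S" "\<And>v. v \<in> S \<Longrightarrow> \<sigma> v * \<sigma> v = (1::real)" "v \<in> S" "w \<in> S"
  shows "rsg S (\<lambda>v w. \<sigma> v * \<sigma> w * D v w) t v w = \<sigma> v * \<sigma> w * rsg S D t v w"
proof -
  have "rpow S (\<lambda>v w. - t * (\<sigma> v * \<sigma> w * D v w)) k v w / fact k = \<sigma> v * \<sigma> w * (rpow S (\<lambda>v w. - t * D v w) k v w / fact k)" for k
    using rpow_scale[of S "- t" "\<lambda>v w. \<sigma> v * \<sigma> w * D v w" k v w] rpow_scale[of S "- t" D k v w]
      rpow_signature[OF assms(2-4), where D = D and k = k] by simp
  then show ?thesis
    unfolding rsg_def rexp_def using rexp_summable'[OF assms(1,3)] by (simp only: suminf_mult)
qed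

text \<open>Off the diagonal the semigroup is \<open>- t * D x y\<close> up to an error of order
  \<open>t^2\<close>.\<close>

lemma rsg_initially_negative:
  assumes S: "finite S" and xy: "x \<in> S" "y \<in> S" "x \<noteq> y" and D: "0 < D x y"
  shows "\<exists>t>0. rsg S D t x y < 0"
proof -
  obtain \<beta> where \<beta>: "0 \<le> \<beta>" "\<forall>v\<in>S. \<forall>w\<in>S. \<bar>D v w\<bar> \<le> \<beta>" using entry_bound[OF S, of D] by blast
  define r where "r = real (card S) * \<beta>"
  have r0: "0 \<le> r" using \<beta> by (simp add: r_def)
  \<comment> \<open>\<open>t\<^sup>2 * M\<close> bounds the series from the quadratic term on when
    \<open>t \<le> 1\<close>, by \<open>t ^ (k + 2) \<le> t\<^sup>2\<close> and
    \<open>fact k \<le> fact (k + 2)\<close>.\<close>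
  define M where "M = r\<^sup>2 * exp r"
  have M0: "0 \<le> M" by (simp add: M_def)
  define t where "t = min 1 (D x y / (M + 1)) / 2"
  have t: "0 < t" "t \<le> 1" "t * (M + 1) < D x y"
  proof -
    show "0 < t" using D M0 by (simp add: t_def)
    show "t \<le> 1" by (simp add: t_def)
    have "0 < D x y / (M + 1)" using D M0 by simp
    moreover have "min 1 q / 2 < q" if "0 < q" for q :: real using that by linarith
    ultimately have "t < D x y / (M + 1)" unfolding t_def by blast
    then show "t * (M + 1) < D x y" using M0 by (simp add: pos_less_divide_eq)
  qed
  let ?a = "\<lambda>k. rpow S (\<lambda>v w. - t * D v w) k x y / fact k"
  have a: "summable ?a" by (rule rexp_summable'[OF S xy(1)])
  have "rsg S D t x y = (\<Sum>k. ?a (k + 2)) + (\<Sum>k<2. ?a k)"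
    unfolding rsg_def rexp_def by (rule suminf_split_initial_segment[OF a])
  also have "(\<Sum>k<2. ?a k) = - t * D x y"
    using xy S by (simp add: numeral_2_eq_2 if_distrib cong: if_cong)
  also have "(\<Sum>k. ?a (k + 2)) \<le> t\<^sup>2 * M"
  proof -
    have b: "?a (k + 2) \<le> t\<^sup>2 * r\<^sup>2 * (r ^ k / fact k)" for k
    proof -
      have "\<bar>rpow S D (k + 2) x y\<bar> \<le> r ^ (k + 2)"
        unfolding r_def by (rule rpow_bound) (use \<beta> xy in auto)
      moreover have "t ^ (k + 2) \<le> t ^ 2" using t by (intro power_decreasing) auto
      ultimately have "t ^ (k + 2) * \<bar>rpow S D (k + 2) x y\<bar> \<le> t\<^sup>2 * r ^ (k + 2)"
        using t by (intro mult_mono) auto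
      moreover have "rpow S (\<lambda>v w. - t * D v w) (k + 2) x y \<le> t ^ (k + 2) * \<bar>rpow S D (k + 2) x y\<bar>"
        unfolding rpow_scale using t abs_ge_self[of "(- t) ^ (k + 2) * rpow S D (k + 2) x y"]
        by (simp add: abs_mult power_abs)
      ultimately have "?a (k + 2) \<le> t\<^sup>2 * r ^ (k + 2) / fact (k + 2)"
        by (intro divide_right_mono) auto
      also have "\<dots> \<le> t\<^sup>2 * r ^ (k + 2) / fact k"
        using r0 by (intro divide_left_mono fact_mono) auto
      also have "\<dots> = t\<^sup>2 * r\<^sup>2 * (r ^ k / fact k)"
        by (simp add: power_add power2_eq_square)
      finally show ?thesis .
    qed
    have "(\<Sum>k. ?a (k + 2)) \<le> (\<Sum>k. t\<^sup>2 * r\<^sup>2 * (r ^ k / fact k))"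
      by (rule suminf_le[OF b]) (use a summable_ignore_initial_segment summable_mult[OF summable_exp_div] in blast)+
    also have "\<dots> = t\<^sup>2 * M"
      unfolding suminf_mult[OF summable_exp_div] suminf_exp_div by (simp add: M_def)
    finally show ?thesis .
  qed
  finally have "rsg S D t x y \<le> t * (t * M - D x y)"
    by (simp add: algebra_simps power2_eq_square)
  also have "\<dots> < 0" using t M0 by (intro mult_pos_neg) (auto simp: algebra_simps)
  finally show ?thesis using t by blast
qed

section \<open>Limits of matrix semigroups\<close>

lemma tendsto_rpow:
  assumes "finite S" "\<And>v w. v \<in> S \<Longrightarrow> w \<in> S \<Longrightarrow> (\<lambda>n. B n v w) \<longlonglongrightarrow> B0 v w" "v \<in> S" "w \<in> S"
  shows "(\<lambda>n. rpow S (B n) k v w) \<longlonglongrightarrow> rpow S B0 k v w"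
  using assms(3) by (induction k arbitrary: v) (auto intro!: tendsto_intros assms(2))

lemma tendsto_rexp:
  assumes S: "finite S" and lim: "\<And>v w. v \<in> S \<Longrightarrow> w \<in> S \<Longrightarrow> (\<lambda>n. B n v w) \<longlonglongrightarrow> B0 v w"
    and bnd: "\<And>n v w. v \<in> S \<Longrightarrow> w \<in> S \<Longrightarrow> \<bar>B n v w\<bar> \<le> \<beta>" and vw: "v \<in> S" "w \<in> S"
  shows "(\<lambda>n. rexp S (B n) v w) \<longlonglongrightarrow> rexp S B0 v w"
  unfolding rexp_def
proof -
  have "0 \<le> \<beta>" using bnd[OF vw] abs_ge_zero order_trans by blast
  have "\<forall>k n. norm (rpow S (B n) k v w / fact k) \<le> (real (card S) * \<beta>) ^ k / fact k"
  proof (intro allI)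
    fix k n
    have "\<bar>rpow S (B n) k v w\<bar> \<le> (real (card S) * \<beta>) ^ k"
      by (rule rpow_bound[OF bnd vw(1)])
    then show "norm (rpow S (B n) k v w / fact k) \<le> (real (card S) * \<beta>) ^ k / fact k"
      by (simp add: divide_right_mono)
  qed
  then have b: "\<forall>\<^sub>F (k, n) in at_top \<times>\<^sub>F sequentially. norm (rpow S (B n) k v w / fact k) \<le> (real (card S) * \<beta>) ^ k / fact k"
    by (intro always_eventually) auto
  have l: "(\<lambda>n. rpow S (B n) k v w / fact k) \<longlonglongrightarrow> rpow S B0 k v w / fact k" for k
    by (intro tendsto_intros tendsto_rpow[OF S lim vw]) simp_all
  show "(\<lambda>n. \<Sum>k. rpow S (B n) k v w / fact k) \<longlonglongrightarrow> (\<Sum>k. rpow S B0 k v w / fact k)"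
    using tannerys_theorem[OF l b summable_exp_div] by simp
qed

text \<open>Every \<open>t \<ge> 1\<close> is a positive integer times a number in
  \<open>{1..2}\<close>, and products of entrywise positive matrices are positive. Positivity for
  all large times is thus a matter of a compact interval.\<close>

lemma rsg_pos_all:
  assumes S: "finite S" "S \<noteq> {}" and pos: "\<And>t v w. 1 \<le> t \<Longrightarrow> t \<le> 2 \<Longrightarrow> v \<in> S \<Longrightarrow> w \<in> S \<Longrightarrow> 0 < rsg S D t v w"
    and t: "1 \<le> t" and vw: "v \<in> S" "w \<in> S"
  shows "0 < rsg S D t v w"
proof -
  have mult: "0 < rsg S D (real (Suc k) * s) v w" if "1 \<le> s" "s \<le> 2" "v \<in> S" "w \<in> S" for k s v w
    using that(3)
  proof (induction k arbitrary: v)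
    case 0
    then show ?case using pos that by simp
  next
    case (Suc k)
    have "rsg S D (real (Suc (Suc k)) * s) v w = (\<Sum>u\<in>S. rsg S D s v u * rsg S D (real (Suc k) * s) u w)"
      using rsg_add[OF S(1) Suc.prems, of D s "real (Suc k) * s" w] by (simp add: algebra_simps)
    also have "\<dots> > 0"
      by (rule sum_pos[OF S]) (use pos that Suc in \<open>auto intro!: mult_pos_pos\<close>)
    finally show ?case .
  qed
  define k where "k = nat \<lfloor>t\<rfloor>"
  have k: "1 \<le> k" "real k \<le> t" "t < real k + 1"
    using t by (auto simp: k_def le_nat_iff)
  then have "1 \<le> t / real k" "t / real k \<le> 2" by (auto simp: field_simps)
  moreover have "real (Suc (k - 1)) * (t / real k) = t" using k by simp
  ultimately show ?thesis using mult[of "t / real k" v w "k - 1"] vw by simp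
qed

text \<open>If positivity failed on \<open>{1..2}\<close> for infinitely many \<open>n\<close>, the
  failing times would accumulate at some \<open>l\<close>, where the limit semigroup would have an
  entry that is not positive. The starting time 1 is the same for all large
  \<open>n\<close>.\<close>

lemma eventually_strongly_positive_limit:
  assumes S: "finite S" "S \<noteq> {}" and lim: "\<And>v w. v \<in> S \<Longrightarrow> w \<in> S \<Longrightarrow> (\<lambda>n. D n v w) \<longlonglongrightarrow> D0 v w"
    and Z: "Zmatrix S D0" and irr: "irreducible_matrix S D0"
  shows "\<forall>\<^sub>F n in sequentially. \<forall>t\<ge>1. \<forall>v\<in>S. \<forall>w\<in>S. 0 < rsg S (D n) t v w"
proof -
  have "\<forall>\<^sub>F n in sequentially. \<forall>t\<in>{1..2}. 0 < rsg S (D n) t v w" if vw: "v \<in> S" "w \<in> S" for v w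
  proof (rule ccontr)
    assume "\<not> ?thesis"
    then have "\<exists>\<^sub>\<infinity>n. \<exists>t\<in>{1..2}. rsg S (D n) t v w \<le> 0"
      by (simp add: not_eventually frequently_cofinite[symmetric] cofinite_eq_sequentially not_less)
    then have inf: "infinite {n. \<exists>t\<in>{1..2}. rsg S (D n) t v w \<le> 0}"
      by (simp add: frequently_cofinite)
    define r where "r = enumerate {n. \<exists>t\<in>{1..2}. rsg S (D n) t v w \<le> 0}"
    have r: "strict_mono r" "\<And>n. \<exists>t\<in>{1..2}. rsg S (D (r n)) t v w \<le> 0"
      using strict_mono_enumerate[OF inf] enumerate_in_set[OF inf] by (auto simp: r_def)
    then obtain \<tau> where \<tau>: "\<And>n. \<tau> n \<in> {1..2}" "\<And>n. rsg S (D (r n)) (\<tau> n) v w \<le> 0" by metis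
    have "compact {1..2::real}" by simp
    then obtain l q where l: "l \<in> {1..2}" and q: "strict_mono q" and ql: "(\<tau> \<circ> q) \<longlonglongrightarrow> l"
      using \<tau>(1) unfolding compact_def by blast
    have lim2: "(\<lambda>n. - \<tau> (q n) * D (r (q n)) x y) \<longlonglongrightarrow> - l * D0 x y" if "x \<in> S" "y \<in> S" for x y
    proof -
      have "(\<lambda>n. D (r (q n)) x y) \<longlonglongrightarrow> D0 x y"
        using LIMSEQ_subseq_LIMSEQ[OF lim[OF that] strict_mono_o[OF r(1) q]] by (simp add: o_def)
      then show ?thesis using ql by (intro tendsto_intros) (simp_all add: o_def)
    qed
    have "\<exists>\<beta>. \<forall>n. \<forall>x\<in>S. \<forall>y\<in>S. \<bar>- \<tau> (q n) * D (r (q n)) x y\<bar> \<le> \<beta>"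
    proof -
      have "\<forall>p\<in>S \<times> S. \<exists>b. \<forall>n. \<bar>- \<tau> (q n) * D (r (q n)) (fst p) (snd p)\<bar> \<le> b"
      proof
        fix p assume p: "p \<in> S \<times> S"
        have "Bseq (\<lambda>n. - \<tau> (q n) * D (r (q n)) (fst p) (snd p))"
          by (rule convergent_imp_Bseq) (use lim2[of "fst p" "snd p"] p in \<open>auto simp: convergent_def\<close>)
        then show "\<exists>b. \<forall>n. \<bar>- \<tau> (q n) * D (r (q n)) (fst p) (snd p)\<bar> \<le> b"
          by (auto simp: Bseq_def)
      qed
      from bchoice[OF this] obtain b where b: "\<forall>p\<in>S \<times> S. \<forall>n. \<bar>- \<tau> (q n) * D (r (q n)) (fst p) (snd p)\<bar> \<le> b p" ..
      show ?thesis
      proof (intro exI[of _ "\<Sum>p\<in>S \<times> S. \<bar>b p\<bar>"] allI ballI)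
        fix n x y assume xy: "x \<in> S" "y \<in> S"
        then have "\<bar>- \<tau> (q n) * D (r (q n)) x y\<bar> \<le> b (x, y)" using b by fastforce
        also have "\<dots> \<le> \<bar>b (x, y)\<bar>" by simp
        also have "\<dots> \<le> (\<Sum>p\<in>S \<times> S. \<bar>b p\<bar>)"
          by (rule member_le_sum[of _ _ "\<lambda>p. \<bar>b p\<bar>"]) (use xy S in auto)
        finally show "\<bar>- \<tau> (q n) * D (r (q n)) x y\<bar> \<le> (\<Sum>p\<in>S \<times> S. \<bar>b p\<bar>)" .
      qed
    qed
    then obtain \<beta> where \<beta>: "\<And>n x y. x \<in> S \<Longrightarrow> y \<in> S \<Longrightarrow> \<bar>- \<tau> (q n) * D (r (q n)) x y\<bar> \<le> \<beta>" by blast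
    have "(\<lambda>n. rsg S (D (r (q n))) (\<tau> (q n)) v w) \<longlonglongrightarrow> rsg S D0 l v w"
      unfolding rsg_def by (rule tendsto_rexp[OF S(1) lim2 \<beta> vw])
    then have "rsg S D0 l v w \<le> 0"
      using \<tau>(2) by (intro tendsto_upperbound[of _ _ sequentially]) auto
    moreover have "0 < rsg S D0 l v w"
      by (rule Zmatrix_pos[OF S(1) Z irr _ vw]) (use l in auto)
    ultimately show False by simp
  qed
  then have "\<forall>\<^sub>F n in sequentially. \<forall>v\<in>S. \<forall>w\<in>S. \<forall>t\<in>{1..2}. 0 < rsg S (D n) t v w"
    using S(1) by (simp add: eventually_ball_finite)
  then show ?thesis
  proof eventually_elim
    case (elim n)
    show ?case
    proof (intro allI impI ballI)
      fix t v w assume t: "1 \<le> (t::real)" and vw: "v \<in> S" "w \<in> S"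
      show "0 < rsg S (D n) t v w"
      proof (rule rsg_pos_all[OF S _ t vw])
        fix t v w assume "1 \<le> (t::real)" "t \<le> 2" "v \<in> S" "w \<in> S"
        then show "0 < rsg S (D n) t v w" using elim by simp
      qed
    qed
  qed
qed

section \<open>Schur complements\<close>

context qgraph_locale
begin

definition nonsing :: "('v \<times> 'v \<Rightarrow> real) \<Rightarrow> ('v \<times> 'v \<Rightarrow> real) \<Rightarrow> bool" where
  "nonsing a b \<longleftrightarrow> (\<forall>x. (\<forall>u. u \<notin> Vi \<longrightarrow> x u = 0) \<longrightarrow> (\<forall>v\<in>Vi. net E a b x v = 0) \<longrightarrow> (\<forall>u\<in>Vi. x u = 0))"

definition harmonic :: "('v \<times> 'v \<Rightarrow> real) \<Rightarrow> ('v \<times> 'v \<Rightarrow> real) \<Rightarrow> 'v \<Rightarrow> ('v \<Rightarrow> real) \<Rightarrow> bool" where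
  "harmonic a b w y \<longleftrightarrow> (\<forall>v\<in>Vo. y v = (if v = w then 1 else 0)) \<and> (\<forall>v\<in>Vi. net E a b y v = 0)"

text \<open>The Schur complement of \<open>net E a b\<close> with respect to the inner vertices.\<close>

definition schur :: "('v \<times> 'v \<Rightarrow> real) \<Rightarrow> ('v \<times> 'v \<Rightarrow> real) \<Rightarrow> 'v \<Rightarrow> 'v \<Rightarrow> real" where
  "schur a b v w = net E a b (SOME y. harmonic a b w y) v"

lemma harmonic_ex:
  assumes "nonsing a b"
  shows "\<exists>y. harmonic a b w y"
proof -
  define d where "d u = (if u \<in> Vo \<and> u = w then 1 else 0 :: real)" for u
  have "\<exists>x. (\<forall>u. u \<notin> Vi \<longrightarrow> x u = 0) \<and> (\<forall>v\<in>Vi. net E a b x v = - net E a b d v)"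
  proof (rule lin_op_surj[OF finite_Vi finite_Vi refl lin_op_net])
    fix x assume "\<forall>u. u \<notin> Vi \<longrightarrow> x u = 0" "\<forall>v\<in>Vi. net E a b x v = 0"
    then show "\<forall>u\<in>Vi. x u = 0" using assms unfolding nonsing_def by blast
  qed
  then obtain x where x: "\<forall>u. u \<notin> Vi \<longrightarrow> x u = 0" "\<forall>v\<in>Vi. net E a b x v = - net E a b d v" by blast
  have "net E a b (\<lambda>u. x u + 1 * d u) v = net E a b x v + 1 * net E a b d v" for v
    by (rule lin_opD[OF lin_op_net])
  then have "harmonic a b w (\<lambda>u. x u + 1 * d u)"
    using x by (simp add: harmonic_def d_def)
  then show ?thesis by blast
qed

lemma net_cong:
  assumes "\<And>u. u \<in> V \<Longrightarrow> x u = y u" "v \<in> V"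
  shows "net E a b x v = net E a b y v"
  unfolding net_def using assms edge_V by (intro arg_cong2[of _ _ _ _ "(+)"] sum.cong) auto

lemma schur_eq:
  assumes ns: "nonsing a b" and y: "harmonic a b w y" and v: "v \<in> V"
  shows "schur a b v w = net E a b y v"
proof -
  define z where "z = (SOME y. harmonic a b w y)"
  have z: "harmonic a b w z" unfolding z_def by (rule someI_ex[OF harmonic_ex[OF ns]])
  define d where "d u = (if u \<in> V then y u + (-1) * z u else 0)" for u
  have net: "net E a b d v = net E a b y v + (-1) * net E a b z v" if "v \<in> V" for v
    using net_cong[of d "\<lambda>u. y u + (-1) * z u" v a b] that lin_opD[OF lin_op_net, of E a b y "-1" z v]
    by (simp add: d_def)
  have "\<forall>u. u \<notin> Vi \<longrightarrow> d u = 0" using y z by (auto simp: d_def harmonic_def)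
  moreover have "\<forall>v\<in>Vi. net E a b d v = 0" using y z net by (auto simp: harmonic_def)
  ultimately have "\<forall>u\<in>Vi. d u = 0" using ns unfolding nonsing_def by blast
  then have "d u = 0" for u using \<open>\<forall>u. u \<notin> Vi \<longrightarrow> d u = 0\<close> by blast
  then have "d = (\<lambda>u. 0)" by blast
  then have "net E a b d v = 0" by (simp add: net_def)
  then show ?thesis using net[OF v] by (simp add: schur_def flip: z_def)
qed

lemma harmonic_schur:
  assumes "nonsing a b"
  obtains y where "harmonic a b w y" "\<And>v. v \<in> V \<Longrightarrow> schur a b v w = net E a b y v"
  using harmonic_ex[OF assms, of w] schur_eq[OF assms] by blast

lemma net_scale: "net E (\<lambda>e. c * a e) (\<lambda>e. c * b e) x v = c * (net E a b x v :: real)"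
  by (simp add: net_def sum_distrib_left distrib_left right_diff_distrib mult.assoc)

lemma schur_scale:
  assumes "nonsing a b" "c \<noteq> 0"
  shows "nonsing (\<lambda>e. c * a e) (\<lambda>e. c * b e)"
    and "v \<in> V \<Longrightarrow> schur (\<lambda>e. c * a e) (\<lambda>e. c * b e) v w = c * schur a b v w"
proof -
  show ns: "nonsing (\<lambda>e. c * a e) (\<lambda>e. c * b e)"
    using assms unfolding nonsing_def net_scale by simp
  assume v: "v \<in> V"
  obtain y where y: "harmonic a b w y" "schur a b v w = net E a b y v"
    using harmonic_schur[OF assms(1), of w] v by metis
  have "harmonic (\<lambda>e. c * a e) (\<lambda>e. c * b e) w y"
    using y(1) by (simp add: harmonic_def net_scale)
  from schur_eq[OF ns this v] show "schur (\<lambda>e. c * a e) (\<lambda>e. c * b e) v w = c * schur a b v w"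
    by (simp add: net_scale y(2))
qed

text \<open>Weights are compared only up to a common factor \<open>c\<close>, which may be negative:
  besides \<open>\<omega>\<close>, the later choices include \<open>- \<omega>\<close> and
  \<open>\<omega> / p\<close>.\<close>

lemma dtn_schur:
  assumes r: "regular \<mu>" and w: "\<And>e. e \<in> E \<Longrightarrow> wa \<mu> e = c * a e" "\<And>e. e \<in> E \<Longrightarrow> wb \<mu> e = c * b e"
    and ns: "nonsing a b" and c: "c \<noteq> 0"
  shows "complex_of_real \<mu> \<notin> spectrum G Vo"
    and "v \<in> Vo \<Longrightarrow> w \<in> Vo \<Longrightarrow> dtn_matrix G Vo \<mu> v w = of_real (c * schur a b v w)"
proof -
  have net: "rnet \<mu> x v = c * net E a b x v" for x v
    unfolding net_scale[symmetric] unfolding net_def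
    by (intro arg_cong2[of _ _ _ _ "(+)"] sum.cong) (auto simp: w)
  have "nonsingular \<mu>"
    using ns c unfolding nonsingular_def nonsing_def net by simp
  then show \<mu>: "complex_of_real \<mu> \<notin> spectrum G Vo"
    by (rule regular_not_in_spectrum[OF r])
  assume vw: "v \<in> Vo" "w \<in> Vo"
  then have v: "v \<in> V" using Vo by blast
  obtain y where y: "harmonic a b w y" "schur a b v w = net E a b y v"
    using harmonic_schur[OF ns, of w] v by metis
  show "dtn_matrix G Vo \<mu> v w = of_real (c * schur a b v w)"
    unfolding y(2) net[symmetric]
    by (rule dtn_regular[OF \<mu> r]) (use y(1) in \<open>auto simp: harmonic_def net\<close>)
qed

section \<open>Positive definite inner blocks and the minimum principle\<close>

definition qf :: "('v \<times> 'v \<Rightarrow> real) \<Rightarrow> ('v \<times> 'v \<Rightarrow> real) \<Rightarrow> ('v \<Rightarrow> real) \<Rightarrow> ('v \<Rightarrow> real) \<Rightarrow> real" where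
  "qf a b y x = (\<Sum>e\<in>E. a e * (y (fst e) * x (fst e) + y (snd e) * x (snd e)) - b e * (y (fst e) * x (snd e) + y (snd e) * x (fst e)))"

lemma qf_net: "(\<Sum>v\<in>V. y v * net E a b x v) = qf a b y x"
  unfolding qf_def by (rule net_form[OF finite_V E_sub])

lemma qf_add: "qf a b y (\<lambda>u. x u + x' u) = qf a b y x + qf a b y x'"
  unfolding qf_def sum.distrib[symmetric] by (rule sum.cong) (auto simp: algebra_simps)

definition PD :: "('v \<times> 'v \<Rightarrow> real) \<Rightarrow> ('v \<times> 'v \<Rightarrow> real) \<Rightarrow> bool" where
  "PD a b \<longleftrightarrow> (\<forall>x. (\<forall>u. u \<notin> Vi \<longrightarrow> x u = 0) \<longrightarrow> (\<exists>u\<in>Vi. x u \<noteq> 0) \<longrightarrow> 0 < qf a b x x)"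

lemma PD_nonsing:
  assumes "PD a b"
  shows "nonsing a b"
  unfolding nonsing_def
proof (intro allI impI)
  fix x assume x: "\<forall>u. u \<notin> Vi \<longrightarrow> x u = 0" and n: "\<forall>v\<in>Vi. net E a b x v = 0"
  have "x v * net E a b x v = 0" for v using x n by (cases "v \<in> Vi") simp_all
  then have "qf a b x x = 0" unfolding qf_net[symmetric] by (intro sum.neutral ballI)
  then show "\<forall>u\<in>Vi. x u = 0" using assms x unfolding PD_def by (metis less_irrefl)
qed

text \<open>Test with the negative part \<open>g\<close> of \<open>y\<close>, which is supported on
  \<open>Vi\<close>, and put \<open>h = y - g\<close>. Then \<open>qf a b g y = 0\<close>, while
  \<open>qf a b g h\<close> is non-negative: the diagonal terms vanish because \<open>g\<close> and
  \<open>h\<close> have disjoint supports, and the others have a favourable sign by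
  \<open>b \<ge> 0\<close>. So \<open>qf a b g g \<le> 0\<close>, against \<open>PD\<close>.\<close>

lemma minimum_principle:
  assumes pd: "PD a b" and b: "\<And>e. e \<in> E \<Longrightarrow> 0 \<le> b e"
    and o: "\<And>v. v \<in> Vo \<Longrightarrow> 0 \<le> y v" and n: "\<And>v. v \<in> Vi \<Longrightarrow> net E a b y v = 0" and u: "u \<in> V"
  shows "0 \<le> y u"
proof (rule ccontr)
  assume neg: "\<not> 0 \<le> y u"
  define g where "g u = (if u \<in> V then min (y u) 0 else 0)" for u
  define h where "h u = y u - g u" for u
  have supp: "\<forall>u. u \<notin> Vi \<longrightarrow> g u = 0"
  proof (intro allI impI)
    fix u assume "u \<notin> Vi"
    then show "g u = 0" using o[of u] by (cases "u \<in> V") (simp_all add: g_def)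
  qed
  have "\<exists>u\<in>Vi. g u \<noteq> 0"
    using neg u o by (intro bexI[of _ u]) (auto simp: g_def)
  then have pos: "0 < qf a b g g" using pd supp unfolding PD_def by blast
  have "g v * net E a b y v = 0" for v using supp n by (cases "v \<in> Vi") simp_all
  then have "qf a b g y = 0" unfolding qf_net[symmetric] by (intro sum.neutral ballI)
  then have "0 = qf a b g y" by simp
  also have "\<dots> = qf a b g g + qf a b g h"
    using qf_add[of a b g g h] by (simp add: h_def)
  finally have "0 = qf a b g g + qf a b g h" .
  moreover have "0 \<le> qf a b g h"
    unfolding qf_def
  proof (rule sum_nonneg)
    fix e assume e: "e \<in> E"
    have gh: "g v * h v = 0" "g v \<le> 0" "0 \<le> h v" if "v \<in> V" for v
      using that by (auto simp: g_def h_def min_def)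
    have "g (fst e) * h (snd e) \<le> 0" "g (snd e) * h (fst e) \<le> 0"
      using gh edge_V[OF e] by (auto intro: mult_nonpos_nonneg)
    then have "b e * (g (fst e) * h (snd e) + g (snd e) * h (fst e)) \<le> 0"
      using b[OF e] by (intro mult_nonneg_nonpos) auto
    then show "0 \<le> a e * (g (fst e) * h (fst e) + g (snd e) * h (snd e)) - b e * (g (fst e) * h (snd e) + g (snd e) * h (fst e))"
      unfolding gh(1)[OF edge_V(1)[OF e]] gh(1)[OF edge_V(2)[OF e]] by simp
  qed
  ultimately show False using pos by simp
qed

lemma net_at_zero:
  fixes y :: "'v \<Rightarrow> real"
  assumes "y v = 0"
  shows "net E a b y v = - ((\<Sum>e\<in>{e\<in>E. fst e = v}. b e * y (snd e)) + (\<Sum>e\<in>{e\<in>E. snd e = v}. b e * y (fst e)))"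
  using assms by (simp add: net_def sum_negf)

text \<open>The harmonic extension of a unit vector is non-negative. At another outer vertex it is
  zero, so there \<open>net\<close> is minus a sum of non-negative terms.\<close>

lemma schur_Zmatrix:
  assumes pd: "PD a b" and b: "\<And>e. e \<in> E \<Longrightarrow> 0 \<le> b e"
  shows "Zmatrix Vo (schur a b)"
  unfolding Zmatrix_def
proof (intro ballI impI)
  fix v w assume vw: "v \<in> Vo" "w \<in> Vo" "v \<noteq> w"
  then have v: "v \<in> V" using Vo by blast
  obtain y where y: "harmonic a b w y" "schur a b v w = net E a b y v"
    using harmonic_schur[OF PD_nonsing[OF pd], of w] v by metis
  have y0: "0 \<le> y u" if "u \<in> V" for u
    by (rule minimum_principle[OF pd b _ _ that]) (use y(1) in \<open>auto simp: harmonic_def\<close>)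
  have "y v = 0" using y(1) vw by (simp add: harmonic_def)
  then show "schur a b v w \<le> 0"
    unfolding y(2) net_at_zero[of y v, OF \<open>y v = 0\<close>] neg_le_0_iff_le
    by (intro add_nonneg_nonneg sum_nonneg mult_nonneg_nonneg b y0 edge_V) simp_all
qed

text \<open>Suppose that no entry from outside \<open>T\<close> into \<open>T\<close> is negative.
  Summing the columns in \<open>T\<close>, the harmonic extension \<open>y\<close> of the indicator
  of \<open>T\<close> satisfies \<open>net E a b y v = 0\<close> at all vertices outside
  \<open>T\<close>. By \<open>b > 0\<close>, zeros of the non-negative \<open>y\<close> spread to
  all neighbours, so \<open>y\<close> is zero on the whole graph, although it is 1 on
  \<open>T\<close>.\<close>

lemma schur_irreducible:
  assumes pd: "PD a b" and b: "\<And>e. e \<in> E \<Longrightarrow> 0 < b e"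
  shows "irreducible_matrix Vo (schur a b)"
  unfolding irreducible_matrix_def
proof (intro allI impI)
  fix T assume T: "T \<subseteq> Vo" "T \<noteq> {}" "T \<noteq> Vo"
  have b': "0 \<le> b e" if "e \<in> E" for e using b[OF that] by simp
  have Z: "Zmatrix Vo (schur a b)" by (rule schur_Zmatrix[OF pd b'])
  show "\<exists>v\<in>Vo - T. \<exists>w\<in>T. schur a b v w < 0"
  proof (rule ccontr)
    assume *: "\<not> ?thesis"
    have fT: "finite T" using T(1) finite_Vo finite_subset by blast
    have "\<forall>w. \<exists>y. harmonic a b w y \<and> (\<forall>v\<in>V. schur a b v w = net E a b y v)"
      using harmonic_ex[OF PD_nonsing[OF pd]] schur_eq[OF PD_nonsing[OF pd]] by blast
    from choice[OF this] obtain Y where Y: "\<And>w. harmonic a b w (Y w)" "\<And>w v. v \<in> V \<Longrightarrow> schur a b v w = net E a b (Y w) v"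
      by blast
    define y where "y u = (\<Sum>w\<in>T. 1 * Y w u)" for u
    have net: "net E a b y v = (\<Sum>w\<in>T. net E a b (Y w) v)" for v
      unfolding y_def[abs_def] using lin_op_sum[OF lin_op_net fT, of E a b "\<lambda>_. 1" Y v] by simp
    have yo: "y v = (if v \<in> T then 1 else 0)" if "v \<in> Vo" for v
      unfolding y_def using Y(1) that fT by (simp add: harmonic_def)
    have ni: "net E a b y v = 0" if "v \<in> Vi" for v
      unfolding net using Y(1) that by (simp add: harmonic_def)
    have no: "net E a b y v = 0" if "v \<in> Vo - T" for v
    proof -
      have "schur a b v w = 0" if "w \<in> T" for w
      proof -
        have "v \<noteq> w" "v \<in> Vo" "w \<in> Vo" using \<open>v \<in> Vo - T\<close> that T(1) by auto
        then have "schur a b v w \<le> 0" using Z unfolding Zmatrix_def by simp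
        moreover have "\<not> schur a b v w < 0" using * \<open>v \<in> Vo - T\<close> that by blast
        ultimately show ?thesis by simp
      qed
      then show ?thesis unfolding net using Y(2)[of v] that Vo by (auto intro!: sum.neutral)
    qed
    have y0: "0 \<le> y u" if "u \<in> V" for u
      by (rule minimum_principle[OF pd b' _ ni that]) (use yo in auto)
    define Z where "Z = {u\<in>V. y u = 0}"
    have "Z = V"
    proof (rule connected_closed_set)
      show "Z \<subseteq> V" by (auto simp: Z_def)
      obtain v where "v \<in> Vo - T" using T by blast
      then have "v \<in> Z" using yo Vo by (auto simp: Z_def)
      then show "Z \<noteq> {}" by blast
      fix v w assume v: "v \<in> Z" and vw: "adj G v w"
      then have v0: "y v = 0" "v \<in> V" by (auto simp: Z_def)
      then have "v \<notin> T" using yo T(1) by auto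
      then have "net E a b y v = 0" using no ni v0 by blast
      then have s: "(\<Sum>e\<in>{e\<in>E. fst e = v}. b e * y (snd e)) + (\<Sum>e\<in>{e\<in>E. snd e = v}. b e * y (fst e)) = 0"
        unfolding net_at_zero[of y v, OF v0(1)] by simp
      have n1: "0 \<le> b e * y (snd e)" "0 \<le> b e * y (fst e)" if "e \<in> E" for e
        using b'[OF that] y0 edge_V[OF that] by auto
      have f: "finite {e\<in>E. fst e = v}" "finite {e\<in>E. snd e = v}" using finite_E by auto
      have "0 \<le> (\<Sum>e\<in>{e\<in>E. fst e = v}. b e * y (snd e))" "0 \<le> (\<Sum>e\<in>{e\<in>E. snd e = v}. b e * y (fst e))"
        using n1 by (auto intro!: sum_nonneg)
      then have z: "(\<Sum>e\<in>{e\<in>E. fst e = v}. b e * y (snd e)) = 0" "(\<Sum>e\<in>{e\<in>E. snd e = v}. b e * y (fst e)) = 0"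
        using s by linarith+
      have "y w = 0"
        using vw unfolding adj_def
      proof
        assume e: "(v, w) \<in> E"
        have "b (v, w) * y (snd (v, w)) = 0"
          by (rule sum_nonneg_0[OF f(1) _ z(1)]) (use n1 e in auto)
        then show ?thesis using b[OF e] by simp
      next
        assume e: "(w, v) \<in> E"
        have "b (w, v) * y (fst (w, v)) = 0"
          by (rule sum_nonneg_0[OF f(2) _ z(2)]) (use n1 e in auto)
        then show ?thesis using b[OF e] by simp
      qed
      then show "w \<in> Z" using adj_V[OF vw] by (simp add: Z_def)
    qed
    obtain w where w: "w \<in> T" using T by blast
    then have "w \<in> Vo" "w \<in> V" using T(1) Vo by auto
    then have "y w = 1" "w \<in> Z" using yo w \<open>Z = V\<close> by simp_all
    then show False by (simp add: Z_def)
  qed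
qed

lemma strongly_positiveI:
  assumes "\<And>v w. v \<in> Vo \<Longrightarrow> w \<in> Vo \<Longrightarrow> A v w = complex_of_real (c * D v w)" "0 < c"
    and Z: "Zmatrix Vo D" "irreducible_matrix Vo D"
  shows "sg_strongly_positive Vo A"
  unfolding sg_strongly_positive_def entries_pos_def
proof (intro allI impI ballI conjI)
  fix t :: real and v w assume t: "0 < t" and vw: "v \<in> Vo" "w \<in> Vo"
  have "mat_semigroup Vo A t v w = complex_of_real (rsg Vo (\<lambda>v w. c * D v w) t v w)"
    by (rule mat_semigroup_of_real[OF finite_Vo assms(1) vw(1)])
  also have "\<dots> = complex_of_real (rsg Vo D (c * t) v w)" by (simp add: rsg_scale)
  finally have e: "mat_semigroup Vo A t v w = complex_of_real (rsg Vo D (c * t) v w)" .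
  show "mat_semigroup Vo A t v w \<in> \<real>" "0 < Re (mat_semigroup Vo A t v w)"
    unfolding e using Zmatrix_pos[OF finite_Vo Z _ vw, of "c * t"] t assms(2) by auto
qed

lemma strongly_positive_weights:
  assumes "regular \<mu>" and "\<And>e. e \<in> E \<Longrightarrow> wa \<mu> e = c * a e" "\<And>e. e \<in> E \<Longrightarrow> wb \<mu> e = c * b e"
    and pd: "PD a b" and b: "\<And>e. e \<in> E \<Longrightarrow> 0 < b e" and c: "0 < c"
  shows "complex_of_real \<mu> \<notin> spectrum G Vo \<and> sg_strongly_positive Vo (dtn_matrix G Vo \<mu>)"
proof -
  have c0: "c \<noteq> 0" using c by simp
  note d = dtn_schur[OF assms(1-3) PD_nonsing[OF pd] c0]
  show ?thesis
  proof
    show "complex_of_real \<mu> \<notin> spectrum G Vo" by (rule d(1))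
    show "sg_strongly_positive Vo (dtn_matrix G Vo \<mu>)"
      by (rule strongly_positiveI[OF d(2) c schur_Zmatrix[OF pd less_imp_le[OF b]] schur_irreducible[OF pd b]])
  qed
qed

lemma not_eventually_positive_weights:
  assumes "regular \<mu>" and "\<And>e. e \<in> E \<Longrightarrow> wa \<mu> e = (- c) * a e" "\<And>e. e \<in> E \<Longrightarrow> wb \<mu> e = (- c) * b e"
    and pd: "PD a b" and b: "\<And>e. e \<in> E \<Longrightarrow> 0 < b e" and c: "0 < c" and card: "2 \<le> card Vo"
  shows "complex_of_real \<mu> \<notin> spectrum G Vo \<and> \<not> sg_eventually_positive Vo (dtn_matrix G Vo \<mu>)"
proof
  have c0: "- c \<noteq> 0" using c by simp
  note d = dtn_schur[OF assms(1-3) PD_nonsing[OF pd] c0]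
  show "complex_of_real \<mu> \<notin> spectrum G Vo" by (rule d(1))
  show "\<not> sg_eventually_positive Vo (dtn_matrix G Vo \<mu>)"
  proof
    assume "sg_eventually_positive Vo (dtn_matrix G Vo \<mu>)"
    then obtain t where t: "0 < t" and nn: "\<And>v w. v \<in> Vo \<Longrightarrow> w \<in> Vo \<Longrightarrow> 0 \<le> Re (mat_semigroup Vo (dtn_matrix G Vo \<mu>) t v w)"
      unfolding sg_eventually_positive_def entries_nonneg_def by blast
    have "Zmatrix Vo (schur a b)" by (rule schur_Zmatrix[OF pd less_imp_le[OF b]])
    from rsg_uminus_not_eventually_nonneg[OF finite_Vo this schur_irreducible[OF pd b] card, of "c * t"] t c
    obtain v w where vw: "v \<in> Vo" "w \<in> Vo" and neg: "rsg Vo (\<lambda>v w. - schur a b v w) (c * t) v w < 0"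
      by auto
    have "mat_semigroup Vo (dtn_matrix G Vo \<mu>) t v w = complex_of_real (rsg Vo (\<lambda>v w. (- c) * schur a b v w) t v w)"
      by (rule mat_semigroup_of_real[OF finite_Vo d(2) vw(1)])
    also have "\<dots> = complex_of_real (rsg Vo (\<lambda>v w. - schur a b v w) (c * t) v w)"
      using rsg_scale[of Vo c "\<lambda>v w. - schur a b v w" t] by simp
    finally show False using nn[OF vw] neg by simp
  qed
qed

end

section \<open>Positive definiteness below the first eigenvalue\<close>

definition usphere :: "'v set \<Rightarrow> ('v \<Rightarrow> real) set" where
  "usphere S = {x. (\<forall>u. u \<notin> S \<longrightarrow> x u = 0) \<and> (\<Sum>u\<in>S. (x u)\<^sup>2) = 1}"

lemma continuous_on_coordinate: "continuous_on A (\<lambda>x::'v \<Rightarrow> real. x u)"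
  by (rule continuous_on_subset[OF continuous_on_product_coordinates]) simp

text \<open>Tychonoff: the sphere is a closed part of a product of intervals \<open>{-1..1}\<close>
  over \<open>S\<close> and one-point sets elsewhere.\<close>

lemma compact_usphere:
  assumes "finite S"
  shows "compact (usphere S)"
proof -
  define K where "K = PiE UNIV (\<lambda>u. if u \<in> S then {-1..1} else {0::real})"
  have "compactin (product_topology (\<lambda>_. euclidean) UNIV) K"
    unfolding K_def compactin_PiE by auto
  then have "compact K"
    by (simp add: euclidean_product_topology)
  moreover have "closed {x::'a \<Rightarrow> real. (\<Sum>u\<in>S. (x u)\<^sup>2) = 1}"
    by (intro closed_Collect_eq continuous_intros continuous_on_coordinate)
  ultimately have "compact (K \<inter> {x. (\<Sum>u\<in>S. (x u)\<^sup>2) = 1})"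
    by (rule compact_Int_closed)
  moreover have "K \<inter> {x. (\<Sum>u\<in>S. (x u)\<^sup>2) = 1} = usphere S"
  proof (intro equalityI subsetI)
    fix x assume "x \<in> K \<inter> {x. (\<Sum>u\<in>S. (x u)\<^sup>2) = 1}"
    then show "x \<in> usphere S"
      unfolding K_def usphere_def PiE_UNIV_domain by (auto dest!: spec split: if_splits)
  next
    fix x assume x: "x \<in> usphere S"
    have "-1 \<le> x u \<and> x u \<le> 1" if "u \<in> S" for u
    proof -
      have "(x u)\<^sup>2 \<le> (\<Sum>u\<in>S. (x u)\<^sup>2)"
        by (rule member_le_sum[OF that _ assms]) auto
      then have "(x u)\<^sup>2 \<le> 1" using x by (simp add: usphere_def)
      then have "\<bar>x u\<bar> \<le> 1" by (simp add: abs_square_le_1)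
      then show ?thesis by auto
    qed
    then show "x \<in> K \<inter> {x. (\<Sum>u\<in>S. (x u)\<^sup>2) = 1}"
      using x unfolding K_def usphere_def by (auto simp: PiE_UNIV_domain)
  qed
  ultimately show ?thesis by simp
qed

lemma usphere_normalize:
  assumes "finite S" "\<forall>u. u \<notin> S \<longrightarrow> x u = 0" "u \<in> S" "x u \<noteq> 0"
  defines "s \<equiv> (\<Sum>u\<in>S. (x u)\<^sup>2)"
  shows "0 < s" "(\<lambda>u. x u / sqrt s) \<in> usphere S"
proof -
  have "(x u)\<^sup>2 \<le> s"
    unfolding s_def by (rule member_le_sum[OF assms(3) _ assms(1)]) auto
  moreover have "0 < (x u)\<^sup>2" using assms(4) by simp
  ultimately show s: "0 < s" by linarith
  have "(\<Sum>u\<in>S. (x u / sqrt s)\<^sup>2) = (\<Sum>u\<in>S. (x u)\<^sup>2) / s"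
    using s by (simp add: power_divide sum_divide_distrib)
  also have "\<dots> = 1" using s by (simp flip: s_def)
  finally show "(\<lambda>u. x u / sqrt s) \<in> usphere S"
    using assms(2) by (simp add: usphere_def)
qed

context qgraph_locale
begin

lemma qf_diff_form: "qf a b x x = (\<Sum>e\<in>E. b e * (x (fst e) - x (snd e))\<^sup>2 + (a e - b e) * ((x (fst e))\<^sup>2 + (x (snd e))\<^sup>2))"
  unfolding qf_def by (rule sum.cong) (auto simp: power2_eq_square algebra_simps)

text \<open>A quadratic form without kernel attains a positive minimum on the compact unit sphere.
  \<open>F\<close> will be all of \<open>E\<close> for small angles, and the set of edges inside the
  classes for contractions.\<close>

lemma coercive:
  assumes F: "F \<subseteq> E" and "\<And>x. \<forall>u. u \<notin> Vi \<longrightarrow> x u = (0::real) \<Longrightarrow> \<forall>e\<in>F. x (fst e) = x (snd e) \<Longrightarrow> \<forall>u\<in>Vi. x u = 0"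
  shows "\<exists>\<kappa>>0. \<forall>x :: 'v \<Rightarrow> real. (\<forall>u. u \<notin> Vi \<longrightarrow> x u = 0) \<longrightarrow> \<kappa> * (\<Sum>u\<in>Vi. (x u)\<^sup>2) \<le> (\<Sum>e\<in>F. (x (fst e) - x (snd e))\<^sup>2)"
proof (cases "usphere Vi = {}")
  case True
  have "x u = 0" if "\<forall>u. u \<notin> Vi \<longrightarrow> x u = (0::real)" "u \<in> Vi" for x u
    using usphere_normalize(2)[OF finite_Vi that] True by blast
  then have z: "(\<Sum>u\<in>Vi. (x u)\<^sup>2) = 0" if "\<forall>u. u \<notin> Vi \<longrightarrow> x u = (0::real)" for x
    using that by (intro sum.neutral) simp
  show ?thesis
  proof (intro exI[of _ 1] conjI allI impI)
    fix x :: "'v \<Rightarrow> real" assume "\<forall>u. u \<notin> Vi \<longrightarrow> x u = 0"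
    then show "1 * (\<Sum>u\<in>Vi. (x u)\<^sup>2) \<le> (\<Sum>e\<in>F. (x (fst e) - x (snd e))\<^sup>2)"
      by (simp only: z) (simp add: sum_nonneg)
  qed simp
next
  case False
  let ?q = "\<lambda>x :: 'v \<Rightarrow> real. \<Sum>e\<in>F. (x (fst e) - x (snd e))\<^sup>2"
  have fF: "finite F" using F finite_E finite_subset by blast
  have "continuous_on (usphere Vi) ?q"
    by (intro continuous_intros continuous_on_coordinate)
  then obtain x0 where x0: "x0 \<in> usphere Vi" "\<And>x. x \<in> usphere Vi \<Longrightarrow> ?q x0 \<le> ?q x"
    using continuous_attains_inf[OF compact_usphere[OF finite_Vi] False] by blast
  have "?q x0 \<noteq> 0"
  proof
    assume "?q x0 = 0"
    then have "\<forall>e\<in>F. (x0 (fst e) - x0 (snd e))\<^sup>2 = 0"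
      using sum_nonneg_eq_0_iff[OF fF, of "\<lambda>e. (x0 (fst e) - x0 (snd e))\<^sup>2"] by simp
    then have "\<forall>u\<in>Vi. x0 u = 0"
      using assms(2)[of x0] x0(1) by (simp add: usphere_def)
    then show False using x0(1) by (simp add: usphere_def)
  qed
  moreover have "0 \<le> ?q x0" by (intro sum_nonneg) auto
  ultimately have pos: "0 < ?q x0" by simp
  show ?thesis
  proof (intro exI[of _ "?q x0"] conjI allI impI pos)
    fix x assume x: "\<forall>u. u \<notin> Vi \<longrightarrow> x u = (0::real)"
    show "?q x0 * (\<Sum>u\<in>Vi. (x u)\<^sup>2) \<le> ?q x"
    proof (cases "\<exists>u\<in>Vi. x u \<noteq> 0")
      case True
      then obtain u where u: "u \<in> Vi" "x u \<noteq> 0" by blast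
      define s where "s = (\<Sum>u\<in>Vi. (x u)\<^sup>2)"
      have s: "0 < s" "(\<lambda>u. x u / sqrt s) \<in> usphere Vi"
        unfolding s_def using usphere_normalize[OF finite_Vi x u] by blast+
      have "?q x0 \<le> ?q (\<lambda>u. x u / sqrt s)" by (rule x0(2)[OF s(2)])
      also have "\<dots> = ?q x / s"
        using s(1) by (simp add: power_divide sum_divide_distrib flip: diff_divide_distrib)
      finally show ?thesis using s(1) by (simp add: pos_le_divide_eq flip: s_def)
    next
      case False
      then have "(\<Sum>u\<in>Vi. (x u)\<^sup>2) = 0" by simp
      then show ?thesis by (simp add: sum_nonneg)
    qed
  qed
qed

lemma constant_on_edges_zero:
  assumes "\<forall>u. u \<notin> Vi \<longrightarrow> x u = (0::real)" "\<forall>e\<in>E. x (fst e) = x (snd e)"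
  shows "\<forall>u\<in>Vi. x u = 0"
proof -
  have "{u\<in>V. x u = 0} = V"
  proof (rule connected_closed_set)
    show "{u\<in>V. x u = 0} \<noteq> {}" using assms(1) Vo by auto
    fix v w assume "v \<in> {u\<in>V. x u = 0}" "adj G v w"
    then show "w \<in> {u\<in>V. x u = 0}" using assms(2) adj_V unfolding adj_def by force
  qed auto
  then show ?thesis by blast
qed

lemma PD_of_le:
  assumes "\<And>e. e \<in> E \<Longrightarrow> 0 < b e" "\<And>e. e \<in> E \<Longrightarrow> b e \<le> a e"
  shows "PD a b"
  unfolding PD_def
proof (intro allI impI)
  fix x assume x: "\<forall>u. u \<notin> Vi \<longrightarrow> x u = (0::real)" and ne: "\<exists>u\<in>Vi. x u \<noteq> 0"
  have "\<exists>e\<in>E. x (fst e) \<noteq> x (snd e)" using constant_on_edges_zero[OF x] ne by blast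
  then obtain e where e: "e \<in> E" "x (fst e) \<noteq> x (snd e)" by blast
  show "0 < qf a b x x"
    unfolding qf_diff_form
  proof (rule sum_pos2[OF finite_E e(1)])
    have "0 < b e * (x (fst e) - x (snd e))\<^sup>2" using assms(1) e by simp
    moreover have "0 \<le> (a e - b e) * ((x (fst e))\<^sup>2 + (x (snd e))\<^sup>2)" using assms(2)[OF e(1)] by simp
    ultimately show "0 < b e * (x (fst e) - x (snd e))\<^sup>2 + (a e - b e) * ((x (fst e))\<^sup>2 + (x (snd e))\<^sup>2)" by linarith
    show "0 \<le> b e * (x (fst e) - x (snd e))\<^sup>2 + (a e - b e) * ((x (fst e))\<^sup>2 + (x (snd e))\<^sup>2)" if "e \<in> E" for e
      using assms(1)[OF that] assms(2)[OF that] by simp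
  qed
qed

lemma sum_endpoints_le:
  assumes "\<forall>u. u \<notin> Vi \<longrightarrow> x u = (0::real)"
  shows "(\<Sum>e\<in>E. (x (fst e))\<^sup>2 + (x (snd e))\<^sup>2) \<le> 2 * real (card E) * (\<Sum>u\<in>Vi. (x u)\<^sup>2)"
proof -
  have *: "(x v)\<^sup>2 \<le> (\<Sum>u\<in>Vi. (x u)\<^sup>2)" for v
    using assms member_le_sum[of v Vi "\<lambda>u. (x u)\<^sup>2"] finite_Vi
    by (cases "v \<in> Vi") (simp_all add: sum_nonneg)
  have "(\<Sum>e\<in>E. (x (fst e))\<^sup>2 + (x (snd e))\<^sup>2) \<le> (\<Sum>e\<in>E. 2 * (\<Sum>u\<in>Vi. (x u)\<^sup>2))"
    by (rule sum_mono) (use add_mono[OF * *] in simp)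
  then show ?thesis by (simp add: mult_ac)
qed

text \<open>For angles below \<open>\<delta>\<close> the weight \<open>1 / sin\<close> is at least
  1, and the difference of the two weights, \<open>- (1 - cos) / sin\<close>, is at least
  \<open>- \<delta>\<close>. The form is thus the coercive edge form up to a small multiple of the
  squared norm.\<close>

lemma PD_small_angles:
  "\<exists>\<delta>>0. \<delta> \<le> 1 \<and> (\<forall>\<theta>. (\<forall>e\<in>E. 0 < \<theta> e \<and> \<theta> e < \<delta>) \<longrightarrow> PD (\<lambda>e. cos (\<theta> e) / sin (\<theta> e)) (\<lambda>e. 1 / sin (\<theta> e)))"
proof -
  obtain \<kappa> where \<kappa>: "\<kappa> > 0" "\<And>x :: 'v \<Rightarrow> real. \<forall>u. u \<notin> Vi \<longrightarrow> x u = 0 \<Longrightarrow> \<kappa> * (\<Sum>u\<in>Vi. (x u)\<^sup>2) \<le> (\<Sum>e\<in>E. (x (fst e) - x (snd e))\<^sup>2)"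
    using coercive[OF subset_refl constant_on_edges_zero] by blast
  define n where "n = real (card E)"
  have n: "n > 0" using finite_E E_ne by (simp add: n_def card_gt_0_iff)
  \<comment> \<open>By \<open>sum_endpoints_le\<close> the loss is at most
    \<open>2 * n * \<delta>\<close> times the squared norm; the 4 leaves half of
    \<open>\<kappa>\<close>. The bound 1 keeps the angles below \<open>pi / 2\<close>.\<close>
  define \<delta> where "\<delta> = min 1 (\<kappa> / (4 * n))"
  have \<delta>: "0 < \<delta>" "\<delta> \<le> 1" using \<kappa>(1) n by (auto simp: \<delta>_def)
  have "\<delta> \<le> \<kappa> / (4 * n)" by (simp add: \<delta>_def)
  then have "\<delta> * (4 * n) \<le> \<kappa>" using n by (simp add: pos_le_divide_eq)
  moreover have "2 * n * \<delta> = \<delta> * (4 * n) / 2" by simp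
  ultimately have \<delta>n: "2 * n * \<delta> < \<kappa>" using \<kappa>(1) by linarith
  show ?thesis
  proof (intro exI[of _ \<delta>] conjI allI impI \<delta>)
    fix \<theta> assume \<theta>: "\<forall>e\<in>E. 0 < \<theta> e \<and> \<theta> e < \<delta>"
    have edge: "0 < sin (\<theta> e)" "1 \<le> 1 / sin (\<theta> e)" "- \<delta> \<le> cos (\<theta> e) / sin (\<theta> e) - 1 / sin (\<theta> e)" if "e \<in> E" for e
    proof -
      have t: "0 < \<theta> e" "\<theta> e < \<delta>" "\<theta> e < 1" using \<theta> that \<delta> by fastforce+
      have tp: "\<theta> e < pi / 2" using t pi_gt3 by simp
      show s: "0 < sin (\<theta> e)" using t tp by (intro sin_gt_zero) auto
      show "1 \<le> 1 / sin (\<theta> e)" using s by (simp add: pos_le_divide_eq)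
      have c: "0 < cos (\<theta> e)" using t tp by (intro cos_gt_zero) auto
      have "1 - cos (\<theta> e) \<le> (sin (\<theta> e))\<^sup>2"
      proof -
        have "cos (\<theta> e) * cos (\<theta> e) \<le> 1 * cos (\<theta> e)" using c by (intro mult_right_mono) auto
        then show ?thesis using sin_squared_eq[of "\<theta> e"] by (simp add: power2_eq_square)
      qed
      also have "\<dots> \<le> \<delta> * sin (\<theta> e)"
        using s sin_x_le_x[of "\<theta> e"] t by (simp add: power2_eq_square)
      finally show "- \<delta> \<le> cos (\<theta> e) / sin (\<theta> e) - 1 / sin (\<theta> e)"
        using s by (simp add: field_simps)
    qed
    show "PD (\<lambda>e. cos (\<theta> e) / sin (\<theta> e)) (\<lambda>e. 1 / sin (\<theta> e))"
      unfolding PD_def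
    proof (intro allI impI)
      fix x assume x: "\<forall>u. u \<notin> Vi \<longrightarrow> x u = (0::real)" and ne: "\<exists>u\<in>Vi. x u \<noteq> 0"
      let ?s = "\<Sum>u\<in>Vi. (x u)\<^sup>2"
      have s0: "0 < ?s" using ne usphere_normalize(1)[OF finite_Vi x] by blast
      have "0 < (\<kappa> - 2 * n * \<delta>) * ?s" using s0 \<delta>n by simp
      also have "\<dots> \<le> (\<Sum>e\<in>E. (x (fst e) - x (snd e))\<^sup>2) + (- \<delta>) * (\<Sum>e\<in>E. (x (fst e))\<^sup>2 + (x (snd e))\<^sup>2)"
      proof -
        have "\<delta> * (\<Sum>e\<in>E. (x (fst e))\<^sup>2 + (x (snd e))\<^sup>2) \<le> \<delta> * (2 * real (card E) * ?s)"
          by (rule mult_left_mono[OF sum_endpoints_le[OF x]]) (use \<delta>(1) in simp)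
        moreover have "(\<kappa> - 2 * n * \<delta>) * ?s = \<kappa> * ?s - \<delta> * (2 * real (card E) * ?s)"
          by (simp add: n_def algebra_simps)
        ultimately show ?thesis using \<kappa>(2)[OF x] by linarith
      qed
      also have "\<dots> = (\<Sum>e\<in>E. 1 * (x (fst e) - x (snd e))\<^sup>2 + (- \<delta>) * ((x (fst e))\<^sup>2 + (x (snd e))\<^sup>2))"
        unfolding sum_distrib_left mult_1_left sum.distrib[symmetric] ..
      also have "\<dots> \<le> qf (\<lambda>e. cos (\<theta> e) / sin (\<theta> e)) (\<lambda>e. 1 / sin (\<theta> e)) x x"
        unfolding qf_diff_form by (intro sum_mono add_mono mult_right_mono edge) auto
      finally show "0 < qf (\<lambda>e. cos (\<theta> e) / sin (\<theta> e)) (\<lambda>e. 1 / sin (\<theta> e)) x x" .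
    qed
  qed
qed

lemma weights_nonpos:
  assumes "\<mu> \<le> 0"
  shows "regular \<mu>" "PD (wa \<mu>) (wb \<mu>)" "e \<in> E \<Longrightarrow> 0 < wb \<mu> e"
proof -
  have s: "0 < sinm \<mu> (len G e)" if "e \<in> E" for e by (rule sinm_pos[OF assms len_pos[OF that]])
  then show "regular \<mu>" unfolding regular_def by force
  show b: "e \<in> E \<Longrightarrow> 0 < wb \<mu> e" for e using s by (simp add: wb_def)
  show "PD (wa \<mu>) (wb \<mu>)"
    by (rule PD_of_le[OF b]) (use s cosm_ge_1[OF assms] in \<open>auto simp: wa_def wb_def less_imp_le divide_right_mono\<close>)
qed

lemma nonpos_strongly_positive:
  assumes "\<mu> \<le> 0"
  shows "complex_of_real \<mu> \<notin> spectrum G Vo \<and> sg_strongly_positive Vo (dtn_matrix G Vo \<mu>)"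
  by (rule strongly_positive_weights[of \<mu> 1 "wa \<mu>" "wb \<mu>"]) (use weights_nonpos[OF assms] in auto)

lemma weights_square:
  assumes "0 < \<omega>"
  shows "wa (\<omega>\<^sup>2) e = \<omega> * (cos (\<omega> * len G e) / sin (\<omega> * len G e))" "wb (\<omega>\<^sup>2) e = \<omega> * (1 / sin (\<omega> * len G e))"
    and "regular (\<omega>\<^sup>2) \<longleftrightarrow> (\<forall>e\<in>E. sin (\<omega> * len G e) \<noteq> 0)"
  using assms by (simp_all add: wa_def wb_def regular_def sinm_def cosm_def)

abbreviation PDang :: "real \<Rightarrow> bool" where
  "PDang \<omega> \<equiv> PD (\<lambda>e. cos (\<omega> * len G e) / sin (\<omega> * len G e)) (\<lambda>e. 1 / sin (\<omega> * len G e))"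

text \<open>At the first frequency at which positive definiteness fails, the form is semidefinite with a non-trivial null vector.\<close>

lemma first_singular_frequency:
  assumes \<omega>: "0 < \<omega>" "\<And>e. e \<in> E \<Longrightarrow> \<omega> * len G e < pi" and npd: "\<not> PDang \<omega>"
  shows "\<exists>\<omega>'. 0 < \<omega>' \<and> \<omega>' \<le> \<omega> \<and> complex_of_real (\<omega>'\<^sup>2) \<in> spectrum G Vo"
proof -
  obtain \<delta> where \<delta>: "\<delta> > 0" "\<And>\<theta>. \<forall>e\<in>E. 0 < \<theta> e \<and> \<theta> e < \<delta> \<Longrightarrow> PD (\<lambda>e. cos (\<theta> e) / sin (\<theta> e)) (\<lambda>e. 1 / sin (\<theta> e))"
    using PD_small_angles by blast
  define M where "M = (\<Sum>e\<in>E. len G e)"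
  have lenM: "len G e \<le> M" if "e \<in> E" for e
    unfolding M_def by (rule member_le_sum[OF that _ finite_E]) (use len_pos in \<open>auto intro: less_imp_le\<close>)
  have M: "0 < M" using E_ne lenM len_pos by fastforce
  \<comment> \<open>A frequency at which all angles are below \<open>\<delta>\<close>. Starting
    there also keeps the interval away from 0, where the weights blow up.\<close>
  define \<omega>0 where "\<omega>0 = min \<omega> (\<delta> / (2 * M))"
  have \<omega>0: "0 < \<omega>0" "\<omega>0 \<le> \<omega>" using \<omega> \<delta> M by (auto simp: \<omega>0_def)
  have pd0: "PDang \<omega>0"
  proof (rule \<delta>(2), intro ballI conjI)
    fix e assume e: "e \<in> E"
    show "0 < \<omega>0 * len G e" using \<omega>0 len_pos[OF e] by simp
    have "\<omega>0 * len G e \<le> \<delta> / (2 * M) * M"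
      by (rule mult_mono) (use \<omega>0 lenM[OF e] len_pos[OF e] \<delta> M in \<open>auto simp: \<omega>0_def\<close>)
    also have "\<dots> < \<delta>" using M \<delta> by simp
    finally show "\<omega>0 * len G e < \<delta>" .
  qed
  define Q where "Q t x = qf (\<lambda>e. cos (t * len G e) / sin (t * len G e)) (\<lambda>e. 1 / sin (t * len G e)) x x" for t x
  have ne: "sin (t * len G e) > 0" if "t \<in> {\<omega>0..\<omega>}" "e \<in> E" for t e
  proof (rule sin_gt_zero)
    show "0 < t * len G e" using that \<omega>0 len_pos by auto
    have "t * len G e \<le> \<omega> * len G e" using that(1) less_imp_le[OF len_pos[OF that(2)]] by (intro mult_right_mono) auto
    then show "t * len G e < pi" using \<omega>(2)[OF that(2)] by linarith
  qed
  have cont: "continuous_on ({\<omega>0..\<omega>} \<times> usphere Vi) (\<lambda>p. Q (fst p) (snd p))"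
  proof -
    have "continuous_on ({\<omega>0..\<omega>} \<times> usphere Vi) (\<lambda>p. snd p u)" for u
      by (rule continuous_on_compose2[OF continuous_on_coordinate[of UNIV] continuous_on_snd[OF continuous_on_id]]) auto
    moreover have "sin (fst p * len G e) \<noteq> 0" if "p \<in> {\<omega>0..\<omega>} \<times> usphere Vi" "e \<in> E" for p e
      using ne[of "fst p" e] that by auto
    moreover have "continuous_on S (\<lambda>p. cos (fst p * L))" "continuous_on S (\<lambda>p. sin (fst p * L))"
      for S :: "(real \<times> ('v \<Rightarrow> real)) set" and L :: real
      by (rule continuous_on_compose2[of UNIV]; auto intro!: continuous_intros)+
    ultimately show ?thesis
      unfolding Q_def qf_def by (intro continuous_on_sum continuous_on_add continuous_on_diff continuous_on_mult continuous_on_divide continuous_on_const) blast+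
  qed
  \<comment> \<open>Pairs of a frequency and a unit vector on which the form is not positive.
    Compactness of \<open>C\<close> yields a pair of least frequency.\<close>
  define C where "C = {p \<in> {\<omega>0..\<omega>} \<times> usphere Vi. Q (fst p) (snd p) \<le> 0}"
  have cc: "compact ({\<omega>0..\<omega>} \<times> usphere Vi)"
    by (intro compact_Times compact_usphere finite_Vi) simp
  have "compact C"
  proof -
    have "closedin (top_of_set ({\<omega>0..\<omega>} \<times> usphere Vi)) ({\<omega>0..\<omega>} \<times> usphere Vi \<inter> (\<lambda>p. Q (fst p) (snd p)) -` {..0})"
      by (rule continuous_closedin_preimage[OF cont]) simp
    moreover have "({\<omega>0..\<omega>} \<times> usphere Vi \<inter> (\<lambda>p. Q (fst p) (snd p)) -` {..0}) = C"
      by (auto simp: C_def)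
    ultimately show ?thesis using closedin_compact[OF cc] by simp
  qed
  have Qscale: "Q t (\<lambda>u. x u / r) = Q t x / r\<^sup>2" for t x r
  proof -
    have "Q t (\<lambda>u. i * x u) = i\<^sup>2 * Q t x" for i
      unfolding Q_def qf_def sum_distrib_left
      by (rule sum.cong[OF refl]) (simp add: power2_eq_square algebra_simps)
    from this[of "1 / r"] show ?thesis by (simp add: power_divide)
  qed
  have "C \<noteq> {}"
  proof -
    obtain x u where x: "\<forall>u. u \<notin> Vi \<longrightarrow> x u = 0" "u \<in> Vi" "x u \<noteq> 0" "Q \<omega> x \<le> 0"
      using npd unfolding PD_def Q_def by (auto simp: not_less)
    let ?s = "\<Sum>u\<in>Vi. (x u)\<^sup>2"
    note s = usphere_normalize[OF finite_Vi x(1-3)]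
    have "Q \<omega> (\<lambda>u. x u / sqrt ?s) \<le> 0" unfolding Qscale using x(4) s(1) by (simp add: divide_le_0_iff)
    then have "(\<omega>, \<lambda>u. x u / sqrt ?s) \<in> C" using s(2) \<omega>0 by (simp add: C_def)
    then show ?thesis by blast
  qed
  then obtain p where p: "p \<in> C" "\<And>p'. p' \<in> C \<Longrightarrow> fst p \<le> fst p'"
    using continuous_attains_inf[OF \<open>compact C\<close> _ continuous_on_fst[OF continuous_on_id]] by blast
  obtain t x where tx: "p = (t, x)" by (cases p)
  have t: "t \<in> {\<omega>0..\<omega>}" and x: "x \<in> usphere Vi" and Qtx: "Q t x \<le> 0" using p(1) by (auto simp: C_def tx)
  have first: "0 < Q r y" if "r \<in> {\<omega>0..<t}" "y \<in> usphere Vi" for r y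
  proof (rule ccontr)
    assume "\<not> 0 < Q r y"
    then have "(r, y) \<in> C" using that t by (auto simp: C_def)
    from p(2)[OF this] show False using that by (simp add: tx)
  qed
  have xsupp: "\<forall>u. u \<notin> Vi \<longrightarrow> x u = 0" using x by (simp add: usphere_def)
  have xne: "\<exists>u\<in>Vi. x u \<noteq> 0"
  proof (rule ccontr)
    assume "\<not> ?thesis"
    then have "(\<Sum>u\<in>Vi. (x u)\<^sup>2) = 0" by simp
    then show False using x by (simp add: usphere_def)
  qed
  have "t \<noteq> \<omega>0"
    using pd0 xsupp xne Qtx unfolding PD_def Q_def by (auto simp: not_less[symmetric])
  then have t0: "\<omega>0 < t" using t by simp
  \<comment> \<open>The form is positive at all earlier frequencies in the interval, so by
    continuity it is non-negative at \<open>t\<close>. Together with \<open>Q t x \<le> 0\<close>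
    this makes \<open>x\<close> a minimiser.\<close>
  have psd1: "0 \<le> Q t y" if y: "y \<in> usphere Vi" for y
  proof (rule tendsto_lowerbound)
    have "continuous_on {\<omega>0..\<omega>} (\<lambda>r. Q r y)"
    proof -
      have "continuous_on {\<omega>0..\<omega>} (\<lambda>r. (r, y))"
        by (intro continuous_on_Pair continuous_on_id continuous_on_const)
      moreover have "(\<lambda>r. (r, y)) ` {\<omega>0..\<omega>} \<subseteq> {\<omega>0..\<omega>} \<times> usphere Vi" using y by auto
      ultimately show ?thesis using continuous_on_compose2[OF cont] by fastforce
    qed
    then have "continuous_on {\<omega>0..t} (\<lambda>r. Q r y)" by (rule continuous_on_subset) (use t in auto)
    then have "((\<lambda>r. Q r y) \<longlongrightarrow> Q t y) (at t within {\<omega>0..t})"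
      using t0 by (simp add: continuous_on_def)
    then show "((\<lambda>r. Q r y) \<longlongrightarrow> Q t y) (at_left t)"
      using at_within_Icc_at_left[OF t0] by simp
    show "\<forall>\<^sub>F r in at_left t. 0 \<le> Q r y"
      using eventually_at_left_real[OF t0] by eventually_elim (use first[OF _ y] in \<open>force intro: less_imp_le\<close>)
  qed simp
  have psd: "0 \<le> Q t y" if y: "\<forall>u. u \<notin> Vi \<longrightarrow> y u = 0" for y
  proof (cases "\<exists>u\<in>Vi. y u \<noteq> 0")
    case True
    then obtain u where u: "u \<in> Vi" "y u \<noteq> 0" by blast
    note s = usphere_normalize[OF finite_Vi y u]
    have "0 \<le> Q t (\<lambda>u. y u / sqrt (\<Sum>u\<in>Vi. (y u)\<^sup>2))" by (rule psd1[OF s(2)])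
    then show ?thesis unfolding Qscale using s(1) by (simp add: zero_le_divide_iff)
  next
    case False
    then have "y = (\<lambda>u. 0)" using y by blast
    then show ?thesis by (simp add: Q_def qf_def)
  qed
  define A where "A e = cos (t * len G e) / sin (t * len G e)" for e
  define B where "B e = 1 / sin (t * len G e)" for e
  have Q: "Q t y = qf A B y y" for y unfolding Q_def A_def[abs_def] B_def[abs_def] ..
  have "net E A B x v = 0" if v: "v \<in> Vi" for v
  proof -
    define d where "d u = (if u = v then 1 else 0 :: real)" for u
    define r where "r = net E A B x v"
    have qd: "qf A B d x = r"
    proof -
      have "qf A B d x = (\<Sum>u\<in>V. if u = v then net E A B x u else 0)"
        unfolding qf_net[symmetric] by (rule sum.cong) (auto simp: d_def)
      then show ?thesis using v finite_V by (simp add: r_def)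
    qed
    have sym: "qf A B x d = qf A B d x"
      unfolding qf_def by (rule sum.cong) (auto simp: algebra_simps)
    have expand: "Q t (\<lambda>u. x u + s * d u) = Q t x + s * (2 * r) + s\<^sup>2 * qf A B d d" for s
    proof -
      have "Q t (\<lambda>u. x u + s * d u) = qf A B x x + s * qf A B x d + s * qf A B d x + s\<^sup>2 * qf A B d d"
        unfolding Q qf_def sum_distrib_left sum.distrib[symmetric]
        by (rule sum.cong) (auto simp: algebra_simps power2_eq_square)
      then show ?thesis by (simp add: sym qd Q)
    qed
    have nonneg: "0 \<le> s * (2 * r) + s\<^sup>2 * qf A B d d" for s
    proof -
      have "\<forall>u. u \<notin> Vi \<longrightarrow> x u + s * d u = 0" using xsupp v by (auto simp: d_def)
      from psd[OF this] show ?thesis unfolding expand using Qtx by linarith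
    qed
    \<comment> \<open>The first variation \<open>r\<close> of the form at its minimiser
      \<open>x\<close> has to vanish: as \<open>K\<close> exceeds \<open>qf A B d d\<close>, the
      step \<open>s = - r / K\<close> would lower the form by at least
      \<open>r\<^sup>2 / K\<close>.\<close>
    define K where "K = \<bar>qf A B d d\<bar> + 1"
    have K: "K > 0" by (simp add: K_def)
    have "0 \<le> (- r / K) * (2 * r) + (- r / K)\<^sup>2 * qf A B d d" by (rule nonneg)
    also have "\<dots> \<le> (- r / K) * (2 * r) + (- r / K)\<^sup>2 * K"
      by (intro add_left_mono mult_left_mono) (auto simp: K_def)
    also have "\<dots> = - (r\<^sup>2 / K)" using K by (simp add: power2_eq_square field_simps)
    finally have "r\<^sup>2 / K \<le> 0" by simp
    then have "r\<^sup>2 \<le> 0" using K by (simp add: divide_le_0_iff)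
    then show ?thesis by (simp add: r_def)
  qed
  then have n: "rnet (t\<^sup>2) x v = 0" if "v \<in> Vi" for v
  proof -
    have "rnet (t\<^sup>2) x v = net E (\<lambda>e. t * A e) (\<lambda>e. t * B e) x v"
      using weights_square(1,2)[of t] t0 \<omega>0 by (simp add: A_def B_def fun_eq_iff net_def)
    then show ?thesis using \<open>v \<in> Vi \<Longrightarrow> net E A B x v = 0\<close>[OF that] by (simp add: net_scale)
  qed
  have reg: "regular (t\<^sup>2)"
    using weights_square(3)[of t] t0 \<omega>0 ne[OF t] by force
  obtain u where u: "u \<in> Vi" "x u \<noteq> 0" using xne by blast
  have "complex_of_real (t\<^sup>2) \<in> spectrum G Vo"
    by (rule singular_in_spectrum[OF reg _ n u]) (use xsupp in auto)
  then show ?thesis using t t0 \<omega>0 by (intro exI[of _ t]) simp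
qed

end

section \<open>A spectral point with angles at most \<open>pi\<close>, and the range below
  \<open>lambda1\<close>\<close>

lemma cot_le_inverse:
  assumes "0 < t" "t < pi"
  shows "cos t / sin t \<le> 1 / t"
proof -
  have "(\<lambda>t. sin t - t * cos t) 0 \<le> (\<lambda>t. sin t - t * cos t) t"
  proof (rule DERIV_nonneg_imp_nondecreasing[of 0 t "\<lambda>t. sin t - t * cos t"])
    fix x assume "0 \<le> x" "x \<le> t"
    then have "0 \<le> x * sin x" using assms by (intro mult_nonneg_nonneg sin_ge_zero) auto
    moreover have "((\<lambda>t. sin t - t * cos t) has_real_derivative x * sin x) (at x)"
      by (auto intro!: derivative_eq_intros)
    ultimately show "\<exists>y. ((\<lambda>t. sin t - t * cos t) has_real_derivative y) (at x) \<and> 0 \<le> y" by blast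
  qed (use assms in auto)
  then have "t * cos t \<le> sin t" by simp
  moreover have "0 < sin t" using assms by (intro sin_gt_zero)
  ultimately show ?thesis using assms by (simp add: field_simps)
qed

context qgraph_locale
begin

text \<open>Consider the longest edge \<open>em\<close>. If both of its endpoints are outer, its
  sine half wave is an eigenfunction. Otherwise, shortly before its angle reaches \<open>pi\<close>,
  its cotangent is so negative that the form is negative on the unit vector of an inner endpoint;
  positive definiteness has been lost, and \<open>first_singular_frequency\<close> supplies a
  smaller or equal frequency.\<close>

lemma spectrum_meets:
  "\<exists>\<mu>>0. (\<forall>e\<in>E. sqrt \<mu> * len G e \<le> pi) \<and> complex_of_real \<mu> \<in> spectrum G Vo"
proof -
  have "Max (len G ` E) \<in> len G ` E" using finite_E E_ne by simp
  then obtain em where em: "em \<in> E" "len G em = Max (len G ` E)" by auto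
  define L where "L = len G em"
  have L: "0 < L" unfolding L_def by (rule len_pos[OF em(1)])
  have le: "len G e \<le> L" if "e \<in> E" for e
    unfolding L_def em(2) using that finite_E by simp
  show ?thesis
  proof (cases "fst em \<in> Vo \<and> snd em \<in> Vo")
    case True
    have "sqrt ((pi / L)\<^sup>2) = pi / L" using L by simp
    then have "sqrt ((pi / L)\<^sup>2) * len G e \<le> pi" if "e \<in> E" for e
      using le[OF that] L by (simp only:) (simp add: field_simps)
    then show ?thesis
      using dirichlet_eigenvalue_in_spectrum[OF em(1)] True L
      by (intro exI[of _ "(pi / L)\<^sup>2"]) (auto simp: L_def)
  next
    case False
    then obtain v where v: "v \<in> Vi" "v = fst em \<or> v = snd em" using edge_V[OF em(1)] by blast
    \<comment> \<open>Upper bound for the sum of all cotangents, from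
      \<open>cot t \<le> 1 / t\<close> and the estimate \<open>\<omega> \<ge> pi / (2 * L)\<close>
      below.\<close>
    define R where "R = (\<Sum>e\<in>E. 2 * L / (pi * len G e))"
    have Rt: "0 \<le> 2 * L / (pi * len G e)" if "e \<in> E" for e using L len_pos[OF that] by simp
    have R: "0 \<le> R" unfolding R_def by (intro sum_nonneg Rt)
    \<comment> \<open>\<open>em\<close> gets the angle \<open>pi - \<epsilon>\<close>. From
      \<open>sin \<epsilon> \<le> \<epsilon>\<close> and \<open>cos \<epsilon> \<ge> 1 / 2\<close>
      its cotangent is at most \<open>- (R + 1)\<close>, which outweighs all other edges.\<close>
    define \<epsilon> where "\<epsilon> = min 1 (1 / (2 * (R + 1)))"
    have \<epsilon>: "0 < \<epsilon>" "\<epsilon> \<le> 1" "\<epsilon> \<le> 1 / (2 * (R + 1))" using R by (auto simp: \<epsilon>_def)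
    define \<omega> where "\<omega> = (pi - \<epsilon>) / L"
    have \<omega>L: "\<omega> * L = pi - \<epsilon>" using L by (simp add: \<omega>_def)
    have \<omega>: "0 < \<omega>" using \<epsilon> L pi_gt3 by (simp add: \<omega>_def)
    have lt: "\<omega> * len G e < pi" if "e \<in> E" for e
    proof -
      have "\<omega> * len G e \<le> \<omega> * L" using \<omega> le[OF that] by simp
      then show ?thesis using \<omega>L \<epsilon> by simp
    qed
    let ?cot = "\<lambda>e. cos (\<omega> * len G e) / sin (\<omega> * len G e)"
    have other: "?cot e \<le> 2 * L / (pi * len G e)" if "e \<in> E" for e
    proof -
      have p: "0 < \<omega> * len G e" using \<omega> len_pos[OF that] by simp
      have "?cot e \<le> 1 / (\<omega> * len G e)" by (rule cot_le_inverse[OF p lt[OF that]])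
      also have "\<dots> \<le> 1 / (pi / (2 * L) * len G e)"
      proof (rule divide_left_mono)
        have "pi / 2 \<le> pi - \<epsilon>" using \<epsilon>(2) pi_gt3 by simp
        then have "pi / (2 * L) \<le> \<omega>" using L by (simp add: \<omega>_def field_simps)
        then show "pi / (2 * L) * len G e \<le> \<omega> * len G e"
          by (rule mult_right_mono) (use len_pos[OF that] in simp)
        show "0 < \<omega> * len G e * (pi / (2 * L) * len G e)" using p L len_pos[OF that] by simp
      qed simp
      finally show ?thesis using L by simp
    qed
    have big: "?cot em \<le> - (R + 1)"
    proof -
      have s: "0 < sin \<epsilon>" using \<epsilon> pi_gt3 by (intro sin_gt_zero) auto
      have "sin \<epsilon> \<le> 1 / (2 * (R + 1))" using sin_x_le_x[of \<epsilon>] \<epsilon> by linarith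
      then have "(R + 1) * sin \<epsilon> \<le> 1 / 2" using R by (simp add: field_simps)
      also have "1 / 2 \<le> cos \<epsilon>"
        using cos_monotone_0_pi_le[of \<epsilon> "pi / 3"] \<epsilon> pi_gt3 by (simp add: cos_60)
      finally have "R + 1 \<le> cos \<epsilon> / sin \<epsilon>" using s by (simp add: pos_le_divide_eq)
      moreover have "?cot em = - (cos \<epsilon> / sin \<epsilon>)"
        using \<omega>L by (simp add: L_def)
      ultimately show ?thesis by simp
    qed
    define d where "d u = (if u = v then 1 else 0 :: real)" for u
    have "qf ?cot (\<lambda>e. 1 / sin (\<omega> * len G e)) d d = (\<Sum>e\<in>E. ?cot e * (d (fst e) + d (snd e)))"
      unfolding qf_def by (rule sum.cong[OF refl]) (use edge_ne in \<open>auto simp: d_def\<close>)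
    also have "\<dots> = ?cot em * (d (fst em) + d (snd em)) + (\<Sum>e\<in>E - {em}. ?cot e * (d (fst e) + d (snd e)))"
      by (rule sum.remove[OF finite_E em(1)])
    also have "\<dots> \<le> - (R + 1) + R"
    proof (rule add_mono)
      have "d (fst em) + d (snd em) = 1" using v edge_ne[OF em(1)] by (auto simp: d_def)
      then show "?cot em * (d (fst em) + d (snd em)) \<le> - (R + 1)" using big by simp
      have "(\<Sum>e\<in>E - {em}. ?cot e * (d (fst e) + d (snd e))) \<le> (\<Sum>e\<in>E - {em}. 2 * L / (pi * len G e))"
      proof (rule sum_mono)
        fix e assume e: "e \<in> E - {em}"
        then have "d (fst e) + d (snd e) = 0 \<or> d (fst e) + d (snd e) = 1" using edge_ne[of e] by (auto simp: d_def)
        then show "?cot e * (d (fst e) + d (snd e)) \<le> 2 * L / (pi * len G e)"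
        proof
          assume "d (fst e) + d (snd e) = 0"
          then show ?thesis using Rt e by simp
        next
          assume "d (fst e) + d (snd e) = 1"
          then show ?thesis using other[of e] e by simp
        qed
      qed
      also have "\<dots> \<le> R" unfolding R_def by (rule sum_mono2[OF finite_E]) (use Rt in auto)
      finally show "(\<Sum>e\<in>E - {em}. ?cot e * (d (fst e) + d (snd e))) \<le> R" .
    qed
    finally have neg: "qf ?cot (\<lambda>e. 1 / sin (\<omega> * len G e)) d d < 0" by simp
    have "\<not> PDang \<omega>"
    proof
      assume "PDang \<omega>"
      moreover have "\<forall>u. u \<notin> Vi \<longrightarrow> d u = 0" "\<exists>u\<in>Vi. d u \<noteq> 0" using v(1) by (auto simp: d_def)
      ultimately have "0 < qf ?cot (\<lambda>e. 1 / sin (\<omega> * len G e)) d d" unfolding PD_def by blast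
      then show False using neg by simp
    qed
    from first_singular_frequency[OF \<omega> lt this] obtain \<omega>' where \<omega>': "0 < \<omega>'" "\<omega>' \<le> \<omega>" "complex_of_real (\<omega>'\<^sup>2) \<in> spectrum G Vo" by blast
    have "sqrt (\<omega>'\<^sup>2) * len G e \<le> pi" if "e \<in> E" for e
    proof -
      have "\<omega>' * len G e \<le> \<omega> * len G e" using \<omega>'(2) len_pos[OF that] by simp
      then show ?thesis using lt[OF that] \<omega>'(1) by simp
    qed
    then show ?thesis using \<omega>' by (intro exI[of _ "\<omega>'\<^sup>2"]) auto
  qed
qed

text \<open>The point from \<open>spectrum_meets\<close> bounds \<open>lambda1\<close> from above,
  so all angles lie in \<open>(0, pi)\<close> and the off-diagonal weights are negative. A failure
  of positive definiteness would produce a spectral point not exceeding \<open>\<mu>\<close>. The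
  infimum is usable because no \<open>\<mu> \<le> 0\<close> is in the spectrum, up to the harmless
  value 0 as lower bound.\<close>

lemma strongly_positive_below_lambda1:
  assumes "\<mu> < lambda1 G Vo"
  shows "sg_strongly_positive Vo (dtn_matrix G Vo \<mu>)"
proof (cases "\<mu> \<le> 0")
  case True
  then show ?thesis using nonpos_strongly_positive by blast
next
  case False
  have "0 \<le> \<nu>" if "complex_of_real \<nu> \<in> spectrum G Vo" for \<nu>
    using nonpos_strongly_positive[of \<nu>] that by force
  then have bdd: "bdd_below {\<nu>. complex_of_real \<nu> \<in> spectrum G Vo}" by (intro bdd_belowI[of _ 0]) auto
  have lower: "lambda1 G Vo \<le> \<nu>" if "complex_of_real \<nu> \<in> spectrum G Vo" for \<nu>
    unfolding lambda1_def by (rule cInf_lower[OF _ bdd]) (use that in simp)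
  obtain \<mu>1 where \<mu>1: "0 < \<mu>1" "\<forall>e\<in>E. sqrt \<mu>1 * len G e \<le> pi" "complex_of_real \<mu>1 \<in> spectrum G Vo"
    using spectrum_meets by blast
  define \<omega> where "\<omega> = sqrt \<mu>"
  have \<omega>: "0 < \<omega>" "\<mu> = \<omega>\<^sup>2" using False by (simp_all add: \<omega>_def)
  have "\<omega> < sqrt \<mu>1" using lower[OF \<mu>1(3)] assms by (simp add: \<omega>_def)
  then have lt: "\<omega> * len G e < pi" if "e \<in> E" for e
    using \<mu>1(2) that mult_strict_right_mono[OF _ len_pos[OF that], of \<omega> "sqrt \<mu>1"] by force
  have sp: "0 < sin (\<omega> * len G e)" if "e \<in> E" for e
    using \<omega>(1) len_pos[OF that] lt[OF that] by (intro sin_gt_zero) auto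
  have "PDang \<omega>"
  proof (rule ccontr)
    assume "\<not> PDang \<omega>"
    from first_singular_frequency[OF \<omega>(1) lt this] obtain \<omega>' where \<omega>': "0 < \<omega>'" "\<omega>' \<le> \<omega>" "complex_of_real (\<omega>'\<^sup>2) \<in> spectrum G Vo" by blast
    have "\<omega>'\<^sup>2 \<le> \<omega>\<^sup>2" using \<omega>' by (intro power_mono) auto
    then show False using lower[OF \<omega>'(3)] assms \<omega>(2) by simp
  qed
  moreover have "regular \<mu>" unfolding \<omega>(2) weights_square(3)[OF \<omega>(1)] using sp by force
  ultimately show ?thesis
    using strongly_positive_weights[of \<mu> \<omega> "\<lambda>e. cos (\<omega> * len G e) / sin (\<omega> * len G e)" "\<lambda>e. 1 / sin (\<omega> * len G e)"]
      weights_square(1,2)[OF \<omega>(1)] sp \<omega> by simp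
qed

end

section \<open>Sign patterns on trees\<close>

lemma is_path_mono:
  assumes "is_path R p" "\<And>a b. R a b \<Longrightarrow> R' a b"
  shows "is_path R' p"
  using assms unfolding is_path_def by (blast intro: successively_mono)

lemma is_path_subset:
  assumes "is_path R p" "hd p \<in> V" "\<And>a b. R a b \<Longrightarrow> b \<in> V"
  shows "set p \<subseteq> V"
proof -
  have "successively R p \<Longrightarrow> hd p \<in> V \<Longrightarrow> set p \<subseteq> V"
  proof (induction p)
    case (Cons x p)
    then show ?case using assms(3) by (cases p) auto
  qed simp
  then show ?thesis using assms(1,2) by (simp add: is_path_def)
qed

text \<open>After deleting an edge \<open>x y\<close>, flip the signs on the component of \<open>y\<close> if necessary.\<close>

lemma forest_signature:
  assumes "finite {(v, w). R v w}" "\<And>v w. R v w \<Longrightarrow> R w v" "\<And>v w. R v w \<Longrightarrow> v \<in> V \<and> w \<in> V \<and> v \<noteq> w"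
    and "\<not> has_cycle V R" "\<And>v w. R v w \<Longrightarrow> s v w = s w v" "\<And>v w. s v w = 1 \<or> s v w = (-1::real)"
  shows "\<exists>\<sigma>. (\<forall>v. \<sigma> v = 1 \<or> \<sigma> v = (-1::real)) \<and> (\<forall>v w. R v w \<longrightarrow> \<sigma> v * \<sigma> w = s v w)"
  using assms(1-5)
proof (induction "card {(v, w). R v w}" arbitrary: R rule: less_induct)
  case less
  note sym = less.prems(2) and inV = less.prems(3) and acyc = less.prems(4) and ssym = less.prems(5)
  show ?case
  proof (cases "\<exists>x y. R x y")
    case False
    then show ?thesis by (intro exI[of _ "\<lambda>v. 1"]) auto
  next
    case True
    then obtain x y where xy: "R x y" by blast
    define R' where "R' a b \<longleftrightarrow> R a b \<and> {a, b} \<noteq> {x, y}" for a b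
    have sub: "R' a b \<Longrightarrow> R a b" for a b by (simp add: R'_def)
    have psub: "{(v, w). R' v w} \<subset> {(v, w). R v w}" using xy by (auto simp: R'_def)
    have sym': "R' v w \<Longrightarrow> R' w v" for v w using sym by (auto simp: R'_def)
    have "\<not> has_cycle V R'"
    proof
      assume "has_cycle V R'"
      then obtain p where p: "3 \<le> length p" "set p \<subseteq> V" "is_path R' p" "R' (last p) (hd p)"
        unfolding has_cycle_def by blast
      have "is_path R p" by (rule is_path_mono[OF p(3)]) (rule sub)
      then show False
        using acyc p sub[OF p(4)] unfolding has_cycle_def by blast
    qed
    then have "\<exists>\<sigma>. (\<forall>v. \<sigma> v = 1 \<or> \<sigma> v = (-1::real)) \<and> (\<forall>v w. R' v w \<longrightarrow> \<sigma> v * \<sigma> w = s v w)"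
      using inV[OF sub] ssym[OF sub] sym'
      by (intro less.hyps psubset_card_mono[OF less.prems(1) psub] finite_subset[OF psubset_imp_subset[OF psub] less.prems(1)])
    then obtain \<sigma> where \<sigma>: "\<And>v. \<sigma> v = 1 \<or> \<sigma> v = (-1::real)" "\<And>v w. R' v w \<Longrightarrow> \<sigma> v * \<sigma> w = s v w"
      by blast
    define C where "C = {z. R'\<^sup>*\<^sup>* y z}"
    \<comment> \<open>A path from \<open>y\<close> to \<open>x\<close> in the remaining graph closes
      up with the deleted edge. It has at least three vertices, since the deleted edge itself is no
      longer available.\<close>
    have "x \<notin> C"
    proof
      assume "x \<in> C"
      then obtain p where p: "is_path R' p" "hd p = y" "last p = x"
        using rtranclp_path[of R' y x] by (auto simp: C_def)
      have "y \<noteq> x" using inV[OF xy] by blast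
      then obtain a q where pq: "p = y # a # q"
        using p by (cases p; cases "tl p") (auto simp: is_path_def)
      have "q \<noteq> []"
        using p pq by (auto simp: is_path_def R'_def)
      then have "3 \<le> length p" using pq by (cases q) auto
      moreover have "set p \<subseteq> V"
        by (rule is_path_subset[OF p(1)]) (use p inV sub xy in blast)+
      moreover have "is_path R p" by (rule is_path_mono[OF p(1)]) (rule sub)
      ultimately have "has_cycle V R"
        unfolding has_cycle_def using p(2,3) xy by blast
      then show False using acyc by blast
    qed
    have yC: "y \<in> C" by (simp add: C_def)
    have Ciff: "v \<in> C \<longleftrightarrow> w \<in> C" if "R' v w" for v w
      using that sym'[OF that] unfolding C_def by (auto intro: rtranclp.rtrancl_into_rtrancl)
    show ?thesis
    proof (cases "\<sigma> x * \<sigma> y = s x y")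
      case True
      have "\<sigma> v * \<sigma> w = s v w" if "R v w" for v w
      proof (cases "{v, w} = {x, y}")
        case True
        then show ?thesis using \<open>\<sigma> x * \<sigma> y = s x y\<close> ssym[OF xy] by (auto simp: doubleton_eq_iff mult.commute)
      next
        case False
        then show ?thesis using \<sigma>(2) that by (simp add: R'_def)
      qed
      then show ?thesis using \<sigma>(1) by blast
    next
      case False
      define \<tau> where "\<tau> z = (if z \<in> C then - \<sigma> z else \<sigma> z)" for z
      have t1: "\<tau> v = 1 \<or> \<tau> v = -1" for v using \<sigma>(1)[of v] by (auto simp: \<tau>_def)
      have txy: "\<tau> x * \<tau> y = s x y"
        using False \<sigma>(1)[of x] \<sigma>(1)[of y] assms(6)[of x y] \<open>x \<notin> C\<close> yC by (auto simp: \<tau>_def)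
      have "\<tau> v * \<tau> w = s v w" if "R v w" for v w
      proof (cases "{v, w} = {x, y}")
        case True
        then show ?thesis using txy ssym[OF xy] by (auto simp: doubleton_eq_iff mult.commute)
      next
        case False
        then have "R' v w" using that by (simp add: R'_def)
        then show ?thesis using \<sigma>(2) Ciff by (simp add: \<tau>_def)
      qed
      then show ?thesis using t1 by blast
    qed
  qed
qed

context qgraph_locale
begin

lemma reduced_adj_sym: "reduced_adj G Vo v w \<Longrightarrow> reduced_adj G Vo w v"
proof -
  assume r: "reduced_adj G Vo v w"
  have "\<exists>q. q \<noteq> [] \<and> set q \<subseteq> Vi \<and> is_path (adj G) (w # q @ [v])"
    if p: "p \<noteq> []" "set p \<subseteq> Vi" "is_path (adj G) (v # p @ [w])" for p
  proof (intro exI[of _ "rev p"] conjI)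
    have "is_path (adj G) (rev (v # p @ [w]))"
      using p(3) adj_sym unfolding is_path_def successively_rev by (auto intro: successively_mono)
    then show "is_path (adj G) (w # rev p @ [v])" by simp
  qed (use p in auto)
  then show ?thesis using r adj_sym unfolding reduced_adj_def by blast
qed

text \<open>By \<open>forest_signature\<close> the off-diagonal entries become non-positive after
  conjugation with signs; entries off the reduced graph are zero by \<open>dtn_matrix_local\<close>.
  If all sign products are 1, the semigroup is positive. If
  \<open>\<sigma> v * \<sigma> w = -1\<close>, the entry at \<open>v\<close>, \<open>w\<close> is
  never positive.\<close>

lemma tree_alternative:
  assumes tree: "is_tree Vo (reduced_adj G Vo)" and \<mu>: "complex_of_real \<mu> \<notin> spectrum G Vo"
  shows "sg_positive Vo (dtn_matrix G Vo \<mu>) \<or> \<not> sg_eventually_strongly_positive Vo (dtn_matrix G Vo \<mu>)"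
proof -
  define D where "D v w = Re (dtn_matrix G Vo \<mu> v w)" for v w
  have D: "dtn_matrix G Vo \<mu> v w = complex_of_real (D v w)" for v w
    using dtn_matrix_real[OF \<mu>, of v w] by (simp add: D_def)
  define s where "s v w = (if D v w \<le> 0 then 1 else -1 :: real)" for v w
  have "\<exists>\<sigma>. (\<forall>v. \<sigma> v = 1 \<or> \<sigma> v = (-1::real)) \<and> (\<forall>v w. reduced_adj G Vo v w \<longrightarrow> \<sigma> v * \<sigma> w = s v w)"
  proof (rule forest_signature)
    show "finite {(v, w). reduced_adj G Vo v w}"
      by (rule finite_subset[of _ "Vo \<times> Vo"]) (use finite_Vo in \<open>auto simp: reduced_adj_def\<close>)
    show "\<not> has_cycle Vo (reduced_adj G Vo)" using tree by (simp add: is_tree_def)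
    fix v w
    show "s v w = 1 \<or> s v w = -1" by (simp add: s_def)
    assume r: "reduced_adj G Vo v w"
    then show "reduced_adj G Vo w v" by (rule reduced_adj_sym)
    show "v \<in> Vo \<and> w \<in> Vo \<and> v \<noteq> w" using r by (simp add: reduced_adj_def)
    then show "s v w = s w v" using dtn_matrix_sym[OF \<mu>, of v w] by (simp add: s_def D_def)
  qed
  then obtain \<sigma> where \<sigma>: "\<And>v. \<sigma> v = 1 \<or> \<sigma> v = (-1::real)" "\<And>v w. reduced_adj G Vo v w \<Longrightarrow> \<sigma> v * \<sigma> w = s v w" by blast
  have sq: "\<sigma> v * \<sigma> v = 1" for v using \<sigma>(1)[of v] by auto
  have Z: "Zmatrix Vo (\<lambda>v w. \<sigma> v * \<sigma> w * D v w)"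
    unfolding Zmatrix_def
  proof (intro ballI impI)
    fix v w assume vw: "v \<in> Vo" "w \<in> Vo" "v \<noteq> w"
    show "\<sigma> v * \<sigma> w * D v w \<le> 0"
    proof (cases "reduced_adj G Vo v w")
      case True
      then show ?thesis by (simp add: \<sigma>(2) s_def)
    next
      case False
      then show ?thesis using dtn_matrix_local[OF \<mu> vw] by (simp add: D_def)
    qed
  qed
  have sg: "rsg Vo D t v w = \<sigma> v * \<sigma> w * rsg Vo (\<lambda>v w. \<sigma> v * \<sigma> w * D v w) t v w" if "v \<in> Vo" "w \<in> Vo" for t v w
  proof -
    have "rsg Vo (\<lambda>v w. \<sigma> v * \<sigma> w * D v w) t v w = \<sigma> v * \<sigma> w * rsg Vo D t v w"
      by (rule rsg_signature[OF finite_Vo sq that])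
    then have "\<sigma> v * \<sigma> w * rsg Vo (\<lambda>v w. \<sigma> v * \<sigma> w * D v w) t v w = (\<sigma> v * \<sigma> v) * (\<sigma> w * \<sigma> w) * rsg Vo D t v w"
      by (simp add: mult_ac)
    then show ?thesis by (simp only: sq mult_1_left)
  qed
  have m: "mat_semigroup Vo (dtn_matrix G Vo \<mu>) t v w = complex_of_real (rsg Vo D t v w)" if "v \<in> Vo" for t v w
    by (rule mat_semigroup_of_real[OF finite_Vo D that])
  show ?thesis
  proof (cases "\<forall>v\<in>Vo. \<forall>w\<in>Vo. \<sigma> v * \<sigma> w = 1")
    case True
    have "sg_positive Vo (dtn_matrix G Vo \<mu>)"
      unfolding sg_positive_def entries_nonneg_def
      using Zmatrix_nonneg[OF finite_Vo Z] True by (simp add: m sg)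
    then show ?thesis by blast
  next
    case False
    then obtain v w where vw: "v \<in> Vo" "w \<in> Vo" "\<sigma> v * \<sigma> w \<noteq> 1" by blast
    then have neg: "\<sigma> v * \<sigma> w = -1" using \<sigma>(1)[of v] \<sigma>(1)[of w] by auto
    have "\<not> sg_eventually_strongly_positive Vo (dtn_matrix G Vo \<mu>)"
    proof
      assume "sg_eventually_strongly_positive Vo (dtn_matrix G Vo \<mu>)"
      then obtain t where t: "0 < t" "entries_pos Vo (mat_semigroup Vo (dtn_matrix G Vo \<mu>) t)"
        unfolding sg_eventually_strongly_positive_def by blast
      then have "0 < rsg Vo D t v w" using vw by (simp add: entries_pos_def m)
      then have "rsg Vo (\<lambda>v w. \<sigma> v * \<sigma> w * D v w) t v w < 0"
        using sg[OF vw(1,2), of t] neg by simp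
      then show False using Zmatrix_nonneg[OF finite_Vo Z _ vw(1,2), of t] t(1) by simp
    qed
    then show ?thesis by blast
  qed
qed

section \<open>Rationally independent lengths: recurrence of prescribed angles\<close>

text \<open>Kronecker's theorem provides a real \<open>t\<close> of uncontrolled size and sign.
  Simultaneous Dirichlet approximation then adds a multiple \<open>q * K\<close> which hardly
  changes the angles modulo full turns and pushes the frequency beyond \<open>T\<close>.\<close>

lemma prescribed_angles:
  assumes ind: "lengths_independent G" and \<epsilon>: "0 < \<epsilon>"
  shows "\<exists>\<omega>>T. \<forall>e\<in>E. \<exists>m::int. \<bar>\<omega> * len G e - 2 * pi * of_int m - target e\<bar> < \<epsilon>"
proof -
  have indE: "\<forall>e\<in>E. c e = 0" if "(\<Sum>e\<in>E. of_rat (c e) * len G e) = 0" for c :: "'v \<times> 'v \<Rightarrow> rat"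
    using ind that unfolding lengths_independent_def by blast
  define \<Theta> where "\<Theta> e = len G e / (2 * pi)" for e
  have inj\<Theta>: "inj_on \<Theta> E"
  proof (rule inj_onI, rule ccontr)
    fix e e' assume e: "e \<in> E" "e' \<in> E" "\<Theta> e = \<Theta> e'" "e \<noteq> e'"
    define c :: "'v \<times> 'v \<Rightarrow> rat" where "c x = (if x = e then 1 else 0) - (if x = e' then 1 else 0)" for x
    have "(\<Sum>x\<in>E. of_rat (c x) * len G x) = (\<Sum>x\<in>E. (if x = e then len G x else 0) - (if x = e' then len G x else 0))"
      by (rule sum.cong) (auto simp: c_def)
    also have "\<dots> = len G e - len G e'" using e finite_E by (simp add: sum_subtractf)
    also have "\<dots> = 0" using e(3) by (simp add: \<Theta>_def)
    finally have "c e = 0" using indE e(1) by blast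
    then show False using e(4) by (simp add: c_def)
  qed
  interpret M: Modules.module "(\<lambda>r. (*) (real_of_int r))"
    by (simp add: Modules.module.intro distrib_left mult.commute)
  have indep: "M.independent (\<Theta> ` E)"
  proof
    assume "M.dependent (\<Theta> ` E)"
    then obtain t u where t: "finite t" "t \<subseteq> \<Theta> ` E" and z: "(\<Sum>x\<in>t. real_of_int (u x) * x) = 0" and nz: "\<exists>x\<in>t. u x \<noteq> 0"
      unfolding M.dependent_explicit by blast
    define c :: "'v \<times> 'v \<Rightarrow> rat" where "c e = (if \<Theta> e \<in> t then of_int (u (\<Theta> e)) else 0)" for e
    have "(\<Sum>e\<in>E. of_rat (c e) * len G e) = (\<Sum>e\<in>E. 2 * pi * (if \<Theta> e \<in> t then real_of_int (u (\<Theta> e)) * \<Theta> e else 0))"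
      by (rule sum.cong) (auto simp: c_def \<Theta>_def)
    also have "\<dots> = 2 * pi * (\<Sum>x\<in>\<Theta> ` E. (if x \<in> t then real_of_int (u x) * x else 0))"
      by (simp add: sum.reindex[OF inj\<Theta>] sum_distrib_left)
    also have "(\<Sum>x\<in>\<Theta> ` E. (if x \<in> t then real_of_int (u x) * x else 0)) = (\<Sum>x\<in>t. real_of_int (u x) * x)"
      using t finite_E by (simp add: sum.inter_restrict[symmetric] Int_absorb1)
    finally have c0: "\<forall>e\<in>E. c e = 0" using indE z by simp
    obtain x where x: "x \<in> t" "u x \<noteq> 0" using nz by blast
    then obtain e where e: "e \<in> E" "x = \<Theta> e" using t(2) by blast
    then have "c e = 0" using c0 by blast
    then show False using x e(2) by (simp add: c_def)
  qed
  define n where "n = card E"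
  obtain f where f: "bij_betw f {..<n} E"
    using ex_bij_betw_nat_finite[OF finite_E] by (auto simp: n_def atLeast0LessThan)
  define \<theta> where "\<theta> i = \<Theta> (f i)" for i
  have im: "\<theta> ` {..<n} = \<Theta> ` E" using f by (simp add: \<theta>_def bij_betw_def image_image[symmetric])
  have inj\<theta>: "inj_on \<theta> {..<n}"
    using f inj\<Theta> comp_inj_on[of f "{..<n}" \<Theta>] unfolding \<theta>_def bij_betw_def by (simp add: o_def)
  \<comment> \<open>Two errors of size \<open>\<eta>\<close>, one from each approximation, measured
    in full turns and hence multiplied by \<open>2 * pi\<close>.\<close>
  define \<eta> where "\<eta> = \<epsilon> / (4 * pi)"
  have \<eta>: "0 < \<eta>" using \<epsilon> by (simp add: \<eta>_def)
  obtain t h where th: "\<And>i. i < n \<Longrightarrow> \<bar>t * \<theta> i - of_int (h i) - target (f i) / (2 * pi)\<bar> < \<eta>"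
    using Kronecker_thm_1[of \<theta> n \<eta> "\<lambda>i. target (f i) / (2 * pi)"] indep inj\<theta> \<eta> unfolding im by metis
  \<comment> \<open>Large enough that \<open>t + K > T\<close>; since \<open>K\<close> is positive,
    the same holds for all its positive integer multiples.\<close>
  define K where "K = \<bar>T\<bar> + \<bar>t\<bar> + 1"
  obtain N :: nat where N: "1 / \<eta> < real N" using reals_Archimedean2 by blast
  then have "0 < real N" using \<eta> by (smt (verit) divide_pos_pos)
  then have N0: "N > 0" by simp
  have N1: "1 / real N < \<eta>" using N \<eta> \<open>0 < real N\<close> by (simp add: field_simps)
  obtain q p where q: "0 < q" and qp: "\<And>i. i < n \<Longrightarrow> \<bar>of_int q * (K * \<theta> i) - of_int (p i)\<bar> < 1 / N"
    using Dirichlet_approx_simult[OF N0, of n "\<lambda>i. K * \<theta> i"] by metis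
  define \<omega> where "\<omega> = t + of_int q * K"
  have "1 * K \<le> of_int q * K" by (rule mult_right_mono) (use q in \<open>auto simp: K_def\<close>)
  moreover have "T < t + K" unfolding K_def by linarith
  ultimately have "\<omega> > T" unfolding \<omega>_def by linarith
  moreover have "\<exists>m::int. \<bar>\<omega> * len G e - 2 * pi * of_int m - target e\<bar> < \<epsilon>" if e: "e \<in> E" for e
  proof -
    have "e \<in> f ` {..<n}" using bij_betw_imp_surj_on[OF f] e by simp
    then obtain i where i: "i < n" "f i = e" by auto
    have "\<bar>\<omega> * \<theta> i - of_int (h i + p i) - target e / (2 * pi)\<bar> \<le>
        \<bar>t * \<theta> i - of_int (h i) - target (f i) / (2 * pi)\<bar> + \<bar>of_int q * (K * \<theta> i) - of_int (p i)\<bar>"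
      unfolding \<omega>_def using i by (simp add: algebra_simps abs_triangle_ineq)
    also have "\<dots> < \<eta> + \<eta>" using th[OF i(1)] qp[OF i(1)] N1 by linarith
    finally have "\<bar>\<omega> * \<theta> i - of_int (h i + p i) - target e / (2 * pi)\<bar> < 2 * \<eta>" by simp
    then have "2 * pi * \<bar>\<omega> * \<theta> i - of_int (h i + p i) - target e / (2 * pi)\<bar> < 2 * pi * (2 * \<eta>)"
      by simp
    moreover have "2 * pi * \<bar>\<omega> * \<theta> i - of_int (h i + p i) - target e / (2 * pi)\<bar> =
        \<bar>2 * pi * (\<omega> * \<theta> i - of_int (h i + p i) - target e / (2 * pi))\<bar>"
      by (simp add: abs_mult)
    moreover have "2 * pi * (\<omega> * \<theta> i - of_int (h i + p i) - target e / (2 * pi)) = \<omega> * len G e - 2 * pi * of_int (h i + p i) - target e"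
      by (simp add: \<theta>_def i \<Theta>_def right_diff_distrib)
    ultimately have "\<bar>\<omega> * len G e - 2 * pi * of_int (h i + p i) - target e\<bar> < \<epsilon>"
      by (simp add: \<eta>_def)
    then show ?thesis by blast
  qed
  ultimately show ?thesis by blast
qed

lemma prescribed_angles_trig:
  assumes ind: "lengths_independent G" and \<epsilon>: "0 < \<epsilon>"
  shows "\<exists>\<omega> \<theta>. 0 < \<omega> \<and> \<mu>0 < \<omega>\<^sup>2 \<and> (\<forall>e\<in>E. \<bar>\<theta> e - target e\<bar> < \<epsilon> \<and> cos (\<omega> * len G e) = cos (\<theta> e) \<and> sin (\<omega> * len G e) = sin (\<theta> e))"
proof -
  obtain \<omega> where \<omega>: "\<bar>\<mu>0\<bar> + 1 < \<omega>" and "\<forall>e\<in>E. \<exists>m::int. \<bar>\<omega> * len G e - 2 * pi * of_int m - target e\<bar> < \<epsilon>"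
    using prescribed_angles[OF ind \<epsilon>] by blast
  from bchoice[OF this(2)] obtain m :: "'v \<times> 'v \<Rightarrow> int" where m: "\<forall>e\<in>E. \<bar>\<omega> * len G e - 2 * pi * of_int (m e) - target e\<bar> < \<epsilon>" ..
  have "\<omega> * 1 \<le> \<omega> * \<omega>" using \<omega> by (intro mult_left_mono) auto
  then have "\<mu>0 < \<omega>\<^sup>2" using \<omega> unfolding power2_eq_square by linarith
  moreover have "cos (x - 2 * pi * of_int k) = cos x" "sin (x - 2 * pi * of_int k) = sin x" for x and k :: int
    using cos_int_2pin[of k] sin_int_2pin[of k] by (simp_all add: cos_diff sin_diff)
  ultimately show ?thesis using \<omega> m
    by (intro exI[of _ \<omega>] exI[of _ "\<lambda>e. \<omega> * len G e - 2 * pi * of_int (m e)"]) auto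
qed

lemma strongly_positive_recurs:
  assumes ind: "lengths_independent G"
  shows "\<exists>\<mu>>\<mu>0. complex_of_real \<mu> \<notin> spectrum G Vo \<and> sg_strongly_positive Vo (dtn_matrix G Vo \<mu>)"
proof -
  obtain \<delta> where \<delta>: "\<delta> > 0" "\<delta> \<le> 1" and pd: "\<And>\<theta>. \<forall>e\<in>E. 0 < \<theta> e \<and> \<theta> e < \<delta> \<Longrightarrow> PD (\<lambda>e. cos (\<theta> e) / sin (\<theta> e)) (\<lambda>e. 1 / sin (\<theta> e))"
    using PD_small_angles by blast
  obtain \<omega> \<theta> where \<omega>: "0 < \<omega>" "\<mu>0 < \<omega>\<^sup>2" and \<theta>: "\<And>e. e \<in> E \<Longrightarrow> \<bar>\<theta> e - \<delta> / 2\<bar> < \<delta> / 2"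
    and trig: "\<And>e. e \<in> E \<Longrightarrow> cos (\<omega> * len G e) = cos (\<theta> e)" "\<And>e. e \<in> E \<Longrightarrow> sin (\<omega> * len G e) = sin (\<theta> e)"
    using prescribed_angles_trig[OF ind, of "\<delta> / 2" \<mu>0 "\<lambda>e. \<delta> / 2"] \<delta>(1) by auto
  have ang: "0 < \<theta> e" "\<theta> e < \<delta>" if "e \<in> E" for e using \<theta>[OF that] by linarith+
  have s: "0 < sin (\<theta> e)" if "e \<in> E" for e
    using ang[OF that] \<delta>(2) pi_gt3 by (intro sin_gt_zero) auto
  have "complex_of_real (\<omega>\<^sup>2) \<notin> spectrum G Vo \<and> sg_strongly_positive Vo (dtn_matrix G Vo (\<omega>\<^sup>2))"
  proof (rule strongly_positive_weights[OF _ _ _ pd])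
    show "regular (\<omega>\<^sup>2)" unfolding weights_square(3)[OF \<omega>(1)] using s trig by force
  qed (use weights_square(1,2)[OF \<omega>(1)] trig s ang \<omega>(1) in auto)
  then show ?thesis using \<omega>(2) by blast
qed

text \<open>Sine and cotangent are odd, so angles slightly below 0 give \<open>- \<omega>\<close>
  times the weights of the small positive angles \<open>- \<theta> e\<close>.\<close>

lemma not_eventually_positive_recurs:
  assumes ind: "lengths_independent G" and card: "2 \<le> card Vo"
  shows "\<exists>\<mu>>\<mu>0. complex_of_real \<mu> \<notin> spectrum G Vo \<and> \<not> sg_eventually_positive Vo (dtn_matrix G Vo \<mu>)"
proof -
  obtain \<delta> where \<delta>: "\<delta> > 0" "\<delta> \<le> 1" and pd: "\<And>\<theta>. \<forall>e\<in>E. 0 < \<theta> e \<and> \<theta> e < \<delta> \<Longrightarrow> PD (\<lambda>e. cos (\<theta> e) / sin (\<theta> e)) (\<lambda>e. 1 / sin (\<theta> e))"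
    using PD_small_angles by blast
  obtain \<omega> \<theta> where \<omega>: "0 < \<omega>" "\<mu>0 < \<omega>\<^sup>2" and \<theta>: "\<And>e. e \<in> E \<Longrightarrow> \<bar>\<theta> e - (- \<delta> / 2)\<bar> < \<delta> / 2"
    and trig: "\<And>e. e \<in> E \<Longrightarrow> cos (\<omega> * len G e) = cos (\<theta> e)" "\<And>e. e \<in> E \<Longrightarrow> sin (\<omega> * len G e) = sin (\<theta> e)"
    using prescribed_angles_trig[OF ind, of "\<delta> / 2" \<mu>0 "\<lambda>e. - \<delta> / 2"] \<delta>(1) by auto
  have ang: "0 < - \<theta> e" "- \<theta> e < \<delta>" if "e \<in> E" for e using \<theta>[OF that] by linarith+
  have s: "0 < sin (- \<theta> e)" if "e \<in> E" for e
    using ang[OF that] \<delta>(2) pi_gt3 by (intro sin_gt_zero) auto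
  have "complex_of_real (\<omega>\<^sup>2) \<notin> spectrum G Vo \<and> \<not> sg_eventually_positive Vo (dtn_matrix G Vo (\<omega>\<^sup>2))"
  proof (rule not_eventually_positive_weights[OF _ _ _ pd[of "\<lambda>e. - \<theta> e"] _ \<omega>(1) card])
    show "regular (\<omega>\<^sup>2)" unfolding weights_square(3)[OF \<omega>(1)] using s trig by force
  qed (use weights_square(1,2)[OF \<omega>(1)] trig s ang in auto)
  then show ?thesis using \<omega>(2) by blast
qed

end

section \<open>Contraction of classes of vertices\<close>

lemma successively_crossing:
  assumes "successively R p" "hd p \<in> T" "last p \<notin> T" "p \<noteq> []"
  shows "\<exists>p1 c d p2. p = p1 @ c # d # p2 \<and> c \<in> T \<and> d \<notin> T \<and> R c d"
  using assms
proof (induction p)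
  case (Cons x p)
  then obtain y q where p: "p = y # q" by (cases p) auto
  show ?case
  proof (cases "y \<in> T")
    case True
    then obtain p1 c d p2 where "p = p1 @ c # d # p2" "c \<in> T" "d \<notin> T" "R c d"
      using Cons.IH Cons.prems p by auto
    then show ?thesis by (intro exI[of _ "x # p1"]) auto
  next
    case False
    then show ?thesis using Cons.prems p by (intro exI[of _ "[]"]) auto
  qed
qed simp

context qgraph_locale
begin

text \<open>The last clause says that every class is joined to its outer vertex through edges inside the class.\<close>

definition classes :: "('v \<Rightarrow> 'v) \<Rightarrow> bool" where
  "classes r \<longleftrightarrow> (\<forall>v\<in>Vo. r v = v) \<and> (\<forall>u\<in>V. r u \<in> Vo) \<and>
     (\<forall>x::'v \<Rightarrow> real. (\<forall>u\<in>Vo. x u = 0) \<longrightarrow> (\<forall>e\<in>E. r (fst e) = r (snd e) \<longrightarrow> x (fst e) = x (snd e)) \<longrightarrow> (\<forall>u\<in>V. x u = 0))"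

text \<open>Starting from the identity on \<open>Vo\<close>, a vertex adjacent to the vertices
  already assigned joins the class of a neighbour. \<open>P U r\<close> is the defining property of
  \<open>classes\<close> restricted to edges inside \<open>U\<close>; the new edge carries the value
  zero to the new vertex.\<close>

lemma classes_ex: "\<exists>r. classes r"
proof -
  define P where "P U r \<longleftrightarrow> (\<forall>v\<in>Vo. r v = v) \<and> (\<forall>u\<in>U. r u \<in> Vo) \<and>
     (\<forall>x::'v \<Rightarrow> real. (\<forall>u\<in>Vo. x u = 0) \<longrightarrow> (\<forall>e\<in>E. fst e \<in> U \<longrightarrow> snd e \<in> U \<longrightarrow> r (fst e) = r (snd e) \<longrightarrow> x (fst e) = x (snd e)) \<longrightarrow> (\<forall>u\<in>U. x u = 0))"
    for U r
  have grow: "\<exists>r. P V r" if "Vo \<subseteq> U" "U \<subseteq> V" "P U r" for U r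
    using that
  proof (induction "card (V - U)" arbitrary: U r rule: less_induct)
    case less
    show ?case
    proof (cases "U = V")
      case True
      then show ?thesis using less.prems(3) by blast
    next
      case False
      then obtain v w where vw: "v \<in> U" "adj G v w" "w \<notin> U"
        using connected_closed_set[OF less.prems(2)] less.prems(1) Vo(2) by blast
      define r' where "r' = r(w := r v)"
      have wV: "w \<in> V" by (rule adj_V(2)[OF vw(2)])
      have "P (insert w U) r'"
        unfolding P_def
      proof (intro conjI allI impI)
        show "\<forall>v\<in>Vo. r' v = v" using less.prems vw unfolding P_def r'_def by auto
        show "\<forall>u\<in>insert w U. r' u \<in> Vo" using less.prems vw unfolding P_def r'_def by auto
        fix x :: "'v \<Rightarrow> real"
        assume x0: "\<forall>u\<in>Vo. x u = 0" and xe: "\<forall>e\<in>E. fst e \<in> insert w U \<longrightarrow> snd e \<in> insert w U \<longrightarrow> r' (fst e) = r' (snd e) \<longrightarrow> x (fst e) = x (snd e)"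
        have "\<forall>e\<in>E. fst e \<in> U \<longrightarrow> snd e \<in> U \<longrightarrow> r (fst e) = r (snd e) \<longrightarrow> x (fst e) = x (snd e)"
        proof (intro ballI impI)
          fix e assume "e \<in> E" "fst e \<in> U" "snd e \<in> U" "r (fst e) = r (snd e)"
          moreover have "fst e \<noteq> w" "snd e \<noteq> w" using calculation vw(3) by auto
          ultimately show "x (fst e) = x (snd e)" using xe by (simp add: r'_def)
        qed
        then have xU: "\<forall>u\<in>U. x u = 0" using less.prems(3) x0 unfolding P_def by blast
        have "v \<noteq> w" using vw by auto
        have "x v = x w"
          using vw(2) unfolding adj_def
        proof
          assume "(v, w) \<in> E"
          then show ?thesis using bspec[OF xe, of "(v, w)"] vw(1) \<open>v \<noteq> w\<close> by (simp add: r'_def)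
        next
          assume "(w, v) \<in> E"
          then show ?thesis using bspec[OF xe, of "(w, v)"] vw(1) \<open>v \<noteq> w\<close> by (simp add: r'_def)
        qed
        then show "\<forall>u\<in>insert w U. x u = 0" using xU vw(1) by simp
      qed
      moreover have "card (V - insert w U) < card (V - U)"
        by (rule psubset_card_mono) (use finite_V wV vw(3) in auto)
      ultimately show ?thesis
        using less.hyps[of "insert w U" r'] less.prems wV by auto
    qed
  qed
  have "P Vo (\<lambda>u. u)" by (simp add: P_def)
  from grow[OF _ _ this] obtain r where "P V r" using Vo by blast
  then show ?thesis using edge_V unfolding P_def classes_def by (intro exI[of _ r]) blast
qed

lemma qf_sym: "qf a b x y = qf a b y x"
  unfolding qf_def by (rule sum.cong) (auto simp: algebra_simps)

lemma tendsto_net: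
  assumes "\<And>e. e \<in> E \<Longrightarrow> (\<lambda>n. a n e) \<longlonglongrightarrow> a0 e" "\<And>e. e \<in> E \<Longrightarrow> (\<lambda>n. b n e) \<longlonglongrightarrow> b0 e"
  shows "(\<lambda>n. net E (a n) (b n) x v) \<longlonglongrightarrow> (net E a0 b0 x v :: real)"
  unfolding net_def using assms by (auto intro!: tendsto_intros)

lemma tendsto_qf:
  assumes "\<And>e. e \<in> E \<Longrightarrow> (\<lambda>n. a n e) \<longlonglongrightarrow> a0 e" "\<And>e. e \<in> E \<Longrightarrow> (\<lambda>n. b n e) \<longlonglongrightarrow> b0 e"
    and "\<And>u. u \<in> V \<Longrightarrow> (\<lambda>n. x n u) \<longlonglongrightarrow> x0 u"
  shows "(\<lambda>n. qf (a n) (b n) y (x n)) \<longlonglongrightarrow> qf a0 b0 y x0"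
  unfolding qf_def using assms edge_V by (intro tendsto_intros) auto

text \<open>A change of weights of total size \<open>\<epsilon> n\<close> changes the form by at
  most \<open>2 * \<epsilon> n\<close> times the squared norm;
  \<open>\<epsilon> n < \<kappa> / 4\<close> therefore leaves half of the coercivity
  constant.\<close>

lemma qf_perturbation:
  assumes a: "\<And>e. e \<in> E \<Longrightarrow> (\<lambda>n. a n e) \<longlonglongrightarrow> a0 e" and b: "\<And>e. e \<in> E \<Longrightarrow> (\<lambda>n. b n e) \<longlonglongrightarrow> b0 e"
    and \<kappa>: "0 < \<kappa>" "\<And>x. \<forall>u. u \<notin> Vi \<longrightarrow> x u = 0 \<Longrightarrow> \<kappa> * (\<Sum>u\<in>Vi. (x u)\<^sup>2) \<le> qf a0 b0 x x"
  shows "\<forall>\<^sub>F n in sequentially. \<forall>x. (\<forall>u. u \<notin> Vi \<longrightarrow> x u = 0) \<longrightarrow> \<kappa> / 2 * (\<Sum>u\<in>Vi. (x u)\<^sup>2) \<le> qf (a n) (b n) x x"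
proof -
  define \<epsilon> where "\<epsilon> n = (\<Sum>e\<in>E. \<bar>a n e - a0 e\<bar> + \<bar>b n e - b0 e\<bar>)" for n
  have "\<epsilon> \<longlonglongrightarrow> (\<Sum>e\<in>E. \<bar>a0 e - a0 e\<bar> + \<bar>b0 e - b0 e\<bar>)"
    unfolding \<epsilon>_def using a b by (intro tendsto_intros) auto
  then have "\<epsilon> \<longlonglongrightarrow> 0" by simp
  then have "\<forall>\<^sub>F n in sequentially. \<epsilon> n < \<kappa> / 4"
    using order_tendstoD(2) \<kappa>(1) by (metis divide_pos_pos zero_less_numeral)
  then show ?thesis
  proof eventually_elim
    case (elim n)
    show ?case
    proof (intro allI impI)
      fix x assume x: "\<forall>u. u \<notin> Vi \<longrightarrow> x u = (0::real)"
      let ?s = "\<Sum>u\<in>Vi. (x u)\<^sup>2"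
      have s0: "0 \<le> ?s" by (intro sum_nonneg) auto
      have xs: "(x v)\<^sup>2 \<le> ?s" for v
        using x member_le_sum[of v Vi "\<lambda>u. (x u)\<^sup>2"] finite_Vi s0 by (cases "v \<in> Vi") simp_all
      have "qf a0 b0 x x - qf (a n) (b n) x x \<le> (\<Sum>e\<in>E. (\<bar>a n e - a0 e\<bar> + \<bar>b n e - b0 e\<bar>) * (2 * ?s))"
        unfolding qf_def sum_subtractf[symmetric]
      proof (rule sum_mono)
        fix e
        let ?p = "x (fst e) * x (fst e) + x (snd e) * x (snd e)" and ?q = "x (fst e) * x (snd e) + x (snd e) * x (fst e)"
        have p: "\<bar>?p\<bar> \<le> 2 * ?s" using xs[of "fst e"] xs[of "snd e"] by (simp add: power2_eq_square)
        have "0 \<le> (x (fst e) - x (snd e))\<^sup>2" "0 \<le> (x (fst e) + x (snd e))\<^sup>2" by simp_all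
        then have "\<bar>?q\<bar> \<le> ?p" by (simp add: power2_eq_square algebra_simps abs_le_iff)
        then have q: "\<bar>?q\<bar> \<le> 2 * ?s" using p by linarith
        have "(a0 e * ?p - b0 e * ?q) - (a n e * ?p - b n e * ?q) = (a0 e - a n e) * ?p + (b n e - b0 e) * ?q"
          by (simp add: algebra_simps)
        also have "\<dots> \<le> \<bar>a0 e - a n e\<bar> * \<bar>?p\<bar> + \<bar>b n e - b0 e\<bar> * \<bar>?q\<bar>"
          unfolding abs_mult[symmetric] by (intro add_mono abs_ge_self)
        also have "\<dots> \<le> \<bar>a0 e - a n e\<bar> * (2 * ?s) + \<bar>b n e - b0 e\<bar> * (2 * ?s)"
          by (intro add_mono mult_left_mono p q) auto
        finally show "(a0 e * ?p - b0 e * ?q) - (a n e * ?p - b n e * ?q) \<le> (\<bar>a n e - a0 e\<bar> + \<bar>b n e - b0 e\<bar>) * (2 * ?s)"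
          by (simp add: algebra_simps abs_minus_commute)
      qed
      also have "\<dots> = \<epsilon> n * (2 * ?s)" by (simp add: \<epsilon>_def sum_distrib_right)
      also have "\<dots> \<le> \<kappa> / 4 * (2 * ?s)" using elim s0 by (intro mult_right_mono) auto
      finally show "\<kappa> / 2 * ?s \<le> qf (a n) (b n) x x" using \<kappa>(2)[OF x] by (simp add: field_simps)
    qed
  qed
qed

end

text \<open>
  The edges inside the classes of \<open>r\<close> are contracted in the limit \<open>p \<rightarrow> 0\<close>; the edges of \<open>R\<close> carry unit weights
  in the limit, and the weights of the other edges vanish.
\<close>

locale contraction = qgraph_locale G Vo for G :: "'v qgraph" and Vo :: "'v set" +
  fixes r :: "'v \<Rightarrow> 'v" and R :: "('v \<times> 'v) set" and p :: "nat \<Rightarrow> real" and \<alpha> \<beta> \<kappa> :: "nat \<Rightarrow> 'v \<times> 'v \<Rightarrow> real"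
  assumes r: "classes r" and R: "R \<subseteq> E" "\<And>e. e \<in> R \<Longrightarrow> r (fst e) \<noteq> r (snd e)"
    and p: "\<And>n. 0 < p n" "p \<longlonglongrightarrow> 0"
    and \<alpha>: "\<And>e. e \<in> E \<Longrightarrow> (\<lambda>n. \<alpha> n e) \<longlonglongrightarrow> (if e \<in> R then 1 else 0)"
    and \<beta>: "\<And>e. e \<in> E \<Longrightarrow> (\<lambda>n. \<beta> n e) \<longlonglongrightarrow> (if e \<in> R then 1 else 0)"
    and \<kappa>: "\<And>e. e \<in> E \<Longrightarrow> (\<lambda>n. \<kappa> n e) \<longlonglongrightarrow> (if r (fst e) = r (snd e) then 1 else 0)"
    and \<kappa>0: "\<And>n e. e \<in> E \<Longrightarrow> r (fst e) \<noteq> r (snd e) \<Longrightarrow> \<kappa> n e = 0"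
begin

text \<open>The weights in units of \<open>\<omega> / p\<close>. Their singular part has the same
  coefficient on and off the diagonal, so it annihilates functions constant on the classes.
  \<open>\<kappa>0\<close> asks for exact zeros between classes because
  \<open>1 / (p n)\<^sup>2\<close> would amplify a mere null sequence.\<close>

definition "ma n e = \<alpha> n e - \<kappa> n e / (p n)\<^sup>2"
definition "mb n e = \<beta> n e - \<kappa> n e / (p n)\<^sup>2"
definition "bS e = (if r (fst e) = r (snd e) then 1 else 0 :: real)" for e :: "'v \<times> 'v"
definition "bR e = (if e \<in> R then 1 else 0 :: real)" for e :: "'v \<times> 'v"
text \<open>The indicator of the class of \<open>z\<close>: it restricts to a unit vector on
  \<open>Vo\<close> and lies in the kernel of the singular part.\<close>

definition "ind z u = (if r u = z then 1 else 0 :: real)" for z u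

lemma r_Vo: "v \<in> Vo \<Longrightarrow> r v = v" and r_in: "u \<in> V \<Longrightarrow> r u \<in> Vo"
  using r by (auto simp: classes_def)

lemma qf_bS: "qf bS bS x x = (\<Sum>e\<in>{e\<in>E. r (fst e) = r (snd e)}. (x (fst e) - x (snd e))\<^sup>2)"
  unfolding qf_diff_form sum.inter_filter[OF finite_E] by (rule sum.cong) (auto simp: bS_def)

text \<open>The last clause of \<open>classes\<close> excludes a kernel: a vector vanishing on
  \<open>Vo\<close> and constant along inside edges is zero.\<close>

lemma coercive_S:
  "\<exists>\<kappa>>0. \<forall>x. (\<forall>u. u \<notin> Vi \<longrightarrow> x u = 0) \<longrightarrow> \<kappa> * (\<Sum>u\<in>Vi. (x u)\<^sup>2) \<le> qf bS bS x x"
  unfolding qf_bS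
proof (rule coercive)
  fix x :: "'v \<Rightarrow> real"
  assume x: "\<forall>u. u \<notin> Vi \<longrightarrow> x u = 0" and e: "\<forall>e\<in>{e\<in>E. r (fst e) = r (snd e)}. x (fst e) = x (snd e)"
  have "\<forall>u\<in>V. x u = 0" using r x e unfolding classes_def by simp
  then show "\<forall>u\<in>Vi. x u = 0" by blast
qed auto

lemma nonsing_S: "nonsing bS bS"
proof -
  obtain k where k: "k > 0" "\<And>x. \<forall>u. u \<notin> Vi \<longrightarrow> x u = 0 \<Longrightarrow> k * (\<Sum>u\<in>Vi. (x u)\<^sup>2) \<le> qf bS bS x x"
    using coercive_S by blast
  have "PD bS bS"
    unfolding PD_def
  proof (intro allI impI)
    fix x assume x: "\<forall>u. u \<notin> Vi \<longrightarrow> x u = (0::real)" "\<exists>u\<in>Vi. x u \<noteq> 0"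
    then have "0 < (\<Sum>u\<in>Vi. (x u)\<^sup>2)" using usphere_normalize(1)[OF finite_Vi x(1)] by blast
    then have "0 < k * (\<Sum>u\<in>Vi. (x u)\<^sup>2)" using k(1) by simp
    then show "0 < qf bS bS x x" using k(2)[OF x(1)] by linarith
  qed
  then show ?thesis by (rule PD_nonsing)
qed

text \<open>The first order correction of the harmonic extension of the unit vector of \<open>z\<close>.\<close>

definition corrector :: "'v \<Rightarrow> ('v \<Rightarrow> real) \<Rightarrow> bool" where
  "corrector z g \<longleftrightarrow> (\<forall>u. u \<notin> Vi \<longrightarrow> g u = 0) \<and> (\<forall>v\<in>Vi. net E bS bS g v = net E bR bR (ind z) v)"

lemma corrector_ex: "\<exists>g. corrector z g"
  unfolding corrector_def
  by (rule lin_op_surj[OF finite_Vi finite_Vi refl lin_op_net]) (use nonsing_S in \<open>simp add: nonsing_def\<close>)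

lemma net_sub: "net E (\<lambda>e. a e - c * a' e) (\<lambda>e. b e - c * b' e) x v = net E a b x v - c * (net E a' b' x v :: real)"
  by (simp add: net_def algebra_simps sum.distrib sum_subtractf sum_distrib_left)

lemma qf_sub: "qf (\<lambda>e. a e - c * a' e) (\<lambda>e. b e - c * b' e) x y = qf a b x y - c * qf a' b' x y"
  by (simp add: qf_def algebra_simps sum.distrib sum_subtractf sum_distrib_left)

text \<open>Insert \<open>ind w + (p n)\<^sup>2 * G n\<close> for the harmonic extension. The
  singular part annihilates \<open>ind w\<close>, so the condition at inner vertices becomes an
  equation for \<open>G n\<close> whose limit defines the corrector. Pairing with
  \<open>ind v\<close> removes the singular part a second time. The resulting formula for the
  entries is exact; a limit is taken only in \<open>G n\<close>.\<close>

lemma schur_asymptotics: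
  assumes g: "corrector w g"
  shows "\<exists>G. (\<forall>u. (\<lambda>n. G n u) \<longlonglongrightarrow> g u) \<and> (\<forall>\<^sub>F n in sequentially. nonsing (ma n) (mb n) \<and>
     (\<forall>v\<in>Vo. schur (ma n) (mb n) v w = qf (\<alpha> n) (\<beta> n) (ind v) (ind w) + (p n)\<^sup>2 * qf (\<alpha> n) (\<beta> n) (ind v) (G n)))"
proof -
  obtain k where k: "k > 0" "\<And>x. \<forall>u. u \<notin> Vi \<longrightarrow> x u = 0 \<Longrightarrow> k * (\<Sum>u\<in>Vi. (x u)\<^sup>2) \<le> qf bS bS x x"
    using coercive_S by blast
  define a where "a n e = \<kappa> n e - (p n)\<^sup>2 * \<alpha> n e" for n e
  define b where "b n e = \<kappa> n e - (p n)\<^sup>2 * \<beta> n e" for n e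
  have lim: "(\<lambda>n. a n e) \<longlonglongrightarrow> bS e" "(\<lambda>n. b n e) \<longlonglongrightarrow> bS e" if "e \<in> E" for e
  proof -
    have "(\<lambda>n. a n e) \<longlonglongrightarrow> (if r (fst e) = r (snd e) then 1 else 0) - 0\<^sup>2 * (if e \<in> R then 1 else 0)"
      unfolding a_def by (intro tendsto_intros p \<alpha> \<kappa> that)
    moreover have "(\<lambda>n. b n e) \<longlonglongrightarrow> (if r (fst e) = r (snd e) then 1 else 0) - 0\<^sup>2 * (if e \<in> R then 1 else 0)"
      unfolding b_def by (intro tendsto_intros p \<beta> \<kappa> that)
    ultimately show "(\<lambda>n. a n e) \<longlonglongrightarrow> bS e" "(\<lambda>n. b n e) \<longlonglongrightarrow> bS e" by (simp_all add: bS_def)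
  qed
  have ev: "\<forall>\<^sub>F n in sequentially. \<forall>x. (\<forall>u. u \<notin> Vi \<longrightarrow> x u = 0) \<longrightarrow> k / 2 * (\<Sum>u\<in>Vi. (x u)\<^sup>2) \<le> qf (a n) (b n) x x"
    by (rule qf_perturbation[OF lim k])
  have ns: "nonsing (a n) (b n)" if *: "\<forall>x. (\<forall>u. u \<notin> Vi \<longrightarrow> x u = 0) \<longrightarrow> k / 2 * (\<Sum>u\<in>Vi. (x u)\<^sup>2) \<le> qf (a n) (b n) x x" for n
  proof (rule PD_nonsing, unfold PD_def, intro allI impI)
    fix x assume x: "\<forall>u. u \<notin> Vi \<longrightarrow> x u = (0::real)" "\<exists>u\<in>Vi. x u \<noteq> 0"
    then have "0 < (\<Sum>u\<in>Vi. (x u)\<^sup>2)" using usphere_normalize(1)[OF finite_Vi x(1)] by blast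
    then have "0 < k / 2 * (\<Sum>u\<in>Vi. (x u)\<^sup>2)" using k(1) by simp
    then show "0 < qf (a n) (b n) x x" using * x(1) by (meson less_le_trans)
  qed
  have "\<forall>n. \<exists>G. nonsing (a n) (b n) \<longrightarrow> (\<forall>u. u \<notin> Vi \<longrightarrow> G u = 0) \<and> (\<forall>v\<in>Vi. net E (a n) (b n) G v = net E (\<alpha> n) (\<beta> n) (ind w) v)"
  proof
    fix n
    show "\<exists>G. nonsing (a n) (b n) \<longrightarrow> (\<forall>u. u \<notin> Vi \<longrightarrow> G u = 0) \<and> (\<forall>v\<in>Vi. net E (a n) (b n) G v = net E (\<alpha> n) (\<beta> n) (ind w) v)"
    proof (cases "nonsing (a n) (b n)")
      case True
      have "\<exists>G. (\<forall>u. u \<notin> Vi \<longrightarrow> G u = 0) \<and> (\<forall>v\<in>Vi. net E (a n) (b n) G v = net E (\<alpha> n) (\<beta> n) (ind w) v)"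
        by (rule lin_op_surj[OF finite_Vi finite_Vi refl lin_op_net]) (use True in \<open>simp add: nonsing_def\<close>)
      then show ?thesis by blast
    qed simp
  qed
  from choice[OF this] obtain G0 where G0: "\<And>n. nonsing (a n) (b n) \<Longrightarrow> \<forall>u. u \<notin> Vi \<longrightarrow> G0 n u = 0"
    "\<And>n. nonsing (a n) (b n) \<Longrightarrow> \<forall>v\<in>Vi. net E (a n) (b n) (G0 n) v = net E (\<alpha> n) (\<beta> n) (ind w) v" by blast
  \<comment> \<open>The residual of the limit \<open>g\<close> in the equation for
    \<open>G0 n\<close>. It tends to zero, and coercivity with Young's inequality turns this into
    convergence of \<open>G0 n\<close> to \<open>g\<close>.\<close>
  define \<rho> where "\<rho> n v = net E (\<alpha> n) (\<beta> n) (ind w) v - net E (a n) (b n) g v" for n v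
  have "(\<lambda>n. \<rho> n v) \<longlonglongrightarrow> net E bR bR (ind w) v - net E bS bS g v" for v
    unfolding \<rho>_def using \<alpha> \<beta> lim by (intro tendsto_diff tendsto_net) (simp_all add: bR_def)
  then have \<rho>0: "(\<lambda>n. \<rho> n v) \<longlonglongrightarrow> 0" if "v \<in> Vi" for v
    using g that unfolding corrector_def by (metis diff_self)
  have bound: "k / 4 * (\<Sum>u\<in>Vi. (G0 n u - g u)\<^sup>2) \<le> (\<Sum>u\<in>Vi. (\<rho> n u)\<^sup>2) / k"
    if *: "\<forall>x. (\<forall>u. u \<notin> Vi \<longrightarrow> x u = 0) \<longrightarrow> k / 2 * (\<Sum>u\<in>Vi. (x u)\<^sup>2) \<le> qf (a n) (b n) x x" for n
  proof -
    note G = G0[OF ns[OF *]]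
    define z where "z u = G0 n u + (-1) * g u" for u
    have zs: "\<forall>u. u \<notin> Vi \<longrightarrow> z u = 0" using G(1) g by (simp add: z_def corrector_def)
    have zn: "net E (a n) (b n) z v = \<rho> n v" if "v \<in> Vi" for v
      using lin_opD[OF lin_op_net, of E "a n" "b n" "G0 n" "-1" g v] G(2) that by (simp add: z_def[abs_def] \<rho>_def)
    have "k / 2 * (\<Sum>u\<in>Vi. (z u)\<^sup>2) \<le> qf (a n) (b n) z z" using * zs by blast
    also have "\<dots> = (\<Sum>v\<in>Vi. z v * net E (a n) (b n) z v)"
      unfolding qf_net[symmetric] by (rule sum.mono_neutral_right) (use finite_V zs in auto)
    also have "\<dots> = (\<Sum>v\<in>Vi. z v * \<rho> n v)" by (rule sum.cong) (use zn in auto)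
    also have "\<dots> \<le> (\<Sum>v\<in>Vi. k / 4 * (z v)\<^sup>2 + (\<rho> n v)\<^sup>2 / k)"
    proof (rule sum_mono)
      fix v
      have "0 \<le> (k / 2 * z v - \<rho> n v)\<^sup>2 / k" using k(1) by simp
      also have "\<dots> = k / 4 * (z v)\<^sup>2 - z v * \<rho> n v + (\<rho> n v)\<^sup>2 / k"
        using k(1) by (simp add: power2_eq_square field_simps)
      finally show "z v * \<rho> n v \<le> k / 4 * (z v)\<^sup>2 + (\<rho> n v)\<^sup>2 / k" by simp
    qed
    also have "\<dots> = k / 4 * (\<Sum>u\<in>Vi. (z u)\<^sup>2) + (\<Sum>u\<in>Vi. (\<rho> n u)\<^sup>2) / k"
      by (simp add: sum.distrib sum_distrib_left sum_divide_distrib)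
    finally have "k / 2 * (\<Sum>u\<in>Vi. (z u)\<^sup>2) \<le> k / 4 * (\<Sum>u\<in>Vi. (z u)\<^sup>2) + (\<Sum>u\<in>Vi. (\<rho> n u)\<^sup>2) / k" .
    moreover have "k / 2 * s = k / 4 * s + k / 4 * s" for s :: real by simp
    ultimately have "k / 4 * (\<Sum>u\<in>Vi. (z u)\<^sup>2) \<le> (\<Sum>u\<in>Vi. (\<rho> n u)\<^sup>2) / k"
      by (metis add_le_cancel_left)
    then show ?thesis by (simp add: z_def)
  qed
  have Glim: "(\<lambda>n. G0 n u) \<longlonglongrightarrow> g u" for u
  proof (cases "u \<in> Vi")
    case True
    have "(\<lambda>n. (\<Sum>u\<in>Vi. (\<rho> n u)\<^sup>2) / k * (4 / k)) \<longlonglongrightarrow> (\<Sum>u\<in>Vi. 0\<^sup>2) / k * (4 / k)"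
      using k(1) by (intro tendsto_intros \<rho>0) auto
    then have up: "(\<lambda>n. (\<Sum>u\<in>Vi. (\<rho> n u)\<^sup>2) / k * (4 / k)) \<longlonglongrightarrow> 0" by simp
    have "\<forall>\<^sub>F n in sequentially. norm ((G0 n u - g u)\<^sup>2) \<le> (\<Sum>u\<in>Vi. (\<rho> n u)\<^sup>2) / k * (4 / k)"
      using ev
    proof eventually_elim
      case (elim n)
      have "(G0 n u - g u)\<^sup>2 \<le> (\<Sum>u\<in>Vi. (G0 n u - g u)\<^sup>2)"
        by (rule member_le_sum[OF True _ finite_Vi]) auto
      also have "\<dots> = (k / 4 * (\<Sum>u\<in>Vi. (G0 n u - g u)\<^sup>2)) * (4 / k)" using k(1) by simp
      also have "\<dots> \<le> (\<Sum>u\<in>Vi. (\<rho> n u)\<^sup>2) / k * (4 / k)"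
        by (rule mult_right_mono[OF bound[OF elim]]) (use k(1) in simp)
      finally show ?case by simp
    qed
    from Lim_null_comparison[OF this up] have "(\<lambda>n. (G0 n u - g u)\<^sup>2) \<longlonglongrightarrow> 0" .
    then have "(\<lambda>n. sqrt ((G0 n u - g u)\<^sup>2)) \<longlonglongrightarrow> sqrt 0" by (rule tendsto_real_sqrt)
    then have "(\<lambda>n. G0 n u - g u) \<longlonglongrightarrow> 0" by (simp add: tendsto_rabs_zero_iff)
    then show ?thesis by (simp add: LIM_zero_iff)
  next
    case False
    have "\<forall>\<^sub>F n in sequentially. G0 n u = g u"
      using ev
    proof eventually_elim
      case (elim n)
      then show ?case using G0(1)[OF ns[OF elim]] g False by (simp add: corrector_def)
    qed
    then show ?thesis by (rule tendsto_eventually)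
  qed
  have formula: "nonsing (ma n) (mb n) \<and>
     (\<forall>v\<in>Vo. schur (ma n) (mb n) v w = qf (\<alpha> n) (\<beta> n) (ind v) (ind w) + (p n)\<^sup>2 * qf (\<alpha> n) (\<beta> n) (ind v) (G0 n))"
    if ns: "nonsing (a n) (b n)" for n
  proof -
    have p2: "(p n)\<^sup>2 \<noteq> 0" using p(1)[of n] by simp
    define c where "c = - (1 / (p n)\<^sup>2)"
    have m: "ma n = (\<lambda>e. c * a n e)" "mb n = (\<lambda>e. c * b n e)"
      using p2 by (auto simp: fun_eq_iff ma_def mb_def a_def b_def c_def field_simps)
    have m2: "ma n = (\<lambda>e. \<alpha> n e - (1 / (p n)\<^sup>2) * \<kappa> n e)" "mb n = (\<lambda>e. \<beta> n e - (1 / (p n)\<^sup>2) * \<kappa> n e)"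
      by (auto simp: fun_eq_iff ma_def mb_def)
    have nsm: "nonsing (ma n) (mb n)"
      unfolding m by (rule schur_scale(1)[OF ns]) (use p2 in \<open>simp add: c_def\<close>)
    note G = G0[OF ns]
    define f where "f u = ind w u + (p n)\<^sup>2 * G0 n u" for u
    have k0: "net E (\<kappa> n) (\<kappa> n) (ind w) v = 0" for v
    proof -
      have "\<kappa> n e * ind w (fst e) = \<kappa> n e * ind w (snd e)" if "e \<in> E" for e
        using \<kappa>0[OF that, of n] by (auto simp: ind_def)
      then have "\<kappa> n e * ind w v - \<kappa> n e * ind w (snd e) = 0 \<or> fst e \<noteq> v"
        "\<kappa> n e * ind w v - \<kappa> n e * ind w (fst e) = 0 \<or> snd e \<noteq> v" if "e \<in> E" for e
        using that by (metis diff_self)+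
      then have "(\<Sum>e\<in>{e\<in>E. fst e = v}. \<kappa> n e * ind w v - \<kappa> n e * ind w (snd e)) = 0"
        "(\<Sum>e\<in>{e\<in>E. snd e = v}. \<kappa> n e * ind w v - \<kappa> n e * ind w (fst e)) = 0"
        by (intro sum.neutral; blast)+
      then show ?thesis unfolding net_def by simp
    qed
    have nf: "net E a' b' f v = net E a' b' (ind w) v + (p n)\<^sup>2 * net E a' b' (G0 n) v" for a' b' v
      unfolding f_def[abs_def] by (rule lin_opD[OF lin_op_net])
    have har: "harmonic (ma n) (mb n) w f"
      unfolding harmonic_def
    proof (intro conjI ballI)
      fix v assume "v \<in> Vo"
      then show "f v = (if v = w then 1 else 0)" using G(1) by (simp add: f_def ind_def r_Vo)
    next
      fix v assume v: "v \<in> Vi"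
      have B: "net E (a n) (b n) (G0 n) v = net E (\<kappa> n) (\<kappa> n) (G0 n) v - (p n)\<^sup>2 * net E (\<alpha> n) (\<beta> n) (G0 n) v"
        unfolding a_def b_def by (rule net_sub)
      have "net E (ma n) (mb n) f v = net E (\<alpha> n) (\<beta> n) f v - (1 / (p n)\<^sup>2) * net E (\<kappa> n) (\<kappa> n) f v"
        unfolding m2 by (rule net_sub)
      also have "\<dots> = net E (\<alpha> n) (\<beta> n) (ind w) v + (p n)\<^sup>2 * net E (\<alpha> n) (\<beta> n) (G0 n) v - net E (\<kappa> n) (\<kappa> n) (G0 n) v"
        using p2 by (simp add: nf k0)
      also have "\<dots> = net E (\<alpha> n) (\<beta> n) (ind w) v - net E (a n) (b n) (G0 n) v"
        unfolding B by simp
      also have "\<dots> = 0" using G(2) v by simp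
      finally show "net E (ma n) (mb n) f v = 0" .
    qed
    have "schur (ma n) (mb n) v w = qf (\<alpha> n) (\<beta> n) (ind v) (ind w) + (p n)\<^sup>2 * qf (\<alpha> n) (\<beta> n) (ind v) (G0 n)"
      if v: "v \<in> Vo" for v
    proof -
      have vV: "v \<in> V" using v Vo by blast
      have "schur (ma n) (mb n) v w = net E (ma n) (mb n) f v" by (rule schur_eq[OF nsm har vV])
      also have "\<dots> = (\<Sum>u\<in>V. if u = v then net E (ma n) (mb n) f u else 0)" using vV finite_V by simp
      \<comment> \<open>The unit vector of \<open>v\<close> may be replaced by \<open>ind v\<close>:
        they agree on \<open>Vo\<close>, and at inner vertices \<open>net\<close> of the harmonic
        \<open>f\<close> is zero.\<close>
      also have "\<dots> = (\<Sum>u\<in>V. ind v u * net E (ma n) (mb n) f u)"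
      proof (rule sum.cong[OF refl])
        fix u assume "u \<in> V"
        then show "(if u = v then net E (ma n) (mb n) f u else 0) = ind v u * net E (ma n) (mb n) f u"
          using har v by (cases "u \<in> Vo") (auto simp: ind_def r_Vo harmonic_def)
      qed
      also have "\<dots> = qf (ma n) (mb n) (ind v) f" by (rule qf_net)
      also have "\<dots> = qf (\<alpha> n) (\<beta> n) (ind v) f - (1 / (p n)\<^sup>2) * qf (\<kappa> n) (\<kappa> n) (ind v) f"
        unfolding m2 by (rule qf_sub)
      also have "qf (\<kappa> n) (\<kappa> n) (ind v) f = 0"
        unfolding qf_def
      proof (rule sum.neutral, rule ballI)
        fix e assume e: "e \<in> E"
        show "\<kappa> n e * (ind v (fst e) * f (fst e) + ind v (snd e) * f (snd e)) - \<kappa> n e * (ind v (fst e) * f (snd e) + ind v (snd e) * f (fst e)) = 0"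
          using \<kappa>0[OF e, of n] by (cases "r (fst e) = r (snd e)") (auto simp: ind_def)
      qed
      also have "qf (\<alpha> n) (\<beta> n) (ind v) f = qf (\<alpha> n) (\<beta> n) (ind v) (ind w) + (p n)\<^sup>2 * qf (\<alpha> n) (\<beta> n) (ind v) (G0 n)"
        unfolding qf_def f_def sum_distrib_left sum.distrib[symmetric] by (rule sum.cong) (auto simp: algebra_simps)
      finally show ?thesis by simp
    qed
    then show ?thesis using nsm by blast
  qed
  have "\<forall>\<^sub>F n in sequentially. nonsing (ma n) (mb n) \<and>
     (\<forall>v\<in>Vo. schur (ma n) (mb n) v w = qf (\<alpha> n) (\<beta> n) (ind v) (ind w) + (p n)\<^sup>2 * qf (\<alpha> n) (\<beta> n) (ind v) (G0 n))"
    using ev by eventually_elim (rule formula[OF ns])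
  then show ?thesis using Glim by blast
qed

end

section \<open>Signs of the entries: limit matrix, first order and second order\<close>

text \<open>The inner vertices reached by the influence of the class \<open>b\<close>, which enters
  a neighbouring class at a vertex bordering on \<open>b\<close> and then travels inside that class.
  Outer vertices are barred because correctors vanish there. At linked vertices the corrector of
  \<open>b\<close> is strictly negative.\<close>

inductive linked :: "'v qgraph \<Rightarrow> 'v set \<Rightarrow> ('v \<Rightarrow> 'v) \<Rightarrow> 'v \<Rightarrow> 'v \<Rightarrow> bool" for G Vo r b where
  base: "u \<in> verts G - Vo \<Longrightarrow> adj G u w \<Longrightarrow> r w = b \<Longrightarrow> r u \<noteq> b \<Longrightarrow> linked G Vo r b u"
| step: "linked G Vo r b u \<Longrightarrow> adj G u u' \<Longrightarrow> u' \<in> verts G - Vo \<Longrightarrow> r u' = r u \<Longrightarrow> linked G Vo r b u'"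

context contraction
begin

text \<open>The limit matrix on the quotient graph: off the diagonal it is minus the number of edges
  of \<open>R\<close> between two classes.\<close>

definition D0 :: "'v \<Rightarrow> 'v \<Rightarrow> real" where "D0 v w = qf bR bR (ind v) (ind w)"

lemma tendsto_\<alpha>: "e \<in> E \<Longrightarrow> (\<lambda>n. \<alpha> n e) \<longlonglongrightarrow> bR e" and tendsto_\<beta>: "e \<in> E \<Longrightarrow> (\<lambda>n. \<beta> n e) \<longlonglongrightarrow> bR e"
  using \<alpha> \<beta> by (simp_all add: bR_def)

lemma tendsto_qf_G:
  assumes "\<And>u. (\<lambda>n. x n u) \<longlonglongrightarrow> x0 u"
  shows "(\<lambda>n. qf (\<alpha> n) (\<beta> n) y (x n)) \<longlonglongrightarrow> qf bR bR y x0"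
  by (rule tendsto_qf[OF tendsto_\<alpha> tendsto_\<beta> assms])

lemma schur_tendsto:
  assumes "v \<in> Vo"
  shows "(\<lambda>n. schur (ma n) (mb n) v w) \<longlonglongrightarrow> D0 v w"
proof -
  obtain g where g: "corrector w g" using corrector_ex by blast
  obtain H where H: "\<And>u. (\<lambda>n. H n u) \<longlonglongrightarrow> g u" and ev: "\<forall>\<^sub>F n in sequentially. nonsing (ma n) (mb n) \<and>
     (\<forall>v\<in>Vo. schur (ma n) (mb n) v w = qf (\<alpha> n) (\<beta> n) (ind v) (ind w) + (p n)\<^sup>2 * qf (\<alpha> n) (\<beta> n) (ind v) (H n))"
    using schur_asymptotics[OF g] by blast
  have "(\<lambda>n. qf (\<alpha> n) (\<beta> n) (ind v) (ind w) + (p n)\<^sup>2 * qf (\<alpha> n) (\<beta> n) (ind v) (H n)) \<longlonglongrightarrow>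
      qf bR bR (ind v) (ind w) + 0\<^sup>2 * qf bR bR (ind v) g"
    by (intro tendsto_intros p(2) tendsto_qf_G H)
  then have "(\<lambda>n. qf (\<alpha> n) (\<beta> n) (ind v) (ind w) + (p n)\<^sup>2 * qf (\<alpha> n) (\<beta> n) (ind v) (H n)) \<longlonglongrightarrow> D0 v w"
    by (simp add: D0_def)
  moreover have "\<forall>\<^sub>F n in sequentially. qf (\<alpha> n) (\<beta> n) (ind v) (ind w) + (p n)\<^sup>2 * qf (\<alpha> n) (\<beta> n) (ind v) (H n) = schur (ma n) (mb n) v w"
    using ev by eventually_elim (use assms in simp)
  ultimately show ?thesis by (rule Lim_transform_eventually)
qed

lemma eventually_nonsing: "\<forall>\<^sub>F n in sequentially. nonsing (ma n) (mb n)"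
proof -
  obtain w where "w \<in> Vo" using Vo by blast
  obtain g where g: "corrector w g" using corrector_ex by blast
  obtain H where "\<forall>\<^sub>F n in sequentially. nonsing (ma n) (mb n) \<and>
     (\<forall>v\<in>Vo. schur (ma n) (mb n) v w = qf (\<alpha> n) (\<beta> n) (ind v) (ind w) + (p n)\<^sup>2 * qf (\<alpha> n) (\<beta> n) (ind v) (H n))"
    using schur_asymptotics[OF g] by blast
  then show ?thesis by eventually_elim blast
qed

lemma qf_ind:
  assumes "a \<noteq> b"
  shows "qf a' b' (ind a) (ind b) = - (\<Sum>e\<in>E. b' e * (ind a (fst e) * ind b (snd e) + ind a (snd e) * ind b (fst e)))"
  unfolding qf_def sum_negf[symmetric] by (rule sum.cong) (use assms in \<open>auto simp: ind_def\<close>)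

lemma D0_Zmatrix: "Zmatrix Vo D0"
  unfolding Zmatrix_def
proof (intro ballI impI)
  fix v w :: 'v assume "v \<noteq> w"
  then show "D0 v w \<le> 0"
    unfolding D0_def by (subst qf_ind) (auto intro!: sum_nonneg simp: bR_def ind_def)
qed

lemma D0_neg:
  assumes e: "e \<in> R" and ab: "{r (fst e), r (snd e)} = {a, b}"
  shows "D0 a b < 0"
proof -
  have ne: "a \<noteq> b" using R(2)[OF e] ab by (auto simp: doubleton_eq_iff)
  have "0 < (\<Sum>e\<in>E. bR e * (ind a (fst e) * ind b (snd e) + ind a (snd e) * ind b (fst e)))"
  proof (rule sum_pos2[OF finite_E])
    show "e \<in> E" using e R by blast
    show "0 < bR e * (ind a (fst e) * ind b (snd e) + ind a (snd e) * ind b (fst e))"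
      using e ab ne by (auto simp: bR_def ind_def doubleton_eq_iff)
  qed (auto simp: bR_def ind_def)
  then show ?thesis unfolding D0_def qf_ind[OF ne] by simp
qed

text \<open>The hypothesis says that the edges of \<open>R\<close> connect the quotient graph, which
  makes the limit Z-matrix irreducible.\<close>

lemma eventually_rsg_pos:
  assumes cross: "\<And>T. T \<subseteq> Vo \<Longrightarrow> T \<noteq> {} \<Longrightarrow> T \<noteq> Vo \<Longrightarrow> \<exists>e\<in>R. r (fst e) \<in> T \<longleftrightarrow> r (snd e) \<notin> T"
  shows "\<forall>\<^sub>F n in sequentially. \<forall>t\<ge>1. \<forall>v\<in>Vo. \<forall>w\<in>Vo. 0 < rsg Vo (schur (ma n) (mb n)) t v w"
proof (rule eventually_strongly_positive_limit[OF finite_Vo Vo(2) _ D0_Zmatrix])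
  show "(\<lambda>n. schur (ma n) (mb n) v w) \<longlonglongrightarrow> D0 v w" if "v \<in> Vo" for v w
    by (rule schur_tendsto[OF that])
  show "irreducible_matrix Vo D0"
    unfolding irreducible_matrix_def
  proof (intro allI impI)
    fix T assume T: "T \<subseteq> Vo" "T \<noteq> {}" "T \<noteq> Vo"
    obtain e where e: "e \<in> R" "r (fst e) \<in> T \<longleftrightarrow> r (snd e) \<notin> T" using cross[OF T] by blast
    have eV: "r (fst e) \<in> Vo" "r (snd e) \<in> Vo" using e(1) R edge_V r_in by blast+
    show "\<exists>v\<in>Vo - T. \<exists>w\<in>T. D0 v w < 0"
    proof (cases "r (fst e) \<in> T")
      case True
      have "D0 (r (snd e)) (r (fst e)) < 0" by (rule D0_neg[OF e(1)]) auto
      then show ?thesis using True e(2) eV by blast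
    next
      case False
      have "D0 (r (fst e)) (r (snd e)) < 0" by (rule D0_neg[OF e(1)]) auto
      then show ?thesis using False e(2) eV by blast
    qed
  qed
qed

text \<open>After division by \<open>p n\<close> the correction in \<open>schur_asymptotics\<close>
  still carries a factor \<open>p n\<close> and disappears in the limit.\<close>

lemma schur_pos_first_order:
  assumes x: "x \<in> Vo" and c: "(\<lambda>n. qf (\<alpha> n) (\<beta> n) (ind x) (ind y) / p n) \<longlonglongrightarrow> c" "0 < c"
  shows "\<forall>\<^sub>F n in sequentially. 0 < schur (ma n) (mb n) x y"
proof -
  obtain g where g: "corrector y g" using corrector_ex by blast
  obtain H where H: "\<And>u. (\<lambda>n. H n u) \<longlonglongrightarrow> g u" and ev: "\<forall>\<^sub>F n in sequentially. nonsing (ma n) (mb n) \<and>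
     (\<forall>v\<in>Vo. schur (ma n) (mb n) v y = qf (\<alpha> n) (\<beta> n) (ind v) (ind y) + (p n)\<^sup>2 * qf (\<alpha> n) (\<beta> n) (ind v) (H n))"
    using schur_asymptotics[OF g] by blast
  have "(\<lambda>n. qf (\<alpha> n) (\<beta> n) (ind x) (ind y) / p n + p n * qf (\<alpha> n) (\<beta> n) (ind x) (H n)) \<longlonglongrightarrow> c + 0 * qf bR bR (ind x) g"
    by (intro tendsto_intros p(2) tendsto_qf_G H c)
  then have "\<forall>\<^sub>F n in sequentially. 0 < qf (\<alpha> n) (\<beta> n) (ind x) (ind y) / p n + p n * qf (\<alpha> n) (\<beta> n) (ind x) (H n)"
    using c(2) by (intro order_tendstoD(1)) auto
  then show ?thesis
    using ev
  proof eventually_elim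
    case (elim n)
    have "schur (ma n) (mb n) x y = p n * (qf (\<alpha> n) (\<beta> n) (ind x) (ind y) / p n + p n * qf (\<alpha> n) (\<beta> n) (ind x) (H n))"
      using elim(2) x p(1)[of n] by (simp add: distrib_left power2_eq_square)
    then show ?case using elim(1) p(1)[of n] by simp
  qed
qed

lemma schur_pos_second_order:
  assumes x: "x \<in> Vo" and z: "\<And>n. qf (\<alpha> n) (\<beta> n) (ind x) (ind y) = 0"
    and g: "corrector y g" "0 < qf bR bR (ind x) g"
  shows "\<forall>\<^sub>F n in sequentially. 0 < schur (ma n) (mb n) x y"
proof -
  obtain H where H: "\<And>u. (\<lambda>n. H n u) \<longlonglongrightarrow> g u" and ev: "\<forall>\<^sub>F n in sequentially. nonsing (ma n) (mb n) \<and>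
     (\<forall>v\<in>Vo. schur (ma n) (mb n) v y = qf (\<alpha> n) (\<beta> n) (ind v) (ind y) + (p n)\<^sup>2 * qf (\<alpha> n) (\<beta> n) (ind v) (H n))"
    using schur_asymptotics[OF g(1)] by blast
  have "\<forall>\<^sub>F n in sequentially. 0 < qf (\<alpha> n) (\<beta> n) (ind x) (H n)"
    by (rule order_tendstoD(1)[OF tendsto_qf_G[OF H] g(2)])
  then show ?thesis
    using ev
  proof eventually_elim
    case (elim n)
    then show ?case using x z p(1)[of n] by simp
  qed
qed

lemma qf_bS_bilinear: "qf bS bS y x = (\<Sum>e\<in>E. bS e * ((y (fst e) - y (snd e)) * (x (fst e) - x (snd e))))"
  unfolding qf_def by (rule sum.cong) (auto simp: algebra_simps)

lemma qf_bS_definite: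
  assumes "\<forall>u. u \<notin> Vi \<longrightarrow> x u = 0" "qf bS bS x x \<le> 0"
  shows "x u = 0"
proof (rule ccontr)
  assume ne: "x u \<noteq> 0"
  then have "u \<in> Vi" using assms(1) by blast
  then have "0 < (\<Sum>u\<in>Vi. (x u)\<^sup>2)" using usphere_normalize(1)[OF finite_Vi assms(1) _ ne] by blast
  moreover obtain k where "k > 0" "k * (\<Sum>u\<in>Vi. (x u)\<^sup>2) \<le> qf bS bS x x" using coercive_S assms(1) by blast
  ultimately show False using assms(2) mult_pos_pos by fastforce
qed

lemma corrector_qf:
  assumes g: "corrector z g" and y: "\<forall>u. u \<notin> Vi \<longrightarrow> y u = 0"
  shows "qf bS bS y g = (\<Sum>u\<in>V. y u * net E bR bR (ind z) u)"
  unfolding qf_net[symmetric]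
proof (rule sum.cong[OF refl])
  fix u assume "u \<in> V"
  show "y u * net E bS bS g u = y u * net E bR bR (ind z) u"
    using g y unfolding corrector_def by (cases "u \<in> Vi") auto
qed

lemma net_ind_nonpos:
  assumes "r u \<noteq> z"
  shows "net E bR bR (ind z) u \<le> 0"
proof -
  have "ind z u = 0" using assms by (simp add: ind_def)
  then show ?thesis
    unfolding net_at_zero[of "ind z" u, OF \<open>ind z u = 0\<close>] neg_le_0_iff_le
    by (intro add_nonneg_nonneg sum_nonneg) (auto simp: bR_def ind_def)
qed

lemma net_ind_zero:
  assumes "r u \<noteq> z" "\<And>e. e \<in> R \<Longrightarrow> {r (fst e), r (snd e)} \<noteq> {r u, z}"
  shows "net E bR bR (ind z) u = 0"
proof -
  have z: "ind z u = 0" using assms by (simp add: ind_def)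
  have "bR e * ind z (snd e) = 0" if "fst e = u" for e
    using assms(2)[of e] that by (auto simp: bR_def ind_def)
  then have a: "(\<Sum>e\<in>{e\<in>E. fst e = u}. bR e * ind z (snd e)) = 0" by (intro sum.neutral) blast
  have "bR e * ind z (fst e) = 0" if "snd e = u" for e
    using assms(2)[of e] that by (auto simp: bR_def ind_def)
  then have b: "(\<Sum>e\<in>{e\<in>E. snd e = u}. bR e * ind z (fst e)) = 0" by (intro sum.neutral) blast
  show ?thesis unfolding net_at_zero[of "ind z" u, OF z] a b by simp
qed

lemma net_ind_neg:
  assumes Rall: "R = {e\<in>E. r (fst e) \<noteq> r (snd e)}" and u: "r u \<noteq> z" and w: "adj G u w" "r w = z"
  shows "net E bR bR (ind z) u < 0"
proof -
  have z0: "ind z u = 0" using u by (simp add: ind_def)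
  let ?A = "\<Sum>e\<in>{e\<in>E. fst e = u}. bR e * ind z (snd e)" and ?B = "\<Sum>e\<in>{e\<in>E. snd e = u}. bR e * ind z (fst e)"
  have nn: "0 \<le> ?A" "0 \<le> ?B" by (intro sum_nonneg; simp add: bR_def ind_def)+
  have "0 < ?A \<or> 0 < ?B"
    using w(1) unfolding adj_def
  proof
    assume e: "(u, w) \<in> E"
    have "(u, w) \<in> R" unfolding Rall using e u w(2) by simp
    then have p: "0 < bR (u, w) * ind z (snd (u, w))" using w(2) by (simp add: bR_def ind_def)
    have "0 < ?A" by (rule sum_pos2[of _ "(u, w)" "\<lambda>e. bR e * ind z (snd e)", OF _ _ p]) (use finite_E e in \<open>auto simp: bR_def ind_def\<close>)
    then show ?thesis by blast
  next
    assume e: "(w, u) \<in> E"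
    have "(w, u) \<in> R" unfolding Rall using e u w(2) by simp
    then have p: "0 < bR (w, u) * ind z (fst (w, u))" using w(2) by (simp add: bR_def ind_def)
    have "0 < ?B" by (rule sum_pos2[of _ "(w, u)" "\<lambda>e. bR e * ind z (fst e)", OF _ _ p]) (use finite_E e in \<open>auto simp: bR_def ind_def\<close>)
    then show ?thesis by blast
  qed
  then show ?thesis unfolding net_at_zero[of "ind z" u, OF z0] using nn by linarith
qed

text \<open>A maximum principle inside the classes. Test with the positive part \<open>y\<close> of
  \<open>g\<close> off the class \<open>b\<close>: truncation gives
  \<open>qf bS bS y y \<le> qf bS bS y g\<close>, and the right-hand side of the corrector equation
  is non-positive off that class.\<close>

lemma corrector_nonpos:
  assumes g: "corrector b g" and u: "r u \<noteq> b"
  shows "g u \<le> 0"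
proof -
  define y where "y u = (if r u \<noteq> b then max (g u) 0 else 0)" for u
  have ys: "\<forall>u. u \<notin> Vi \<longrightarrow> y u = 0" using g by (simp add: y_def corrector_def)
  have "qf bS bS y y \<le> qf bS bS y g"
    unfolding qf_bS_bilinear
  proof (rule sum_mono)
    fix e
    show "bS e * ((y (fst e) - y (snd e)) * (y (fst e) - y (snd e))) \<le> bS e * ((y (fst e) - y (snd e)) * (g (fst e) - g (snd e)))"
    proof (cases "r (fst e) = r (snd e)")
      case True
      have "(max s 0 - max t 0) * (max s 0 - max t 0) \<le> (max s 0 - max t 0) * (s - t)" for s t :: real
      proof -
        consider "s \<le> 0" "t \<le> 0" | "s \<le> 0" "0 < t" | "0 < s" "t \<le> 0" | "0 < s" "0 < t" by linarith
        then show ?thesis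
        proof cases
          case 2
          then have "t * s \<le> 0" by (intro mult_nonneg_nonpos) auto
          then show ?thesis using 2 by (simp add: max_def algebra_simps)
        next
          case 3
          then have "s * t \<le> 0" by (intro mult_nonneg_nonpos) auto
          then show ?thesis using 3 by (simp add: max_def algebra_simps)
        qed (auto simp: max_def)
      qed
      then show ?thesis using True by (simp add: y_def bS_def)
    qed (simp add: bS_def)
  qed
  also have "\<dots> = (\<Sum>u\<in>V. y u * net E bR bR (ind b) u)" by (rule corrector_qf[OF g ys])
  also have "\<dots> \<le> 0"
  proof (rule sum_nonpos)
    fix u
    show "y u * net E bR bR (ind b) u \<le> 0"
      using net_ind_nonpos[of u b] by (cases "r u = b") (auto simp: y_def intro!: mult_nonneg_nonpos)
  qed
  finally have "y u = 0" using qf_bS_definite[OF ys] by blast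
  then show ?thesis using u by (simp add: y_def max_def split: if_splits)
qed

text \<open>\<open>bS\<close> lives on inside edges, so the corrector equation decouples over the
  classes; in a class without an \<open>R\<close>-edge to \<open>b\<close> its right-hand side is
  zero.\<close>

lemma corrector_zero:
  assumes g: "corrector b g" and u: "r u = a" and ab: "a \<noteq> b" and none: "\<And>e. e \<in> R \<Longrightarrow> {r (fst e), r (snd e)} \<noteq> {a, b}"
  shows "g u = 0"
proof -
  define y where "y u = (if r u = a then g u else 0)" for u
  have ys: "\<forall>u. u \<notin> Vi \<longrightarrow> y u = 0" using g by (simp add: y_def corrector_def)
  have "qf bS bS y y = qf bS bS y g"
    unfolding qf_bS_bilinear by (rule sum.cong) (auto simp: bS_def y_def)
  also have "\<dots> = (\<Sum>u\<in>V. y u * net E bR bR (ind b) u)" by (rule corrector_qf[OF g ys])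
  also have "\<dots> = 0"
  proof (rule sum.neutral, rule ballI)
    fix u
    show "y u * net E bR bR (ind b) u = 0"
    proof (cases "r u = a")
      case True
      then have "net E bR bR (ind b) u = 0" using net_ind_zero[of u b] ab none by blast
      then show ?thesis by simp
    qed (simp add: y_def)
  qed
  finally have "y u = 0" using qf_bS_definite[OF ys] by simp
  then show ?thesis using u by (simp add: y_def)
qed

text \<open>A strong maximum principle: at a zero of \<open>g\<close> the corrector equation equates
  a number that is at most zero with one that is at least zero. Both vanish, and so does
  \<open>g\<close> at the neighbours in the same class.\<close>

lemma corrector_touching_zero:
  assumes g: "corrector b g" and u: "u \<in> Vi" "r u \<noteq> b" "g u = 0"
  shows "net E bR bR (ind b) u = 0" and "adj G u w \<Longrightarrow> r w = r u \<Longrightarrow> g w = 0"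
proof -
  let ?A = "\<Sum>e\<in>{e\<in>E. fst e = u}. bS e * g (snd e)" and ?B = "\<Sum>e\<in>{e\<in>E. snd e = u}. bS e * g (fst e)"
  have t: "bS e * g (snd e) \<le> 0" if "fst e = u" for e
    using corrector_nonpos[OF g, of "snd e"] that u(2) by (auto simp: bS_def)
  have t': "bS e * g (fst e) \<le> 0" if "snd e = u" for e
    using corrector_nonpos[OF g, of "fst e"] that u(2) by (auto simp: bS_def)
  have A: "?A \<le> 0" and B: "?B \<le> 0" using t t' by (auto intro!: sum_nonpos)
  have "net E bS bS g u = net E bR bR (ind b) u" using g u(1) unfolding corrector_def by blast
  from trans[OF this[symmetric] net_at_zero[of g u, OF u(3)]] have e: "net E bR bR (ind b) u = - (?A + ?B)" .
  then show "net E bR bR (ind b) u = 0" using A B net_ind_nonpos[of u b] u(2) by linarith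
  then have AB: "?A = 0" "?B = 0" using e A B by linarith+
  assume w: "adj G u w" "r w = r u"
  have fin: "finite {e\<in>E. fst e = u}" "finite {e\<in>E. snd e = u}" using finite_E by auto
  show "g w = 0"
    using w(1) unfolding adj_def
  proof
    assume e: "(u, w) \<in> E"
    have "- (bS (u, w) * g (snd (u, w))) = 0"
      by (rule sum_nonneg_0[OF fin(1), of "\<lambda>e. - (bS e * g (snd e))"]) (use t AB(1) e in \<open>auto simp: sum_negf\<close>)
    then show ?thesis using w(2) by (simp add: bS_def)
  next
    assume e: "(w, u) \<in> E"
    have "- (bS (w, u) * g (fst (w, u))) = 0"
      by (rule sum_nonneg_0[OF fin(2), of "\<lambda>e. - (bS e * g (fst e))"]) (use t' AB(2) e in \<open>auto simp: sum_negf\<close>)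
    then show ?thesis using w(2) by (simp add: bS_def)
  qed
qed

text \<open>A zero at a vertex bordering on \<open>b\<close> contradicts the strict sign of
  \<open>net_ind_neg\<close>; along a step inside the class a zero would propagate backwards to the
  previous vertex.\<close>

lemma corrector_linked:
  assumes Rall: "R = {e\<in>E. r (fst e) \<noteq> r (snd e)}" and g: "corrector b g" and l: "linked G Vo r b u"
  shows "u \<in> Vi \<and> r u \<noteq> b \<and> g u < 0"
  using l
proof induction
  case (base u w)
  have "g u \<noteq> 0"
    using corrector_touching_zero(1)[OF g base(1,4)] net_ind_neg[OF Rall base(4,2,3)] by auto
  then show ?case using corrector_nonpos[OF g base(4)] base by simp
next
  case (step u u')
  have rb: "r u' \<noteq> b" using step by simp
  have "g u' \<noteq> 0"
    using corrector_touching_zero(2)[OF g step.hyps(3) rb _ adj_sym[OF step.hyps(2)]] step by auto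
  then show ?case using corrector_nonpos[OF g rb] step.hyps(3) rb by simp
qed

text \<open>With no edge between the two classes the second order term decides. By symmetry of the
  form it is the sum of \<open>g v * net E bR bR (ind a) v\<close>. The first factor is zero in the
  class \<open>a\<close>, the second in the class \<open>b\<close>, and elsewhere both are
  non-positive; at the linked vertex \<open>u\<close>, which borders on \<open>a\<close>, both are
  negative.\<close>

lemma schur_pos_linked:
  assumes Rall: "R = {e\<in>E. r (fst e) \<noteq> r (snd e)}" and ab: "a \<in> Vo" "a \<noteq> b"
    and none: "\<And>e. e \<in> E \<Longrightarrow> {r (fst e), r (snd e)} \<noteq> {a, b}"
    and l: "linked G Vo r b u" and w: "adj G u w" "r w = a" "r u \<noteq> a"
  shows "\<forall>\<^sub>F n in sequentially. 0 < schur (ma n) (mb n) a b"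
proof -
  obtain g where g: "corrector b g" using corrector_ex by blast
  have noneR: "{r (fst e), r (snd e)} \<noteq> {a, b}" if "e \<in> R" for e using none R that by blast
  have "0 < qf bR bR g (ind a)"
    unfolding qf_net[symmetric]
  proof (rule sum_pos2[OF finite_V])
    note gl = corrector_linked[OF Rall g l]
    show "u \<in> V" using gl by blast
    show "0 < g u * net E bR bR (ind a) u"
      using gl net_ind_neg[OF Rall w(3,1,2)] by (intro mult_neg_neg) auto
    fix v assume "v \<in> V"
    consider "r v = a" | "r v = b" | "r v \<noteq> a" "r v \<noteq> b" by blast
    then show "0 \<le> g v * net E bR bR (ind a) v"
    proof cases
      case 1
      then show ?thesis using corrector_zero[OF g 1 ab(2) noneR] by simp
    next
      case 2
      then have "net E bR bR (ind a) v = 0"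
        using net_ind_zero[of v a] ab(2) noneR by (metis insert_commute)
      then show ?thesis by simp
    next
      case 3
      then show ?thesis using corrector_nonpos[OF g 3(2)] net_ind_nonpos[OF 3(1)] by (rule_tac mult_nonpos_nonpos)
    qed
  qed
  then have pos: "0 < qf bR bR (ind a) g" by (subst qf_sym)
  have "qf (\<alpha> n) (\<beta> n) (ind a) (ind b) = 0" for n
  proof -
    have "ind a (fst e) * ind b (snd e) + ind a (snd e) * ind b (fst e) = 0" if "e \<in> E" for e
      using none[OF that] by (auto simp: ind_def)
    then have "(\<Sum>e\<in>E. \<beta> n e * (ind a (fst e) * ind b (snd e) + ind a (snd e) * ind b (fst e))) = 0"
      by (intro sum.neutral) simp
    then show ?thesis unfolding qf_ind[OF ab(2)] by simp
  qed
  from schur_pos_second_order[OF ab(1) this g pos] show ?thesis .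
qed

text \<open>The edges of \<open>W\<close> are absent from the limit and have off-diagonal weight
  \<open>- \<beta> n e\<close>, asymptotically \<open>p n\<close>; to first order the entry is
  \<open>p n\<close> times the number of these edges.\<close>

lemma schur_pos_weak:
  assumes xy: "x \<in> Vo" "x \<noteq> y" and W: "W = {e\<in>E. {r (fst e), r (snd e)} = {x, y}}" "W \<noteq> {}" "W \<inter> R = {}"
    and lim: "\<And>e. e \<in> W \<Longrightarrow> (\<lambda>n. \<beta> n e / p n) \<longlonglongrightarrow> -1"
  shows "\<forall>\<^sub>F n in sequentially. 0 < schur (ma n) (mb n) x y"
proof (rule schur_pos_first_order[OF xy(1)])
  have fW: "finite W" using finite_E W(1) by simp
  have "qf (\<alpha> n) (\<beta> n) (ind x) (ind y) / p n = - (\<Sum>e\<in>W. \<beta> n e / p n)" for n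
  proof -
    have "(\<Sum>e\<in>E. \<beta> n e * (ind x (fst e) * ind y (snd e) + ind x (snd e) * ind y (fst e))) = (\<Sum>e\<in>W. \<beta> n e)"
      unfolding W(1) sum.inter_filter[OF finite_E]
      by (rule sum.cong) (use xy(2) in \<open>auto simp: ind_def doubleton_eq_iff\<close>)
    then show ?thesis unfolding qf_ind[OF xy(2)] by (simp add: sum_divide_distrib)
  qed
  moreover have "(\<lambda>n. - (\<Sum>e\<in>W. \<beta> n e / p n)) \<longlonglongrightarrow> - (\<Sum>e\<in>W. -1)"
    by (intro tendsto_intros lim)
  ultimately show "(\<lambda>n. qf (\<alpha> n) (\<beta> n) (ind x) (ind y) / p n) \<longlonglongrightarrow> real (card W)" by simp
  show "0 < real (card W)" using fW W(2) by (simp add: card_gt_0_iff)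
qed

text \<open>Time is rescaled by the positive factor \<open>c\<close>, so only the signs of the Schur complement matter.\<close>

lemma eventually_positive_not_positive:
  assumes "\<forall>t\<ge>1. \<forall>v\<in>Vo. \<forall>w\<in>Vo. 0 < rsg Vo (schur (ma n) (mb n)) t v w"
    and xy: "x \<in> Vo" "y \<in> Vo" "x \<noteq> y" "0 < schur (ma n) (mb n) x y" and ns: "nonsing (ma n) (mb n)"
    and reg: "regular \<mu>" and c: "0 < c" and w: "\<And>e. e \<in> E \<Longrightarrow> wa \<mu> e = c * ma n e" "\<And>e. e \<in> E \<Longrightarrow> wb \<mu> e = c * mb n e"
  shows "complex_of_real \<mu> \<notin> spectrum G Vo \<and> sg_eventually_strongly_positive Vo (dtn_matrix G Vo \<mu>) \<and>
    \<not> sg_positive Vo (dtn_matrix G Vo \<mu>)"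
proof -
  have c0: "c \<noteq> 0" using c by simp
  note d = dtn_schur[OF reg w ns c0]
  have m: "mat_semigroup Vo (dtn_matrix G Vo \<mu>) t v w = complex_of_real (rsg Vo (schur (ma n) (mb n)) (c * t) v w)"
    if "v \<in> Vo" for t v w
    using mat_semigroup_of_real[where t = t and w = w, OF finite_Vo d(2) that] by (simp add: rsg_scale)
  have "sg_eventually_strongly_positive Vo (dtn_matrix G Vo \<mu>)"
    unfolding sg_eventually_strongly_positive_def
  proof (intro exI[of _ "1 / c"] conjI allI impI)
    show "0 < 1 / c" using c by simp
    fix t assume "1 / c \<le> t"
    then have "1 \<le> c * t" using c by (simp add: field_simps)
    then show "entries_pos Vo (mat_semigroup Vo (dtn_matrix G Vo \<mu>) t)"
      unfolding entries_pos_def using assms(1) by (simp add: m)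
  qed
  moreover have "\<not> sg_positive Vo (dtn_matrix G Vo \<mu>)"
  proof
    assume pos: "sg_positive Vo (dtn_matrix G Vo \<mu>)"
    obtain t where t: "0 < t" "rsg Vo (schur (ma n) (mb n)) t x y < 0"
      using rsg_initially_negative[where D = "schur (ma n) (mb n)", OF finite_Vo xy] by blast
    have "0 \<le> t / c" using t c by simp
    then have "entries_nonneg Vo (mat_semigroup Vo (dtn_matrix G Vo \<mu>) (t / c))"
      using pos unfolding sg_positive_def by blast
    then have "0 \<le> rsg Vo (schur (ma n) (mb n)) t x y"
      unfolding entries_nonneg_def using xy(1,2) m[OF xy(1), of "t / c" y] c by fastforce
    then show False using t by simp
  qed
  ultimately show ?thesis using d(1) by blast
qed

end

text \<open>Kronecker's theorem reaches a target \<open>c * q n\<close> only approximately; an error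
  that is small relative to \<open>q n\<close> does not affect the first order behaviour of the
  sine.\<close>

lemma tendsto_sin_quotient:
  fixes \<theta> q p :: "nat \<Rightarrow> real"
  assumes q: "\<And>n. 0 < q n" "q \<longlonglongrightarrow> 0" and p: "p \<longlonglongrightarrow> 0" and \<theta>: "\<And>n. \<bar>\<theta> n - c * q n\<bar> \<le> p n * q n" and c: "c \<noteq> 0"
  shows "\<theta> \<longlonglongrightarrow> 0" and "(\<lambda>n. sin (\<theta> n) / q n) \<longlonglongrightarrow> c"
proof -
  have "\<forall>\<^sub>F n in sequentially. norm (\<theta> n / q n - c) \<le> p n"
  proof (intro always_eventually allI)
    fix n
    have "\<theta> n / q n - c = (\<theta> n - c * q n) / q n" using q(1)[of n] by (simp add: field_simps)
    then have "\<bar>\<theta> n / q n - c\<bar> = \<bar>\<theta> n - c * q n\<bar> / q n" using q(1)[of n] by simp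
    also have "\<dots> \<le> p n" using \<theta>[of n] q(1)[of n] by (simp add: pos_divide_le_eq)
    finally show "norm (\<theta> n / q n - c) \<le> p n" by simp
  qed
  from Lim_null_comparison[OF this p] have l: "(\<lambda>n. \<theta> n / q n) \<longlonglongrightarrow> c" by (simp add: LIM_zero_iff)
  have qn: "q n \<noteq> 0" for n using q(1)[of n] by simp
  have "(\<lambda>n. \<theta> n / q n * q n) \<longlonglongrightarrow> c * 0" by (intro tendsto_intros l q(2))
  then show \<theta>0: "\<theta> \<longlonglongrightarrow> 0" using qn by simp
  have ne: "\<forall>\<^sub>F n in sequentially. \<theta> n \<noteq> 0"
    using tendsto_imp_eventually_ne[OF l c] by eventually_elim auto
  have "((\<lambda>x::real. sin x / x) \<longlongrightarrow> 1) (at 0)"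
    using DERIV_sin[of "0::real"] by (simp add: has_field_derivative_iff)
  moreover have "filterlim \<theta> (at 0) sequentially"
    using \<theta>0 ne by (simp add: filterlim_at)
  ultimately have "(\<lambda>n. sin (\<theta> n) / \<theta> n) \<longlonglongrightarrow> 1" by (rule filterlim_compose)
  then have "(\<lambda>n. sin (\<theta> n) / \<theta> n * (\<theta> n / q n)) \<longlonglongrightarrow> 1 * c" by (intro tendsto_intros l)
  moreover have "\<forall>\<^sub>F n in sequentially. sin (\<theta> n) / \<theta> n * (\<theta> n / q n) = sin (\<theta> n) / q n"
    using ne by eventually_elim simp
  ultimately show "(\<lambda>n. sin (\<theta> n) / q n) \<longlonglongrightarrow> c"
    using Lim_transform_eventually by force
qed

lemma abs_one_minus_cos_le: "\<bar>cos x - 1\<bar> \<le> \<bar>x :: real\<bar>"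
proof -
  have "cos x - 1 = - 2 * (sin (x / 2) * sin (x / 2))"
    using cos_double_sin[of "x / 2"] by (simp add: power2_eq_square)
  moreover have "\<bar>sin (x / 2)\<bar> * \<bar>sin (x / 2)\<bar> \<le> \<bar>x / 2\<bar> * 1"
    by (intro mult_mono abs_sin_x_le_abs_x abs_sin_le_one) auto
  ultimately show ?thesis by (simp add: abs_mult)
qed

context qgraph_locale
begin

text \<open>The angle \<open>- p ^ 3\<close> inside the classes gives, after division by \<open>\<omega> / p\<close>, weights of order \<open>- 1 / p\<^sup>2\<close>.\<close>

lemma contraction_ex:
  assumes ind: "lengths_independent G" and r: "classes r" and W: "W \<subseteq> {e\<in>E. r (fst e) \<noteq> r (snd e)}"
  shows "\<exists>p \<alpha> \<beta> \<kappa> \<omega>. contraction G Vo r ({e\<in>E. r (fst e) \<noteq> r (snd e)} - W) p \<alpha> \<beta> \<kappa> \<and>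
    (\<forall>e\<in>W. (\<lambda>n. \<beta> n e / p n) \<longlonglongrightarrow> -1) \<and> (\<forall>n. 0 < \<omega> n \<and> \<mu>0 < (\<omega> n)\<^sup>2) \<and>
    (\<forall>\<^sub>F n in sequentially. regular ((\<omega> n)\<^sup>2)) \<and>
    (\<forall>n. \<forall>e\<in>E. wa ((\<omega> n)\<^sup>2) e = \<omega> n / p n * (\<alpha> n e - \<kappa> n e / (p n)\<^sup>2) \<and> wb ((\<omega> n)\<^sup>2) e = \<omega> n / p n * (\<beta> n e - \<kappa> n e / (p n)\<^sup>2))"
proof -
  define p :: "nat \<Rightarrow> real" where "p n = 1 / (real n + 2)" for n
  have p0: "0 < p n" and p1: "p n \<le> 1" for n by (simp_all add: p_def)
  have pl: "p \<longlonglongrightarrow> 0"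
    unfolding p_def using LIMSEQ_ignore_initial_segment[OF lim_1_over_n, of 2] by (simp add: add.commute)
  define S where "S e \<longleftrightarrow> r (fst e) = r (snd e)" for e
  define target where "target n e = (if S e then - (p n ^ 3) else if e \<in> W then - pi / 2 else p n)" for n e
  \<comment> \<open>The tolerance \<open>p n ^ 4\<close> is \<open>p n\<close> times the smallest
    target \<open>p n ^ 3\<close>, hence negligible relative to every target.\<close>
  have "\<forall>n. \<exists>\<omega>. \<exists>\<theta>. 0 < \<omega> \<and> \<mu>0 < \<omega>\<^sup>2 \<and> (\<forall>e\<in>E. \<bar>\<theta> e - target n e\<bar> < p n ^ 4 \<and> cos (\<omega> * len G e) = cos (\<theta> e) \<and> sin (\<omega> * len G e) = sin (\<theta> e))"
    by (intro allI prescribed_angles_trig[OF ind] zero_less_power p0)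
  from choice[OF this] obtain \<omega> where
    "\<forall>n. \<exists>\<theta>. 0 < \<omega> n \<and> \<mu>0 < (\<omega> n)\<^sup>2 \<and> (\<forall>e\<in>E. \<bar>\<theta> e - target n e\<bar> < p n ^ 4 \<and> cos (\<omega> n * len G e) = cos (\<theta> e) \<and> sin (\<omega> n * len G e) = sin (\<theta> e))" ..
  from choice[OF this] obtain \<theta> where
    "\<forall>n. 0 < \<omega> n \<and> \<mu>0 < (\<omega> n)\<^sup>2 \<and> (\<forall>e\<in>E. \<bar>\<theta> n e - target n e\<bar> < p n ^ 4 \<and> cos (\<omega> n * len G e) = cos (\<theta> n e) \<and> sin (\<omega> n * len G e) = sin (\<theta> n e))" ..
  then have \<omega>: "0 < \<omega> n" "\<mu>0 < (\<omega> n)\<^sup>2" and \<theta>: "e \<in> E \<Longrightarrow> \<bar>\<theta> n e - target n e\<bar> < p n ^ 4"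
    and trig: "e \<in> E \<Longrightarrow> cos (\<omega> n * len G e) = cos (\<theta> n e)" "e \<in> E \<Longrightarrow> sin (\<omega> n * len G e) = sin (\<theta> n e)" for n e
    by auto
  \<comment> \<open>On an inside edge \<open>\<kappa>\<close> absorbs the whole off-diagonal weight
    \<open>p n / sin (\<theta> n e)\<close>. Thus \<open>\<beta>\<close> is zero there, and
    \<open>\<alpha>\<close> keeps the difference of the two weights, which tends to zero.\<close>
  define \<alpha> where "\<alpha> n e = (if S e then p n * (cos (\<theta> n e) - 1) / sin (\<theta> n e) else p n * cos (\<theta> n e) / sin (\<theta> n e))" for n e
  define \<beta> where "\<beta> n e = (if S e then 0 else p n / sin (\<theta> n e))" for n e
  define \<kappa> where "\<kappa> n e = (if S e then - (p n ^ 3) / sin (\<theta> n e) else 0)" for n e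
  have limS: "(\<lambda>n. \<kappa> n e) \<longlonglongrightarrow> 1" "(\<lambda>n. \<alpha> n e) \<longlonglongrightarrow> 0" "\<forall>\<^sub>F n in sequentially. sin (\<theta> n e) \<noteq> 0" if e: "e \<in> E" "S e" for e
  proof -
    have b: "\<bar>\<theta> n e - (-1) * p n ^ 3\<bar> \<le> p n * p n ^ 3" for n
      using \<theta>[OF e(1), of n] e(2) by (simp add: target_def power_Suc[symmetric] numeral_eq_Suc del: power_Suc)
    have p3: "(\<lambda>n. p n ^ 3) \<longlonglongrightarrow> 0" using tendsto_power[OF pl, of 3] by simp
    have p3': "0 < p n ^ 3" for n using p0[of n] by simp
    have l: "(\<lambda>n. sin (\<theta> n e) / p n ^ 3) \<longlonglongrightarrow> -1"
      by (rule tendsto_sin_quotient(2)[OF p3' p3 pl b]) simp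
    have "(\<lambda>n. - inverse (sin (\<theta> n e) / p n ^ 3)) \<longlonglongrightarrow> - inverse (-1)" by (intro tendsto_intros l) simp
    then show "(\<lambda>n. \<kappa> n e) \<longlonglongrightarrow> 1" using e(2) by (simp add: \<kappa>_def)
    have "\<forall>\<^sub>F n in sequentially. norm ((cos (\<theta> n e) - 1) / (p n)\<^sup>2) \<le> 2 * p n"
    proof (intro always_eventually allI)
      fix n
      have "p n * p n ^ 3 \<le> 1 * p n ^ 3" using p1[of n] p0[of n] by (intro mult_right_mono) auto
      then have "\<bar>\<theta> n e\<bar> \<le> 2 * p n ^ 3" using b[of n] by simp
      then have "\<bar>cos (\<theta> n e) - 1\<bar> \<le> 2 * p n ^ 3" using abs_one_minus_cos_le order_trans by blast
      then have "\<bar>cos (\<theta> n e) - 1\<bar> \<le> 2 * p n * (p n)\<^sup>2" by (simp add: power2_eq_square power3_eq_cube mult.assoc)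
      then show "norm ((cos (\<theta> n e) - 1) / (p n)\<^sup>2) \<le> 2 * p n" using p0[of n] by (simp add: pos_divide_le_eq)
    qed
    moreover have "(\<lambda>n. 2 * p n) \<longlonglongrightarrow> 0" using tendsto_mult_right_zero[OF pl, of 2] by simp
    ultimately have "(\<lambda>n. (cos (\<theta> n e) - 1) / (p n)\<^sup>2) \<longlonglongrightarrow> 0" by (rule Lim_null_comparison)
    then have "(\<lambda>n. ((cos (\<theta> n e) - 1) / (p n)\<^sup>2) / (sin (\<theta> n e) / p n ^ 3)) \<longlonglongrightarrow> 0 / -1" by (intro tendsto_divide l) auto
    moreover have "((cos (\<theta> n e) - 1) / (p n)\<^sup>2) / (sin (\<theta> n e) / p n ^ 3) = p n * (cos (\<theta> n e) - 1) / sin (\<theta> n e)" for n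
      using p0[of n] by (simp add: power2_eq_square power3_eq_cube)
    ultimately show "(\<lambda>n. \<alpha> n e) \<longlonglongrightarrow> 0" using e(2) by (simp add: \<alpha>_def)
    have "\<forall>\<^sub>F n in sequentially. sin (\<theta> n e) / p n ^ 3 \<noteq> 0" by (rule tendsto_imp_eventually_ne[OF l]) simp
    then show "\<forall>\<^sub>F n in sequentially. sin (\<theta> n e) \<noteq> 0" by eventually_elim auto
  qed
  have limR: "(\<lambda>n. \<alpha> n e) \<longlonglongrightarrow> 1" "(\<lambda>n. \<beta> n e) \<longlonglongrightarrow> 1" "\<forall>\<^sub>F n in sequentially. sin (\<theta> n e) \<noteq> 0" if e: "e \<in> E" "\<not> S e" "e \<notin> W" for e
  proof -
    have b: "\<bar>\<theta> n e - 1 * p n\<bar> \<le> p n * p n" for n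
    proof -
      have "p n ^ 4 \<le> p n ^ 2" using p0[of n] p1[of n] by (intro power_decreasing) auto
      then show ?thesis using \<theta>[OF e(1), of n] e(2,3) by (simp add: target_def power2_eq_square)
    qed
    have l: "(\<lambda>n. sin (\<theta> n e) / p n) \<longlonglongrightarrow> 1" and t: "(\<lambda>n. \<theta> n e) \<longlonglongrightarrow> 0"
      using tendsto_sin_quotient[OF p0 pl pl b] by simp_all
    have "(\<lambda>n. inverse (sin (\<theta> n e) / p n)) \<longlonglongrightarrow> inverse 1" by (intro tendsto_intros l) simp
    then have i: "(\<lambda>n. p n / sin (\<theta> n e)) \<longlonglongrightarrow> 1" by simp
    then show "(\<lambda>n. \<beta> n e) \<longlonglongrightarrow> 1" using e(2) by (simp add: \<beta>_def)
    have "(\<lambda>n. cos (\<theta> n e) * (p n / sin (\<theta> n e))) \<longlonglongrightarrow> cos 0 * 1" by (intro tendsto_intros t i)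
    then show "(\<lambda>n. \<alpha> n e) \<longlonglongrightarrow> 1" using e(2) by (simp add: \<alpha>_def mult.commute)
    have "\<forall>\<^sub>F n in sequentially. sin (\<theta> n e) / p n \<noteq> 0" by (rule tendsto_imp_eventually_ne[OF l]) simp
    then show "\<forall>\<^sub>F n in sequentially. sin (\<theta> n e) \<noteq> 0" by eventually_elim auto
  qed
  have limW: "(\<lambda>n. \<alpha> n e) \<longlonglongrightarrow> 0" "(\<lambda>n. \<beta> n e) \<longlonglongrightarrow> 0" "(\<lambda>n. \<beta> n e / p n) \<longlonglongrightarrow> -1" "\<forall>\<^sub>F n in sequentially. sin (\<theta> n e) \<noteq> 0"
    if e: "e \<in> E" "\<not> S e" "e \<in> W" for e
  proof -
    have "\<forall>\<^sub>F n in sequentially. norm (\<theta> n e - (- pi / 2)) \<le> p n ^ 4"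
    proof (intro always_eventually allI)
      fix n show "norm (\<theta> n e - (- pi / 2)) \<le> p n ^ 4"
        using \<theta>[OF e(1), of n] e(2,3) by (simp add: target_def)
    qed
    moreover have "(\<lambda>n. p n ^ 4) \<longlonglongrightarrow> 0" using tendsto_power[OF pl, of 4] by simp
    ultimately have "(\<lambda>n. \<theta> n e - (- pi / 2)) \<longlonglongrightarrow> 0" by (rule Lim_null_comparison)
    then have t: "(\<lambda>n. \<theta> n e) \<longlonglongrightarrow> - pi / 2" using LIM_zero_iff by blast
    have s: "(\<lambda>n. sin (\<theta> n e)) \<longlonglongrightarrow> -1" using tendsto_sin[OF t] by simp
    have c: "(\<lambda>n. cos (\<theta> n e)) \<longlonglongrightarrow> 0" using tendsto_cos[OF t] by simp
    have "(\<lambda>n. p n * cos (\<theta> n e) / sin (\<theta> n e)) \<longlonglongrightarrow> 0 * 0 / -1" by (intro tendsto_intros pl c s) simp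
    then show "(\<lambda>n. \<alpha> n e) \<longlonglongrightarrow> 0" using e(2) by (simp add: \<alpha>_def)
    have "(\<lambda>n. p n / sin (\<theta> n e)) \<longlonglongrightarrow> 0 / -1" by (intro tendsto_intros pl s) simp
    then show "(\<lambda>n. \<beta> n e) \<longlonglongrightarrow> 0" using e(2) by (simp add: \<beta>_def)
    have "(\<lambda>n. 1 / sin (\<theta> n e)) \<longlonglongrightarrow> 1 / -1" by (intro tendsto_intros s) simp
    moreover have "\<beta> n e / p n = 1 / sin (\<theta> n e)" for n using p0[of n] e(2) by (simp add: \<beta>_def)
    ultimately show "(\<lambda>n. \<beta> n e / p n) \<longlonglongrightarrow> -1" by simp
    show "\<forall>\<^sub>F n in sequentially. sin (\<theta> n e) \<noteq> 0" by (rule tendsto_imp_eventually_ne[OF s]) simp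
  qed
  let ?R = "{e\<in>E. r (fst e) \<noteq> r (snd e)} - W"
  have WS: "e \<in> E" "\<not> S e" if "e \<in> W" for e using W that by (auto simp: S_def)
  have "contraction G Vo r ?R p \<alpha> \<beta> \<kappa>"
  proof
    show "(\<lambda>n. \<alpha> n e) \<longlonglongrightarrow> (if e \<in> ?R then 1 else 0)" if "e \<in> E" for e
    proof -
      consider "S e" | "\<not> S e" "e \<in> W" | "\<not> S e" "e \<notin> W" by blast
      then show ?thesis by cases (use limS(2) limW(1) limR(1) that in \<open>auto simp: S_def\<close>)
    qed
    show "(\<lambda>n. \<beta> n e) \<longlonglongrightarrow> (if e \<in> ?R then 1 else 0)" if "e \<in> E" for e
    proof -
      consider "S e" | "\<not> S e" "e \<in> W" | "\<not> S e" "e \<notin> W" by blast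
      then show ?thesis
      proof cases
        case 1
        then show ?thesis by (simp add: \<beta>_def S_def)
      qed (use limW(2) limR(2) that in \<open>auto simp: S_def\<close>)
    qed
    show "(\<lambda>n. \<kappa> n e) \<longlonglongrightarrow> (if r (fst e) = r (snd e) then 1 else 0)" if "e \<in> E" for e
    proof (cases "S e")
      case True
      then show ?thesis using limS(1)[OF that True] by (simp add: S_def)
    next
      case False
      then show ?thesis by (simp add: S_def \<kappa>_def)
    qed
  qed (use r p0 pl in \<open>auto simp: \<kappa>_def S_def\<close>)
  moreover have "\<forall>\<^sub>F n in sequentially. regular ((\<omega> n)\<^sup>2)"
  proof -
    have "\<forall>\<^sub>F n in sequentially. \<forall>e\<in>E. sin (\<theta> n e) \<noteq> 0"
      using limS(3) limR(3) limW(4) by (intro eventually_ball_finite finite_E ballI) blast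
    then show ?thesis by eventually_elim (simp add: weights_square(3)[OF \<omega>(1)] trig)
  qed
  moreover have "wa ((\<omega> n)\<^sup>2) e = \<omega> n / p n * (\<alpha> n e - \<kappa> n e / (p n)\<^sup>2) \<and> wb ((\<omega> n)\<^sup>2) e = \<omega> n / p n * (\<beta> n e - \<kappa> n e / (p n)\<^sup>2)"
    if "e \<in> E" for n e
  proof (cases "S e")
    case True
    have "- (p n ^ 3) / sin (\<theta> n e) / (p n)\<^sup>2 = - p n / sin (\<theta> n e)"
      using p0[of n] by (simp add: power2_eq_square power3_eq_cube)
    then have k: "\<kappa> n e / (p n)\<^sup>2 = - p n / sin (\<theta> n e)" using True by (simp add: \<kappa>_def)
    show ?thesis
      unfolding weights_square(1,2)[OF \<omega>(1)] trig[OF that] k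
      using True p0[of n] by (simp add: \<alpha>_def \<beta>_def diff_divide_distrib right_diff_distrib)
  next
    case False
    then show ?thesis
      unfolding weights_square(1,2)[OF \<omega>(1)] trig[OF that]
      using p0[of n] by (simp add: \<alpha>_def \<beta>_def \<kappa>_def)
  qed
  ultimately show ?thesis using \<omega> limW(3) WS
    by (intro exI[of _ p] exI[of _ \<alpha>] exI[of _ \<beta>] exI[of _ \<kappa>] exI[of _ \<omega>]) blast
qed

end

context contraction
begin

lemma eventually_positive_contraction:
  assumes cross: "\<And>T. T \<subseteq> Vo \<Longrightarrow> T \<noteq> {} \<Longrightarrow> T \<noteq> Vo \<Longrightarrow> \<exists>e\<in>R. r (fst e) \<in> T \<longleftrightarrow> r (snd e) \<notin> T"
    and xy: "x \<in> Vo" "y \<in> Vo" "x \<noteq> y" and pos: "\<forall>\<^sub>F n in sequentially. 0 < schur (ma n) (mb n) x y"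
    and \<omega>: "\<And>n. 0 < \<omega> n \<and> \<mu>0 < (\<omega> n)\<^sup>2" and reg: "\<forall>\<^sub>F n in sequentially. regular ((\<omega> n)\<^sup>2)"
    and w: "\<And>n e. e \<in> E \<Longrightarrow> wa ((\<omega> n)\<^sup>2) e = \<omega> n / p n * ma n e \<and> wb ((\<omega> n)\<^sup>2) e = \<omega> n / p n * mb n e"
  shows "\<exists>\<mu>>\<mu>0. complex_of_real \<mu> \<notin> spectrum G Vo \<and> sg_eventually_strongly_positive Vo (dtn_matrix G Vo \<mu>) \<and>
    \<not> sg_positive Vo (dtn_matrix G Vo \<mu>)"
proof -
  have "\<forall>\<^sub>F n in sequentially. (\<forall>t\<ge>1. \<forall>v\<in>Vo. \<forall>w\<in>Vo. 0 < rsg Vo (schur (ma n) (mb n)) t v w) \<and>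
      0 < schur (ma n) (mb n) x y \<and> nonsing (ma n) (mb n) \<and> regular ((\<omega> n)\<^sup>2)"
    by (intro eventually_conj eventually_rsg_pos cross pos eventually_nonsing reg)
  from eventually_happens'[OF sequentially_bot this] obtain n where n: "\<forall>t\<ge>1. \<forall>v\<in>Vo. \<forall>w\<in>Vo. 0 < rsg Vo (schur (ma n) (mb n)) t v w"
      "0 < schur (ma n) (mb n) x y" "nonsing (ma n) (mb n)" "regular ((\<omega> n)\<^sup>2)"
    by blast
  have c: "0 < \<omega> n / p n" using \<omega> p(1) by simp
  show ?thesis
    using eventually_positive_not_positive[OF n(1) xy n(2,3,4) c] w \<omega> by blast
qed

end

context qgraph_locale
begin

section \<open>The quotient graph: with a cycle and without one\<close>

definition class_adj :: "('v \<Rightarrow> 'v) \<Rightarrow> 'v \<Rightarrow> 'v \<Rightarrow> bool" where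
  "class_adj r a b \<longleftrightarrow> a \<noteq> b \<and> (\<exists>e\<in>E. {r (fst e), r (snd e)} = {a, b})"

lemma class_adjI: "adj G u w \<Longrightarrow> r u \<noteq> r w \<Longrightarrow> class_adj r (r u) (r w)"
  unfolding class_adj_def adj_def by force

lemma class_adj_sym: "class_adj r a b \<Longrightarrow> class_adj r b a"
  unfolding class_adj_def by (metis insert_commute)

text \<open>Connectedness of the quotient graph: otherwise the vertices whose class lies in
  \<open>T\<close> would be closed under adjacency.\<close>

lemma class_boundary:
  assumes r: "classes r" and T: "T \<subseteq> Vo" "T \<noteq> {}" "T \<noteq> Vo"
  shows "\<exists>e\<in>E. r (fst e) \<in> T \<longleftrightarrow> r (snd e) \<notin> T"
proof (rule ccontr)
  assume *: "\<not> ?thesis"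
  have r_Vo: "r v = v" if "v \<in> Vo" for v using r that by (simp add: classes_def)
  have "{u\<in>V. r u \<in> T} = V"
  proof (rule connected_closed_set)
    show "{u\<in>V. r u \<in> T} \<noteq> {}" using T Vo r_Vo by force
    fix v w assume "v \<in> {u\<in>V. r u \<in> T}" "adj G v w"
    then show "w \<in> {u\<in>V. r u \<in> T}" using * adj_V(2) unfolding adj_def by force
  qed auto
  then show False using T Vo r_Vo by (metis (no_types, lifting) mem_Collect_eq subset_antisym subset_iff)
qed

lemma linked_class_adj:
  assumes "linked G Vo r b u"
  shows "class_adj r (r u) b" and "u \<in> Vi" and "b \<in> r ` V"
proof -
  have "class_adj r (r u) b \<and> u \<in> Vi \<and> b \<in> r ` V"
    using assms
  proof induction
    case (base u w)
    then show ?case using class_adjI[OF base(2), of r] adj_V(2)[OF base(2)] by auto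
  qed auto
  then show "class_adj r (r u) b" "u \<in> Vi" "b \<in> r ` V" by blast+
qed

text \<open>\<open>x\<close> and \<open>y\<close> are the ends of the cycle written as a list.
  Moving all edges between these two classes into \<open>W\<close> leaves the quotient connected, as
  the rest of the cycle is a detour; the limit matrix stays irreducible while the entry for
  \<open>x\<close>, \<open>y\<close> becomes positive.\<close>

lemma eventually_positive_class_cycle:
  assumes ind: "lengths_independent G" and r: "classes r" and cyc: "has_cycle Vo (class_adj r)"
  shows "\<exists>\<mu>>\<mu>0. complex_of_real \<mu> \<notin> spectrum G Vo \<and> sg_eventually_strongly_positive Vo (dtn_matrix G Vo \<mu>) \<and>
    \<not> sg_positive Vo (dtn_matrix G Vo \<mu>)"
proof -
  obtain q where q: "3 \<le> length q" "set q \<subseteq> Vo" "distinct q" "successively (class_adj r) q" "class_adj r (last q) (hd q)"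
    using cyc unfolding has_cycle_def is_path_def by blast
  have qne: "q \<noteq> []" using q(1) by auto
  define x y where "x = last q" and "y = hd q"
  have xy: "x \<in> Vo" "y \<in> Vo" "x \<noteq> y" using q(2,5) qne by (auto simp: x_def y_def class_adj_def)
  define W where "W = {e\<in>E. {r (fst e), r (snd e)} = {x, y}}"
  have Wne: "W \<noteq> {}" using q(5) unfolding W_def class_adj_def x_def y_def by blast
  have Wsub: "W \<subseteq> {e\<in>E. r (fst e) \<noteq> r (snd e)}" using xy(3) by (auto simp: W_def)
  let ?R = "{e\<in>E. r (fst e) \<noteq> r (snd e)} - W"
  have detour: "\<exists>e\<in>?R. r (fst e) \<in> T \<longleftrightarrow> r (snd e) \<notin> T" if T: "y \<in> T" "x \<notin> T" for T
  proof -
    obtain q1 c d q2 where s: "q = q1 @ c # d # q2" "c \<in> T" "d \<notin> T" "class_adj r c d"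
      using successively_crossing[OF q(4) _ _ qne] T unfolding x_def y_def by blast
    \<comment> \<open>A crossing from \<open>y\<close> directly to \<open>x\<close> would join the
      first to the last element of the distinct list, which has at least three elements.\<close>
    have "{c, d} \<noteq> {x, y}"
    proof
      assume "{c, d} = {x, y}"
      then have "c = y" "d = x" using s(2,3) T by (auto simp: doubleton_eq_iff)
      then have "hd q = c" "last q = d" unfolding x_def y_def by blast+
      note this[unfolded s(1)]
      moreover note q(1,3)[unfolded s(1)]
      ultimately show False by (cases q1; cases q2 rule: rev_cases) auto
    qed
    moreover obtain e where "e \<in> E" "{r (fst e), r (snd e)} = {c, d}" using s(4) unfolding class_adj_def by blast
    ultimately show ?thesis using s(2,3)
      by (intro bexI[of _ e]) (auto simp: W_def doubleton_eq_iff)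
  qed
  have cross: "\<exists>e\<in>?R. r (fst e) \<in> T \<longleftrightarrow> r (snd e) \<notin> T" if T: "T \<subseteq> Vo" "T \<noteq> {}" "T \<noteq> Vo" for T
  proof -
    obtain e where e: "e \<in> E" "r (fst e) \<in> T \<longleftrightarrow> r (snd e) \<notin> T" using class_boundary[OF r T] by blast
    show ?thesis
    proof (cases "e \<in> W")
      case True
      then have "x \<in> T \<longleftrightarrow> y \<notin> T" using e(2) by (auto simp: W_def doubleton_eq_iff)
      then show ?thesis using detour[of T] detour[of "- T"] by auto
    next
      case False
      then show ?thesis using e by (intro bexI[of _ e]) auto
    qed
  qed
  obtain p \<alpha> \<beta> \<kappa> \<omega> where con: "contraction G Vo r ?R p \<alpha> \<beta> \<kappa>" and lim: "\<forall>e\<in>W. (\<lambda>n. \<beta> n e / p n) \<longlonglongrightarrow> -1"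
    and \<omega>: "\<forall>n. 0 < \<omega> n \<and> \<mu>0 < (\<omega> n)\<^sup>2" and reg: "\<forall>\<^sub>F n in sequentially. regular ((\<omega> n)\<^sup>2)"
    and w: "\<forall>n. \<forall>e\<in>E. wa ((\<omega> n)\<^sup>2) e = \<omega> n / p n * (\<alpha> n e - \<kappa> n e / (p n)\<^sup>2) \<and> wb ((\<omega> n)\<^sup>2) e = \<omega> n / p n * (\<beta> n e - \<kappa> n e / (p n)\<^sup>2)"
    using contraction_ex[OF ind r Wsub, of \<mu>0] by blast
  interpret contraction G Vo r ?R p \<alpha> \<beta> \<kappa> by (rule con)
  have "\<forall>\<^sub>F n in sequentially. 0 < schur (ma n) (mb n) x y"
    by (rule schur_pos_weak[OF xy(1,3) W_def Wne]) (use lim in auto)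
  from eventually_positive_contraction[OF cross xy this _ reg, of \<mu>0] \<omega> w show ?thesis unfolding ma_def mb_def by blast
qed

text \<open>Follow the connecting path from \<open>x\<close>. Without a branching, each of its inner
  vertices lies in the class of \<open>x\<close> or is linked to it, because leaving a linked class
  towards a third class is a branching. The last step to \<open>y\<close> then makes the classes of
  \<open>x\<close> and \<open>y\<close> adjacent or is itself a branching.\<close>

lemma linked_branching:
  assumes r: "classes r" and red: "reduced_adj G Vo x y" and nadj: "\<not> class_adj r x y"
  shows "\<exists>b u w. linked G Vo r b u \<and> adj G u w \<and> r u \<noteq> r w \<and> r w \<noteq> b"
proof (rule ccontr)
  assume none: "\<not> ?thesis"
  have r_Vo: "r v = v" if "v \<in> Vo" for v using r that by (simp add: classes_def)
  have xy: "x \<in> Vo" "y \<in> Vo" "x \<noteq> y" using red by (auto simp: reduced_adj_def)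
  have nxy: "\<not> adj G x y" using class_adjI[of x y r] nadj xy r_Vo by auto
  obtain q where q: "q \<noteq> []" "set q \<subseteq> Vi" "successively (adj G) (x # q @ [y])"
    using red nxy unfolding reduced_adj_def is_path_def by blast
  have inv: "r (last q') = x \<or> linked G Vo r x (last q')" if "q' \<noteq> []" "set q' \<subseteq> Vi" "successively (adj G) (x # q')" for q'
    using that
  proof (induction q' rule: rev_induct)
    case (snoc u' q')
    show ?case
    proof (cases "q' = []")
      case True
      then have "adj G x u'" "u' \<in> Vi" using snoc.prems by auto
      then show ?thesis using linked.base[OF _ adj_sym[of x u'], of Vo r x] r_Vo[OF xy(1)] True by auto
    next
      case False
      let ?u = "last q'"
      have suc: "successively (adj G) (x # q')" "adj G ?u u'"
        using snoc.prems(3) False by (simp_all add: successively_append_iff successively_Cons)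
      have u': "u' \<in> Vi" using snoc.prems(2) by simp
      have "r ?u = x \<or> linked G Vo r x ?u" using snoc.IH[OF False _ suc(1)] snoc.prems(2) by simp
      then have "r u' = x \<or> linked G Vo r x u'"
      proof
        assume "r ?u = x"
        then show ?thesis using linked.base[OF u' adj_sym[OF suc(2)], of r x] by blast
      next
        assume l: "linked G Vo r x ?u"
        show ?thesis
        proof (cases "r u' = r ?u")
          case True
          then show ?thesis using linked.step[OF l suc(2) u'] by blast
        next
          case False
          then show ?thesis using none l suc(2) by metis
        qed
      qed
      then show ?thesis by simp
    qed
  qed simp
  have l: "successively (adj G) (x # q)" "adj G (last q) y"
    using q by (simp_all add: successively_append_iff successively_Cons)
  from inv[OF q(1,2) l(1)] show False
  proof
    assume "r (last q) = x"
    then show False using class_adjI[OF l(2), of r] xy nadj r_Vo by auto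
  next
    assume k: "linked G Vo r x (last q)"
    show False
    proof (cases "r (last q) = y")
      case True
      then show False using linked_class_adj(1)[OF k] class_adj_sym nadj by blast
    next
      case False
      then show False using none k l(2) r_Vo xy by metis
    qed
  qed
qed

text \<open>Some edge of the cycle in the reduced graph is missing in the quotient, since the
  quotient has no cycle; this yields a branching class \<open>r u\<close> between \<open>b\<close>
  and \<open>r w\<close>. These two are not adjacent, as the three classes would otherwise form a
  triangle. With \<open>W\<close> empty, all edges between classes survive in the limit.\<close>

lemma eventually_positive_class_forest:
  assumes ind: "lengths_independent G" and r: "classes r" and cyc: "\<not> has_cycle Vo (class_adj r)"
    and red: "has_cycle Vo (reduced_adj G Vo)"
  shows "\<exists>\<mu>>\<mu>0. complex_of_real \<mu> \<notin> spectrum G Vo \<and> sg_eventually_strongly_positive Vo (dtn_matrix G Vo \<mu>) \<and>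
    \<not> sg_positive Vo (dtn_matrix G Vo \<mu>)"
proof -
  have r_in: "r u \<in> Vo" if "u \<in> V" for u using r that by (simp add: classes_def)
  obtain x y where xy: "reduced_adj G Vo x y" "\<not> class_adj r x y"
  proof (rule ccontr)
    assume *: "\<not> thesis"
    then have sub: "class_adj r x y" if "reduced_adj G Vo x y" for x y using that \<open>\<And>x y. reduced_adj G Vo x y \<Longrightarrow> \<not> class_adj r x y \<Longrightarrow> thesis\<close> by blast
    obtain q where q: "3 \<le> length q" "set q \<subseteq> Vo" "is_path (reduced_adj G Vo) q" "reduced_adj G Vo (last q) (hd q)"
      using red unfolding has_cycle_def by blast
    have "is_path (class_adj r) q" by (rule is_path_mono[OF q(3)]) (rule sub)
    then show False using cyc q sub unfolding has_cycle_def by blast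
  qed
  obtain b u w where l: "linked G Vo r b u" "adj G u w" "r u \<noteq> r w" "r w \<noteq> b"
    using linked_branching[OF r xy] by blast
  have b: "b \<in> Vo" using linked_class_adj(3)[OF l(1)] r_in by blast
  have a: "r w \<in> Vo" using adj_V(2)[OF l(2)] r_in by blast
  have z: "r u \<in> Vo" using linked_class_adj(2)[OF l(1)] r_in by blast
  have none: "\<not> class_adj r (r w) b"
  proof
    assume n: "class_adj r (r w) b"
    have "has_cycle Vo (class_adj r)"
      unfolding has_cycle_def is_path_def
      by (rule exI[of _ "[r w, r u, b]"])
        (use n a b z l linked_class_adj(1)[OF l(1)] class_adjI[OF l(2,3)] class_adj_sym in \<open>auto simp: class_adj_def[of r "r u" b]\<close>)
    then show False using cyc by blast
  qed
  let ?R = "{e\<in>E. r (fst e) \<noteq> r (snd e)} - {}"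
  have cross: "\<exists>e\<in>?R. r (fst e) \<in> T \<longleftrightarrow> r (snd e) \<notin> T" if T: "T \<subseteq> Vo" "T \<noteq> {}" "T \<noteq> Vo" for T
  proof -
    obtain e where "e \<in> E" "r (fst e) \<in> T \<longleftrightarrow> r (snd e) \<notin> T" using class_boundary[OF r T] by blast
    then show ?thesis by (intro bexI[of _ e]) auto
  qed
  obtain p \<alpha> \<beta> \<kappa> \<omega> where con: "contraction G Vo r ?R p \<alpha> \<beta> \<kappa>"
    and \<omega>: "\<forall>n. 0 < \<omega> n \<and> \<mu>0 < (\<omega> n)\<^sup>2" and reg: "\<forall>\<^sub>F n in sequentially. regular ((\<omega> n)\<^sup>2)"
    and w: "\<forall>n. \<forall>e\<in>E. wa ((\<omega> n)\<^sup>2) e = \<omega> n / p n * (\<alpha> n e - \<kappa> n e / (p n)\<^sup>2) \<and> wb ((\<omega> n)\<^sup>2) e = \<omega> n / p n * (\<beta> n e - \<kappa> n e / (p n)\<^sup>2)"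
    using contraction_ex[OF ind r empty_subsetI, of \<mu>0] by blast
  interpret contraction G Vo r ?R p \<alpha> \<beta> \<kappa> by (rule con)
  have "\<forall>\<^sub>F n in sequentially. 0 < schur (ma n) (mb n) (r w) b"
    by (rule schur_pos_linked[OF _ a l(4) _ l(1,2) refl l(3)]) (use none l(4) in \<open>auto simp: class_adj_def\<close>)
  from eventually_positive_contraction[OF cross a b l(4) this _ reg, of \<mu>0] \<omega> w show ?thesis unfolding ma_def mb_def by blast
qed

lemma eventually_positive_recurs:
  assumes "lengths_independent G" "has_cycle Vo (reduced_adj G Vo)"
  shows "\<exists>\<mu>>\<mu>0. complex_of_real \<mu> \<notin> spectrum G Vo \<and> sg_eventually_strongly_positive Vo (dtn_matrix G Vo \<mu>) \<and>
    \<not> sg_positive Vo (dtn_matrix G Vo \<mu>)"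
proof -
  obtain r where r: "classes r" using classes_ex by blast
  show ?thesis
    using eventually_positive_class_cycle[OF assms(1) r] eventually_positive_class_forest[OF assms(1) r _ assms(2)] by blast
qed

end

theorem theorem1p3:
  fixes G :: "'v qgraph" and Vo :: "'v set"
  assumes "quantum_graph G" and "Vo \<subseteq> verts G" and "Vo \<noteq> {}"
  shows "(\<forall>\<mu>. \<mu> < lambda1 G Vo \<longrightarrow> sg_strongly_positive Vo (dtn_matrix G Vo \<mu>)) \<and>
    (is_tree Vo (reduced_adj G Vo) \<longrightarrow>
       (\<forall>\<mu>. complex_of_real \<mu> \<notin> spectrum G Vo \<longrightarrow>
          sg_positive Vo (dtn_matrix G Vo \<mu>) \<or>
          \<not> sg_eventually_strongly_positive Vo (dtn_matrix G Vo \<mu>))) \<and>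
    (lengths_independent G \<longrightarrow>
       (\<forall>\<mu>0. \<exists>\<mu>>\<mu>0. complex_of_real \<mu> \<notin> spectrum G Vo \<and>
          sg_strongly_positive Vo (dtn_matrix G Vo \<mu>)) \<and>
       (2 \<le> card Vo \<longrightarrow>
          (\<forall>\<mu>0. \<exists>\<mu>>\<mu>0. complex_of_real \<mu> \<notin> spectrum G Vo \<and>
             \<not> sg_eventually_positive Vo (dtn_matrix G Vo \<mu>))) \<and>
       (has_cycle Vo (reduced_adj G Vo) \<longrightarrow>
          (\<forall>\<mu>0. \<exists>\<mu>>\<mu>0. complex_of_real \<mu> \<notin> spectrum G Vo \<and>
             sg_eventually_strongly_positive Vo (dtn_matrix G Vo \<mu>) \<and>
             \<not> sg_positive Vo (dtn_matrix G Vo \<mu>))))"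
proof -
  interpret qgraph_locale G Vo using assms by (rule qgraph_locale.intro)
  show ?thesis
    using strongly_positive_below_lambda1 tree_alternative strongly_positive_recurs
      not_eventually_positive_recurs eventually_positive_recurs by blast
qed

end
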